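(* A connected hyperbolic surface $M\subset LG(2,4)$ is a Dupin cyclide if and only if $M$ is 2-elliptic with $\kappa_1=\kappa_2=0$ and $\tau\in\mathbb{R}$ constant. Moreover, distinct $\tau\in\mathbb{R}$ correspond to $CSp(4,\mathbb{R})$-inequivalent classes of Dupin cyclides. Any Dupin cyclide $M$ is a CSI surface with $\dim(M')\neq0$: (1) $\tau=\pm1$ if and only if $\dim(M')=1$, and (2) $\tau\neq\pm1$ if and only if $\dim(M')=2$.
   Context: $V=\mathbb{R}^5$ with $\langle z,w\rangle=-z_0w_4-z_4w_0+z_1w_3+z_3w_1-2z_2w_2$ (signature $(2,3)$), and $\mathcal{Q}=\{[z]\in\mathbb{P}V:\langle z,z\rangle=0\}$. $LG(2,4)$ (Lagrangian planes in the standard symplectic $\mathbb{R}^4$) is identified with $\mathcal{Q}$ by the Plücker embedding, $\mathrm{span}\{e_1+re_3+se_4,e_2+se_3+te_4\}\leftrightarrow[1,r,s,t,rt-s^2]$; the conformal symplectic group $CSp(4,\mathbb{R})$ acts on $\mathcal{Q}$ by projective isometries of $\langle\cdot,\cdot\rangle$. The invariant conformal Lorentzian structure is represented by $dr\,dt-ds^2$. An (embedded) surface is hyperbolic if every tangent plane contains exactly two null lines. For $[z]\in\mathbb{P}V$ the sphere $\mathcal{S}_{[z]}$ is $\mathbb{P}(z^\perp)\cap\mathcal{Q}$. $M$ is the envelope of a 1-parameter family of spheres if there is a smooth map $M\to\mathbb{P}V$, $p\mapsto[z(p)]$, of rank 1 such that $\mathcal{S}_{[z(p)]}$ passes through $p$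 and is tangent to $M$ at $p$ (i.e. for a local lift $\mathbf x$ of $M$, $\langle z,\mathbf x\rangle=0$ and $\langle z,d\mathbf x\rangle=0$). $M$ is a Dupin cyclide if it is the envelope of two (pointwise distinct) 1-parameter families of spheres. Invariants. A hyperbolic frame is a basis $(v_0,\dots,v_4)$ of $V$ with $\langle v_0,v_4\rangle=-1$, $\langle v_1,v_2\rangle=1$, $\langle v_3,v_3\rangle=-2$, all other products zero. A 3-adapted moving frame on a hyperbolic 2-generic surface $M$ is a smooth field of hyperbolic frames with $[v_0]$ the point of $M$ and $$\begin{aligned}dv_0&=(\alpha_{11}+\alpha_{22})v_0+\theta_1v_1+\theta_2v_2,\\ dv_1&=\beta_1v_0+(\alpha_{22}-\alpha_{11})v_1-\alpha_{12}v_3+\theta_2v_4,\\ dv_2&=\beta_2v_0+(\alpha_{11}-\alpha_{22})v_2-\alpha_{21}v_3+\theta_1v_4,\\ dv_3&=-2\alpha_{21}v_1-2\alpha_{12}v_2,\\ dv_4&=\beta_2v_1+\beta_1v_2-(\alpha_{11}+\alpha_{22})v_4,\end{aligned}$$ with $\alpha_{12}=\lambda_{11}\theta_1$, $\alpha_{21}=\lambda_{22}\theta_2$. Here 2-generic means $\lambda_{11}\lambda_{22}\ne0$, equivalently $\ell_1\ell_2\neq0$ where $\ell_i=\langle N_i(N_i\mathbf x),\mathbf n\rangle$ for a local lift $\mathbf x$, null tangent fields $N_1,N_2$ spanning $TM$, and $\mathbf n$ with $\langle\mathbf n,\mathbf n\rangle=-2$, $\langle\mathbf n,\mathbf x\rangle=0$,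 $\langle\mathbf n,d\mathbf x\rangle=0$; 3-adapted frames then exist locally. $\epsilon=\mathrm{sgn}(\lambda_{11}\lambda_{22})=\mathrm{sgn}(\ell_1\ell_2)$, and $M$ is 2-elliptic if $\epsilon=1$, 2-hyperbolic if $\epsilon=-1$. The frame can be chosen normalized: $\lambda_{11}=1$, $\lambda_{22}=\epsilon$. For a normalized frame there are functions $\kappa_1,\kappa_2,\tau,b_{12},b_{21}$ with $\alpha_{11}=\frac32\kappa_2\theta_1+\frac12\kappa_1\theta_2$, $\alpha_{22}=\frac12\kappa_2\theta_1+\frac32\kappa_1\theta_2$, $\beta_1=\tau\theta_1+b_{12}\theta_2$, $\beta_2=b_{21}\theta_1+\epsilon\tau\theta_2$; for $\epsilon=1$, $\tau$ does not depend on the choice of normalized frame, nor does the condition $\kappa_1=\kappa_2=0$. The conjugate manifold $M'\subset\mathcal{Q}$ is the image of $[v_4]$ for a 3-adapted frame, and $\dim(M')$ is the rank of this map (assumed constant). A surface is CSI (constant symplectic invariant) if all its $CSp(4,\mathbb{R})$-invariants are constant, equivalently it is an open piece of a homogeneous surface. *)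

theory Defs
  imports "HOL-Analysis.Analysis"
begin

section \<open>Smooth maps\<close>

abbreviation D :: "('a::real_normed_vector \<Rightarrow> 'b::real_normed_vector) \<Rightarrow> 'a \<Rightarrow> 'a \<Rightarrow> 'b"
  where "D f u \<equiv> frechet_derivative f (at u)"

primrec Ck_on :: "nat \<Rightarrow> 'a::real_normed_vector set \<Rightarrow> ('a \<Rightarrow> 'b::real_normed_vector) \<Rightarrow> bool" where
  "Ck_on 0 U f \<longleftrightarrow> continuous_on U f"
| "Ck_on (Suc k) U f \<longleftrightarrow>
     (\<forall>u\<in>U. f differentiable (at u)) \<and> (\<forall>w. Ck_on k U (\<lambda>u. D f u w))"

definition smooth_on :: "'a::real_normed_vector set \<Rightarrow> ('a \<Rightarrow> 'b::real_normed_vector) \<Rightarrow> bool"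
  where "smooth_on U f \<longleftrightarrow> open U \<and> (\<forall>k. Ck_on k U f)"


section \<open>The quadric in projective 4-space\<close>

text \<open>
  Components of \<open>z :: real^5\<close> are written \<open>z $ 0, \<dots>, z $ 4\<close>; in the index type \<open>5\<close> the
  numeral \<open>0\<close> is the same element as \<open>5\<close>, so these are all five of them.
\<close>

lemma UNIV_5: "(UNIV :: 5 set) = {0, 1, 2, 3, 4}"
proof -
  have "card {0, 1, 2, 3, 4 :: 5} = card (UNIV :: 5 set)"
    by simp
  then show ?thesis
    by (metis card_subset_eq finite subset_UNIV)
qed

definition ip :: "real^5 \<Rightarrow> real^5 \<Rightarrow> real" where
  "ip z w = - (z$0 * w$4) - z$4 * w$0 + z$1 * w$3 + z$3 * w$1 - 2 * (z$2 * w$2)"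

text \<open>A point of the projective space is a line \<open>span {z}\<close>, \<open>z \<noteq> 0\<close>, in \<open>real^5\<close>.\<close>

abbreviation pt :: "real^5 \<Rightarrow> (real^5) set"
  where "pt z \<equiv> span {z}"

definition proj_space :: "(real^5) set topology" where
  "proj_space = topology (\<lambda>W. W \<subseteq> {pt z | z. z \<noteq> 0} \<and> open {z. z \<noteq> 0 \<and> pt z \<in> W})"

lemma openin_proj_space:
  "openin proj_space W \<longleftrightarrow> W \<subseteq> {pt z | z. z \<noteq> 0} \<and> open {z. z \<noteq> 0 \<and> pt z \<in> W}"
proof -
  have "istopology (\<lambda>W. W \<subseteq> {pt z | z. z \<noteq> 0} \<and> open {z. z \<noteq> 0 \<and> pt z \<in> W})"
    unfolding istopology_def
  proof (intro conjI allI impI)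
    fix S T :: "(real^5) set set"
    assume "S \<subseteq> {pt z | z. z \<noteq> 0} \<and> open {z. z \<noteq> 0 \<and> pt z \<in> S}"
      and "T \<subseteq> {pt z | z. z \<noteq> 0} \<and> open {z. z \<noteq> 0 \<and> pt z \<in> T}"
    moreover have "{z. z \<noteq> 0 \<and> pt z \<in> S \<inter> T} =
        {z. z \<noteq> 0 \<and> pt z \<in> S} \<inter> {z. z \<noteq> 0 \<and> pt z \<in> T}"
      by auto
    ultimately show "S \<inter> T \<subseteq> {pt z | z. z \<noteq> 0}" "open {z. z \<noteq> 0 \<and> pt z \<in> S \<inter> T}"
      by auto
  next
    fix \<K> :: "(real^5) set set set"
    assume *: "\<forall>W\<in>\<K>. W \<subseteq> {pt z | z. z \<noteq> 0} \<and> open {z. z \<noteq> 0 \<and> pt z \<in> W}"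
    then show "\<Union>\<K> \<subseteq> {pt z | z. z \<noteq> 0}"
      by blast
    have "{z. z \<noteq> 0 \<and> pt z \<in> \<Union>\<K>} = (\<Union>W\<in>\<K>. {z. z \<noteq> 0 \<and> pt z \<in> W})"
      by auto
    then show "open {z. z \<noteq> 0 \<and> pt z \<in> \<Union>\<K>}"
      using * by auto
  qed
  then show ?thesis
    by (simp add: proj_space_def)
qed

definition quadric :: "(real^5) set set" where
  "quadric = {pt z | z. z \<noteq> 0 \<and> ip z z = 0}"


section \<open>The Lagrangian-Grassmannian and the conformal symplectic group\<close>

definition omega :: "real^4 \<Rightarrow> real^4 \<Rightarrow> real" where
  "omega a b = a$1 * b$3 - a$3 * b$1 + a$2 * b$4 - a$4 * b$2"

definition LG :: "(real^4) set set" where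
  "LG = {L. subspace L \<and> dim L = 2 \<and> (\<forall>a\<in>L. \<forall>b\<in>L. omega a b = 0)}"

definition CSp :: "(real^4^4) set" where
  "CSp = {A. \<exists>c. c \<noteq> 0 \<and> (\<forall>a b. omega (A *v a) (A *v b) = c * omega a b)}"

text \<open>
  With \<open>p\<^sub>i\<^sub>j\<close> the Pluecker coordinates of \<open>a \<and> b\<close>, isotropy reads \<open>p\<^sub>1\<^sub>3 = - p\<^sub>2\<^sub>4\<close>, so that
  \<open>p\<^sub>1\<^sub>2, - p\<^sub>2\<^sub>3, p\<^sub>1\<^sub>3, p\<^sub>1\<^sub>4, p\<^sub>3\<^sub>4\<close> determine \<open>a \<and> b\<close>, and the Pluecker relation becomes
  \<open>ip z z = 0\<close>.
\<close>

definition plucker_vec :: "real^4 \<Rightarrow> real^4 \<Rightarrow> real^5" where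
  "plucker_vec a b =
     (let p = (\<lambda>i j. a$i * b$j - a$j * b$i) in
      \<chi> k. if k = 0 then p 1 2 else if k = 1 then - p 2 3 else if k = 2 then p 1 3
           else if k = 3 then p 1 4 else p 3 4)"

definition plucker :: "(real^4) set \<Rightarrow> (real^5) set" where
  "plucker L = span {plucker_vec a b | a b. a \<in> L \<and> b \<in> L}"

lemma plucker_chart:
  "plucker (span {axis 1 1 + r *\<^sub>R axis 3 1 + s *\<^sub>R axis 4 1,
                  axis 2 1 + s *\<^sub>R axis 3 1 + t *\<^sub>R axis 4 1})
   = pt (\<chi> k. if k = 0 then 1 else if k = 1 then r else if k = 2 then s
              else if k = 3 then t else r * t - s\<^sup>2)"
  (is "plucker (span {?A, ?B}) = pt ?z")
proof -
  have AB: "plucker_vec (\<alpha> *\<^sub>R ?A + \<beta> *\<^sub>R ?B) (\<gamma> *\<^sub>R ?A + \<delta> *\<^sub>R ?B) = (\<alpha> * \<delta> - \<beta> * \<gamma>) *\<^sub>R ?z"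
    for \<alpha> \<beta> \<gamma> \<delta>
    by (simp add: plucker_vec_def Let_def vec_eq_iff axis_def algebra_simps power2_eq_square)
  have "x \<in> span {y, z} \<longleftrightarrow> (\<exists>\<alpha> \<beta>. x = \<alpha> *\<^sub>R y + \<beta> *\<^sub>R z)" for x y z :: "real^4"
    unfolding span_breakdown_eq[of x y "{z}"] span_singleton image_iff
    by (simp add: diff_eq_eq add.commute)
  note span2 = this[of _ ?A ?B]
  have "{plucker_vec a b | a b. a \<in> span {?A, ?B} \<and> b \<in> span {?A, ?B}} = pt ?z"
  proof
    show "{plucker_vec a b | a b. a \<in> span {?A, ?B} \<and> b \<in> span {?A, ?B}} \<subseteq> pt ?z"
      using AB by (auto simp: span2 span_singleton)
    show "pt ?z \<subseteq> {plucker_vec a b | a b. a \<in> span {?A, ?B} \<and> b \<in> span {?A, ?B}}"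
    proof
      fix x assume "x \<in> pt ?z"
      then obtain c where "x = c *\<^sub>R ?z"
        by (auto simp: span_singleton)
      then have "x = plucker_vec (c *\<^sub>R ?A + 0 *\<^sub>R ?B) (0 *\<^sub>R ?A + 1 *\<^sub>R ?B)"
        using AB[of c 0 0 1] by simp
      then show "x \<in> {plucker_vec a b | a b. a \<in> span {?A, ?B} \<and> b \<in> span {?A, ?B}}"
        using span2 by blast
    qed
  qed
  then show ?thesis
    by (simp add: plucker_def span_span)
qed

text \<open>
  The action on subsets of the quadric, transported from the natural action \<open>L \<mapsto> A L\<close> on
  Lagrangian planes by the Pluecker identification of \<open>LG\<close> with the quadric.
\<close>

definition csp_act :: "real^4^4 \<Rightarrow> (real^5) set set \<Rightarrow> (real^5) set set" where
  "csp_act A M = {plucker ((*v) A ` L) | L. L \<in> LG \<and> plucker L \<in> M}"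


section \<open>Embedded hyperbolic surfaces\<close>

text \<open>Rank at \<open>u\<close> of the map \<open>u \<mapsto> pt (z u)\<close> into projective space (for \<open>z u \<noteq> 0\<close>).\<close>

definition proj_rank :: "(real^2 \<Rightarrow> real^5) \<Rightarrow> real^2 \<Rightarrow> nat" where
  "proj_rank z u = dim (insert (z u) (range (D z u))) - 1"

text \<open>
  \<open>local_lift M U x\<close>: \<open>x\<close> is a local lift of \<open>M\<close>, that is, \<open>u \<mapsto> pt (x u)\<close> is a smooth
  immersion of \<open>U\<close> which is a homeomorphism onto an open subset of \<open>M\<close>.
\<close>

definition local_lift :: "(real^5) set set \<Rightarrow> (real^2) set \<Rightarrow> (real^2 \<Rightarrow> real^5) \<Rightarrow> bool" where
  "local_lift M U x \<longleftrightarrow>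
     smooth_on U x \<and> (\<forall>u\<in>U. x u \<noteq> 0 \<and> proj_rank x u = 2) \<and>
     embedding_map (top_of_set U) proj_space (\<lambda>u. pt (x u)) \<and>
     openin (subtopology proj_space M) ((\<lambda>u. pt (x u)) ` U)"

definition surface :: "(real^5) set set \<Rightarrow> bool" where
  "surface M \<longleftrightarrow> M \<noteq> {} \<and> M \<subseteq> quadric \<and>
     (\<forall>p\<in>M. \<exists>U x u. local_lift M U x \<and> u \<in> U \<and> p = pt (x u))"

text \<open>
  Since \<open>ip x x = 0\<close> on a lift, \<open>w \<mapsto> ip (D x u w) (D x u w)\<close> is, up to a factor, independent of
  the lift; for the lift \<open>(1, r, s, t, r t - s\<^sup>2)\<close> it is \<open>2 (dr dt - ds\<^sup>2)\<close>, the conformal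
  Lorentzian structure.
\<close>

definition null_vec :: "(real^2 \<Rightarrow> real^5) \<Rightarrow> real^2 \<Rightarrow> real^2 \<Rightarrow> bool" where
  "null_vec x u w \<longleftrightarrow> ip (D x u w) (D x u w) = 0"

definition hyperbolic_surface :: "(real^5) set set \<Rightarrow> bool" where
  "hyperbolic_surface M \<longleftrightarrow> surface M \<and>
     (\<forall>U x. local_lift M U x \<longrightarrow>
        (\<forall>u\<in>U. card {span {w} | w. w \<noteq> 0 \<and> null_vec x u w} = 2))"

definition connected_hyperbolic :: "(real^5) set set \<Rightarrow> bool" where
  "connected_hyperbolic M \<longleftrightarrow> hyperbolic_surface M \<and> connectedin proj_space M"


section \<open>Dupin cyclides\<close>

definition sphere_of :: "real^5 \<Rightarrow> (real^5) set set" where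
  "sphere_of z = {pt y | y. y \<noteq> 0 \<and> ip z y = 0} \<inter> quadric"

definition envelope_family :: "(real^5) set set \<Rightarrow> ((real^5) set \<Rightarrow> (real^5) set) \<Rightarrow> bool" where
  "envelope_family M Z \<longleftrightarrow>
     (\<forall>U x. local_lift M U x \<longrightarrow> (\<forall>u\<in>U. \<exists>U' z. u \<in> U' \<and> U' \<subseteq> U \<and> smooth_on U' z \<and>
        (\<forall>y\<in>U'. z y \<noteq> 0 \<and> Z (pt (x y)) = pt (z y) \<and> proj_rank z y = 1 \<and>
           pt (x y) \<in> sphere_of (z y) \<and> (\<forall>w. ip (z y) (D x y w) = 0))))"

definition dupin_cyclide :: "(real^5) set set \<Rightarrow> bool" where
  "dupin_cyclide M \<longleftrightarrow>
     (\<exists>Z1 Z2. envelope_family M Z1 \<and> envelope_family M Z2 \<and> (\<forall>p\<in>M. Z1 p \<noteq> Z2 p))"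


section \<open>Invariants\<close>

text \<open>The quantity \<open>\<langle>N (N x), n\<rangle>\<close> at \<open>u\<close>, where the field \<open>N\<close> acts on the lift \<open>x\<close> by
  differentiation.\<close>

definition ell :: "(real^2 \<Rightarrow> real^5) \<Rightarrow> (real^2 \<Rightarrow> real^2) \<Rightarrow> real^2 \<Rightarrow> real^5 \<Rightarrow> real" where
  "ell x N u n = ip (D (\<lambda>y. D x y (N y)) u (N u)) n"

text \<open>\<open>is_epsilon x U u e\<close>: the sign \<open>\<epsilon>\<close>, computed at \<open>u\<close> from the lift \<open>x\<close> on \<open>U\<close>, is \<open>e\<close>
  (\<open>0\<close> if the surface is not 2-generic there).\<close>

definition is_epsilon :: "(real^2 \<Rightarrow> real^5) \<Rightarrow> (real^2) set \<Rightarrow> real^2 \<Rightarrow> real \<Rightarrow> bool" where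
  "is_epsilon x U u e \<longleftrightarrow>
     (\<exists>U' N1 N2 n. u \<in> U' \<and> U' \<subseteq> U \<and> smooth_on U' N1 \<and> smooth_on U' N2 \<and>
        (\<forall>y\<in>U'. null_vec x y (N1 y) \<and> null_vec x y (N2 y) \<and> span {N1 y, N2 y} = UNIV) \<and>
        ip n n = -2 \<and> ip n (x u) = 0 \<and> (\<forall>w. ip n (D x u w) = 0) \<and>
        e = sgn (ell x N1 u n * ell x N2 u n))"

definition two_generic :: "(real^5) set set \<Rightarrow> bool" where
  "two_generic M \<longleftrightarrow>
     (\<forall>U x. local_lift M U x \<longrightarrow> (\<forall>u\<in>U. \<exists>e. e \<noteq> 0 \<and> is_epsilon x U u e))"

definition two_elliptic :: "(real^5) set set \<Rightarrow> bool" where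
  "two_elliptic M \<longleftrightarrow>
     (\<forall>U x. local_lift M U x \<longrightarrow> (\<forall>u\<in>U. is_epsilon x U u 1))"

definition hyperbolic_frame :: "(nat \<Rightarrow> real^5) \<Rightarrow> bool" where
  "hyperbolic_frame v \<longleftrightarrow>
     inj_on v {..4} \<and> independent (v ` {..4}) \<and> span (v ` {..4}) = UNIV \<and>
     (\<forall>i\<le>4. \<forall>j\<le>4. ip (v i) (v j) =
        (if {i, j} = {0, 4} then -1 else if {i, j} = {1, 2} then 1
         else if i = 3 \<and> j = 3 then -2 else 0))"

text \<open>
  Moving frames live on parameter domains of local lifts of \<open>M\<close>, and \<open>v 0\<close> itself is the lift.
  A 1-form is a function of a base point and a tangent vector.
\<close>

type_synonym form = "real^2 \<Rightarrow> real^2 \<Rightarrow> real"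

definition structure_eqs ::
  "(nat \<Rightarrow> real^2 \<Rightarrow> real^5) \<Rightarrow> form \<Rightarrow> form \<Rightarrow> form \<Rightarrow> form \<Rightarrow> form \<Rightarrow> form \<Rightarrow> form \<Rightarrow> form
    \<Rightarrow> real^2 \<Rightarrow> real^2 \<Rightarrow> bool" where
  "structure_eqs v \<theta>1 \<theta>2 \<alpha>11 \<alpha>12 \<alpha>21 \<alpha>22 \<beta>1 \<beta>2 u w \<longleftrightarrow>
     D (v 0) u w = (\<alpha>11 u w + \<alpha>22 u w) *\<^sub>R v 0 u + \<theta>1 u w *\<^sub>R v 1 u + \<theta>2 u w *\<^sub>R v 2 u \<and>
     D (v 1) u w = \<beta>1 u w *\<^sub>R v 0 u + (\<alpha>22 u w - \<alpha>11 u w) *\<^sub>R v 1 u - \<alpha>12 u w *\<^sub>R v 3 u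
                     + \<theta>2 u w *\<^sub>R v 4 u \<and>
     D (v 2) u w = \<beta>2 u w *\<^sub>R v 0 u + (\<alpha>11 u w - \<alpha>22 u w) *\<^sub>R v 2 u - \<alpha>21 u w *\<^sub>R v 3 u
                     + \<theta>1 u w *\<^sub>R v 4 u \<and>
     D (v 3) u w = - (2 * \<alpha>21 u w) *\<^sub>R v 1 u - (2 * \<alpha>12 u w) *\<^sub>R v 2 u \<and>
     D (v 4) u w = \<beta>2 u w *\<^sub>R v 1 u + \<beta>1 u w *\<^sub>R v 2 u - (\<alpha>11 u w + \<alpha>22 u w) *\<^sub>R v 4 u"

definition three_adapted ::
  "(real^5) set set \<Rightarrow> (real^2) set \<Rightarrow> (nat \<Rightarrow> real^2 \<Rightarrow> real^5) \<Rightarrow> form \<Rightarrow> form \<Rightarrow> form \<Rightarrow> form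
    \<Rightarrow> form \<Rightarrow> form \<Rightarrow> (real^2 \<Rightarrow> real) \<Rightarrow> (real^2 \<Rightarrow> real) \<Rightarrow> bool" where
  "three_adapted M U v \<theta>1 \<theta>2 \<alpha>11 \<alpha>22 \<beta>1 \<beta>2 lam11 lam22 \<longleftrightarrow>
     hyperbolic_surface M \<and> two_generic M \<and>
     local_lift M U (v 0) \<and> (\<forall>i\<le>4. smooth_on U (v i)) \<and>
     (\<forall>u\<in>U. hyperbolic_frame (\<lambda>i. v i u) \<and> lam11 u * lam22 u \<noteq> 0 \<and>
        (\<forall>w. structure_eqs v \<theta>1 \<theta>2 \<alpha>11 (\<lambda>u w. lam11 u * \<theta>1 u w) (\<lambda>u w. lam22 u * \<theta>2 u w) \<alpha>22 \<beta>1 \<beta>2 u w))"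

definition three_adapted_frame ::
  "(real^5) set set \<Rightarrow> (real^2) set \<Rightarrow> (nat \<Rightarrow> real^2 \<Rightarrow> real^5) \<Rightarrow> bool" where
  "three_adapted_frame M U v \<longleftrightarrow>
     (\<exists>\<theta>1 \<theta>2 \<alpha>11 \<alpha>22 \<beta>1 \<beta>2 lam11 lam22. three_adapted M U v \<theta>1 \<theta>2 \<alpha>11 \<alpha>22 \<beta>1 \<beta>2 lam11 lam22)"

text \<open>\<open>normalized_frame M \<epsilon> U v \<kappa>1 \<kappa>2 \<tau>\<close>: \<open>v\<close> is a 3-adapted frame with \<open>\<lambda>\<^sub>1\<^sub>1 = 1\<close>,
  \<open>\<lambda>\<^sub>2\<^sub>2 = \<epsilon>\<close>, and \<open>\<kappa>1, \<kappa>2, \<tau>\<close> are its coefficient functions.\<close>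

definition normalized_frame ::
  "(real^5) set set \<Rightarrow> real \<Rightarrow> (real^2) set \<Rightarrow> (nat \<Rightarrow> real^2 \<Rightarrow> real^5)
    \<Rightarrow> (real^2 \<Rightarrow> real) \<Rightarrow> (real^2 \<Rightarrow> real) \<Rightarrow> (real^2 \<Rightarrow> real) \<Rightarrow> bool" where
  "normalized_frame M \<epsilon> U v \<kappa>1 \<kappa>2 \<tau> \<longleftrightarrow>
     (\<exists>\<theta>1 \<theta>2 b12 b21. three_adapted M U v \<theta>1 \<theta>2
        (\<lambda>u w. 3/2 * \<kappa>2 u * \<theta>1 u w + 1/2 * \<kappa>1 u * \<theta>2 u w)
        (\<lambda>u w. 1/2 * \<kappa>2 u * \<theta>1 u w + 3/2 * \<kappa>1 u * \<theta>2 u w)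
        (\<lambda>u w. \<tau> u * \<theta>1 u w + b12 u * \<theta>2 u w)
        (\<lambda>u w. b21 u * \<theta>1 u w + \<epsilon> * \<tau> u * \<theta>2 u w)
        (\<lambda>_. 1) (\<lambda>_. \<epsilon>))"

text \<open>
  The next three notions quantify over all frames, so that independence of the choice of frame is
  part of what they assert; the last two also ask for frames near every point, so that they
  determine \<open>t\<close> and \<open>d\<close>. The first two are meant for 2-elliptic surfaces (\<open>\<epsilon> = 1\<close>).
\<close>

definition kappas_vanish :: "(real^5) set set \<Rightarrow> bool" where
  "kappas_vanish M \<longleftrightarrow>
     (\<forall>U v \<kappa>1 \<kappa>2 \<tau>. normalized_frame M 1 U v \<kappa>1 \<kappa>2 \<tau> \<longrightarrow> (\<forall>u\<in>U. \<kappa>1 u = 0 \<and> \<kappa>2 u = 0))"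

definition tau_const :: "(real^5) set set \<Rightarrow> real \<Rightarrow> bool" where
  "tau_const M t \<longleftrightarrow>
     (\<forall>p\<in>M. \<exists>U v \<kappa>1 \<kappa>2 \<tau>. normalized_frame M 1 U v \<kappa>1 \<kappa>2 \<tau> \<and> p \<in> (\<lambda>u. pt (v 0 u)) ` U) \<and>
     (\<forall>U v \<kappa>1 \<kappa>2 \<tau>. normalized_frame M 1 U v \<kappa>1 \<kappa>2 \<tau> \<longrightarrow> (\<forall>u\<in>U. \<tau> u = t))"

text \<open>\<open>conj_dim M d\<close>: the conjugate manifold \<open>M'\<close> has dimension \<open>d\<close>.\<close>

definition conj_dim :: "(real^5) set set \<Rightarrow> nat \<Rightarrow> bool" where
  "conj_dim M d \<longleftrightarrow>
     (\<forall>p\<in>M. \<exists>U v. three_adapted_frame M U v \<and> p \<in> (\<lambda>u. pt (v 0 u)) ` U) \<and>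
     (\<forall>U v. three_adapted_frame M U v \<longrightarrow> (\<forall>u\<in>U. proj_rank (v 4) u = d))"


section \<open>Equivalence and homogeneity\<close>

text \<open>
  Surfaces are compared up to passing to nonempty open pieces. Both pieces may be the whole
  surface, so inequivalent surfaces are in particular not related by any \<open>csp_act A M1 = M2\<close>.
\<close>

definition csp_equivalent :: "(real^5) set set \<Rightarrow> (real^5) set set \<Rightarrow> bool" where
  "csp_equivalent M1 M2 \<longleftrightarrow>
     (\<exists>A W1 W2. A \<in> CSp \<and> W1 \<noteq> {} \<and> openin (subtopology proj_space M1) W1 \<and>
        openin (subtopology proj_space M2) W2 \<and> csp_act A W1 = W2)"

definition homogeneous_surface :: "(real^5) set set \<Rightarrow> bool" where
  "homogeneous_surface N \<longleftrightarrow> surface N \<and>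
     (\<forall>p\<in>N. \<forall>q\<in>N. \<exists>A\<in>CSp. csp_act A N = N \<and> csp_act A {p} = {q})"

definition CSI_surface :: "(real^5) set set \<Rightarrow> bool" where
  "CSI_surface M \<longleftrightarrow>
     surface M \<and> (\<exists>N. homogeneous_surface N \<and> openin (subtopology proj_space N) M)"

end

theory Submission
  imports Defs
begin

text \<open>
  For a normalized frame the normal spheres through a point tangent to the surface are
  \<open>v\<^sub>3 + c v\<^sub>0\<close>; such a map can have rank one in two ways only if the two are
  \<open>v\<^sub>3 \<plusminus> 2 v\<^sub>0\<close>, \<open>\<epsilon> = 1\<close> and \<open>\<kappa>\<^sub>1 = \<kappa>\<^sub>2 = 0\<close>. The integrability conditions \<open>d\<^sup>2 = 0\<close> then give
  \<open>b\<^sub>1\<^sub>2 = b\<^sub>2\<^sub>1 = 1\<close> and \<open>d\<tau> = 0\<close>, and \<open>dv\<^sub>4\<close> splits along \<open>v\<^sub>1 \<plusminus> v\<^sub>2\<close> with factors \<open>1 \<plusminus> \<tau>\<close>, whence the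
  dimension of \<open>M'\<close>. With constant coefficients each fixed vector has coordinates in the frame that stay on
  an explicit pair of conics, so that a connected surface of this kind lies in an algebraic orbit determined by
  \<open>\<tau>\<close> and one frame; frames, hence orbits with the same \<open>\<tau>\<close>, are carried to each other by
  isometries of \<open>ip\<close>, and these are induced by conformal symplectic maps.
\<close>

section \<open>Smooth maps\<close>

text \<open>For \<epsilon> = 1 or -1 the tangential part of d(v3 + c v0) is (c \<theta>1 - 2
  \<epsilon> \<theta>2) v1 + (c \<theta>2 - 2 \<theta>1) v2; its coefficients are dependent exactly
  when c^2 = 4 \<epsilon>, which is where c = 2, -2 and \<epsilon> = 1 come from. With these values
  the v0 component c (\<alpha>11 + \<alpha>22) must be a multiple of \<theta>1 - \<theta>2 for one
  sign and of \<theta>1 + \<theta>2 for the other, so both \<kappa> vanish. The formal argument goes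
  the other way: two sphere maps, scaled to norm -2 and oriented alike, differ by a multiple of the
  lift, and a quarter of their difference (up to sign) serves as v0, so no frame has to be given in
  advance. The main burden is that the definitions quantify over all lifts and all frames. Every
  given frame has to be compared with a constructed one on a common parameter domain, which calls
  for smooth transition maps and a pointwise dictionary between frames. The sign ambiguities left by
  this comparison are the reason why the model surfaces are described by conditions invariant under
  sign changes of the frame.\<close>

lemma D_cong:
  assumes "open U" "u \<in> U" "\<And>y. y \<in> U \<Longrightarrow> f y = g y"
  shows "D f u = D g u"
proof -
  have "(f has_derivative f') (at u) \<longleftrightarrow> (g has_derivative f') (at u)" for f'
    using assms has_derivative_transform_within_open[of f f' u UNIV U g]
      has_derivative_transform_within_open[of g f' u UNIV U f] by auto
  then show ?thesis
    by (simp add: frechet_derivative_def)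
qed

lemma differentiable_cong_open:
  assumes "open U" "u \<in> U" "\<And>y. y \<in> U \<Longrightarrow> f y = g y" "f differentiable (at u)"
  shows "g differentiable (at u)"
  using assms has_derivative_transform_within_open[of f _ u UNIV U g]
  by (auto simp: differentiable_def)

lemma Ck_on_cong:
  assumes "open U" "\<And>y. y \<in> U \<Longrightarrow> f y = g y" "Ck_on k U f"
  shows "Ck_on k U g"
  using assms(2,3)
proof (induction k arbitrary: f g)
  case 0
  then show ?case by (metis Ck_on.simps(1) continuous_on_cong)
next
  case (Suc k)
  show ?case
    unfolding Ck_on.simps
  proof (intro conjI ballI allI)
    fix u assume "u \<in> U"
    then show "g differentiable (at u)"
      using Suc.prems differentiable_cong_open[OF assms(1), of u f g] by auto
  next
    fix w
    show "Ck_on k U (\<lambda>u. D g u w)"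
    proof (rule Suc.IH)
      show "Ck_on k U (\<lambda>u. D f u w)"
        using Suc.prems by simp
      show "D f y w = D g y w" if "y \<in> U" for y
        using D_cong[OF assms(1) that, of f g] Suc.prems by simp
    qed
  qed
qed

lemma Ck_on_subset: "Ck_on k U f \<Longrightarrow> V \<subseteq> U \<Longrightarrow> Ck_on k V f"
  by (induction k arbitrary: f) (auto intro: continuous_on_subset)

lemma Ck_on_continuous: "Ck_on k U f \<Longrightarrow> continuous_on U f"
  by (cases k) (auto intro!: continuous_at_imp_continuous_on differentiable_imp_continuous_within)

lemma Ck_on_Suc_imp: "Ck_on (Suc k) U f \<Longrightarrow> Ck_on k U f"
proof (induction k arbitrary: f)
  case 0
  then show ?case using Ck_on_continuous[of "Suc 0"] by simp
next
  case (Suc k)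
  then show ?case by (metis Ck_on.simps(2))
qed

lemma D_eqI: "(f has_derivative f') (at u) \<Longrightarrow> D f u = f'"
  by (rule frechet_derivative_at[symmetric])

lemma has_D: "f differentiable (at u) \<Longrightarrow> (f has_derivative D f u) (at u)"
  by (simp add: frechet_derivative_works)

lemma Ck_on_const: "Ck_on k U (\<lambda>_. c)"
  by (induction k arbitrary: c) auto

lemma Ck_on_bounded_linear: "bounded_linear f \<Longrightarrow> Ck_on k U f"
proof (cases k)
  case (Suc j)
  assume f: "bounded_linear f"
  then have "D f u = f" for u
    by (intro D_eqI bounded_linear_imp_has_derivative)
  then show ?thesis
    using f by (simp add: Suc Ck_on_const bounded_linear_imp_differentiable)
qed (simp add: linear_continuous_on)

lemma D_bilinear:
  assumes "bounded_bilinear p" "f differentiable (at u)" "g differentiable (at u)"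
  shows "D (\<lambda>y. p (f y) (g y)) u w = p (f u) (D g u w) + p (D f u w) (g u)"
    and "(\<lambda>y. p (f y) (g y)) differentiable (at u)"
proof -
  have "((\<lambda>y. p (f y) (g y)) has_derivative (\<lambda>w. p (f u) (D g u w) + p (D f u w) (g u))) (at u)"
    using bounded_bilinear.FDERIV[OF assms(1) has_D[OF assms(2)] has_D[OF assms(3)]] .
  then show "D (\<lambda>y. p (f y) (g y)) u w = p (f u) (D g u w) + p (D f u w) (g u)"
    "(\<lambda>y. p (f y) (g y)) differentiable (at u)"
    by (auto simp: D_eqI differentiable_def)
qed

lemma D_plus:
  assumes "f differentiable (at u)" "g differentiable (at u)"
  shows "D (\<lambda>y. f y + g y) u w = D f u w + D g u w"
  using D_eqI[OF has_derivative_add[OF has_D[OF assms(1)] has_D[OF assms(2)]]] by simp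

lemma D_minus:
  assumes "f differentiable (at u)" "g differentiable (at u)"
  shows "D (\<lambda>y. f y - g y) u w = D f u w - D g u w"
  using D_eqI[OF has_derivative_diff[OF has_D[OF assms(1)] has_D[OF assms(2)]]] by simp

lemma D_linear_comp:
  assumes "bounded_linear L" "f differentiable (at u)"
  shows "D (\<lambda>y. L (f y)) u w = L (D f u w)"
  using D_eqI[OF bounded_linear.has_derivative[OF assms(1) has_D[OF assms(2)]]] by simp

lemma D_comp:
  assumes "f differentiable (at (g u))" "g differentiable (at u)"
  shows "D (\<lambda>y. f (g y)) u w = D f (g u) (D g u w)"
    and "(\<lambda>y. f (g y)) differentiable (at u)"
proof -
  have "((\<lambda>y. f (g y)) has_derivative (\<lambda>w. D f (g u) (D g u w))) (at u)"
    using has_derivative_compose[OF has_D[OF assms(2)] has_D[OF assms(1)]] .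
  then show "D (\<lambda>y. f (g y)) u w = D f (g u) (D g u w)" "(\<lambda>y. f (g y)) differentiable (at u)"
    by (auto simp: D_eqI differentiable_def)
qed

lemma D_lin: "f differentiable (at u) \<Longrightarrow> linear (D f u)"
  by (rule linear_frechet_derivative)

section \<open>Closure of k-fold differentiability under algebra, composition, inversion and square
  roots\<close>

lemma Ck_on_add:
  assumes "open U" "Ck_on k U f" "Ck_on k U g"
  shows "Ck_on k U (\<lambda>u. f u + g u)"
  using assms(2,3)
proof (induction k arbitrary: f g)
  case (Suc k)
  have "Ck_on k U (\<lambda>u. D (\<lambda>u. f u + g u) u w)" for w
  proof (rule Ck_on_cong[OF assms(1)])
    show "Ck_on k U (\<lambda>u. D f u w + D g u w)"
      using Suc.prems by (intro Suc.IH) simp_all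
    show "D f y w + D g y w = D (\<lambda>u. f u + g u) y w" if "y \<in> U" for y
      using Suc.prems that by (subst D_plus) simp_all
  qed
  then show ?case
    using Suc.prems by auto
qed (auto intro: continuous_intros)

lemma Ck_on_bilinear:
  assumes p: "bounded_bilinear p" and "open U" "Ck_on k U f" "Ck_on k U g"
  shows "Ck_on k U (\<lambda>u. p (f u) (g u))"
  using assms(3,4)
proof (induction k arbitrary: f g)
  case 0
  then show ?case
    by (simp add: bounded_bilinear.continuous_on[OF p])
next
  case (Suc k)
  have "Ck_on k U (\<lambda>u. D (\<lambda>u. p (f u) (g u)) u w)" for w
  proof (rule Ck_on_cong[OF assms(2)])
    show "Ck_on k U (\<lambda>u. p (f u) (D g u w) + p (D f u w) (g u))"
      using Suc.prems Ck_on_Suc_imp[OF Suc.prems(1)] Ck_on_Suc_imp[OF Suc.prems(2)]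
      by (intro Ck_on_add[OF assms(2)] Suc.IH) simp_all
    show "p (f y) (D g y w) + p (D f y w) (g y) = D (\<lambda>u. p (f u) (g u)) y w" if "y \<in> U" for y
      using Suc.prems that by (subst D_bilinear(1)[OF p]) simp_all
  qed
  moreover have "(\<lambda>u. p (f u) (g u)) differentiable (at u)" if "u \<in> U" for u
    using Suc.prems that by (intro D_bilinear(2)[OF p]) simp_all
  ultimately show ?case
    by simp
qed

lemma D_basis_sum:
  fixes f :: "'a::euclidean_space \<Rightarrow> 'b::real_normed_vector"
  assumes "f differentiable (at u)"
  shows "D f u w = (\<Sum>b\<in>Basis. (w \<bullet> b) *\<^sub>R D f u b)"
  using linear_sum[OF D_lin[OF assms], of "\<lambda>b. (w \<bullet> b) *\<^sub>R b" Basis]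
  by (simp add: euclidean_representation linear_scale[OF D_lin[OF assms]])

lemma Ck_on_sum:
  assumes "open U" "\<And>i. i \<in> I \<Longrightarrow> Ck_on k U (f i)"
  shows "Ck_on k U (\<lambda>u. \<Sum>i\<in>I. f i u)"
proof (cases "finite I")
  case True
  then show ?thesis
    using assms(2)
  proof induction
    case empty
    then show ?case by (simp add: Ck_on_const)
  next
    case (insert i I)
    then show ?case
      by (simp add: Ck_on_add[OF assms(1)])
  qed
qed (simp add: Ck_on_const)

text \<open>\<open>Ck_on\<close> controls derivatives in fixed directions only, whereas the chain
  rule applies \<open>D f (g u)\<close> to the moving vector \<open>D g u w\<close>. Expanding that
  vector in \<open>Basis\<close> turns the derivative into a sum of products to which the induction
  hypothesis applies.\<close>

lemma Ck_on_compose: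
  fixes g :: "'a::real_normed_vector \<Rightarrow> 'b::euclidean_space" and f :: "'b \<Rightarrow> 'c::real_normed_vector"
  assumes "open U" "open V" "g ` U \<subseteq> V" "Ck_on k V f" "Ck_on k U g"
  shows "Ck_on k U (\<lambda>u. f (g u))"
  using assms(3-5)
proof (induction k arbitrary: f)
  case 0
  then show ?case
    by (auto intro: continuous_on_compose2)
next
  case (Suc k)
  have df: "f differentiable (at (g u))" "g differentiable (at u)" if "u \<in> U" for u
    using Suc.prems that by auto
  have "Ck_on k U (\<lambda>u. D (\<lambda>u. f (g u)) u w)" for w
  proof (rule Ck_on_cong[OF assms(1)])
    show "Ck_on k U (\<lambda>u. \<Sum>b\<in>Basis. (D g u w \<bullet> b) *\<^sub>R D f (g u) b)"
    proof (intro Ck_on_sum[OF assms(1)] Ck_on_bilinear[OF bounded_bilinear_scaleR assms(1)])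
      fix b :: 'b
      show "Ck_on k U (\<lambda>u. D g u w \<bullet> b)"
        using Suc.prems by (intro Ck_on_bilinear[OF bounded_bilinear_inner assms(1)] Ck_on_const) auto
      show "Ck_on k U (\<lambda>u. D f (g u) b)"
        using Suc.prems Ck_on_Suc_imp[OF Suc.prems(3)] by (intro Suc.IH) auto
    qed
    show "(\<Sum>b\<in>Basis. (D g y w \<bullet> b) *\<^sub>R D f (g y) b) = D (\<lambda>u. f (g u)) y w" if "y \<in> U" for y
      unfolding D_comp(1)[OF df[OF that]] by (rule D_basis_sum[OF df(1)[OF that], symmetric])
  qed
  moreover have "(\<lambda>u. f (g u)) differentiable (at u)" if "u \<in> U" for u
    using D_comp(2)[OF df[OF that]] .
  ultimately show ?case
    by simp
qed

text \<open>The derivative of \<open>inverse\<close> is a constant times a product of two copies of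
  \<open>inverse\<close>, so the induction feeds on itself.\<close>

lemma Ck_on_inverse: "Ck_on k (- {0}) (inverse :: real \<Rightarrow> real)"
proof (induction k)
  case 0
  then show ?case by (auto intro: continuous_intros)
next
  case (Suc k)
  have o: "open (- {0::real})"
    by auto
  have d: "D inverse x w = - (inverse x * w * inverse x)" "inverse differentiable (at x)"
    if "x \<noteq> 0" for x w :: real
    using D_eqI[OF has_derivative_inverse'[OF that, of UNIV]] has_derivative_inverse'[OF that, of UNIV]
    by (auto simp: differentiable_def)
  have "Ck_on k (- {0}) (\<lambda>x::real. (- w) * (inverse x * inverse x))" for w
    using Suc Ck_on_const
    by (intro Ck_on_bilinear[OF bounded_bilinear_mult o]) auto
  then have "Ck_on k (- {0}) (\<lambda>x::real. D inverse x w)" for w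
    by (rule Ck_on_cong[OF o, rotated]) (auto simp: d)
  then show ?case
    using d by auto
qed

text \<open>The derivative is written with \<open>sqrt x * inverse x\<close> instead of a quotient
  by \<open>sqrt x\<close>: both factors are then covered, by the induction hypothesis and by
  \<open>Ck_on_inverse\<close>.\<close>

lemma Ck_on_sqrt: "Ck_on k {0<..} sqrt"
proof (induction k)
  case 0
  then show ?case by (auto intro: continuous_intros)
next
  case (Suc k)
  have o: "open {0::real<..}"
    by auto
  have d: "D sqrt x w = (w / 2) * (sqrt x * inverse x)" "sqrt differentiable (at x)"
    if "x > 0" for x w :: real
  proof -
    have "(sqrt has_derivative (\<lambda>w. (w / 2) * (sqrt x * inverse x))) (at x)"
      using DERIV_real_sqrt[OF that] that
      unfolding has_field_derivative_def
      by (elim has_derivative_eq_rhs) (auto simp: field_simps real_sqrt_mult_self fun_eq_iff)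
    then show "D sqrt x w = (w / 2) * (sqrt x * inverse x)" "sqrt differentiable (at x)"
      by (auto simp: D_eqI differentiable_def)
  qed
  have "Ck_on k {0<..} (\<lambda>x::real. (w / 2) * (sqrt x * inverse x))" for w
    by (intro Ck_on_bilinear[OF bounded_bilinear_mult o] Ck_on_const Suc Ck_on_subset[OF Ck_on_inverse]) auto
  then have "Ck_on k {0<..} (\<lambda>x::real. D sqrt x w)" for w
    by (rule Ck_on_cong[OF o, rotated]) (auto simp: d)
  then show ?case
    using d by auto
qed

section \<open>Calculus of smooth maps\<close>

lemma smooth_on_open: "smooth_on U f \<Longrightarrow> open U"
  by (simp add: smooth_on_def)

lemma smooth_on_Ck: "smooth_on U f \<Longrightarrow> Ck_on k U f"
  by (simp add: smooth_on_def)

lemma smooth_on_differentiable: "smooth_on U f \<Longrightarrow> u \<in> U \<Longrightarrow> f differentiable (at u)"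
  using smooth_on_Ck[of U f "Suc 0"] by simp

lemma smooth_on_D: "smooth_on U f \<Longrightarrow> smooth_on U (\<lambda>u. D f u w)"
  unfolding smooth_on_def by (metis Ck_on.simps(2))

lemma smooth_on_continuous: "smooth_on U f \<Longrightarrow> continuous_on U f"
  using smooth_on_Ck[of U f 0] by simp

lemma smooth_on_subset: "smooth_on U f \<Longrightarrow> open V \<Longrightarrow> V \<subseteq> U \<Longrightarrow> smooth_on V f"
  unfolding smooth_on_def using Ck_on_subset by blast

lemma smooth_on_cong: "smooth_on U f \<Longrightarrow> (\<And>y. y \<in> U \<Longrightarrow> f y = g y) \<Longrightarrow> smooth_on U g"
  unfolding smooth_on_def using Ck_on_cong[of U f g] by blast

lemma smooth_on_const: "open U \<Longrightarrow> smooth_on U (\<lambda>_. c)"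
  by (simp add: smooth_on_def Ck_on_const)

lemma smooth_on_linear: "open U \<Longrightarrow> bounded_linear f \<Longrightarrow> smooth_on U f"
  by (simp add: smooth_on_def Ck_on_bounded_linear)

lemma smooth_on_add: "smooth_on U f \<Longrightarrow> smooth_on U g \<Longrightarrow> smooth_on U (\<lambda>u. f u + g u)"
  by (simp add: smooth_on_def Ck_on_add)

lemma smooth_on_bilinear:
  "bounded_bilinear p \<Longrightarrow> smooth_on U f \<Longrightarrow> smooth_on U g \<Longrightarrow> smooth_on U (\<lambda>u. p (f u) (g u))"
  by (simp add: smooth_on_def Ck_on_bilinear)

lemmas smooth_on_scaleR = smooth_on_bilinear[OF bounded_bilinear_scaleR]
lemmas smooth_on_mult = smooth_on_bilinear[OF bounded_bilinear_mult]
lemmas smooth_on_inner = smooth_on_bilinear[OF bounded_bilinear_inner]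

lemma smooth_on_scaleR_const: "smooth_on U f \<Longrightarrow> smooth_on U (\<lambda>u. c *\<^sub>R f u)"
  by (rule smooth_on_scaleR) (auto simp: smooth_on_const smooth_on_open)

lemma smooth_on_uminus: "smooth_on U f \<Longrightarrow> smooth_on U (\<lambda>u. - f u)"
  using smooth_on_scaleR_const[of U f "-1"] by simp

lemma smooth_on_diff: "smooth_on U f \<Longrightarrow> smooth_on U g \<Longrightarrow> smooth_on U (\<lambda>u. f u - g u)"
  using smooth_on_add[of U f "\<lambda>u. - g u"] by (simp add: smooth_on_uminus)

lemma smooth_on_compose:
  fixes g :: "'a::real_normed_vector \<Rightarrow> 'b::euclidean_space" and f :: "'b \<Rightarrow> 'c::real_normed_vector"
  shows "smooth_on V f \<Longrightarrow> smooth_on U g \<Longrightarrow> g ` U \<subseteq> V \<Longrightarrow> smooth_on U (\<lambda>u. f (g u))"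
  unfolding smooth_on_def using Ck_on_compose by blast

lemma smooth_on_linear_comp:
  fixes f :: "'a::real_normed_vector \<Rightarrow> 'b::euclidean_space"
  shows "bounded_linear L \<Longrightarrow> smooth_on U f \<Longrightarrow> smooth_on U (\<lambda>u. L (f u))"
  using smooth_on_compose[of UNIV L U f] by (simp add: smooth_on_linear)

lemma smooth_on_inverse:
  fixes f :: "'a::real_normed_vector \<Rightarrow> real"
  assumes "smooth_on U f" "\<And>u. u \<in> U \<Longrightarrow> f u \<noteq> 0"
  shows "smooth_on U (\<lambda>u. inverse (f u))"
  using assms by (rule_tac smooth_on_compose[of "- {0}" inverse]) (auto simp: smooth_on_def Ck_on_inverse)

lemma smooth_on_divide:
  fixes f :: "'a::real_normed_vector \<Rightarrow> real"
  assumes "smooth_on U f" "smooth_on U g" "\<And>u. u \<in> U \<Longrightarrow> g u \<noteq> 0"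
  shows "smooth_on U (\<lambda>u. f u / g u)"
  using smooth_on_mult[OF assms(1) smooth_on_inverse[OF assms(2,3)]] by (simp add: divide_inverse)

lemma smooth_on_sqrt:
  fixes f :: "'a::real_normed_vector \<Rightarrow> real"
  assumes "smooth_on U f" "\<And>u. u \<in> U \<Longrightarrow> f u > 0"
  shows "smooth_on U (\<lambda>u. sqrt (f u))"
  using assms by (rule_tac smooth_on_compose[of "{0<..}" sqrt]) (auto simp: smooth_on_def Ck_on_sqrt)

lemma smooth_on_nth: "smooth_on U f \<Longrightarrow> smooth_on U (\<lambda>u. (f u :: real^'n) $ i)"
  by (rule smooth_on_linear_comp) (auto simp: bounded_linear_vec_nth)

lemma D_axis_sum:
  fixes f :: "real^2 \<Rightarrow> 'b::real_normed_vector"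
  assumes "f differentiable (at u)"
  shows "D f u w = (w$1) *\<^sub>R D f u (axis 1 1) + (w$2) *\<^sub>R D f u (axis 2 1)"
proof -
  have "w = (w$1) *\<^sub>R axis 1 1 + (w$2) *\<^sub>R axis 2 1"
    by (simp add: vec_eq_iff forall_2 axis_def)
  then show ?thesis
    using linear_add[OF D_lin[OF assms], of "(w$1) *\<^sub>R axis 1 1" "(w$2) *\<^sub>R axis 2 1"]
    by (simp add: linear_scale[OF D_lin[OF assms]])
qed

text \<open>The moving direction \<open>N u\<close> is resolved along the two coordinate axes, since
  smoothness is only known for fixed directions.\<close>

lemma smooth_on_D_field:
  fixes f :: "real^2 \<Rightarrow> 'b::real_normed_vector" and N :: "real^2 \<Rightarrow> real^2"
  assumes f: "smooth_on U f" and N: "smooth_on U N"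
  shows "smooth_on U (\<lambda>u. D f u (N u))"
proof (rule smooth_on_cong)
  show "smooth_on U (\<lambda>u. (N u$1) *\<^sub>R D f u (axis 1 1) + (N u$2) *\<^sub>R D f u (axis 2 1))"
    by (intro smooth_on_add smooth_on_scaleR smooth_on_D f smooth_on_nth N)
  show "(N u$1) *\<^sub>R D f u (axis 1 1) + (N u$2) *\<^sub>R D f u (axis 2 1) = D f u (N u)" if "u \<in> U" for u
    using D_axis_sum[OF smooth_on_differentiable[OF f that]] by metis
qed

lemma smooth_on_vector2:
  fixes f g :: "'a::real_normed_vector \<Rightarrow> real"
  assumes "smooth_on U f" "smooth_on U g"
  shows "smooth_on U (\<lambda>u. vector [f u, g u] :: real^2)"
proof (rule smooth_on_cong)
  show "smooth_on U (\<lambda>u. f u *\<^sub>R axis 1 1 + g u *\<^sub>R axis 2 1 :: real^2)"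
    using assms by (intro smooth_on_add smooth_on_scaleR smooth_on_const) (auto simp: smooth_on_open)
qed (simp add: vec_eq_iff forall_2 axis_def)

section \<open>Symmetry of second derivatives\<close>

lemma mvt_line:
  fixes f :: "'a::real_normed_vector \<Rightarrow> real"
  assumes "h > 0" "\<And>s. 0 \<le> s \<Longrightarrow> s \<le> h \<Longrightarrow> f differentiable (at (p + s *\<^sub>R w))"
  shows "\<exists>s. 0 < s \<and> s < h \<and> f (p + h *\<^sub>R w) - f p = h * D f (p + s *\<^sub>R w) w"
proof -
  have "((\<lambda>s. f (p + s *\<^sub>R w)) has_real_derivative D f (p + s *\<^sub>R w) w) (at s)"
    if "0 \<le> s" "s \<le> h" for s
  proof -
    have "((\<lambda>s. p + s *\<^sub>R w) has_derivative (\<lambda>t. t *\<^sub>R w)) (at s)"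
      by (auto intro!: derivative_eq_intros)
    then have "((\<lambda>s. f (p + s *\<^sub>R w)) has_derivative (\<lambda>t. D f (p + s *\<^sub>R w) (t *\<^sub>R w))) (at s)"
      using has_D[OF assms(2)[OF that]] by (rule has_derivative_compose)
    then show ?thesis
      unfolding has_field_derivative_def
      by (rule has_derivative_eq_rhs)
        (simp add: fun_eq_iff linear_scale[OF D_lin[OF assms(2)[OF that]]] mult.commute)
  qed
  from MVT2[OF assms(1) this] show ?thesis
    by auto
qed

text \<open>The mean value theorem is applied twice: to the increment
  \<open>g y = f (y + h b) - f y\<close> along \<open>a\<close>, then to the derivative
  \<open>D f y a\<close> along \<open>b\<close>. The second difference is symmetric in
  \<open>a\<close> and \<open>b\<close>, the right-hand side is not; this is what yields Schwarz's
  theorem.\<close>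

lemma second_difference:
  fixes f :: "'a::real_normed_vector \<Rightarrow> real"
  assumes f: "smooth_on (ball u r) f" and h: "h > 0" "h * (norm a + norm b) < r"
  shows "\<exists>p\<in>ball u r. dist p u \<le> h * (norm a + norm b) \<and>
    f (u + h *\<^sub>R a + h *\<^sub>R b) - f (u + h *\<^sub>R a) - f (u + h *\<^sub>R b) + f u
      = h * h * D (\<lambda>y. D f y a) p b"
proof -
  have dist: "dist (u + s *\<^sub>R a + t *\<^sub>R b) u \<le> h * (norm a + norm b)"
    if "0 \<le> s" "s \<le> h" "0 \<le> t" "t \<le> h" for s t
  proof -
    have "dist (u + s *\<^sub>R a + t *\<^sub>R b) u = norm (s *\<^sub>R a + t *\<^sub>R b)"
      by (simp add: dist_norm)
    also have "\<dots> \<le> s * norm a + t * norm b"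
      using that norm_triangle_ineq[of "s *\<^sub>R a" "t *\<^sub>R b"] by simp
    also have "\<dots> \<le> h * norm a + h * norm b"
      using that by (intro add_mono mult_right_mono) auto
    finally show ?thesis
      by (simp add: algebra_simps)
  qed
  then have inb: "u + s *\<^sub>R a + t *\<^sub>R b \<in> ball u r" if "0 \<le> s" "s \<le> h" "0 \<le> t" "t \<le> h" for s t
    using that h(2) by (force simp: dist_commute)
  define g where "g y = f (y + h *\<^sub>R b) - f y" for y
  have gd: "(g has_derivative (\<lambda>w. D f (u + s *\<^sub>R a + h *\<^sub>R b) w - D f (u + s *\<^sub>R a) w)) (at (u + s *\<^sub>R a))"
    if "0 \<le> s" "s \<le> h" for s
  proof -
    have d: "(f has_derivative D f (u + s *\<^sub>R a + h *\<^sub>R b)) (at (u + s *\<^sub>R a + h *\<^sub>R b))"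
      "(f has_derivative D f (u + s *\<^sub>R a)) (at (u + s *\<^sub>R a))"
      using that h inb[of s h] inb[of s 0] by (auto intro!: has_D smooth_on_differentiable[OF f])
    have "((\<lambda>y. y + h *\<^sub>R b) has_derivative (\<lambda>w. w)) (at (u + s *\<^sub>R a))"
      by (auto intro!: derivative_eq_intros)
    from has_derivative_diff[OF has_derivative_compose[OF this d(1)] d(2)] show ?thesis
      unfolding g_def .
  qed
  then have "g differentiable (at (u + s *\<^sub>R a))" if "0 \<le> s" "s \<le> h" for s
    using that by (auto simp: differentiable_def)
  from mvt_line[OF h(1) this] obtain s where s: "0 < s" "s < h"
    "g (u + h *\<^sub>R a) - g u = h * D g (u + s *\<^sub>R a) a"
    by blast
  have 1: "D g (u + s *\<^sub>R a) a = D f (u + s *\<^sub>R a + h *\<^sub>R b) a - D f (u + s *\<^sub>R a) a"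
    using D_eqI[OF gd[of s]] s by simp
  have "(\<lambda>y. D f y a) differentiable (at (u + s *\<^sub>R a + t *\<^sub>R b))" if "0 \<le> t" "t \<le> h" for t
    using s that by (intro smooth_on_differentiable[OF smooth_on_D[OF f]] inb) auto
  from mvt_line[OF h(1) this] obtain t where t: "0 < t" "t < h"
    "D f (u + s *\<^sub>R a + h *\<^sub>R b) a - D f (u + s *\<^sub>R a) a
      = h * D (\<lambda>y. D f y a) (u + s *\<^sub>R a + t *\<^sub>R b) b"
    by blast
  show ?thesis
  proof (intro bexI conjI)
    show "u + s *\<^sub>R a + t *\<^sub>R b \<in> ball u r" "dist (u + s *\<^sub>R a + t *\<^sub>R b) u \<le> h * (norm a + norm b)"
      using s t by (auto intro!: inb dist simp del: mem_ball)
    show "f (u + h *\<^sub>R a + h *\<^sub>R b) - f (u + h *\<^sub>R a) - f (u + h *\<^sub>R b) + f u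
      = h * h * D (\<lambda>y. D f y a) (u + s *\<^sub>R a + t *\<^sub>R b) b"
      using s(3) t(3) 1 by (simp add: g_def algebra_simps)
  qed
qed

text \<open>Arbitrarily close to \<open>u\<close> there are points at which the two mixed
  derivatives take a common value, namely a second difference quotient; both are continuous, so they
  agree at \<open>u\<close>.\<close>

lemma schwarz_real:
  fixes f :: "'a::real_normed_vector \<Rightarrow> real"
  assumes f: "smooth_on U f" and u: "u \<in> U"
  shows "D (\<lambda>y. D f y a) u b = D (\<lambda>y. D f y b) u a"
proof -
  obtain r where r: "r > 0" "ball u r \<subseteq> U"
    using u smooth_on_open[OF f] openE by blast
  have fb: "smooth_on (ball u r) f"
    using smooth_on_subset[OF f _ r(2)] by simp
  define F G where "F p = D (\<lambda>y. D f y a) p b" and "G p = D (\<lambda>y. D f y b) p a" for p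
  \<comment> \<open>The summand 1 keeps \<open>c\<close> positive when both directions
    vanish.\<close>
  define c where "c = norm a + norm b + 1"
  have c: "c > 0"
    by (simp add: c_def add_nonneg_pos)
  have near: "\<exists>p q. dist p u < e \<and> dist q u < e \<and> F p = G q" if "0 < e" for e
  proof -
    \<comment> \<open>The factor 2 leaves room for the strict bounds by \<open>e\<close> and by
      \<open>r\<close>.\<close>
    define h where "h = min e r / (2 * c)"
    have h: "h > 0"
      using that r c by (simp add: h_def)
    have "h * (norm a + norm b) \<le> h * c"
      using h by (intro mult_left_mono) (auto simp: c_def)
    moreover have "h * c = min e r / 2"
      using c by (simp add: h_def)
    moreover have "0 < min e r"
      using that r by simp
    ultimately have hr: "h * (norm a + norm b) < e" "h * (norm a + norm b) < r" "h * (norm b + norm a) < r"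
      by (auto simp: add.commute)
    from second_difference[OF fb h hr(2)] second_difference[OF fb h hr(3)] obtain p q where
      "dist p u \<le> h * (norm a + norm b)" "dist q u \<le> h * (norm b + norm a)"
      "f (u + h *\<^sub>R a + h *\<^sub>R b) - f (u + h *\<^sub>R a) - f (u + h *\<^sub>R b) + f u = h * h * F p"
      "f (u + h *\<^sub>R b + h *\<^sub>R a) - f (u + h *\<^sub>R b) - f (u + h *\<^sub>R a) + f u = h * h * G q"
      unfolding F_def G_def by blast
    moreover from this have "F p = G q"
      using h by (simp add: algebra_simps)
    ultimately show ?thesis
      using hr(1) by (intro exI[of _ p] exI[of _ q]) (auto simp: add.commute)
  qed
  have cont: "isCont F u" "isCont G u"
    using smooth_on_continuous[OF smooth_on_D[OF smooth_on_D[OF f]]] u smooth_on_open[OF f]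
    by (auto simp: F_def[abs_def] G_def[abs_def] continuous_on_eq_continuous_at)
  have "F u = G u"
  proof (rule ccontr)
    assume ne: "F u \<noteq> G u"
    define e where "e = dist (F u) (G u) / 2"
    have e: "e > 0"
      using ne by (simp add: e_def)
    obtain d1 where d1: "d1 > 0" "\<And>y. dist y u < d1 \<Longrightarrow> dist (F y) (F u) < e"
      using cont(1) e by (metis continuous_at_eps_delta dist_commute)
    obtain d2 where d2: "d2 > 0" "\<And>y. dist y u < d2 \<Longrightarrow> dist (G y) (G u) < e"
      using cont(2) e by (metis continuous_at_eps_delta dist_commute)
    obtain p q where pq: "dist p u < min d1 d2" "dist q u < min d1 d2" "F p = G q"
      using near[of "min d1 d2"] d1 d2 by auto
    then have "dist (F p) (F u) < e" "dist (F p) (G u) < e"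
      using d1(2)[of p] d2(2)[of q] by simp_all
    then have "dist (F u) (G u) < 2 * e"
      using dist_triangle3[of "F u" "G u" "F p"] by simp
    then show False
      by (simp add: e_def)
  qed
  then show ?thesis
    by (simp add: F_def G_def)
qed

lemma schwarz:
  fixes f :: "'a::real_normed_vector \<Rightarrow> 'b::euclidean_space"
  assumes f: "smooth_on U f" and u: "u \<in> U"
  shows "D (\<lambda>y. D f y a) u b = D (\<lambda>y. D f y b) u a"
proof (rule euclidean_eqI)
  fix i :: 'b assume "i \<in> Basis"
  have bl: "bounded_linear (\<lambda>z. z \<bullet> i)"
    by (rule bounded_linear_inner_left)
  have 1: "D (\<lambda>y. D f y c) u d \<bullet> i = D (\<lambda>y. D (\<lambda>y. f y \<bullet> i) y c) u d" for c d
  proof -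
    have "D (\<lambda>y. D f y c) u d \<bullet> i = D (\<lambda>y. D f y c \<bullet> i) u d"
      by (rule D_linear_comp[OF bl smooth_on_differentiable[OF smooth_on_D[OF f] u], symmetric])
    also have "D (\<lambda>y. D f y c \<bullet> i) u = D (\<lambda>y. D (\<lambda>y. f y \<bullet> i) y c) u"
      using smooth_on_open[OF f] u
      by (rule D_cong) (simp add: D_linear_comp[OF bl smooth_on_differentiable[OF f]])
    finally show ?thesis .
  qed
  show "D (\<lambda>y. D f y a) u b \<bullet> i = D (\<lambda>y. D f y b) u a \<bullet> i"
    unfolding 1 by (rule schwarz_real[OF smooth_on_linear_comp[OF bl f] u])
qed


declare One_nat_def [simp del]

section \<open>The inner product and hyperbolic frames\<close>

lemma ip_sym: "ip z w = ip w z"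
  by (simp add: ip_def)

lemma bounded_bilinear_ip: "bounded_bilinear ip"
  unfolding bilinear_conv_bounded_bilinear[symmetric] bilinear_def linear_iff
  by (simp add: ip_def algebra_simps)

lemmas ip_simps = bounded_bilinear.add_left[OF bounded_bilinear_ip]
  bounded_bilinear.add_right[OF bounded_bilinear_ip]
  bounded_bilinear.diff_left[OF bounded_bilinear_ip]
  bounded_bilinear.diff_right[OF bounded_bilinear_ip]
  bounded_bilinear.minus_left[OF bounded_bilinear_ip]
  bounded_bilinear.minus_right[OF bounded_bilinear_ip]
  bounded_bilinear.scaleR_left[OF bounded_bilinear_ip]
  bounded_bilinear.scaleR_right[OF bounded_bilinear_ip]
  bounded_bilinear.zero_left[OF bounded_bilinear_ip]
  bounded_bilinear.zero_right[OF bounded_bilinear_ip]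

lemmas smooth_on_ip = smooth_on_bilinear[OF bounded_bilinear_ip]
lemmas D_ip = D_bilinear(1)[OF bounded_bilinear_ip]

lemma all_5: "(\<forall>i::5. P i) \<longleftrightarrow> P 0 \<and> P 1 \<and> P 2 \<and> P 3 \<and> P 4"
proof -
  have "(\<forall>i::5. P i) \<longleftrightarrow> (\<forall>i\<in>UNIV. P i)"
    by simp
  then show ?thesis
    unfolding UNIV_5 by simp
qed

lemma axis_5 [simp]:
  "axis i (x::real) $ (j::5) = (if j = i then x else 0)"
  by (simp add: axis_def)

lemma ip_nondegenerate:
  assumes "\<And>y. ip z y = 0"
  shows "z = 0"
  using assms[of "axis 0 1"] assms[of "axis 1 1"] assms[of "axis 2 1"] assms[of "axis 3 1"]
    assms[of "axis 4 1"]
  by (simp add: ip_def vec_eq_iff all_5)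

lemma all_le_4: "(\<forall>i\<le>4::nat. P i) \<longleftrightarrow> P 0 \<and> P 1 \<and> P 2 \<and> P 3 \<and> P 4"
proof -
  have "{i. i \<le> 4} = {0, 1, 2, 3, 4::nat}"
    by auto
  moreover have "(\<forall>i\<le>4. P i) \<longleftrightarrow> (\<forall>i\<in>{i. i \<le> 4}. P i)"
    by blast
  ultimately show ?thesis
    by simp
qed

text \<open>Only the Gram matrix is recorded. It is invertible, so the basis conditions of
  \<open>hyperbolic_frame\<close> follow from it.\<close>

definition frame_table :: "(nat \<Rightarrow> real^5) \<Rightarrow> bool" where
  "frame_table v \<longleftrightarrow>
     ip (v 0) (v 0) = 0 \<and> ip (v 0) (v 1) = 0 \<and> ip (v 0) (v 2) = 0 \<and> ip (v 0) (v 3) = 0 \<and> ip (v 0) (v 4) = -1 \<and>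
     ip (v 1) (v 1) = 0 \<and> ip (v 1) (v 2) = 1 \<and> ip (v 1) (v 3) = 0 \<and> ip (v 1) (v 4) = 0 \<and>
     ip (v 2) (v 2) = 0 \<and> ip (v 2) (v 3) = 0 \<and> ip (v 2) (v 4) = 0 \<and>
     ip (v 3) (v 3) = -2 \<and> ip (v 3) (v 4) = 0 \<and> ip (v 4) (v 4) = 0"

lemma frame_table_ip:
  assumes "frame_table v"
  shows
    "ip (v 0) (v 0) = 0" "ip (v 0) (v 1) = 0" "ip (v 0) (v 2) = 0" "ip (v 0) (v 3) = 0" "ip (v 0) (v 4) = -1"
    "ip (v 1) (v 0) = 0" "ip (v 1) (v 1) = 0" "ip (v 1) (v 2) = 1" "ip (v 1) (v 3) = 0" "ip (v 1) (v 4) = 0"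
    "ip (v 2) (v 0) = 0" "ip (v 2) (v 1) = 1" "ip (v 2) (v 2) = 0" "ip (v 2) (v 3) = 0" "ip (v 2) (v 4) = 0"
    "ip (v 3) (v 0) = 0" "ip (v 3) (v 1) = 0" "ip (v 3) (v 2) = 0" "ip (v 3) (v 3) = -2" "ip (v 3) (v 4) = 0"
    "ip (v 4) (v 0) = -1" "ip (v 4) (v 1) = 0" "ip (v 4) (v 2) = 0" "ip (v 4) (v 3) = 0" "ip (v 4) (v 4) = 0"
  using assms unfolding frame_table_def
  by (auto simp: ip_sym[of "v 4" "v 0"] ip_sym[of "v 4" "v 1"] ip_sym[of "v 4" "v 2"] ip_sym[of "v 4" "v 3"] ip_sym[of "v 3" "v 0"] ip_sym[of "v 3" "v 1"] ip_sym[of "v 3" "v 2"]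
      ip_sym[of "v 2" "v 0"] ip_sym[of "v 2" "v 1"] ip_sym[of "v 1" "v 0"])

lemma frame_table_basis:
  assumes "frame_table v"
  shows "inj_on v {..4}" "independent (v ` {..4})" "span (v ` {..4}) = UNIV"
proof -
  note t = frame_table_ip[OF assms] ip_simps
  have set: "{..4::nat} = {0, 1, 2, 3, 4}"
    by auto
  have lin: "c0 = 0 \<and> c1 = 0 \<and> c2 = 0 \<and> c3 = 0 \<and> c4 = 0"
    if "c0 *\<^sub>R v 0 + c1 *\<^sub>R v 1 + c2 *\<^sub>R v 2 + c3 *\<^sub>R v 3 + c4 *\<^sub>R v 4 = 0" for c0 c1 c2 c3 c4
    using arg_cong[OF that, of "\<lambda>z. ip z (v 0)"] arg_cong[OF that, of "\<lambda>z. ip z (v 1)"]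
      arg_cong[OF that, of "\<lambda>z. ip z (v 2)"] arg_cong[OF that, of "\<lambda>z. ip z (v 3)"]
      arg_cong[OF that, of "\<lambda>z. ip z (v 4)"]
    by (simp add: t)
  have ne: "v i \<noteq> v j" if "i \<noteq> j" "i \<in> {..4}" "j \<in> {..4}" for i j
  proof
    assume e: "v i = v j"
    have "ip (v i) y = ip (v j) y" for y
      using e by simp
    from this[of "v 0"] this[of "v 1"] this[of "v 2"] this[of "v 3"] this[of "v 4"] show False
      using that unfolding set by (auto simp: t)
  qed
  then show inj: "inj_on v {..4}"
    by (meson inj_on_def)
  have d: "v 0 \<noteq> v 1" "v 0 \<noteq> v 2" "v 0 \<noteq> v 3" "v 0 \<noteq> v 4" "v 1 \<noteq> v 2" "v 1 \<noteq> v 3" "v 1 \<noteq> v 4"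
    "v 2 \<noteq> v 3" "v 2 \<noteq> v 4" "v 3 \<noteq> v 4"
    using ne by simp_all
  show ind: "independent (v ` {..4})"
  proof
    assume "dependent (v ` {..4})"
    then obtain c y where c: "(\<Sum>z\<in>v ` {..4}. c z *\<^sub>R z) = 0" and y: "y \<in> v ` {..4}" "c y \<noteq> 0"
      by (auto simp: dependent_finite)
    have "(\<Sum>z\<in>v ` {..4}. c z *\<^sub>R z) = c (v 0) *\<^sub>R v 0 + c (v 1) *\<^sub>R v 1 + c (v 2) *\<^sub>R v 2 + c (v 3) *\<^sub>R v 3 + c (v 4) *\<^sub>R v 4"
      unfolding sum.reindex[OF inj] by (simp add: set)
    then show False
      using lin[of "c (v 0)" "c (v 1)" "c (v 2)" "c (v 3)" "c (v 4)"] c y by (auto simp: set)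
  qed
  have "card (v ` {..4}) = 5"
    by (simp add: card_image[OF inj])
  then show "span (v ` {..4}) = UNIV"
    using card_eq_dim[of "v ` {..4}" UNIV] ind by (simp add: top.extremum_unique)
qed

lemma hyperbolic_frame_iff: "hyperbolic_frame v \<longleftrightarrow> frame_table v"
proof
  assume "hyperbolic_frame v"
  then show "frame_table v"
    by (simp add: hyperbolic_frame_def all_le_4 frame_table_def doubleton_eq_iff)
next
  assume t: "frame_table v"
  show "hyperbolic_frame v"
    unfolding hyperbolic_frame_def
    using frame_table_basis[OF t] frame_table_ip[OF t]
    by (simp add: all_le_4 doubleton_eq_iff)
qed

lemmas frame_ip = frame_table_ip[OF iffD1[OF hyperbolic_frame_iff]]

lemma frame_eqI:
  assumes v: "hyperbolic_frame v"
    and "ip x (v 0) = ip y (v 0)" "ip x (v 1) = ip y (v 1)" "ip x (v 2) = ip y (v 2)"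
    "ip x (v 3) = ip y (v 3)" "ip x (v 4) = ip y (v 4)"
  shows "x = y"
proof -
  have "ip (x - y) z = 0" for z
  proof -
    have z: "z \<in> span (v ` {..4})"
      using v by (simp add: hyperbolic_frame_def)
    then show ?thesis
    proof (induction rule: span_induct_alt)
      case base
      then show ?case by (simp add: ip_simps)
    next
      case (step c b z)
      then obtain i where i: "i \<le> 4" "b = v i"
        by auto
      have "\<forall>i\<le>4. ip (x - y) (v i) = 0"
        using assms by (simp add: all_le_4 ip_simps)
      with i step show ?case
        by (simp add: ip_simps)
    qed
  qed
  then show ?thesis
    using ip_nondegenerate[of "x - y"] by simp
qed

text \<open>The basis dual to the frame with respect to \<open>ip\<close> is
  \<open>- v 4, v 2, v 1, - v 3 / 2, - v 0\<close>.\<close>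

lemma frame_expand:
  assumes v: "hyperbolic_frame v"
  shows "z = - ip z (v 4) *\<^sub>R v 0 + ip z (v 2) *\<^sub>R v 1 + ip z (v 1) *\<^sub>R v 2
    - (ip z (v 3) / 2) *\<^sub>R v 3 - ip z (v 0) *\<^sub>R v 4"
  by (rule frame_eqI[OF v]) (simp_all add: ip_simps frame_ip[OF v])

section \<open>Projective space and local lifts\<close>

lemma pt_scaleR [simp]: "c \<noteq> 0 \<Longrightarrow> pt (c *\<^sub>R z) = pt z"
proof -
  assume c: "c \<noteq> 0"
  have "pt (c *\<^sub>R z) \<subseteq> pt z" "z = inverse c *\<^sub>R c *\<^sub>R z"
    using c by (auto simp: span_singleton)
  moreover have "pt (inverse c *\<^sub>R c *\<^sub>R z) \<subseteq> pt (c *\<^sub>R z)"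
    by (auto simp: span_singleton)
  ultimately show ?thesis
    by auto
qed

lemma pt_eqD:
  assumes "pt z = pt w" "z \<noteq> 0"
  obtains c where "c \<noteq> 0" "w = c *\<^sub>R z"
proof -
  have "w \<in> pt z" "z \<in> pt w"
    using assms span_base[of w "{w}"] span_base[of z "{z}"] by auto
  then obtain c d where cd: "w = c *\<^sub>R z" "z = d *\<^sub>R w"
    unfolding span_singleton by blast
  have "c \<noteq> 0"
    using cd assms(2) by auto
  with cd that show ?thesis
    by blast
qed

lemma open_nonzero: "open {z::real^5. z \<noteq> 0}"
proof -
  have "{z::real^5. z \<noteq> 0} = - {0}"
    by auto
  then show ?thesis
    by (simp add: open_Compl)
qed

lemma topspace_proj_space: "topspace proj_space = {pt z | z. z \<noteq> 0}"
proof
  show "topspace proj_space \<subseteq> {pt z | z. z \<noteq> 0}"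
    using openin_proj_space[of "topspace proj_space"] by simp
  have "{z. z \<noteq> 0 \<and> pt z \<in> {pt z | z. z \<noteq> 0}} = {z. z \<noteq> 0}"
    by auto
  then have "openin proj_space {pt z | z. z \<noteq> 0}"
    unfolding openin_proj_space using open_nonzero by simp
  then show "{pt z | z. z \<noteq> 0} \<subseteq> topspace proj_space"
    by (rule openin_subset)
qed

text \<open>A set closed under nonzero scaling is, away from 0, the full preimage of its image in
  projective space, so openness passes to the quotient.\<close>

lemma openin_proj_cone:
  assumes "open W"
    and cone: "\<And>z c. z \<in> W \<Longrightarrow> c \<noteq> 0 \<Longrightarrow> c *\<^sub>R z \<in> W"
  shows "openin proj_space {pt z | z. z \<noteq> 0 \<and> z \<in> W}"
proof -
  have "{z. z \<noteq> 0 \<and> pt z \<in> {pt z | z. z \<noteq> 0 \<and> z \<in> W}} = {z. z \<noteq> 0} \<inter> W"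
  proof (intro equalityI subsetI)
    fix z assume "z \<in> {z. z \<noteq> 0 \<and> pt z \<in> {pt z | z. z \<noteq> 0 \<and> z \<in> W}}"
    then obtain y where y: "z \<noteq> 0" "y \<noteq> 0" "y \<in> W" "pt y = pt z"
      by auto
    then obtain c where "c \<noteq> 0" "z = c *\<^sub>R y"
      using pt_eqD by blast
    then show "z \<in> {z. z \<noteq> 0} \<inter> W"
      using y cone by auto
  qed auto
  then show ?thesis
    unfolding openin_proj_space using assms open_nonzero by auto
qed

lemma open_preimage_pt:
  assumes "continuous_on U x" "open U" "\<And>u. u \<in> U \<Longrightarrow> x u \<noteq> 0" "openin proj_space T"
  shows "open {u \<in> U. pt (x u) \<in> T}"
proof -
  have eq: "{u \<in> U. pt (x u) \<in> T} = U \<inter> x -` {z. z \<noteq> 0 \<and> pt z \<in> T}"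
    using assms(3) by auto
  have "open {z. z \<noteq> 0 \<and> pt z \<in> T}"
    using assms(4) unfolding openin_proj_space by simp
  then show ?thesis
    unfolding eq by (rule continuous_open_preimage[OF assms(1,2)])
qed

lemma continuous_map_pt:
  assumes "continuous_on U x" "open U" "\<And>u. u \<in> U \<Longrightarrow> x u \<noteq> 0"
  shows "continuous_map (top_of_set U) proj_space (\<lambda>u. pt (x u))"
  unfolding continuous_map topspace_proj_space
  using assms open_preimage_pt[OF assms]
  by (auto simp: openin_open_eq)

lemma openin_subtopology_mono:
  assumes "openin (subtopology X M) W" "W \<subseteq> N" "N \<subseteq> M"
  shows "openin (subtopology X N) W"
  using assms unfolding openin_subtopology by blast

lemma openin_subtopology_trans:
  assumes "openin (subtopology X N) W" "openin (subtopology X M) N"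
  shows "openin (subtopology X M) W"
proof -
  obtain S T where "openin X S" "W = S \<inter> N" "openin X T" "N = T \<inter> M"
    using assms unfolding openin_subtopology by auto
  then show ?thesis
    unfolding openin_subtopology by (intro exI[of _ "S \<inter> T"]) auto
qed

text \<open>The embedding condition in workable form: continuity is automatic from smoothness of the
  lift, so what remains is injectivity and openness, in the surface, of the images of open
  sets.\<close>

lemma local_lift_iff:
  "local_lift M U x \<longleftrightarrow> smooth_on U x \<and> (\<forall>u\<in>U. x u \<noteq> 0 \<and> proj_rank x u = 2) \<and>
     inj_on (\<lambda>u. pt (x u)) U \<and>
     (\<forall>V. open V \<and> V \<subseteq> U \<longrightarrow> openin (subtopology proj_space M) ((\<lambda>u. pt (x u)) ` V))"
  (is "_ \<longleftrightarrow> ?R")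
proof
  let ?f = "\<lambda>u. pt (x u)"
  assume l: "local_lift M U x"
  then have h: "homeomorphic_map (top_of_set U) (subtopology proj_space (?f ` U)) ?f"
    and U: "open U"
    by (auto simp: local_lift_def embedding_map_def smooth_on_open)
  have "openin (subtopology proj_space M) (?f ` V)" if "open V" "V \<subseteq> U" for V
  proof -
    have "openin (subtopology proj_space (?f ` U)) (?f ` V)"
      using homeomorphic_imp_open_map[OF h] that U unfolding open_map_def
      by (simp add: openin_open_eq)
    then show ?thesis
      using l openin_subtopology_trans unfolding local_lift_def by blast
  qed
  then show ?R
    using l h unfolding local_lift_def homeomorphic_map_def by auto
next
  let ?f = "\<lambda>u. pt (x u)"
  assume R: ?R
  then have U: "open U"
    by (auto simp: smooth_on_open)
  have M: "openin (subtopology proj_space M) (?f ` U)"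
    using R U by auto
  then have sub: "?f ` U \<subseteq> M"
    using openin_imp_subset by blast
  have "homeomorphic_map (top_of_set U) (subtopology proj_space (?f ` U)) ?f"
  proof (rule bijective_open_imp_homeomorphic_map)
    show "continuous_map (top_of_set U) (subtopology proj_space (?f ` U)) ?f"
      using continuous_map_pt[OF smooth_on_continuous U, of x] R
      by (auto intro: continuous_map_into_subtopology)
    show "open_map (top_of_set U) (subtopology proj_space (?f ` U)) ?f"
      unfolding open_map_def
    proof (intro allI impI)
      fix V assume "openin (top_of_set U) V"
      then have "open V" "V \<subseteq> U"
        using U by (auto simp: openin_open_eq)
      then have "openin (subtopology proj_space M) (?f ` V)" "?f ` V \<subseteq> ?f ` U"
        using R by blast+
      then show "openin (subtopology proj_space (?f ` U)) (?f ` V)"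
        using sub by (rule openin_subtopology_mono)
    qed
    have "?f ` U \<subseteq> topspace proj_space"
      using R by (auto simp: topspace_proj_space)
    then show "?f ` topspace (top_of_set U) = topspace (subtopology proj_space (?f ` U))"
      by auto
    show "inj_on ?f (topspace (top_of_set U))"
      using R by simp
  qed
  then show "local_lift M U x"
    using R M unfolding local_lift_def embedding_map_def by simp
qed

lemma local_lift_smooth: "local_lift M U x \<Longrightarrow> smooth_on U x"
  by (simp add: local_lift_def)

lemma local_lift_nonzero: "local_lift M U x \<Longrightarrow> u \<in> U \<Longrightarrow> x u \<noteq> 0"
  by (simp add: local_lift_def)

lemma local_lift_rank: "local_lift M U x \<Longrightarrow> u \<in> U \<Longrightarrow> proj_rank x u = 2"
  by (simp add: local_lift_def)

lemma local_lift_openin: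
  "local_lift M U x \<Longrightarrow> open V \<Longrightarrow> V \<subseteq> U \<Longrightarrow> openin (subtopology proj_space M) ((\<lambda>u. pt (x u)) ` V)"
  by (auto simp: local_lift_iff)

lemma local_lift_open: "local_lift M U x \<Longrightarrow> open U"
  using local_lift_smooth smooth_on_open by blast

lemma local_lift_in: "local_lift M U x \<Longrightarrow> u \<in> U \<Longrightarrow> pt (x u) \<in> M"
  using local_lift_openin[of M U x U] local_lift_open[of M U x] openin_imp_subset by blast

lemma local_lift_subset:
  assumes "local_lift M U x" "open V" "V \<subseteq> U"
  shows "local_lift M V x"
  using assms smooth_on_subset[of U x V] inj_on_subset[of "\<lambda>u. pt (x u)" U V]
  unfolding local_lift_iff by (meson subset_iff)

text \<open>A lift depends on the surface only through the openness of its image. This moves lifts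
  between a surface, its open pieces and larger surfaces in which it is open.\<close>

lemma local_lift_openin_change:
  assumes l: "local_lift M U x" and N: "openin (subtopology proj_space N) ((\<lambda>u. pt (x u)) ` U)"
  shows "local_lift N U x"
  unfolding local_lift_iff
proof (intro conjI allI impI)
  show "smooth_on U x" "\<forall>u\<in>U. x u \<noteq> 0 \<and> proj_rank x u = 2" "inj_on (\<lambda>u. pt (x u)) U"
    using l by (auto simp: local_lift_iff)
  fix V assume V: "open V \<and> V \<subseteq> U"
  have "openin (subtopology proj_space ((\<lambda>u. pt (x u)) ` U)) ((\<lambda>u. pt (x u)) ` V)"
    using V local_lift_in[OF l] by (intro openin_subtopology_mono[OF local_lift_openin[OF l]]) auto
  then show "openin (subtopology proj_space N) ((\<lambda>u. pt (x u)) ` V)"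
    using N openin_subtopology_trans by blast
qed

lemma open_local_lift_preimage:
  assumes l: "local_lift M U x" and W: "openin (subtopology proj_space M) W"
  shows "open {u \<in> U. pt (x u) \<in> W}"
proof -
  obtain T where T: "openin proj_space T" "W = T \<inter> M"
    using W unfolding openin_subtopology by auto
  have "{u \<in> U. pt (x u) \<in> W} = {u \<in> U. pt (x u) \<in> T}"
    using T local_lift_in[OF l] by auto
  then show ?thesis
    using open_preimage_pt[OF smooth_on_continuous[OF local_lift_smooth[OF l]] local_lift_open[OF l]
        local_lift_nonzero[OF l] T(1)] by simp
qed

section \<open>Projective rank and rescaling of lifts\<close>

lemma D_scale:
  assumes "r differentiable (at u)" "z differentiable (at u)"
  shows "D (\<lambda>y. r y *\<^sub>R z y) u w = r u *\<^sub>R D z u w + D r u w *\<^sub>R z u"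
  using D_bilinear(1)[OF bounded_bilinear_scaleR assms] .

lemma proj_rank_cong_span:
  assumes "span (insert (z u) (range (D z u))) = span (insert (z' u') (range (D z' u')))"
  shows "proj_rank z u = proj_rank z' u'"
  unfolding proj_rank_def using assms by (metis dim_span)

lemma proj_rank_scale:
  fixes z :: "real^2 \<Rightarrow> real^5"
  assumes r: "r differentiable (at u)" "r u \<noteq> 0" and z: "z differentiable (at u)"
  shows "proj_rank (\<lambda>y. r y *\<^sub>R z y) u = proj_rank z u"
proof (rule proj_rank_cong_span)
  let ?A = "insert (r u *\<^sub>R z u) (range (D (\<lambda>y. r y *\<^sub>R z y) u))" and ?B = "insert (z u) (range (D z u))"
  have "?A \<subseteq> span ?B"
  proof (intro insert_subsetI subsetI)
    show "r u *\<^sub>R z u \<in> span ?B"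
      by (intro span_scale span_base) simp
    fix a assume "a \<in> range (D (\<lambda>y. r y *\<^sub>R z y) u)"
    then obtain w where "a = r u *\<^sub>R D z u w + D r u w *\<^sub>R z u"
      using D_scale[OF r(1) z] by blast
    also have "\<dots> \<in> span ?B"
      by (intro span_add span_scale span_base) simp_all
    finally show "a \<in> span ?B" .
  qed
  moreover have "?B \<subseteq> span ?A"
  proof -
    have 1: "z u \<in> span ?A"
      using span_scale[OF span_base[of "r u *\<^sub>R z u" ?A], of "inverse (r u)"] r(2) by simp
    have "D z u w \<in> span ?A" for w
    proof -
      have "D z u w = inverse (r u) *\<^sub>R (D (\<lambda>y. r y *\<^sub>R z y) u w - D r u w *\<^sub>R z u)"
        using r(2) by (simp add: D_scale[OF r(1) z])
      also have "\<dots> \<in> span ?A"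
        by (intro span_scale span_diff 1) (auto intro: span_base)
      finally show ?thesis .
    qed
    with 1 show ?thesis
      by auto
  qed
  ultimately show "span ?A = span ?B"
    unfolding span_eq by (rule conjI)
qed

lemma proj_rank_cong:
  assumes "open U" "u \<in> U" "\<And>y. y \<in> U \<Longrightarrow> z y = z' y"
  shows "proj_rank z u = proj_rank z' u"
  using assms D_cong[OF assms] by (simp add: proj_rank_def)

lemma local_lift_scale:
  assumes l: "local_lift M U x" and r: "smooth_on U r" "\<And>u. u \<in> U \<Longrightarrow> r u \<noteq> 0"
  shows "local_lift M U (\<lambda>u. r u *\<^sub>R x u)"
proof -
  have "pt (r u *\<^sub>R x u) = pt (x u)" if "u \<in> U" for u
    using r that by simp
  then have "(\<lambda>u. pt (r u *\<^sub>R x u)) ` V = (\<lambda>u. pt (x u)) ` V"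
    if "V \<subseteq> U" for V
    using that by (auto simp: image_def subset_iff)
  moreover have "inj_on (\<lambda>u. pt (r u *\<^sub>R x u)) U \<longleftrightarrow> inj_on (\<lambda>u. pt (x u)) U"
    using \<open>\<And>u. u \<in> U \<Longrightarrow> pt (r u *\<^sub>R x u) = pt (x u)\<close> by (intro inj_on_cong)
  moreover have "proj_rank (\<lambda>u. r u *\<^sub>R x u) u = proj_rank x u" if "u \<in> U" for u
    using that r l by (intro proj_rank_scale smooth_on_differentiable[of U]) (auto simp: local_lift_smooth)
  ultimately show ?thesis
    using l r unfolding local_lift_iff by (auto intro!: smooth_on_scaleR)
qed


section \<open>Transition maps\<close>

text \<open>Projective rank 2 makes \<open>y v\<close> and the two partial derivatives independent,
  so there are functionals dual to them. The quotient of \<open>m\<close> by \<open>l\<close> is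
  then an affine chart of projective space adapted to the tangent plane of the image.\<close>

lemma immersion_functionals:
  fixes y :: "real^2 \<Rightarrow> real^5"
  assumes d: "y differentiable (at v)" and r: "proj_rank y v = 2"
  obtains l :: "real^5 \<Rightarrow> real" and m :: "real^5 \<Rightarrow> real^2" where
    "linear l" "linear m" "l (y v) = 1" "m (y v) = 0" "\<And>w. l (D y v w) = 0" "\<And>w. m (D y v w) = w"
proof -
  let ?e1 = "axis 1 1 :: real^2" and ?e2 = "axis 2 1 :: real^2"
  let ?B = "{y v, D y v ?e1, D y v ?e2}"
  have "insert (y v) (range (D y v)) \<subseteq> span ?B"
  proof (intro insert_subsetI subsetI)
    show "y v \<in> span ?B"
      by (rule span_base) simp
    fix z assume "z \<in> range (D y v)"
    then obtain w :: "real^2" where "z = (w$1) *\<^sub>R D y v ?e1 + (w$2) *\<^sub>R D y v ?e2"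
      using D_axis_sum[OF d] by blast
    also have "\<dots> \<in> span ?B"
      by (intro span_add span_scale span_base) simp_all
    finally show "z \<in> span ?B" .
  qed
  then have "dim (insert (y v) (range (D y v))) \<le> dim ?B"
    using dim_mono by blast
  moreover have "dim (insert (y v) (range (D y v))) = 3"
    using r by (simp add: proj_rank_def)
  moreover have "dim ?B \<le> card ?B"
    by (rule dim_le_card') simp
  moreover have "card ?B \<le> 3"
    by (simp add: card_insert_if)
  ultimately have c: "card ?B = 3" "dim ?B = card ?B"
    by linarith+
  then have ind: "independent ?B"
    using card_eq_dim[of ?B "span ?B"] span_superset by (metis card.infinite dim_span order_refl zero_neq_numeral)
  have ne: "y v \<noteq> D y v ?e1" "y v \<noteq> D y v ?e2" "D y v ?e1 \<noteq> D y v ?e2"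
    using c(1) by (auto simp: card_insert_if split: if_splits)
  obtain l :: "real^5 \<Rightarrow> real" where l: "linear l" "\<forall>z\<in>?B. l z = (if z = y v then 1 else 0)"
    using linear_independent_extend[OF ind, of "\<lambda>z. if z = y v then 1 else 0"] by auto
  obtain m :: "real^5 \<Rightarrow> real^2" where m: "linear m"
    "\<forall>z\<in>?B. m z = (if z = y v then 0 else if z = D y v ?e1 then ?e1 else ?e2)"
    using linear_independent_extend[OF ind,
        of "\<lambda>z. if z = y v then 0 else if z = D y v ?e1 then ?e1 else ?e2"] by auto
  show ?thesis
  proof (rule that[OF l(1) m(1)])
    show "l (y v) = 1" "m (y v) = 0"
      using l m by auto
    fix w
    show "l (D y v w) = 0"
      using l ne by (subst D_axis_sum[OF d]) (auto simp: linear_add[OF l(1)] linear_scale[OF l(1)])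
    show "m (D y v w) = w"
      using m ne by (subst D_axis_sum[OF d])
        (auto simp: linear_add[OF m(1)] linear_scale[OF m(1)] vec_eq_iff forall_2 axis_def)
  qed
qed

lemma immersion_kernel:
  fixes y :: "real^2 \<Rightarrow> real^5"
  assumes "y differentiable (at v)" "proj_rank y v = 2" "D y v w = c *\<^sub>R y v"
  shows "w = 0" "c = 0"
proof -
  obtain l :: "real^5 \<Rightarrow> real" and m :: "real^5 \<Rightarrow> real^2" where
    "linear l" "linear m" "l (y v) = 1" "m (y v) = 0" "\<And>w. l (D y v w) = 0" "\<And>w. m (D y v w) = w"
    using immersion_functionals[OF assms(1,2)] by blast
  note lm = this
  have m: "m (c *\<^sub>R y v) = 0" and l: "l (c *\<^sub>R y v) = c"
    unfolding linear_scale[OF lm(1)] linear_scale[OF lm(2)] using lm(3,4) by simp_all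
  show "w = 0"
    using lm(6)[of w] unfolding assms(3) m by (rule sym)
  show "c = 0"
    using lm(5)[of w] unfolding assms(3) l .
qed

text \<open>Bootstrapping: by Cramer's rule \<open>D h y\<close> is rational in the Jacobian of
  \<open>f\<close> at \<open>h y\<close>, so k-fold differentiability of \<open>h\<close> gives that
  of its derivative.\<close>

lemma smooth_on_local_inverse:
  fixes f h :: "real^2 \<Rightarrow> real^2"
  assumes f: "smooth_on A f" and B: "open B" and hB: "h ` B \<subseteq> A"
    and fh: "\<And>y. y \<in> B \<Longrightarrow> f (h y) = y"
    and hd: "\<And>y. y \<in> B \<Longrightarrow> h differentiable (at y)"
  shows "smooth_on B h"
proof -
  define a where "a j i y = D f (h y) (axis j 1) $ i" for j i :: 2 and y
  define b where "b j i y = D h y (axis j 1) $ i" for j i :: 2 and y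
  define det where "det y = a 1 1 y * a 2 2 y - a 1 2 y * a 2 1 y" for y
  have fd: "f differentiable (at (h y))" if "y \<in> B" for y
    using that hB smooth_on_differentiable[OF f] by blast
  have id: "D f (h y) (D h y w) = w" if y: "y \<in> B" for y w
  proof -
    have "D (\<lambda>y. f (h y)) y = D (\<lambda>y. y) y"
      by (rule D_cong[OF B y fh])
    then show ?thesis
      using D_comp(1)[OF fd[OF y] hd[OF y], of w] by simp
  qed
  have sys: "w $ i = D h y w $ 1 * a 1 i y + D h y w $ 2 * a 2 i y" if y: "y \<in> B" for y w i
    using arg_cong[OF id[OF y, of w], of "\<lambda>z. z $ i"] D_axis_sum[OF fd[OF y], of "D h y w"]
    by (simp add: a_def)
  have det: "det y \<noteq> 0" if y: "y \<in> B" for y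
  proof
    assume "det y = 0"
    moreover have "1 = det y * (b 1 1 y * b 2 2 y - b 1 2 y * b 2 1 y)"
      using sys[OF y, of "axis 1 1" 1] sys[OF y, of "axis 1 1" 2] sys[OF y, of "axis 2 1" 1]
        sys[OF y, of "axis 2 1" 2]
      unfolding det_def b_def by (simp add: axis_def) algebra
    ultimately show False
      by simp
  qed
  have sol: "D h y w = vector [(w$1 * a 2 2 y - w$2 * a 2 1 y) * inverse (det y),
      (w$2 * a 1 1 y - w$1 * a 1 2 y) * inverse (det y)]" if y: "y \<in> B" for y w
    using det[OF y] sys[OF y, of w 1] sys[OF y, of w 2]
    by (simp add: vec_eq_iff forall_2 det_def field_simps)
  have "Ck_on k B h" for k
  proof (induction k)
    case 0
    then show ?case
      using hd by (auto intro!: continuous_at_imp_continuous_on differentiable_imp_continuous_within)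
  next
    case (Suc k)
    have a: "Ck_on k B (a j i)" for j i
    proof -
      have "smooth_on A (\<lambda>y. D f y (axis j 1) $ i)"
        by (intro smooth_on_nth smooth_on_D f)
      then show ?thesis
        unfolding a_def[abs_def]
        using Ck_on_compose[OF B smooth_on_open[OF f] hB _ Suc, of "\<lambda>y. D f y (axis j 1) $ i"]
        by (simp add: smooth_on_Ck)
    qed
    note mult = Ck_on_bilinear[OF bounded_bilinear_mult B]
    have minus: "Ck_on k B (\<lambda>y. p y - q y)" if "Ck_on k B p" "Ck_on k B q" for p q :: "real^2 \<Rightarrow> real"
      using Ck_on_add[OF B that(1) mult[OF Ck_on_const[of k B "-1"] that(2)]] by simp
    have det': "Ck_on k B det"
      unfolding det_def[abs_def] by (intro minus mult a)
    have inv: "Ck_on k B (\<lambda>y. inverse (det y))"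
      using det by (intro Ck_on_compose[OF B _ _ Ck_on_inverse det']) auto
    have "Ck_on k B (\<lambda>y. D h y w)" for w
    proof (rule Ck_on_cong[OF B])
      show "Ck_on k B (\<lambda>y. ((w$1 * a 2 2 y - w$2 * a 2 1 y) * inverse (det y)) *\<^sub>R axis 1 1
          + ((w$2 * a 1 1 y - w$1 * a 1 2 y) * inverse (det y)) *\<^sub>R axis 2 1 :: real^2)"
        by (intro Ck_on_add[OF B] Ck_on_bilinear[OF bounded_bilinear_scaleR B] mult minus inv a Ck_on_const)
    qed (auto simp: sol vec_eq_iff forall_2 axis_def)
    then show ?case
      using hd by simp
  qed
  then show ?thesis
    using B by (simp add: smooth_on_def)
qed

lemma smooth_inverse_function:
  fixes f :: "real^2 \<Rightarrow> real^2"
  assumes f: "smooth_on V f" and v: "v \<in> V" and Df: "\<And>w. D f v w = w"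
  obtains A B h where "open A" "v \<in> A" "A \<subseteq> V" "open B" "f ` A = B" "smooth_on B h"
    "h ` B = A" "\<And>a. a \<in> A \<Longrightarrow> h (f a) = a"
proof -
  have bl: "bounded_linear (D f y)" if "y \<in> V" for y
    using has_D[OF smooth_on_differentiable[OF f that]] by (rule has_derivative_bounded_linear)
  define f' where "f' y = Blinfun (D f y)" for y
  have f': "blinfun_apply (f' y) = D f y" if "y \<in> V" for y
    by (simp add: f'_def bounded_linear_Blinfun_apply[OF bl[OF that]])
  obtain A B h h' where *: "open A" "A \<subseteq> V" "v \<in> A" "open B" "f v \<in> B" "homeomorphism A B f h"
    "\<And>y. y \<in> B \<Longrightarrow> (h has_derivative (h' y)) (at y)"
  proof (rule inverse_function_theorem[of V f f' v id_blinfun])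
    show "open V" "v \<in> V"
      using f v by (auto simp: smooth_on_open)
    show "(f has_derivative blinfun_apply (f' x)) (at x)" if "x \<in> V" for x
      using has_D[OF smooth_on_differentiable[OF f that]] by (simp add: f'[OF that])
    show "continuous_on V f'"
    proof (rule continuous_on_blinfun_componentwise)
      fix i :: "real^2"
      show "continuous_on V (\<lambda>x. blinfun_apply (f' x) i)"
        using smooth_on_continuous[OF smooth_on_D[OF f, of i]] f' by (simp cong: continuous_on_cong)
    qed
    show "id_blinfun o\<^sub>L f' v = id_blinfun"
      by (rule blinfun_eqI) (simp add: f'[OF v] Df)
  qed (rule that, assumption+)
  have "smooth_on B h"
  proof (rule smooth_on_local_inverse)
    show "smooth_on A f"
      using smooth_on_subset[OF f] * by blast
  qed (use * in \<open>auto simp: homeomorphism_def differentiable_def\<close>)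
  then show ?thesis
    using * by (intro that[of A B h]) (auto simp: homeomorphism_def)
qed

lemma scaleR_solve:
  assumes "0 = r *\<^sub>R a + d *\<^sub>R b" "r \<noteq> 0"
  shows "a = (- d / r) *\<^sub>R (b::'a::real_vector)"
proof -
  have "r *\<^sub>R a = - (d *\<^sub>R b)"
    using assms(1) by (metis add_eq_0_iff2)
  moreover have "a = inverse r *\<^sub>R r *\<^sub>R a"
    using assms(2) by simp
  ultimately have "a = inverse r *\<^sub>R (- (d *\<^sub>R b))"
    by simp
  then show ?thesis
    by (simp add: divide_inverse mult.commute)
qed

text \<open>In the affine chart \<open>m / l\<close> adapted to \<open>y\<close> at
  \<open>v\<close>, the map \<open>y\<close> is a local diffeomorphism with derivative the identity
  at \<open>v\<close>; composing its inverse with the chart expression of \<open>x\<close> gives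
  \<open>\<phi>\<close>. A vector killed by \<open>D \<phi>\<close> would make \<open>D x\<close>
  proportional to \<open>x\<close>, which the rank of \<open>x\<close> excludes.\<close>

lemma transition:
  assumes x: "local_lift M U x" and y: "local_lift M V y"
    and u: "u \<in> U" and v: "v \<in> V" and uv: "pt (x u) = pt (y v)"
  obtains U' \<phi> \<rho> where "open U'" "u \<in> U'" "U' \<subseteq> U" "smooth_on U' \<phi>" "\<phi> ` U' \<subseteq> V" "\<phi> u = v"
    "smooth_on U' \<rho>" "\<And>s. s \<in> U' \<Longrightarrow> \<rho> s \<noteq> 0" "\<And>s. s \<in> U' \<Longrightarrow> y (\<phi> s) = \<rho> s *\<^sub>R x s"
    "\<And>s. s \<in> U' \<Longrightarrow> bij (D \<phi> s)"
proof -
  note xs = local_lift_smooth[OF x] and ys = local_lift_smooth[OF y]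
  obtain l :: "real^5 \<Rightarrow> real" and m :: "real^5 \<Rightarrow> real^2" where lm:
    "linear l" "linear m" "l (y v) = 1" "m (y v) = 0" "\<And>w. l (D y v w) = 0" "\<And>w. m (D y v w) = w"
    using immersion_functionals[OF smooth_on_differentiable[OF ys v] local_lift_rank[OF y v]] by blast
  have bl: "bounded_linear l" "bounded_linear m"
    using lm by (simp_all add: linear_conv_bounded_linear[symmetric])
  define V0 where "V0 = {s \<in> V. l (y s) \<noteq> 0}"
  have "V0 = V \<inter> (\<lambda>s. l (y s)) -` (- {0})"
    by (auto simp: V0_def)
  then have V0: "open V0"
    using continuous_open_preimage[OF smooth_on_continuous[OF smooth_on_linear_comp[OF bl(1) ys]]
        local_lift_open[OF y]] by auto
  have V0V: "V0 \<subseteq> V" "v \<in> V0"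
    using v lm by (auto simp: V0_def)
  define f where "f s = inverse (l (y s)) *\<^sub>R m (y s)" for s
  have ys0: "smooth_on V0 y"
    using smooth_on_subset[OF ys V0 V0V(1)] .
  have r0: "smooth_on V0 (\<lambda>s. inverse (l (y s)))"
    by (rule smooth_on_inverse[OF smooth_on_linear_comp[OF bl(1) ys0]]) (simp add: V0_def)
  have m0: "smooth_on V0 (\<lambda>s. m (y s))"
    by (rule smooth_on_linear_comp[OF bl(2) ys0])
  have f: "smooth_on V0 f"
    unfolding f_def[abs_def] by (rule smooth_on_scaleR[OF r0 m0])
  have "D f v w = w" for w
    unfolding f_def[abs_def]
    using D_scale[OF smooth_on_differentiable[OF r0 V0V(2)] smooth_on_differentiable[OF m0 V0V(2)], of w]
    by (simp add: lm D_linear_comp[OF bl(2) smooth_on_differentiable[OF ys v]])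
  from smooth_inverse_function[OF f V0V(2) this] obtain A B h where h:
    "open A" "v \<in> A" "A \<subseteq> V0" "open B" "f ` A = B" "smooth_on B h" "h ` B = A" "\<And>a. a \<in> A \<Longrightarrow> h (f a) = a"
    by blast
  \<comment> \<open>Points of \<open>x\<close> that happen to lie over the small patch
    \<open>A\<close> of \<open>y\<close>; openness of this set uses that lifts are open onto the
    surface, so that no other sheet can interfere.\<close>
  define U' where "U' = {s \<in> U. pt (x s) \<in> (\<lambda>s. pt (y s)) ` A}"
  have U': "open U'"
    unfolding U'_def using h V0V by (intro open_local_lift_preimage[OF x] local_lift_openin[OF y]) auto
  have uU': "u \<in> U'" "U' \<subseteq> U"
    using u uv h by (auto simp: U'_def)
  define \<phi> where "\<phi> s = h (inverse (l (x s)) *\<^sub>R m (x s))" for s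
  have key: "l (x s) \<noteq> 0 \<and> inverse (l (x s)) *\<^sub>R m (x s) \<in> B \<and> \<phi> s \<in> A \<and> pt (y (\<phi> s)) = pt (x s)"
    if s: "s \<in> U'" for s
  proof -
    obtain a where a: "a \<in> A" "pt (y a) = pt (x s)"
      using s by (auto simp: U'_def)
    have "y a \<noteq> 0"
      using a h V0V local_lift_nonzero[OF y] by blast
    then obtain c where c: "c \<noteq> 0" "x s = c *\<^sub>R y a"
      using pt_eqD[OF a(2)] by blast
    have "l (y a) \<noteq> 0"
      using a h by (auto simp: V0_def)
    then have "l (x s) \<noteq> 0" "inverse (l (x s)) *\<^sub>R m (x s) = f a"
      using c lm by (auto simp: f_def linear_scale[OF lm(1)] linear_scale[OF lm(2)])
    moreover from this have "\<phi> s = a"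
      using h a by (simp add: \<phi>_def)
    ultimately show ?thesis
      using a h by auto
  qed
  have xs': "smooth_on U' x"
    using smooth_on_subset[OF xs U' uU'(2)] .
  have \<phi>: "smooth_on U' \<phi>"
    unfolding \<phi>_def[abs_def]
  proof (rule smooth_on_compose[OF h(6)])
    show "smooth_on U' (\<lambda>s. inverse (l (x s)) *\<^sub>R m (x s))"
      using key by (intro smooth_on_scaleR smooth_on_inverse smooth_on_linear_comp[OF bl(1) xs']
          smooth_on_linear_comp[OF bl(2) xs']) blast
    show "(\<lambda>s. inverse (l (x s)) *\<^sub>R m (x s)) ` U' \<subseteq> B"
      using key by blast
  qed
  have \<phi>V: "\<phi> ` U' \<subseteq> V"
  proof
    fix t assume "t \<in> \<phi> ` U'"
    then have "t \<in> A"
      using key by auto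
    then show "t \<in> V"
      using h(3) V0V(1) by auto
  qed
  have \<phi>u: "\<phi> u = v"
  proof -
    have "pt (y (\<phi> u)) = pt (y v)"
      using key[OF uU'(1)] uv by simp
    moreover have "inj_on (\<lambda>s. pt (y s)) V" "\<phi> u \<in> V"
      using y \<phi>V uU' by (auto simp: local_lift_iff)
    ultimately show ?thesis
      using inj_onD[of "\<lambda>s. pt (y s)" V "\<phi> u" v] v by simp
  qed
  \<comment> \<open>The proportionality factor is written with Euclidean inner products so that its
    smoothness is visible.\<close>
  define \<rho> where "\<rho> s = (y (\<phi> s) \<bullet> x s) * inverse (x s \<bullet> x s)" for s
  have xn: "x s \<noteq> 0" if "s \<in> U'" for s
    using that uU' local_lift_nonzero[OF x] by blast
  have y\<phi>: "smooth_on U' (\<lambda>s. y (\<phi> s))"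
    by (rule smooth_on_compose[OF ys \<phi> \<phi>V])
  have \<rho>s: "smooth_on U' \<rho>"
    unfolding \<rho>_def[abs_def]
    by (intro smooth_on_mult smooth_on_inverse smooth_on_inner y\<phi> xs') (use xn in auto)
  have \<rho>: "\<rho> s \<noteq> 0 \<and> y (\<phi> s) = \<rho> s *\<^sub>R x s" if s: "s \<in> U'" for s
  proof -
    obtain c where c: "c \<noteq> 0" "y (\<phi> s) = c *\<^sub>R x s"
      using pt_eqD[of "x s" "y (\<phi> s)"] key[OF s] xn[OF s] by metis
    then have "\<rho> s = c"
      using xn[OF s] by (simp add: \<rho>_def)
    with c show ?thesis
      by simp
  qed
  have "bij (D \<phi> s)" if s: "s \<in> U'" for s
  proof -
    note d\<phi> = smooth_on_differentiable[OF \<phi> s] and dx = smooth_on_differentiable[OF xs' s]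
    have dy: "y differentiable (at (\<phi> s))"
      using smooth_on_differentiable[OF ys] \<phi>V s by blast
    have "w = 0" if w: "D \<phi> s w = 0" for w
    proof -
      have "0 = D (\<lambda>s. y (\<phi> s)) s w"
        using D_comp(1)[OF dy d\<phi>, of w] w linear_0[OF D_lin[OF dy]] by simp
      also have "\<dots> = D (\<lambda>s. \<rho> s *\<^sub>R x s) s w"
        using D_cong[OF U' s, of "\<lambda>s. y (\<phi> s)" "\<lambda>s. \<rho> s *\<^sub>R x s"] \<rho> by simp
      also have "\<dots> = \<rho> s *\<^sub>R D x s w + D \<rho> s w *\<^sub>R x s"
        by (rule D_scale[OF smooth_on_differentiable[OF \<rho>s s] dx])
      finally have "D x s w = (- D \<rho> s w / \<rho> s) *\<^sub>R x s"
        using \<rho>[OF s] by (intro scaleR_solve) simp_all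
      then show ?thesis
        using immersion_kernel(1)[OF dx] local_lift_rank[OF x] s uU' by blast
    qed
    then have inj: "inj (D \<phi> s)"
      using linear_injective_0[OF D_lin[OF d\<phi>]] by blast
    then show ?thesis
      using linear_injective_imp_surjective[OF D_lin[OF d\<phi>]] by (simp add: bij_def)
  qed
  then show ?thesis
    using that[OF U' uU' \<phi> \<phi>V \<phi>u \<rho>s] \<rho> by blast
qed

section \<open>Cyclide frames\<close>

text \<open>With \<open>W\<^sub>\<plusminus> = v\<^sub>1 \<plusminus> v\<^sub>2\<close> and \<open>\<theta>\<^sub>1 = P + Q\<close>, \<open>\<theta>\<^sub>2 = P - Q\<close> these are the equations for
  \<open>dv\<^sub>0\<close> and \<open>dv\<^sub>3\<close> of a normalized frame with \<open>\<epsilon> = 1\<close> and \<open>\<kappa>\<^sub>1 = \<kappa>\<^sub>2 = 0\<close>; equivalently each of the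
  sphere maps \<open>v\<^sub>3 \<plusminus> 2 v\<^sub>0\<close> has rank one. The other structure equations follow.\<close>

definition cyclide_frame :: "(real^2) set \<Rightarrow> (nat \<Rightarrow> real^2 \<Rightarrow> real^5) \<Rightarrow> bool" where
  "cyclide_frame U v \<longleftrightarrow> open U \<and> (\<forall>i\<le>4. smooth_on U (v i)) \<and>
     (\<forall>u\<in>U. hyperbolic_frame (\<lambda>i. v i u) \<and> inj (D (v 0) u) \<and>
        (\<forall>w. \<exists>P Q. D (v 0) u w = P *\<^sub>R (v 1 u + v 2 u) + Q *\<^sub>R (v 1 u - v 2 u) \<and>
           D (v 3) u w = - (2 * P) *\<^sub>R (v 1 u + v 2 u) + (2 * Q) *\<^sub>R (v 1 u - v 2 u)))"

definition wplus :: "(nat \<Rightarrow> real^2 \<Rightarrow> real^5) \<Rightarrow> real^2 \<Rightarrow> real^5" where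
  "wplus v u = v 1 u + v 2 u"

definition wminus :: "(nat \<Rightarrow> real^2 \<Rightarrow> real^5) \<Rightarrow> real^2 \<Rightarrow> real^5" where
  "wminus v u = v 1 u - v 2 u"

text \<open>\<open>formP\<close> and \<open>formQ\<close> are the coordinates of
  \<open>D (v 0)\<close> along \<open>wplus\<close> and \<open>wminus\<close>; the factors 1/2 and
  -1/2 come from the norms 2 and -2 of these vectors.\<close>

definition formP :: "(nat \<Rightarrow> real^2 \<Rightarrow> real^5) \<Rightarrow> real^2 \<Rightarrow> real^2 \<Rightarrow> real" where
  "formP v u w = ip (D (v 0) u w) (wplus v u) / 2"

definition formQ :: "(nat \<Rightarrow> real^2 \<Rightarrow> real^5) \<Rightarrow> real^2 \<Rightarrow> real^2 \<Rightarrow> real" where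
  "formQ v u w = - ip (D (v 0) u w) (wminus v u) / 2"

lemma cyclide_frame_smooth: "cyclide_frame U v \<Longrightarrow> i \<le> 4 \<Longrightarrow> smooth_on U (v i)"
  by (simp add: cyclide_frame_def)

lemma cyclide_frame_open: "cyclide_frame U v \<Longrightarrow> open U"
  by (simp add: cyclide_frame_def)

lemma cyclide_frame_hyperbolic: "cyclide_frame U v \<Longrightarrow> u \<in> U \<Longrightarrow> hyperbolic_frame (\<lambda>i. v i u)"
  by (simp add: cyclide_frame_def)

lemma w_ip:
  assumes "hyperbolic_frame (\<lambda>i. v i u)"
  shows "ip (wplus v u) (wplus v u) = 2" "ip (wminus v u) (wminus v u) = -2"
    "ip (wplus v u) (wminus v u) = 0" "ip (wminus v u) (wplus v u) = 0"
    "ip (wplus v u) (v 0 u) = 0" "ip (v 0 u) (wplus v u) = 0" "ip (wminus v u) (v 0 u) = 0" "ip (v 0 u) (wminus v u) = 0"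
    "ip (wplus v u) (v 3 u) = 0" "ip (v 3 u) (wplus v u) = 0" "ip (wminus v u) (v 3 u) = 0" "ip (v 3 u) (wminus v u) = 0"
    "ip (wplus v u) (v 4 u) = 0" "ip (v 4 u) (wplus v u) = 0" "ip (wminus v u) (v 4 u) = 0" "ip (v 4 u) (wminus v u) = 0"
  by (simp_all add: wplus_def wminus_def ip_simps frame_ip[OF assms])

lemma frame_eqI_w:
  assumes "hyperbolic_frame (\<lambda>i. v i u)"
    "ip x (v 0 u) = ip y (v 0 u)" "ip x (wplus v u) = ip y (wplus v u)" "ip x (wminus v u) = ip y (wminus v u)"
    "ip x (v 3 u) = ip y (v 3 u)" "ip x (v 4 u) = ip y (v 4 u)"
  shows "x = y"
  using assms(2-) by (intro frame_eqI[OF assms(1)]) (simp_all add: wplus_def wminus_def ip_simps)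

lemma cyclide_frame_D:
  assumes c: "cyclide_frame U v" and u: "u \<in> U"
  shows "D (v 0) u w = formP v u w *\<^sub>R wplus v u + formQ v u w *\<^sub>R wminus v u"
    "D (v 3) u w = - (2 * formP v u w) *\<^sub>R wplus v u + (2 * formQ v u w) *\<^sub>R wminus v u"
proof -
  obtain P Q where PQ: "D (v 0) u w = P *\<^sub>R wplus v u + Q *\<^sub>R wminus v u"
     "D (v 3) u w = - (2 * P) *\<^sub>R wplus v u + (2 * Q) *\<^sub>R wminus v u"
    using c u unfolding cyclide_frame_def wplus_def wminus_def by blast
  have "formP v u w = P" "formQ v u w = Q"
    unfolding formP_def formQ_def PQ
    by (simp_all add: ip_simps w_ip[of v u, OF cyclide_frame_hyperbolic[OF c u]])
  with PQ show "D (v 0) u w = formP v u w *\<^sub>R wplus v u + formQ v u w *\<^sub>R wminus v u"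
    "D (v 3) u w = - (2 * formP v u w) *\<^sub>R wplus v u + (2 * formQ v u w) *\<^sub>R wminus v u"
    by simp_all
qed

lemma cyclide_frame_smooth_w:
  assumes c: "cyclide_frame U v"
  shows "smooth_on U (wplus v)" "smooth_on U (wminus v)"
    "smooth_on U (\<lambda>u. formP v u w)" "smooth_on U (\<lambda>u. formQ v u w)"
proof -
  note s = cyclide_frame_smooth[OF c]
  show W: "smooth_on U (wplus v)" "smooth_on U (wminus v)"
    unfolding wplus_def[abs_def] wminus_def[abs_def] by (auto intro!: smooth_on_add smooth_on_diff s)
  have "smooth_on U (\<lambda>u. (1/2) *\<^sub>R ip (D (v 0) u w) (wplus v u))"
    "smooth_on U (\<lambda>u. (-1/2) *\<^sub>R ip (D (v 0) u w) (wminus v u))"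
    by (intro smooth_on_scaleR_const smooth_on_ip smooth_on_D s W, simp)+
  then show "smooth_on U (\<lambda>u. formP v u w)" "smooth_on U (\<lambda>u. formQ v u w)"
    unfolding formP_def formQ_def by simp_all
qed

lemma form_linear:
  assumes c: "cyclide_frame U v" and u: "u \<in> U"
  shows "linear (formP v u)" "linear (formQ v u)"
proof -
  have "linear (D (v 0) u)"
    using D_lin[OF smooth_on_differentiable[OF cyclide_frame_smooth[OF c] u]] by simp
  then show "linear (formP v u)" "linear (formQ v u)"
    by (auto simp: linear_iff formP_def formQ_def ip_simps field_simps)
qed

text \<open>Injectivity of \<open>D (v 0) u\<close> makes \<open>formP\<close> and
  \<open>formQ\<close> a coframe of the parameter plane; \<open>a, b\<close> is its dual
  basis.\<close>

lemma cyclide_frame_coords: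
  assumes c: "cyclide_frame U v" and u: "u \<in> U"
  obtains a b where "formP v u a = 1" "formQ v u a = 0" "formP v u b = 0" "formQ v u b = 1"
    "\<And>w. w = formP v u w *\<^sub>R a + formQ v u w *\<^sub>R b"
proof -
  note l = form_linear[OF c u]
  define L where "L w = (vector [formP v u w, formQ v u w] :: real^2)" for w
  have lin: "linear L"
    using l by (auto simp: linear_iff L_def vec_eq_iff forall_2)
  have inj0: "inj (D (v 0) u)"
    using c u by (simp add: cyclide_frame_def)
  have "inj L"
  proof (rule injI)
    fix w w' assume "L w = L w'"
    then have "formP v u w = formP v u w'" "formQ v u w = formQ v u w'"
      by (simp_all add: L_def vec_eq_iff forall_2)
    then have "D (v 0) u w = D (v 0) u w'"
      unfolding cyclide_frame_D[OF c u] by simp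
    then show "w = w'"
      using inj0 by (simp add: inj_def)
  qed
  then have "surj L"
    using linear_injective_imp_surjective[OF lin] by blast
  then obtain a b where "L a = vector [1, 0]" "L b = vector [0, 1]"
    by (metis surj_def)
  then have ab: "formP v u a = 1" "formQ v u a = 0" "formP v u b = 0" "formQ v u b = 1"
    by (simp_all add: L_def vec_eq_iff forall_2)
  have "w = formP v u w *\<^sub>R a + formQ v u w *\<^sub>R b" for w
  proof -
    have "L w = L (formP v u w *\<^sub>R a + formQ v u w *\<^sub>R b)"
      by (simp add: L_def vec_eq_iff forall_2 linear_add[OF l(1)] linear_add[OF l(2)]
          linear_scale[OF l(1)] linear_scale[OF l(2)] ab)
    then show ?thesis
      using \<open>inj L\<close> by (simp add: inj_def)
  qed
  with ab that show ?thesis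
    by blast
qed

section \<open>Integrability conditions and the full structure equations\<close>

lemma curl_identity:
  assumes f: "smooth_on U f" and g: "smooth_on U g" and u: "u \<in> U"
  shows "D (\<lambda>y. ip (D f y b) (g y)) u a - ip (D f u b) (D g u a)
       = D (\<lambda>y. ip (D f y a) (g y)) u b - ip (D f u a) (D g u b)"
  using D_ip[OF smooth_on_differentiable[OF smooth_on_D[OF f] u] smooth_on_differentiable[OF g u], of b a]
    D_ip[OF smooth_on_differentiable[OF smooth_on_D[OF f] u] smooth_on_differentiable[OF g u], of a b]
    schwarz[OF f u, of a b]
  by simp

text \<open>Symmetry of the second fundamental form of \<open>f\<close> in a normal direction
  \<open>g\<close>: the exterior derivative of the vanishing one-form \<langle>df, g\<rangle>, in
  which the second derivatives of \<open>f\<close> cancel. All integrability conditions are drawn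
  from this and from \<open>curl_identity\<close>, with various pairs of frame vectors for
  \<open>f\<close> and \<open>g\<close>.\<close>

lemma curl_identity0:
  assumes f: "smooth_on U f" and g: "smooth_on U g" and u: "u \<in> U"
    and z: "\<And>y w. y \<in> U \<Longrightarrow> ip (D f y w) (g y) = 0"
  shows "ip (D f u b) (D g u a) = ip (D f u a) (D g u b)"
proof -
  have "D (\<lambda>y. ip (D f y w) (g y)) u = D (\<lambda>y. 0) u" for w
    using smooth_on_open[OF f] u z by (rule D_cong)
  then show ?thesis
    using curl_identity[OF f g u, of b a] by simp
qed

lemma ip_const_D:
  assumes f: "smooth_on U f" and g: "smooth_on U g" and u: "u \<in> U"
    and z: "\<And>y. y \<in> U \<Longrightarrow> ip (f y) (g y) = k"
  shows "ip (D f u w) (g u) = - ip (f u) (D g u w)"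
proof -
  have "D (\<lambda>y. ip (f y) (g y)) u = D (\<lambda>y. k) u"
    using smooth_on_open[OF f] u z by (rule D_cong)
  then show ?thesis
    using D_ip[OF smooth_on_differentiable[OF f u] smooth_on_differentiable[OF g u], of w] by simp
qed

text \<open>\<open>zplus\<close> and \<open>zminus\<close> are the two sphere maps. Both have norm
  -2 and so has their product, so they differ by a null vector, four times the lift.\<close>

definition zplus :: "(nat \<Rightarrow> real^2 \<Rightarrow> real^5) \<Rightarrow> real^2 \<Rightarrow> real^5" where
  "zplus v u = v 3 u + 2 *\<^sub>R v 0 u"

definition zminus :: "(nat \<Rightarrow> real^2 \<Rightarrow> real^5) \<Rightarrow> real^2 \<Rightarrow> real^5" where
  "zminus v u = v 3 u - 2 *\<^sub>R v 0 u"

lemma zplus_zminus: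
  assumes c: "cyclide_frame U v"
  shows "smooth_on U (zplus v)" "smooth_on U (zminus v)"
    "u \<in> U \<Longrightarrow> D (zplus v) u w = (4 * formQ v u w) *\<^sub>R wminus v u"
    "u \<in> U \<Longrightarrow> D (zminus v) u w = (- 4 * formP v u w) *\<^sub>R wplus v u"
proof -
  note s0 = cyclide_frame_smooth[OF c, of 0, simplified] and s3 = cyclide_frame_smooth[OF c, of 3, simplified]
  show "smooth_on U (zplus v)" "smooth_on U (zminus v)"
    unfolding zplus_def[abs_def] zminus_def[abs_def]
    by (auto intro!: smooth_on_add smooth_on_diff smooth_on_scaleR_const s0 s3)
  assume u: "u \<in> U"
  note d = smooth_on_differentiable[OF s3 u] smooth_on_differentiable[OF smooth_on_scaleR_const[OF s0] u]
  have 2: "D (\<lambda>y. 2 *\<^sub>R v 0 y) u w = 2 *\<^sub>R D (v 0) u w"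
    using smooth_on_differentiable[OF s0 u] by (auto simp: D_linear_comp[OF bounded_linear_scaleR_right])
  have "(4 * r) *\<^sub>R x = (2 * r) *\<^sub>R x + (2 * r) *\<^sub>R x" for r and x :: "real^5"
    by (simp flip: scaleR_add_left)
  then show "D (zplus v) u w = (4 * formQ v u w) *\<^sub>R wminus v u"
    "D (zminus v) u w = (- 4 * formP v u w) *\<^sub>R wplus v u"
    unfolding zplus_def[abs_def] zminus_def[abs_def] D_plus[OF d] D_minus[OF d] 2
      cyclide_frame_D[OF c u]
    by (simp_all add: scaleR_add_right)
qed

text \<open>\<open>D zplus\<close> is parallel to \<open>wminus\<close>, hence normal to
  \<open>wplus\<close>, and symmetry of the resulting second fundamental form removes the
  \<open>wminus\<close> part of \<open>D wplus\<close> along \<open>a\<close>; the pair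
  \<open>zminus\<close>, \<open>wminus\<close> does the same along \<open>b\<close>. In terms of the
  connection forms this is \<alpha>11 - \<alpha>22 = 0.\<close>

lemma cyclide_frame_w_orth:
  assumes c: "cyclide_frame U v" and u: "u \<in> U"
  shows "ip (D (wplus v) u w) (wminus v u) = 0" "ip (D (wminus v) u w) (wplus v u) = 0"
proof -
  note hf = cyclide_frame_hyperbolic[OF c]
  note ips = w_ip[of v, OF hf] ip_simps
  note sw = cyclide_frame_smooth_w[OF c] and z = zplus_zminus[OF c]
  obtain a b where ab: "formP v u a = 1" "formQ v u a = 0" "formP v u b = 0" "formQ v u b = 1"
    and w: "\<And>w. w = formP v u w *\<^sub>R a + formQ v u w *\<^sub>R b"
    using cyclide_frame_coords[OF c u] by metis
  have F1: "ip (wminus v u) (D (wplus v) u a) = 0"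
    using curl_identity0[OF z(1) sw(1) u, of b a] z(3) ab u by (simp add: ips)
  have F2: "ip (wplus v u) (D (wminus v) u b) = 0"
    using curl_identity0[OF z(2) sw(2) u, of b a] z(4) ab u by (simp add: ips)
  have k: "ip (D (wplus v) u w) (wminus v u) = - ip (wplus v u) (D (wminus v) u w)" for w
    by (rule ip_const_D[OF sw(1,2) u w_ip(3)[of v, OF hf]])
  have l: "linear (D (wplus v) u)"
    using D_lin[OF smooth_on_differentiable[OF sw(1) u]] .
  show 1: "ip (D (wplus v) u w) (wminus v u) = 0"
    using F1 F2 k[of b]
    by (subst w) (simp add: ip_simps ip_sym[of _ "wminus v u"] linear_add[OF l] linear_scale[OF l])
  then show "ip (D (wminus v) u w) (wplus v u) = 0"
    using k[of w] by (simp add: ip_sym)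
qed

text \<open>Pairing \<open>v 4\<close> with the two sphere maps shows that \<open>D (v 4)\<close> is
  diagonal for the directions \<open>wplus\<close>, \<open>wminus\<close>. Its two diagonal
  coefficients, and through the constant Gram matrix all remaining derivatives, depend on two
  numbers \<open>t\<close> and \<open>s\<close>. Their equality corresponds to b12 = b21 = 1 and an
  equal \<tau> in both \<beta>.\<close>

lemma cyclide_frame_structure_ex:
  assumes c: "cyclide_frame U v" and u: "u \<in> U"
  shows "\<exists>t. \<forall>w. D (v 4) u w = ((1 + t) * formP v u w) *\<^sub>R wplus v u + ((1 - t) * formQ v u w) *\<^sub>R wminus v u \<and>
     D (wplus v) u w = (2 * formP v u w) *\<^sub>R ((t + 1) *\<^sub>R v 0 u - v 3 u + v 4 u) \<and>
     D (wminus v) u w = (2 * formQ v u w) *\<^sub>R ((t - 1) *\<^sub>R v 0 u - v 3 u - v 4 u)"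
proof -
  note hf = cyclide_frame_hyperbolic[OF c]
  note ips = w_ip[of v, OF hf] frame_ip[OF hf] ip_simps
  note s0 = cyclide_frame_smooth[OF c, of 0, simplified] and s3 = cyclide_frame_smooth[OF c, of 3, simplified]
    and s4 = cyclide_frame_smooth[OF c, of 4, simplified]
  note sw = cyclide_frame_smooth_w[OF c]
  note d0 = cyclide_frame_D(1)[OF c] and d3 = cyclide_frame_D(2)[OF c]
  note z = zplus_zminus[OF c]
  obtain a b where ab: "formP v u a = 1" "formQ v u a = 0" "formP v u b = 0" "formQ v u b = 1"
    and w: "\<And>w. w = formP v u w *\<^sub>R a + formQ v u w *\<^sub>R b"
    using cyclide_frame_coords[OF c u] by metis
  have exp: "D f u w = formP v u w *\<^sub>R D f u a + formQ v u w *\<^sub>R D f u b" if "smooth_on U f" for f :: "real^2 \<Rightarrow> real^5" and w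
    using D_lin[OF smooth_on_differentiable[OF that u]] by (subst w) (simp add: linear_add linear_scale)
  have F3: "ip (wminus v u) (D (v 4) u a) = 0"
    using curl_identity0[OF z(1) s4 u, of b a] z(3) ab u by (simp add: ips)
  have F4: "ip (wplus v u) (D (v 4) u b) = 0"
    using curl_identity0[OF z(2) s4 u, of b a] z(4) ab u by (simp add: ips)
  have k: "ip (D (wplus v) u w) (wminus v u) = - ip (wplus v u) (D (wminus v) u w)"
    "ip (D (wplus v) u w) (wplus v u) = - ip (wplus v u) (D (wplus v) u w)"
    "ip (D (wminus v) u w) (wminus v u) = - ip (wminus v u) (D (wminus v) u w)"
    "ip (D (wplus v) u w) (v 0 u) = - ip (wplus v u) (D (v 0) u w)"
    "ip (D (wplus v) u w) (v 3 u) = - ip (wplus v u) (D (v 3) u w)"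
    "ip (D (wplus v) u w) (v 4 u) = - ip (wplus v u) (D (v 4) u w)"
    "ip (D (wminus v) u w) (v 0 u) = - ip (wminus v u) (D (v 0) u w)"
    "ip (D (wminus v) u w) (v 3 u) = - ip (wminus v u) (D (v 3) u w)"
    "ip (D (wminus v) u w) (v 4 u) = - ip (wminus v u) (D (v 4) u w)"
    "ip (D (v 4) u w) (v 4 u) = - ip (v 4 u) (D (v 4) u w)"
    "ip (D (v 4) u w) (v 3 u) = - ip (v 4 u) (D (v 3) u w)"
    "ip (D (v 4) u w) (v 0 u) = - ip (v 4 u) (D (v 0) u w)"
    for w
    by (rule ip_const_D[OF _ _ u], (rule sw s0 s3 s4)+, rule ips, assumption)+
  \<comment> \<open>Normalized so that the diagonal coefficients of \<open>D (v 4)\<close> become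
    \<open>1 + t\<close> and \<open>1 - s\<close>.\<close>
  define t where "t = ip (wplus v u) (D (v 4) u a) / 2 - 1"
  define s where "s = 1 + ip (wminus v u) (D (v 4) u b) / 2"
  note pm = cyclide_frame_w_orth(1)[OF c u] and mp = cyclide_frame_w_orth(2)[OF c u]
  have self: "ip (D (wplus v) u w) (wplus v u) = 0" "ip (D (wminus v) u w) (wminus v u) = 0"
    "ip (D (v 4) u w) (v 4 u) = 0" for w
    using k(2)[of w] k(3)[of w] k(10)[of w]
    by (simp_all add: ip_sym[of _ "D (wplus v) u w"] ip_sym[of _ "D (wminus v) u w"] ip_sym[of _ "D (v 4) u w"])
  have p4: "ip (D (v 4) u w) (wplus v u) = 2 * (1 + t) * formP v u w" for w
    unfolding exp[OF s4, of w] using F4 by (simp add: ip_simps t_def ip_sym[of _ "wplus v u"])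
  have m4: "ip (D (v 4) u w) (wminus v u) = - 2 * (1 - s) * formQ v u w" for w
    unfolding exp[OF s4, of w] using F3 by (simp add: ip_simps s_def ip_sym[of _ "wminus v u"])
  have D4: "D (v 4) u w = ((1 + t) * formP v u w) *\<^sub>R wplus v u + ((1 - s) * formQ v u w) *\<^sub>R wminus v u" for w
    by (rule frame_eqI_w[where v = v and u = u, OF hf[OF u]],
        simp_all add: p4 m4 self k(11,12) d0[OF u] d3[OF u] ips u) (simp add: algebra_simps)
  have Dp: "D (wplus v) u w = (2 * formP v u w) *\<^sub>R ((t + 1) *\<^sub>R v 0 u - v 3 u + v 4 u)" for w
  proof (rule frame_eqI_w[where v = v and u = u, OF hf[OF u]])
    show "ip (D (wplus v) u w) (v 4 u) = ip ((2 * formP v u w) *\<^sub>R ((t + 1) *\<^sub>R v 0 u - v 3 u + v 4 u)) (v 4 u)"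
      unfolding k(6) D4 by (simp only: ips u ) (simp add: algebra_simps)
    show "ip (D (wplus v) u w) (v 0 u) = ip ((2 * formP v u w) *\<^sub>R ((t + 1) *\<^sub>R v 0 u - v 3 u + v 4 u)) (v 0 u)"
      unfolding k(4) d0[OF u] by (simp add: ips u)
    show "ip (D (wplus v) u w) (v 3 u) = ip ((2 * formP v u w) *\<^sub>R ((t + 1) *\<^sub>R v 0 u - v 3 u + v 4 u)) (v 3 u)"
      unfolding k(5) d3[OF u] by (simp add: ips u)
  qed (simp_all add: pm self ips u)
  have Dm: "D (wminus v) u w = (2 * formQ v u w) *\<^sub>R ((s - 1) *\<^sub>R v 0 u - v 3 u - v 4 u)" for w
  proof (rule frame_eqI_w[where v = v and u = u, OF hf[OF u]])
    show "ip (D (wminus v) u w) (v 4 u) = ip ((2 * formQ v u w) *\<^sub>R ((s - 1) *\<^sub>R v 0 u - v 3 u - v 4 u)) (v 4 u)"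
      unfolding k(9) D4 by (simp only: ips u ) (simp add: algebra_simps)
    show "ip (D (wminus v) u w) (v 0 u) = ip ((2 * formQ v u w) *\<^sub>R ((s - 1) *\<^sub>R v 0 u - v 3 u - v 4 u)) (v 0 u)"
      unfolding k(7) d0[OF u] by (simp add: ips u)
    show "ip (D (wminus v) u w) (v 3 u) = ip ((2 * formQ v u w) *\<^sub>R ((s - 1) *\<^sub>R v 0 u - v 3 u - v 4 u)) (v 3 u)"
      unfolding k(8) d3[OF u] by (simp add: ips u)
  qed (simp_all add: mp self ips u)
  \<comment> \<open>\<open>wplus\<close> is orthogonal to \<open>D wminus\<close> and conversely, so
    symmetry makes \<open>D wplus\<close> along \<open>a\<close> orthogonal to
    \<open>D wminus\<close> along \<open>b\<close>; this product is a multiple of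
    \<open>t - s\<close>.\<close>
  have "s = t"
    using curl_identity0[OF sw(1) sw(2) u cyclide_frame_w_orth(1)[OF c], of b a] ab u by (simp add: Dp Dm ips)
  with D4 Dp Dm show ?thesis
    by blast
qed

definition cyclide_tau :: "(nat \<Rightarrow> real^2 \<Rightarrow> real^5) \<Rightarrow> real^2 \<Rightarrow> real" where
  "cyclide_tau v u = (SOME t. \<forall>w. D (v 4) u w = ((1 + t) * formP v u w) *\<^sub>R wplus v u + ((1 - t) * formQ v u w) *\<^sub>R wminus v u \<and>
     D (wplus v) u w = (2 * formP v u w) *\<^sub>R ((t + 1) *\<^sub>R v 0 u - v 3 u + v 4 u) \<and>
     D (wminus v) u w = (2 * formQ v u w) *\<^sub>R ((t - 1) *\<^sub>R v 0 u - v 3 u - v 4 u))"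

lemma cyclide_frame_structure:
  assumes "cyclide_frame U v" "u \<in> U"
  shows "D (v 4) u w = ((1 + cyclide_tau v u) * formP v u w) *\<^sub>R wplus v u + ((1 - cyclide_tau v u) * formQ v u w) *\<^sub>R wminus v u"
    "D (wplus v) u w = (2 * formP v u w) *\<^sub>R ((cyclide_tau v u + 1) *\<^sub>R v 0 u - v 3 u + v 4 u)"
    "D (wminus v) u w = (2 * formQ v u w) *\<^sub>R ((cyclide_tau v u - 1) *\<^sub>R v 0 u - v 3 u - v 4 u)"
  using someI_ex[OF cyclide_frame_structure_ex[OF assms], folded cyclide_tau_def] by blast+

text \<open>The coframe forms P and Q are closed. The exterior derivatives of \<langle>d wplus,
  v4\<rangle> = -2 (t + 1) P and \<langle>d wminus, v4\<rangle> = -2 (t - 1) Q then reduce to dt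
  \<and> P = 0 and dt \<and> Q = 0, so dt = 0.\<close>

lemma cyclide_tau_has_derivative:
  assumes c: "cyclide_frame U v" and u: "u \<in> U"
  shows "(cyclide_tau v has_derivative (\<lambda>_. 0)) (at u)"
proof -
  note hf = cyclide_frame_hyperbolic[OF c]
  note ips = w_ip[of v, OF hf] frame_ip[OF hf] ip_simps
  note sw = cyclide_frame_smooth_w[OF c] and z = zplus_zminus[OF c]
  note s4 = cyclide_frame_smooth[OF c, of 4, simplified]
  note st = cyclide_frame_structure[OF c]
  let ?t = "cyclide_tau v"
  obtain a b where ab: "formP v u a = 1" "formQ v u a = 0" "formP v u b = 0" "formQ v u b = 1"
    and w: "\<And>w. w = formP v u w *\<^sub>R a + formQ v u w *\<^sub>R b"
    using cyclide_frame_coords[OF c u] by metis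
  have p4: "ip (D (wplus v) y w) (v 4 y) = - 2 * (?t y + 1) * formP v y w"
    and m4: "ip (D (wminus v) y w) (v 4 y) = - 2 * (?t y - 1) * formQ v y w" if "y \<in> U" for y w
    using that by (simp_all add: st ips)
  \<comment> \<open>\<open>cyclide_tau\<close> is a pointwise choice; on the neighbourhood where P
    does not vanish on \<open>a\<close> it is a quotient of smooth functions, hence
    differentiable.\<close>
  define V where "V = U \<inter> (\<lambda>y. formP v y a) -` (- {0})"
  have V: "open V" "u \<in> V" "V \<subseteq> U"
    unfolding V_def
    using continuous_open_preimage[OF smooth_on_continuous[OF sw(3)[of a]] smooth_on_open[OF sw(3)], of "- {0}"] u ab
    by (auto simp: open_Compl)
  have "smooth_on V (\<lambda>y. ip (D (wplus v) y a) (v 4 y) / (- 2 * formP v y a) - 1)"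
    using V by (intro smooth_on_diff smooth_on_divide smooth_on_ip smooth_on_mult smooth_on_const smooth_on_D
        smooth_on_subset[OF s4] smooth_on_subset[OF sw(1)] smooth_on_subset[OF sw(3)]) (auto simp: V_def)
  then have "smooth_on V ?t"
    by (rule smooth_on_cong) (auto simp: V_def p4 field_simps)
  then have td: "?t differentiable (at u)"
    using V by (intro smooth_on_differentiable)
  have dP: "(\<lambda>y. formP v y w) differentiable (at u)" and dQ: "(\<lambda>y. formQ v y w) differentiable (at u)" for w
    using sw u smooth_on_differentiable by blast+
  have dt: "(\<lambda>y. k * (?t y + l)) differentiable (at u)" "D (\<lambda>y. k * (?t y + l)) u w = k * D ?t u w" for k l w
  proof -
    have "((\<lambda>y. k * (?t y + l)) has_derivative (\<lambda>w. k * D ?t u w)) (at u)"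
      by (auto intro!: derivative_eq_intros has_D[OF td])
    then show "(\<lambda>y. k * (?t y + l)) differentiable (at u)" "D (\<lambda>y. k * (?t y + l)) u w = k * D ?t u w"
      by (auto simp: differentiable_def D_eqI)
  qed
  note mult = D_bilinear(1)[OF bounded_bilinear_mult]
  \<comment> \<open>Closedness of P, read off from \<langle>d zminus, wplus\<rangle> = -8 P: the
    correction terms vanish because \<open>D wplus\<close> is orthogonal to
    \<open>wplus\<close>.\<close>
  have P1: "D (\<lambda>y. formP v y b) u a = D (\<lambda>y. formP v y a) u b"
  proof -
    have "D (\<lambda>y. ip (D (zminus v) y w) (wplus v y)) u w' = - 8 * D (\<lambda>y. formP v y w) u w'" for w w'
    proof -
      have "D (\<lambda>y. ip (D (zminus v) y w) (wplus v y)) u = D (\<lambda>y. - 8 * formP v y w) u"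
        using smooth_on_open[OF sw(1)] u by (rule D_cong) (simp add: z ips)
      then show ?thesis
        using D_linear_comp[OF bounded_linear_mult_right dP[of w], of "-8" w'] by simp
    qed
    then show ?thesis
      using curl_identity[OF z(2) sw(1) u, of b a] by (simp add: z st u ips)
  qed
  have Q1: "D (\<lambda>y. formQ v y b) u a = D (\<lambda>y. formQ v y a) u b"
  proof -
    have "D (\<lambda>y. ip (D (zplus v) y w) (wminus v y)) u w' = - 8 * D (\<lambda>y. formQ v y w) u w'" for w w'
    proof -
      have "D (\<lambda>y. ip (D (zplus v) y w) (wminus v y)) u = D (\<lambda>y. - 8 * formQ v y w) u"
        using smooth_on_open[OF sw(1)] u by (rule D_cong) (simp add: z ips)
      then show ?thesis
        using D_linear_comp[OF bounded_linear_mult_right dQ[of w], of "-8" w'] by simp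
    qed
    then show ?thesis
      using curl_identity[OF z(1) sw(2) u, of b a] by (simp add: z st u ips)
  qed
  have P2: "D (\<lambda>y. ip (D (wplus v) y w) (v 4 y)) u w'
      = - 2 * (?t u + 1) * D (\<lambda>y. formP v y w) u w' - 2 * D ?t u w' * formP v u w" for w w'
  proof -
    have "D (\<lambda>y. ip (D (wplus v) y w) (v 4 y)) u = D (\<lambda>y. (- 2 * (?t y + 1)) * formP v y w) u"
      using smooth_on_open[OF sw(1)] u by (rule D_cong) (simp add: p4)
    then show ?thesis
      using mult[OF dt(1)[of "-2" 1] dP[of w], of w'] by (simp only: dt(2))
  qed
  have Q2: "D (\<lambda>y. ip (D (wminus v) y w) (v 4 y)) u w'
      = - 2 * (?t u - 1) * D (\<lambda>y. formQ v y w) u w' - 2 * D ?t u w' * formQ v u w" for w w'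
  proof -
    have "D (\<lambda>y. ip (D (wminus v) y w) (v 4 y)) u = D (\<lambda>y. (- 2 * (?t y + (- 1))) * formQ v y w) u"
      using smooth_on_open[OF sw(1)] u by (rule D_cong) (simp add: m4)
    then show ?thesis
      using mult[OF dt(1)[of "-2" "-1"] dQ[of w], of w'] by (simp only: dt(2)) simp
  qed
  have "D ?t u b = 0"
    using curl_identity[OF sw(1) s4 u, of b a] by (simp add: P2 P1 ab st u ips)
  moreover have "D ?t u a = 0"
    using curl_identity[OF sw(2) s4 u, of b a] by (simp add: Q2 Q1 ab st u ips)
  ultimately have "D ?t u w = 0" for w
    by (subst w) (simp add: linear_add[OF D_lin[OF td]] linear_scale[OF D_lin[OF td]])
  then have "D ?t u = (\<lambda>_. 0)"
    by blast
  then show ?thesis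
    using has_D[OF td] by simp
qed

lemma cyclide_tau_const:
  assumes c: "cyclide_frame U v" and "convex U" "u \<in> U" "u' \<in> U"
  shows "cyclide_tau v u = cyclide_tau v u'"
proof -
  obtain k where "\<And>y. y \<in> U \<Longrightarrow> cyclide_tau v y = k"
    using has_derivative_zero_constant[OF assms(2), of "cyclide_tau v"]
      has_derivative_at_withinI[OF cyclide_tau_has_derivative[OF c]] by metis
  with assms show ?thesis
    by simp
qed

lemma cyclide_tau_unique:
  assumes c: "cyclide_frame U v" and u: "u \<in> U"
    and t: "\<And>w. ip (D (v 4) u w) (wplus v u) = 2 * (1 + t) * formP v u w"
  shows "cyclide_tau v u = t"
proof -
  obtain a where a: "formP v u a = 1"
    using cyclide_frame_coords[OF c u] by metis
  have "ip (D (v 4) u a) (wplus v u) = 2 * (1 + cyclide_tau v u)"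
    unfolding cyclide_frame_structure[OF c u]
    by (simp add: a ip_simps w_ip[of v u, OF cyclide_frame_hyperbolic[OF c u]])
  then show ?thesis
    using t[of a] a by simp
qed

text \<open>The equations hold for every tangent vector, in particular for the images
  \<open>D \<phi> s w\<close>; bijectivity of \<open>D \<phi> s\<close> preserves injectivity of the
  derivative of the lift.\<close>

lemma cyclide_frame_pullback:
  assumes c: "cyclide_frame V v" and \<phi>: "smooth_on U \<phi>" "\<phi> ` U \<subseteq> V"
    and bij: "\<And>s. s \<in> U \<Longrightarrow> bij (D \<phi> s)"
  shows "cyclide_frame U (\<lambda>i s. v i (\<phi> s))"
    and "s \<in> U \<Longrightarrow> cyclide_tau (\<lambda>i s. v i (\<phi> s)) s = cyclide_tau v (\<phi> s)"
proof -
  have D: "D (\<lambda>s. v i (\<phi> s)) s w = D (v i) (\<phi> s) (D \<phi> s w)" if "i \<le> 4" "s \<in> U" for i s w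
    using \<phi>(2) that smooth_on_differentiable[OF cyclide_frame_smooth[OF c that(1)]]
    by (intro D_comp(1) smooth_on_differentiable[OF \<phi>(1)]) auto
  show c': "cyclide_frame U (\<lambda>i s. v i (\<phi> s))"
    unfolding cyclide_frame_def
  proof (intro conjI ballI allI impI)
    show "open U"
      using \<phi>(1) by (rule smooth_on_open)
    show "smooth_on U (\<lambda>s. v i (\<phi> s))" if "i \<le> 4" for i
      using smooth_on_compose[OF cyclide_frame_smooth[OF c that] \<phi>] .
    fix s assume s: "s \<in> U"
    then have \<phi>s: "\<phi> s \<in> V"
      using \<phi>(2) by auto
    then show "hyperbolic_frame (\<lambda>i. v i (\<phi> s))"
      by (rule cyclide_frame_hyperbolic[OF c])
    have "D (\<lambda>s. v 0 (\<phi> s)) s = D (v 0) (\<phi> s) \<circ> D \<phi> s"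
      using D[of 0 s] s by auto
    then show "inj (D (\<lambda>s. v 0 (\<phi> s)) s)"
      using c \<phi>s bij[OF s] unfolding cyclide_frame_def bij_def by (metis inj_compose)
    fix w
    show "\<exists>P Q. D (\<lambda>s. v 0 (\<phi> s)) s w = P *\<^sub>R (v 1 (\<phi> s) + v 2 (\<phi> s)) + Q *\<^sub>R (v 1 (\<phi> s) - v 2 (\<phi> s)) \<and>
       D (\<lambda>s. v 3 (\<phi> s)) s w = - (2 * P) *\<^sub>R (v 1 (\<phi> s) + v 2 (\<phi> s)) + (2 * Q) *\<^sub>R (v 1 (\<phi> s) - v 2 (\<phi> s))"
      using c \<phi>s s unfolding cyclide_frame_def by (simp add: D)
  qed
  assume s: "s \<in> U"
  then have \<phi>s: "\<phi> s \<in> V"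
    using \<phi>(2) by auto
  show "cyclide_tau (\<lambda>i s. v i (\<phi> s)) s = cyclide_tau v (\<phi> s)"
  proof (rule cyclide_tau_unique[OF c' s])
    fix w
    have W: "wplus (\<lambda>i s. v i (\<phi> s)) s = wplus v (\<phi> s)"
      by (simp add: wplus_def)
    have P: "formP (\<lambda>i s. v i (\<phi> s)) s w = formP v (\<phi> s) (D \<phi> s w)"
      unfolding formP_def W D[OF zero_le s] ..
    show "ip (D (\<lambda>s. v 4 (\<phi> s)) s w) (wplus (\<lambda>i s. v i (\<phi> s)) s) =
      2 * (1 + cyclide_tau v (\<phi> s)) * formP (\<lambda>i s. v i (\<phi> s)) s w"
      unfolding W P D[OF order_refl s] cyclide_frame_structure[OF c \<phi>s]
      by (simp add: ip_simps w_ip[of v "\<phi> s", OF cyclide_frame_hyperbolic[OF c \<phi>s]])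
  qed
qed

section \<open>Comparison of arbitrary 3-adapted frames with cyclide frames\<close>

definition adapted ::
  "(real^2) set \<Rightarrow> (nat \<Rightarrow> real^2 \<Rightarrow> real^5) \<Rightarrow> form \<Rightarrow> form \<Rightarrow> form \<Rightarrow> form
    \<Rightarrow> form \<Rightarrow> form \<Rightarrow> (real^2 \<Rightarrow> real) \<Rightarrow> (real^2 \<Rightarrow> real) \<Rightarrow> bool" where
  "adapted U v \<theta>1 \<theta>2 \<alpha>11 \<alpha>22 \<beta>1 \<beta>2 lam11 lam22 \<longleftrightarrow>
     (\<forall>i\<le>4. smooth_on U (v i)) \<and>
     (\<forall>u\<in>U. hyperbolic_frame (\<lambda>i. v i u) \<and> proj_rank (v 0) u = 2 \<and> lam11 u * lam22 u \<noteq> 0 \<and>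
        (\<forall>w. structure_eqs v \<theta>1 \<theta>2 \<alpha>11 (\<lambda>u w. lam11 u * \<theta>1 u w) (\<lambda>u w. lam22 u * \<theta>2 u w) \<alpha>22 \<beta>1 \<beta>2 u w))"

lemma three_adapted_imp_adapted:
  assumes "three_adapted M U v \<theta>1 \<theta>2 \<alpha>11 \<alpha>22 \<beta>1 \<beta>2 lam11 lam22"
  shows "adapted U v \<theta>1 \<theta>2 \<alpha>11 \<alpha>22 \<beta>1 \<beta>2 lam11 lam22"
  using assms unfolding three_adapted_def adapted_def by (auto dest: local_lift_rank)

lemma adapted_subset:
  assumes "adapted U v \<theta>1 \<theta>2 \<alpha>11 \<alpha>22 \<beta>1 \<beta>2 lam11 lam22" "open V" "V \<subseteq> U"
  shows "adapted V v \<theta>1 \<theta>2 \<alpha>11 \<alpha>22 \<beta>1 \<beta>2 lam11 lam22"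
  using assms smooth_on_subset[OF _ assms(2,3)] unfolding adapted_def by blast

text \<open>A vector annihilated by \<theta>1 and \<theta>2 would have derivative parallel to
  \<open>v 0\<close>, against the rank of the lift; so the two forms are a coframe and have a dual
  basis.\<close>

lemma adapted_coords:
  assumes a: "adapted U v \<theta>1 \<theta>2 \<alpha>11 \<alpha>22 \<beta>1 \<beta>2 lam11 lam22" and u: "u \<in> U"
  obtains p q where "\<theta>1 u p = 1" "\<theta>2 u p = 0" "\<theta>1 u q = 0" "\<theta>2 u q = 1"
proof -
  have hf: "hyperbolic_frame (\<lambda>i. v i u)" and r: "proj_rank (v 0) u = 2"
    and st: "\<And>w. D (v 0) u w = (\<alpha>11 u w + \<alpha>22 u w) *\<^sub>R v 0 u + \<theta>1 u w *\<^sub>R v 1 u + \<theta>2 u w *\<^sub>R v 2 u"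
    using a u by (auto simp: adapted_def structure_eqs_def)
  have d: "v 0 differentiable (at u)"
    using a u smooth_on_differentiable[of U "v 0" u] by (auto simp: adapted_def)
  have th: "\<theta>1 u w = ip (D (v 0) u w) (v 2 u)" "\<theta>2 u w = ip (D (v 0) u w) (v 1 u)" for w
    unfolding st by (simp_all add: ip_simps frame_ip[OF hf])
  define L where "L w = (vector [\<theta>1 u w, \<theta>2 u w] :: real^2)" for w
  have lin: "linear L"
    unfolding linear_iff L_def th
    by (auto simp: linear_add[OF D_lin[OF d]] linear_scale[OF D_lin[OF d]] ip_simps vec_eq_iff forall_2)
  have "w = 0" if "L w = 0" for w
  proof -
    have "\<theta>1 u w = 0" "\<theta>2 u w = 0"
      using that by (simp_all add: L_def vec_eq_iff forall_2)
    then have "D (v 0) u w = (\<alpha>11 u w + \<alpha>22 u w) *\<^sub>R v 0 u"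
      by (simp add: st)
    then show ?thesis
      using immersion_kernel(1)[OF d r] by blast
  qed
  then have "surj L"
    using linear_injective_imp_surjective[OF lin] linear_injective_0[OF lin] by blast
  then obtain p q where "L p = vector [1, 0]" "L q = vector [0, 1]"
    by (metis surj_def)
  then show ?thesis
    by (intro that[of p q]) (simp_all add: L_def vec_eq_iff forall_2)
qed

text \<open>Differentiating \<open>r * r = 1\<close> shows that the sign is locally constant, with
  no connectedness of the domain.\<close>

lemma square_one_D:
  fixes r :: "real^2 \<Rightarrow> real"
  assumes r: "smooth_on U r" "\<And>y. y \<in> U \<Longrightarrow> r y * r y = 1" and u: "u \<in> U"
  shows "D r u w = 0"
proof -
  have "D (\<lambda>y. r y * r y) u = D (\<lambda>y. 1) u"
    using smooth_on_open[OF r(1)] u r(2) by (rule D_cong)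
  then have "2 * (r u * D r u w) = 0"
    using D_bilinear(1)[OF bounded_bilinear_mult smooth_on_differentiable[OF r(1) u] smooth_on_differentiable[OF r(1) u], of w]
    by simp
  then show ?thesis
    using r(2)[OF u] by auto
qed

lemma adapted_eqs:
  assumes a: "adapted U v \<theta>1 \<theta>2 \<alpha>11 \<alpha>22 \<beta>1 \<beta>2 lam11 lam22" and y: "y \<in> U"
  shows "hyperbolic_frame (\<lambda>i. v i y)"
    "D (v 0) y w = (\<alpha>11 y w + \<alpha>22 y w) *\<^sub>R v 0 y + \<theta>1 y w *\<^sub>R v 1 y + \<theta>2 y w *\<^sub>R v 2 y"
    "D (v 3) y w = - (2 * (lam22 y * \<theta>2 y w)) *\<^sub>R v 1 y - (2 * (lam11 y * \<theta>1 y w)) *\<^sub>R v 2 y"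
    "D (v 4) y w = \<beta>2 y w *\<^sub>R v 1 y + \<beta>1 y w *\<^sub>R v 2 y - (\<alpha>11 y w + \<alpha>22 y w) *\<^sub>R v 4 y"
    "v 0 differentiable (at y)" "v 3 differentiable (at y)" "v 4 differentiable (at y)"
  using a y smooth_on_differentiable[of U "v 0" y] smooth_on_differentiable[of U "v 3" y]
    smooth_on_differentiable[of U "v 4" y]
  by (auto simp: adapted_def structure_eqs_def)

text \<open>Everything about a 3-adapted frame can be read off at a point from a cyclide frame with the
  same base points: the metric and the second fundamental form of the base determine \<open>v\<^sub>3\<close>
  (the trace-free normal), and \<open>dv\<^sub>3\<close> then determines the span of \<open>v\<^sub>1, v\<^sub>2\<close>.\<close>

lemma frame_comparison_metric:
  fixes v c :: "nat \<Rightarrow> real^2 \<Rightarrow> real^5"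
  assumes c: "cyclide_frame U c"
    and a: "adapted U v \<theta>1 \<theta>2 \<alpha>11 \<alpha>22 \<beta>1 \<beta>2 lam11 lam22"
    and r: "smooth_on U r" "\<And>y. y \<in> U \<Longrightarrow> r y \<noteq> 0"
    and cv: "\<And>y. y \<in> U \<Longrightarrow> c 0 y = r y *\<^sub>R v 0 y"
    and u: "u \<in> U"
  obtains \<eta> P1 P2 p q A where
    "\<eta> * \<eta> = 1" "4 * P1 * P2 = r u * r u" "P1 \<noteq> 0" "P2 \<noteq> 0"
    "\<theta>1 u p = 1" "\<theta>2 u p = 0" "\<theta>1 u q = 0" "\<theta>2 u q = 1"
    "formP c u p = P1" "formQ c u p = \<eta> * P1" "formP c u q = P2" "formQ c u q = - \<eta> * P2"
    "\<And>w. A w = r u * (\<alpha>11 u w + \<alpha>22 u w) + D r u w"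
    "D (c 0) u p = r u *\<^sub>R v 1 u + A p *\<^sub>R v 0 u" "D (c 0) u q = r u *\<^sub>R v 2 u + A q *\<^sub>R v 0 u"
proof -
  note st = adapted_eqs[OF a]
  note hc = cyclide_frame_hyperbolic[OF c]
  note fv = frame_ip[OF st(1)] and fc = frame_ip[OF hc] w_ip[of c, OF hc]
  have Dc0: "D (c 0) u w = r u *\<^sub>R D (v 0) u w + D r u w *\<^sub>R v 0 u" for w
    using D_cong[OF smooth_on_open[OF r(1)] u cv] D_scale[OF smooth_on_differentiable[OF r(1) u] st(5)[OF u]]
    by simp
  obtain p q where pq: "\<theta>1 u p = 1" "\<theta>2 u p = 0" "\<theta>1 u q = 0" "\<theta>2 u q = 1"
    using adapted_coords[OF a u] by blast
  define A where "A w = r u * (\<alpha>11 u w + \<alpha>22 u w) + D r u w" for w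
  have Dc0p: "D (c 0) u p = r u *\<^sub>R v 1 u + A p *\<^sub>R v 0 u"
    and Dc0q: "D (c 0) u q = r u *\<^sub>R v 2 u + A q *\<^sub>R v 0 u"
    unfolding Dc0 st(2)[OF u] by (simp_all add: pq A_def algebra_simps)
  note DC = cyclide_frame_D(1)[OF c u]
  define P1 P2 Q1 Q2 where PQ: "P1 = formP c u p" "P2 = formP c u q" "Q1 = formQ c u p" "Q2 = formQ c u q"
  have "ip (D (c 0) u p) (D (c 0) u p) = 0" "ip (D (c 0) u q) (D (c 0) u q) = 0"
    "ip (D (c 0) u p) (D (c 0) u q) = r u * r u"
    unfolding Dc0p Dc0q by (simp_all add: ip_simps fv u)
  then have eqs: "P1 * P1 = Q1 * Q1" "P2 * P2 = Q2 * Q2" "2 * P1 * P2 - 2 * Q1 * Q2 = r u * r u"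
    unfolding DC by (simp_all add: ip_simps fc u PQ algebra_simps)
  have rr: "r u * r u > 0"
    using r(2)[OF u] by (auto simp: zero_less_mult_iff linorder_neq_iff)
  have P0: "P1 \<noteq> 0" "P2 \<noteq> 0"
    using eqs rr by auto
  \<comment> \<open>Along a null direction Q equals P up to sign. The two null directions carry
    opposite signs, since their product is nonzero; \<open>\<eta>\<close> tells which null line of
    the cyclide frame belongs to \<open>v 1\<close>.\<close>
  define \<eta> where "\<eta> = Q1 / P1"
  have "Q1 = P1 \<or> Q1 = - P1" "Q2 = P2 \<or> Q2 = - P2"
    using eqs by (metis square_eq_iff)+
  then have \<eta>: "\<eta> * \<eta> = 1" "Q1 = \<eta> * P1" "Q2 = - \<eta> * P2"
    using P0 eqs(3) rr by (auto simp: \<eta>_def)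
  have PP: "4 * P1 * P2 = r u * r u"
    using eqs(3) \<eta> by algebra
  show ?thesis
    using that[OF \<eta>(1) PP P0 pq PQ(1)[symmetric] _ PQ(2)[symmetric] _ A_def Dc0p Dc0q] \<eta> PQ by simp
qed

text \<open>\<open>c 3\<close> is normal to the surface, hence a sign times \<open>v 3\<close> plus
  a multiple \<open>k\<close> of \<open>v 0\<close>. Both \<open>c 3\<close> and \<open>v 3\<close>
  have a second fundamental form that vanishes on the pair of distinct null directions, that is,
  without trace; a term \<open>k *\<^sub>R v 0\<close> would contribute \<open>k\<close> times the
  metric, so \<open>k = 0\<close>.\<close>

lemma frame_comparison_normal:
  fixes v c :: "nat \<Rightarrow> real^2 \<Rightarrow> real^5"
  assumes c: "cyclide_frame U c"
    and a: "adapted U v \<theta>1 \<theta>2 \<alpha>11 \<alpha>22 \<beta>1 \<beta>2 lam11 lam22"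
    and r: "smooth_on U r" "\<And>y. y \<in> U \<Longrightarrow> r y \<noteq> 0"
    and cv: "\<And>y. y \<in> U \<Longrightarrow> c 0 y = r y *\<^sub>R v 0 y"
  obtains sg where "smooth_on U sg" "\<And>y. y \<in> U \<Longrightarrow> sg y * sg y = 1" "\<And>y. y \<in> U \<Longrightarrow> c 3 y = sg y *\<^sub>R v 3 y"
proof -
  note st = adapted_eqs[OF a]
  have s: "smooth_on U (v i)" if "i \<le> 4" for i
    using a that by (auto simp: adapted_def)
  note hc = cyclide_frame_hyperbolic[OF c] and cs = cyclide_frame_smooth[OF c]
  note fv = frame_ip[OF st(1)] and fc = frame_ip[OF hc] w_ip[of c, OF hc]
  have c30: "ip (c 3 y) (v 0 y) = 0" if "y \<in> U" for y
    using fc(16)[OF that] cv[OF that] r(2)[OF that] by (simp add: ip_simps)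
  have c312: "ip (c 3 y) (v 1 y) = 0" "ip (c 3 y) (v 2 y) = 0" if y: "y \<in> U" for y
  proof -
    have 0: "ip (c 3 y) (D (c 0) y w) = 0" for w
      unfolding cyclide_frame_D[OF c y] by (simp add: ip_simps fc y)
    obtain p q A where "D (c 0) y p = r y *\<^sub>R v 1 y + A p *\<^sub>R v 0 y" "D (c 0) y q = r y *\<^sub>R v 2 y + A q *\<^sub>R v 0 y"
      using frame_comparison_metric[OF c a r cv y] by metis
    then show "ip (c 3 y) (v 1 y) = 0" "ip (c 3 y) (v 2 y) = 0"
      using 0[of p] 0[of q] r(2)[OF y] by (simp_all add: ip_simps c30 y)
  qed
  define sg where "sg y = - ip (c 3 y) (v 3 y) / 2" for y
  define k where "k y = - ip (c 3 y) (v 4 y)" for y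
  have c3: "c 3 y = sg y *\<^sub>R v 3 y + k y *\<^sub>R v 0 y" if "y \<in> U" for y
    using frame_expand[OF st(1)[OF that], of "c 3 y"] c30[OF that] c312[OF that]
    by (simp add: sg_def k_def algebra_simps)
  have sgs: "smooth_on U sg" "smooth_on U k"
  proof -
    have "smooth_on U (\<lambda>y. (-1/2) *\<^sub>R ip (c 3 y) (v 3 y))" "smooth_on U (\<lambda>y. - ip (c 3 y) (v 4 y))"
      by (intro smooth_on_scaleR_const smooth_on_uminus smooth_on_ip s cs, simp_all)+
    then show "smooth_on U sg" "smooth_on U k"
      by (simp_all add: sg_def[abs_def] k_def[abs_def])
  qed
  have sg1: "sg y * sg y = 1" if "y \<in> U" for y
    using fc(19)[OF that] unfolding c3[OF that] by (simp add: ip_simps fv that)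
  have "k u = 0" if u: "u \<in> U" for u
  proof -
    obtain \<eta> P1 P2 p q A where m:
      "\<eta> * \<eta> = 1" "4 * P1 * P2 = r u * r u" "P1 \<noteq> 0" "P2 \<noteq> 0"
      "\<theta>1 u p = 1" "\<theta>2 u p = 0" "\<theta>1 u q = 0" "\<theta>2 u q = 1"
      "formP c u p = P1" "formQ c u p = \<eta> * P1" "formP c u q = P2" "formQ c u q = - \<eta> * P2"
      "D (c 0) u p = r u *\<^sub>R v 1 u + A p *\<^sub>R v 0 u" "D (c 0) u q = r u *\<^sub>R v 2 u + A q *\<^sub>R v 0 u"
      using frame_comparison_metric[OF c a r cv u] by metis
    have Dc3: "D (c 3) u w = sg u *\<^sub>R D (v 3) u w + k u *\<^sub>R D (v 0) u w + D k u w *\<^sub>R v 0 u" for w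
    proof -
      note dd = smooth_on_differentiable[OF sgs(1) u] smooth_on_differentiable[OF sgs(2) u]
      have "D (c 3) u = D (\<lambda>y. sg y *\<^sub>R v 3 y + k y *\<^sub>R v 0 y) u"
        using smooth_on_open[OF r(1)] u c3 by (rule D_cong)
      then show ?thesis
        using D_plus[OF D_bilinear(2)[OF bounded_bilinear_scaleR dd(1) st(6)[OF u]]
            D_bilinear(2)[OF bounded_bilinear_scaleR dd(2) st(5)[OF u]], of w]
          D_scale[OF dd(1) st(6)[OF u], of w] D_scale[OF dd(2) st(5)[OF u], of w] square_one_D[OF sgs(1) sg1 u, of w]
        by simp
    qed
    have "ip (D (c 0) u p) (D (c 3) u q) = 0"
      unfolding cyclide_frame_D[OF c u] m using m(1) by (simp add: ip_simps fc u)
    moreover have "ip (D (c 0) u p) (D (c 3) u q) = r u * k u"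
      unfolding m(13) Dc3 st(2,3)[OF u] by (simp add: ip_simps fv u m)
    ultimately show ?thesis
      using r(2)[OF u] by simp
  qed
  then show ?thesis
    using that[OF sgs(1) sg1] c3 by simp
qed

text \<open>Since \<open>c 3\<close> is a locally constant sign times \<open>v 3\<close>, the
  equations for \<open>D (c 3)\<close> and \<open>D (v 3)\<close> identify the null combinations of
  \<open>wplus\<close> and \<open>wminus\<close> with multiples of \<open>v 1\<close> and
  \<open>v 2\<close>. Then \<open>D (c 0)\<close> has no \<open>v 0\<close> component, which
  determines \<alpha>11 + \<alpha>22, and \<open>c 4\<close> is fixed by duality.\<close>

lemma frame_comparison:
  fixes v c :: "nat \<Rightarrow> real^2 \<Rightarrow> real^5"
  assumes c: "cyclide_frame U c"
    and a: "adapted U v \<theta>1 \<theta>2 \<alpha>11 \<alpha>22 \<beta>1 \<beta>2 lam11 lam22"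
    and r: "smooth_on U r" "\<And>y. y \<in> U \<Longrightarrow> r y \<noteq> 0"
    and cv: "\<And>y. y \<in> U \<Longrightarrow> c 0 y = r y *\<^sub>R v 0 y"
    and u: "u \<in> U"
  obtains \<sigma> \<eta> P1 P2 p q where
    "\<sigma> * \<sigma> = 1" "\<eta> * \<eta> = 1" "c 3 u = \<sigma> *\<^sub>R v 3 u" "4 * P1 * P2 = r u * r u" "lam11 u * lam22 u = r u * r u"
    "\<theta>1 u p = 1" "\<theta>2 u p = 0" "\<theta>1 u q = 0" "\<theta>2 u q = 1"
    "formP c u p = P1" "formQ c u p = \<eta> * P1" "formP c u q = P2" "formQ c u q = - \<eta> * P2"
    "P1 * \<sigma> * lam22 u = r u * P2"
    "wplus c u + \<eta> *\<^sub>R wminus c u = (\<sigma> * lam22 u / P2) *\<^sub>R v 1 u"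
    "r u * (\<alpha>11 u p + \<alpha>22 u p) + D r u p = 0" "r u * (\<alpha>11 u q + \<alpha>22 u q) + D r u q = 0"
    "c 4 u = (1 / r u) *\<^sub>R v 4 u"
proof -
  note st = adapted_eqs[OF a]
  note hc = cyclide_frame_hyperbolic[OF c]
  note fv = frame_ip[OF st(1)] and fc = frame_ip[OF hc] w_ip[of c, OF hc]
  obtain sg where sg: "smooth_on U sg" "\<And>y. y \<in> U \<Longrightarrow> sg y * sg y = 1" "\<And>y. y \<in> U \<Longrightarrow> c 3 y = sg y *\<^sub>R v 3 y"
    using frame_comparison_normal[OF c a r cv] by blast
  obtain \<eta> P1 P2 p q A where m:
    "\<eta> * \<eta> = 1" "4 * P1 * P2 = r u * r u" "P1 \<noteq> 0" "P2 \<noteq> 0"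
    "\<theta>1 u p = 1" "\<theta>2 u p = 0" "\<theta>1 u q = 0" "\<theta>2 u q = 1"
    "formP c u p = P1" "formQ c u p = \<eta> * P1" "formP c u q = P2" "formQ c u q = - \<eta> * P2"
    "\<And>w. A w = r u * (\<alpha>11 u w + \<alpha>22 u w) + D r u w"
    "D (c 0) u p = r u *\<^sub>R v 1 u + A p *\<^sub>R v 0 u" "D (c 0) u q = r u *\<^sub>R v 2 u + A q *\<^sub>R v 0 u"
    using frame_comparison_metric[OF c a r cv u] by metis
  define s where "s = sg u"
  have s1: "s * s = 1" and c3: "c 3 u = s *\<^sub>R v 3 u"
    using sg u by (auto simp: s_def)
  have Dc3: "D (c 3) u w = s *\<^sub>R D (v 3) u w" for w
  proof -
    have "D (c 3) u = D (\<lambda>y. sg y *\<^sub>R v 3 y) u"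
      using smooth_on_open[OF r(1)] u sg(3) by (rule D_cong)
    then show ?thesis
      using D_scale[OF smooth_on_differentiable[OF sg(1) u] st(6)[OF u], of w] square_one_D[OF sg(1,2) u, of w]
      by (simp add: s_def)
  qed
  have solve: "x = (d / e) *\<^sub>R y" if "(2 * e) *\<^sub>R x = (2 * d) *\<^sub>R y" "e \<noteq> 0" for d e and x y :: "real^5"
    using arg_cong[OF that(1), of "\<lambda>z. (1 / (2 * e)) *\<^sub>R z"] that(2) by simp
  \<comment> \<open>The vector \<open>p\<close> is dual to \<theta>1, so \<open>D (v 3)\<close>
    along it is a multiple of \<open>v 2\<close>, while for the cyclide frame it is a multiple of
    the left-hand side.\<close>
  have e1: "wplus c u - \<eta> *\<^sub>R wminus c u = (s * lam11 u / P1) *\<^sub>R v 2 u"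
  proof (rule solve[OF _ m(3)])
    have "- ((2 * P1) *\<^sub>R (wplus c u - \<eta> *\<^sub>R wminus c u)) = - ((2 * (s * lam11 u)) *\<^sub>R v 2 u)"
      using Dc3[of p] unfolding cyclide_frame_D(2)[OF c u] st(3)[OF u]
      by (simp add: m algebra_simps)
    then show "(2 * P1) *\<^sub>R (wplus c u - \<eta> *\<^sub>R wminus c u) = (2 * (s * lam11 u)) *\<^sub>R v 2 u"
      by (simp only: neg_equal_iff_equal)
  qed
  have e2: "wplus c u + \<eta> *\<^sub>R wminus c u = (s * lam22 u / P2) *\<^sub>R v 1 u"
  proof (rule solve[OF _ m(4)])
    have "- ((2 * P2) *\<^sub>R (wplus c u + \<eta> *\<^sub>R wminus c u)) = - ((2 * (s * lam22 u)) *\<^sub>R v 1 u)"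
      using Dc3[of q] unfolding cyclide_frame_D(2)[OF c u] st(3)[OF u]
      by (simp add: m algebra_simps)
    then show "(2 * P2) *\<^sub>R (wplus c u + \<eta> *\<^sub>R wminus c u) = (2 * (s * lam22 u)) *\<^sub>R v 1 u"
      by (simp only: neg_equal_iff_equal)
  qed
  have "ip (wplus c u + \<eta> *\<^sub>R wminus c u) (wplus c u - \<eta> *\<^sub>R wminus c u) = 4"
    using m(1) by (simp add: ip_simps fc u)
  then have "(s * s) * (lam11 u * lam22 u) = 4 * P1 * P2"
    unfolding e1 e2 using m(3,4) by (simp add: ip_simps fv u field_simps)
  then have lam: "lam11 u * lam22 u = r u * r u"
    using s1 m(2) by simp
  \<comment> \<open>The derivative of the base point along \<open>p\<close>, written in both frames.
    Pairing with \<open>v 4\<close> isolates the component along \<open>v 0\<close>, which is absent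
    on the left by \<open>e2\<close>.\<close>
  have g1: "P1 *\<^sub>R (wplus c u + \<eta> *\<^sub>R wminus c u) = r u *\<^sub>R v 1 u + A p *\<^sub>R v 0 u"
    using m(14) unfolding cyclide_frame_D(1)[OF c u] by (simp add: m scaleR_add_right mult.commute)
  have g2: "P2 *\<^sub>R (wplus c u - \<eta> *\<^sub>R wminus c u) = r u *\<^sub>R v 2 u + A q *\<^sub>R v 0 u"
    using m(15) unfolding cyclide_frame_D(1)[OF c u] by (simp add: m scaleR_diff_right mult.commute)
  have A1: "A p = 0" "P1 * (s * lam22 u / P2) = r u"
    using arg_cong[OF g1, of "\<lambda>z. ip z (v 4 u)"] arg_cong[OF g1, of "\<lambda>z. ip z (v 2 u)"] unfolding e2
    by (simp_all add: ip_simps fv u)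
  have A2: "A q = 0"
    using arg_cong[OF g2, of "\<lambda>z. ip z (v 4 u)"] unfolding e1 by (simp add: ip_simps fv u)
  have c4: "c 4 u = (1 / r u) *\<^sub>R v 4 u"
  proof -
    have lam0: "lam11 u \<noteq> 0" "lam22 u \<noteq> 0" and sg0: "s \<noteq> 0"
      using lam r(2)[OF u] s1 by auto
    have "ip (c 4 u) (wplus c u - \<eta> *\<^sub>R wminus c u) = 0" "ip (c 4 u) (wplus c u + \<eta> *\<^sub>R wminus c u) = 0"
      by (simp_all add: ip_simps fc u)
    then have 12: "ip (c 4 u) (v 1 u) = 0" "ip (c 4 u) (v 2 u) = 0"
      unfolding e1 e2 using lam0 sg0 m(3,4) by (simp_all add: ip_simps)
    have 3: "ip (c 4 u) (v 3 u) = 0"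
      using fc(24)[OF u] sg0 unfolding c3 by (simp add: ip_simps)
    have 0: "ip (c 4 u) (v 0 u) = - 1 / r u"
      using fc(21)[OF u] r(2)[OF u] unfolding cv[OF u] by (simp add: ip_simps field_simps)
    define k where "k = ip (c 4 u) (v 4 u)"
    have c4: "c 4 u = - k *\<^sub>R v 0 u + (1 / r u) *\<^sub>R v 4 u"
      using frame_expand[OF st(1)[OF u], of "c 4 u"] 12 3 0 by (simp add: k_def)
    have "k = 0"
      using fc(25)[OF u] r(2)[OF u] unfolding c4 by (simp add: ip_simps fv u)
    then show ?thesis
      using c4 by simp
  qed
  have "P1 * s * lam22 u = r u * P2"
    using A1(2) m(4) by (simp add: field_simps)
  then show ?thesis
    using that[OF s1 m(1) c3 m(2) lam m(5-12) _ e2 _ _ c4] A1(1) A2 m(13) by metis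
qed

text \<open>The vanishing coefficients are written out to match the shape of \<open>normalized_frame\<close>.\<close>

lemma cyclide_frame_adapted:
  assumes c: "cyclide_frame U v" and rank: "\<And>u. u \<in> U \<Longrightarrow> proj_rank (v 0) u = 2"
  shows "adapted U v (\<lambda>u w. formP v u w + formQ v u w) (\<lambda>u w. formP v u w - formQ v u w)
     (\<lambda>u w. 3/2 * 0 * (formP v u w + formQ v u w) + 1/2 * 0 * (formP v u w - formQ v u w))
     (\<lambda>u w. 1/2 * 0 * (formP v u w + formQ v u w) + 3/2 * 0 * (formP v u w - formQ v u w))
     (\<lambda>u w. cyclide_tau v u * (formP v u w + formQ v u w) + 1 * (formP v u w - formQ v u w))
     (\<lambda>u w. 1 * (formP v u w + formQ v u w) + 1 * cyclide_tau v u * (formP v u w - formQ v u w)) (\<lambda>_. 1) (\<lambda>_. 1)"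
  unfolding adapted_def
proof (intro conjI ballI allI impI)
  show "smooth_on U (v i)" if "i \<le> 4" for i
    using cyclide_frame_smooth[OF c that] .
  fix u w assume u: "u \<in> U"
  show "hyperbolic_frame (\<lambda>i. v i u)" "proj_rank (v 0) u = 2"
    using cyclide_frame_hyperbolic[OF c u] rank[OF u] .
  note sw = cyclide_frame_smooth_w[OF c]
  note d = smooth_on_differentiable[OF sw(1) u] smooth_on_differentiable[OF sw(2) u]
  have half: "D (\<lambda>y. (1/2) *\<^sub>R f y) u w = (1/2) *\<^sub>R D f u w" if "f differentiable (at u)" for f :: "real^2 \<Rightarrow> real^5"
    by (rule D_linear_comp[OF bounded_linear_scaleR_right that])
  have hd: "(\<lambda>y. (1/2) *\<^sub>R wplus v y) differentiable (at u)" "(\<lambda>y. (1/2) *\<^sub>R wminus v y) differentiable (at u)"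
    using smooth_on_differentiable[OF smooth_on_scaleR_const[OF sw(1)] u]
      smooth_on_differentiable[OF smooth_on_scaleR_const[OF sw(2)] u] by blast+
  have "v 1 = (\<lambda>y. (1/2) *\<^sub>R wplus v y + (1/2) *\<^sub>R wminus v y)" "v 2 = (\<lambda>y. (1/2) *\<^sub>R wplus v y - (1/2) *\<^sub>R wminus v y)"
    by (simp_all add: wplus_def wminus_def fun_eq_iff vec_eq_iff field_simps)
  then have e: "D (v 1) u w = D (\<lambda>y. (1/2) *\<^sub>R wplus v y + (1/2) *\<^sub>R wminus v y) u w"
    "D (v 2) u w = D (\<lambda>y. (1/2) *\<^sub>R wplus v y - (1/2) *\<^sub>R wminus v y) u w"
    by (simp_all only:)
  have D12: "D (v 1) u w = (1/2) *\<^sub>R D (wplus v) u w + (1/2) *\<^sub>R D (wminus v) u w"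
    "D (v 2) u w = (1/2) *\<^sub>R D (wplus v) u w - (1/2) *\<^sub>R D (wminus v) u w"
    unfolding e D_plus[OF hd] D_minus[OF hd] half[OF d(1)] half[OF d(2)] by (rule refl)+
  show "structure_eqs v (\<lambda>u w. formP v u w + formQ v u w) (\<lambda>u w. formP v u w - formQ v u w)
     (\<lambda>u w. 3/2 * 0 * (formP v u w + formQ v u w) + 1/2 * 0 * (formP v u w - formQ v u w))
     (\<lambda>u w. 1 * (formP v u w + formQ v u w)) (\<lambda>u w. 1 * (formP v u w - formQ v u w))
     (\<lambda>u w. 1/2 * 0 * (formP v u w + formQ v u w) + 3/2 * 0 * (formP v u w - formQ v u w))
     (\<lambda>u w. cyclide_tau v u * (formP v u w + formQ v u w) + 1 * (formP v u w - formQ v u w))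
     (\<lambda>u w. 1 * (formP v u w + formQ v u w) + 1 * cyclide_tau v u * (formP v u w - formQ v u w)) u w"
    unfolding structure_eqs_def D12 cyclide_frame_D[OF c u] cyclide_frame_structure[OF c u]
    by (simp add: vec_eq_iff wplus_def wminus_def) (simp add: algebra_simps field_simps)
qed simp

text \<open>With \<lambda>11 = \<lambda>22 = 1 the scale satisfies \<open>r * r = 1\<close>, so
  \<open>D r\<close> vanishes, and the conditions on \<alpha>11 + \<alpha>22 = 2 \<kappa>2 \<theta>1
  + 2 \<kappa>1 \<theta>2 leave no room for \<kappa>1 and \<kappa>2. Since \<open>c 4\<close> is a
  locally constant sign times \<open>v 4\<close>, \<tau> is read off from
  \<open>D (v 4)\<close>.\<close>

lemma normalized_comparison:
  fixes v c :: "nat \<Rightarrow> real^2 \<Rightarrow> real^5"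
  assumes c: "cyclide_frame U c"
    and a: "adapted U v \<theta>1 \<theta>2
        (\<lambda>u w. 3/2 * \<kappa>2 u * \<theta>1 u w + 1/2 * \<kappa>1 u * \<theta>2 u w)
        (\<lambda>u w. 1/2 * \<kappa>2 u * \<theta>1 u w + 3/2 * \<kappa>1 u * \<theta>2 u w)
        (\<lambda>u w. \<tau> u * \<theta>1 u w + b12 u * \<theta>2 u w) \<beta>2 (\<lambda>_. 1) (\<lambda>_. 1)"
    and r: "smooth_on U r" "\<And>y. y \<in> U \<Longrightarrow> r y \<noteq> 0"
    and cv: "\<And>y. y \<in> U \<Longrightarrow> c 0 y = r y *\<^sub>R v 0 y"
    and u: "u \<in> U"
  shows "\<kappa>1 u = 0" "\<kappa>2 u = 0" "\<tau> u = cyclide_tau c u" "r u * r u = 1" "c 3 u = r u *\<^sub>R v 3 u"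
proof -
  note st = adapted_eqs[OF a]
  note hc = cyclide_frame_hyperbolic[OF c]
  note fv = frame_ip[OF st(1)] and fc = frame_ip[OF hc] w_ip[of c, OF hc]
  have rr: "r y * r y = 1" if "y \<in> U" for y
    using frame_comparison[OF c a r cv that] by (metis mult.right_neutral)
  have Dr: "D r u w = 0" for w
    by (rule square_one_D[OF r(1) rr u])
  obtain \<sigma> \<eta> P1 P2 p q where m:
    "\<sigma> * \<sigma> = 1" "\<eta> * \<eta> = 1" "c 3 u = \<sigma> *\<^sub>R v 3 u" "4 * P1 * P2 = r u * r u" "1 * 1 = r u * r u"
    "\<theta>1 u p = 1" "\<theta>2 u p = 0" "\<theta>1 u q = 0" "\<theta>2 u q = 1"
    "formP c u p = P1" "formQ c u p = \<eta> * P1" "formP c u q = P2" "formQ c u q = - \<eta> * P2"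
    "P1 * \<sigma> * 1 = r u * P2"
    "wplus c u + \<eta> *\<^sub>R wminus c u = (\<sigma> * 1 / P2) *\<^sub>R v 1 u"
    "r u * ((3/2 * \<kappa>2 u * \<theta>1 u p + 1/2 * \<kappa>1 u * \<theta>2 u p) + (1/2 * \<kappa>2 u * \<theta>1 u p + 3/2 * \<kappa>1 u * \<theta>2 u p)) + D r u p = 0"
    "r u * ((3/2 * \<kappa>2 u * \<theta>1 u q + 1/2 * \<kappa>1 u * \<theta>2 u q) + (1/2 * \<kappa>2 u * \<theta>1 u q + 3/2 * \<kappa>1 u * \<theta>2 u q)) + D r u q = 0" "c 4 u = (1 / r u) *\<^sub>R v 4 u"
    by (rule frame_comparison[OF c a r cv u])
  show k: "\<kappa>1 u = 0" "\<kappa>2 u = 0"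
    using m(16,17) r(2)[OF u] by (simp_all add: Dr m)
  show "r u * r u = 1"
    using rr[OF u] .
  have PP: "4 * P1 * P2 = 1"
    using m(4) rr[OF u] by simp
  \<comment> \<open>The product of the two signs equals \<open>4 * P1 * P1\<close>, which is
    nonnegative and squares to 1.\<close>
  have "r u = \<sigma>"
  proof -
    have "P1 * P1 * \<sigma> * 4 = r u"
      using m(14) PP by algebra
    moreover have "P1 * P1 * 4 = (P1 * P1 * \<sigma> * 4) * \<sigma>"
      using m(1) by algebra
    ultimately have "P1 * P1 * 4 = r u * \<sigma>"
      by simp
    moreover have "(r u * \<sigma>) * (r u * \<sigma>) = 1"
      using m(1) rr[OF u] by algebra
    ultimately have "r u * \<sigma> = 1"
      by (metis abs_1 abs_of_nonneg mult_nonneg_nonneg square_eq_1_iff zero_le_numeral zero_le_square neg_0_le_iff_le not_one_le_zero)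
    then show ?thesis
      using m(1) by algebra
  qed
  then show "c 3 u = r u *\<^sub>R v 3 u"
    using m(3) by simp
  have c4: "c 4 y = r y *\<^sub>R v 4 y" if y: "y \<in> U" for y
  proof -
    have "c 4 y = (1 / r y) *\<^sub>R v 4 y"
      using frame_comparison[OF c a r cv y] by metis
    moreover have "1 / r y = r y"
      using rr[OF y] r(2)[OF y] by (simp add: field_simps)
    ultimately show ?thesis
      by simp
  qed
  have "D (c 4) u = D (\<lambda>y. r y *\<^sub>R v 4 y) u"
    using smooth_on_open[OF r(1)] u c4 by (rule D_cong)
  then have D4: "D (c 4) u p = r u *\<^sub>R D (v 4) u p"
    using D_scale[OF smooth_on_differentiable[OF r(1) u] st(7)[OF u], of p] by (simp add: Dr)
  have P0: "P1 \<noteq> 0" "P2 \<noteq> 0"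
    using PP by auto
  \<comment> \<open>Against the null combination the coefficients \<open>1 + \<tau>\<close> and
    \<open>1 - \<tau>\<close> enter with opposite signs, so only \<tau> survives.\<close>
  have "ip (D (c 4) u p) (wplus c u + \<eta> *\<^sub>R wminus c u) = 4 * cyclide_tau c u * P1"
    unfolding cyclide_frame_structure[OF c u] m(10,11) by (simp only: ip_simps fc[OF u] real_scaleR_def) (use m(2) in algebra)
  moreover have "ip (D (c 4) u p) (wplus c u + \<eta> *\<^sub>R wminus c u) = r u * \<sigma> / P2 * \<tau> u"
    unfolding D4 m(15) st(4)[OF u] by (simp add: ip_simps fv u m k)
  ultimately have "4 * cyclide_tau c u * P1 * P2 = r u * \<sigma> * \<tau> u"
    using P0 by (simp add: field_simps)
  then show "\<tau> u = cyclide_tau c u"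
    using PP \<open>r u = \<sigma>\<close> m(1) by algebra
qed

section \<open>Surfaces covered by cyclide frames\<close>

definition framed_at :: "(real^5) set set \<Rightarrow> (real^2) set \<Rightarrow> (nat \<Rightarrow> real^2 \<Rightarrow> real^5) \<Rightarrow> real^2 \<Rightarrow> (real^5) set \<Rightarrow> bool" where
  "framed_at M U v u p \<longleftrightarrow> cyclide_frame U v \<and> local_lift M U (v 0) \<and> u \<in> U \<and> p = pt (v 0 u)"

text \<open>The hub of the argument: both sides of the characterization are reduced to the existence
  of cyclide frames near every point.\<close>

definition cyclidic :: "(real^5) set set \<Rightarrow> bool" where
  "cyclidic M \<longleftrightarrow> surface M \<and> (\<forall>p\<in>M. \<exists>U v u. framed_at M U v u p)"

lemma framed_at_in: "framed_at M U v u p \<Longrightarrow> p \<in> M"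
  unfolding framed_at_def using local_lift_in by blast

lemma local_lift_cong:
  assumes l: "local_lift M U x" and e: "\<And>u. u \<in> U \<Longrightarrow> x u = y u"
  shows "local_lift M U y"
proof -
  have "proj_rank y u = proj_rank x u" if "u \<in> U" for u
    using proj_rank_cong[OF local_lift_open[OF l] that e] by simp
  moreover have "(\<lambda>u. pt (x u)) ` V = (\<lambda>u. pt (y u)) ` V" if "V \<subseteq> U" for V
    using e that by (auto simp: image_def subset_iff)
  moreover have "inj_on (\<lambda>u. pt (y u)) U \<longleftrightarrow> inj_on (\<lambda>u. pt (x u)) U"
    using e by (intro inj_on_cong) simp
  moreover have "smooth_on U y"
    using local_lift_smooth[OF l] e by (rule smooth_on_cong)
  ultimately show ?thesis
    using l e unfolding local_lift_iff by simp
qed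

text \<open>Pulls a frame back to the parameters of a lift chosen by someone else, which is what
  definitions quantifying over all lifts require.\<close>

lemma framed_transfer:
  assumes f: "framed_at M V v w p" and x: "local_lift M U x" "u \<in> U" and p: "p = pt (x u)"
  obtains U' c r where "open U'" "u \<in> U'" "U' \<subseteq> U" "cyclide_frame U' c" "smooth_on U' r"
    "\<And>y. y \<in> U' \<Longrightarrow> r y \<noteq> 0" "\<And>y. y \<in> U' \<Longrightarrow> c 0 y = r y *\<^sub>R x y"
    "\<And>y. y \<in> U' \<Longrightarrow> framed_at M U' c y (pt (x y))" "c 0 u = v 0 w" "c 3 u = v 3 w"
    "cyclide_tau c u = cyclide_tau v w"
proof -
  have v: "cyclide_frame V v" "local_lift M V (v 0)" "w \<in> V" "pt (x u) = pt (v 0 w)"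
    using f p by (auto simp: framed_at_def)
  obtain U' \<phi> r where *: "open U'" "u \<in> U'" "U' \<subseteq> U" "smooth_on U' \<phi>" "\<phi> ` U' \<subseteq> V" "\<phi> u = w"
    "smooth_on U' r" "\<And>s. s \<in> U' \<Longrightarrow> r s \<noteq> 0" "\<And>s. s \<in> U' \<Longrightarrow> v 0 (\<phi> s) = r s *\<^sub>R x s"
    "\<And>s. s \<in> U' \<Longrightarrow> bij (D \<phi> s)"
    using transition[OF x(1) v(2) x(2) v(3,4)] by blast
  let ?c = "\<lambda>i s. v i (\<phi> s)"
  have c: "cyclide_frame U' ?c"
    by (rule cyclide_frame_pullback(1)[OF v(1) *(4,5,10)])
  have "local_lift M U' (\<lambda>s. r s *\<^sub>R x s)"
    by (rule local_lift_scale[OF local_lift_subset[OF x(1) *(1,3)] *(7,8)])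
  then have l: "local_lift M U' (?c 0)"
    by (rule local_lift_cong) (simp add: *(9))
  have "framed_at M U' ?c y (pt (x y))" if "y \<in> U'" for y
    using c l that *(8,9)[OF that] by (simp add: framed_at_def)
  with c * cyclide_frame_pullback(2)[OF v(1) *(4,5,10) *(2)] show ?thesis
    using that[of U' ?c r] by simp
qed

text \<open>After a change of parameters, one frame is compared with the other regarded as a
  normalized frame; over a given point \<open>v 0\<close> and \<open>v 3\<close> are determined up
  to a common sign and \<tau> completely.\<close>

lemma framed_unique:
  assumes "framed_at M U v u p" "framed_at M V c w p"
  shows "cyclide_tau v u = cyclide_tau c w" "\<exists>k. k \<noteq> 0 \<and> c 0 w = k *\<^sub>R v 0 u \<and> c 3 w = k *\<^sub>R v 3 u"
proof -
  have v: "cyclide_frame U v" "local_lift M U (v 0)" "u \<in> U" "p = pt (v 0 u)"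
    using assms(1) by (auto simp: framed_at_def)
  obtain U' c' r where *: "open U'" "u \<in> U'" "U' \<subseteq> U" "cyclide_frame U' c'" "smooth_on U' r"
    "\<And>y. y \<in> U' \<Longrightarrow> r y \<noteq> 0" "\<And>y. y \<in> U' \<Longrightarrow> c' 0 y = r y *\<^sub>R v 0 y"
    "\<And>y. y \<in> U' \<Longrightarrow> framed_at M U' c' y (pt (v 0 y))" "c' 0 u = c 0 w" "c' 3 u = c 3 w"
    "cyclide_tau c' u = cyclide_tau c w"
    using framed_transfer[OF assms(2) v(2-4)] by blast
  note a = adapted_subset[OF cyclide_frame_adapted[OF v(1) local_lift_rank[OF v(2)]] *(1,3)]
  note n = normalized_comparison[where ?\<kappa>1.0 = "\<lambda>_. 0" and ?\<kappa>2.0 = "\<lambda>_. 0" and ?b12.0 = "\<lambda>_. 1", OF *(4) a *(5-7) *(2)]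
  show "cyclide_tau v u = cyclide_tau c w"
    using n(3) *(11) by simp
  show "\<exists>k. k \<noteq> 0 \<and> c 0 w = k *\<^sub>R v 0 u \<and> c 3 w = k *\<^sub>R v 3 u"
    using n(5) *(2,6,7,9,10) by metis
qed

section \<open>Metric and second fundamental form: hyperbolicity and 2-ellipticity\<close>

lemma lift_D:
  assumes c: "cyclide_frame U c" and r: "smooth_on U r" "\<And>y. y \<in> U \<Longrightarrow> r y \<noteq> 0"
    and cx: "\<And>y. y \<in> U \<Longrightarrow> c 0 y = r y *\<^sub>R x y" and u: "u \<in> U"
  shows "D x u w = inverse (r u) *\<^sub>R D (c 0) u w + D (\<lambda>y. inverse (r y)) u w *\<^sub>R c 0 u"
    and "x u = inverse (r u) *\<^sub>R c 0 u"
proof -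
  have x: "x y = inverse (r y) *\<^sub>R c 0 y" if "y \<in> U" for y
    using r(2)[OF that] cx[OF that] by simp
  then show "x u = inverse (r u) *\<^sub>R c 0 u"
    using u by simp
  have "D x u = D (\<lambda>y. inverse (r y) *\<^sub>R c 0 y) u"
    using smooth_on_open[OF r(1)] u x by (rule D_cong)
  then show "D x u w = inverse (r u) *\<^sub>R D (c 0) u w + D (\<lambda>y. inverse (r y)) u w *\<^sub>R c 0 u"
    using D_scale[OF smooth_on_differentiable[OF smooth_on_inverse[OF r] u]
        smooth_on_differentiable[OF cyclide_frame_smooth[OF c] u], of 0 w] by simp
qed

text \<open>The metric of the lift is \<open>2 * (P^2 - Q^2)\<close> divided by \<open>r^2\<close>;
  terms along \<open>c 0\<close> drop out because \<open>c 0\<close> is null and orthogonal to its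
  derivatives.\<close>

lemma cyclide_null_vec:
  assumes c: "cyclide_frame U c" and r: "smooth_on U r" "\<And>y. y \<in> U \<Longrightarrow> r y \<noteq> 0"
    and cx: "\<And>y. y \<in> U \<Longrightarrow> c 0 y = r y *\<^sub>R x y" and u: "u \<in> U"
  shows "null_vec x u w \<longleftrightarrow> formP c u w = formQ c u w \<or> formP c u w = - formQ c u w"
proof -
  note hc = cyclide_frame_hyperbolic[OF c u]
  have Dx: "D x u w = inverse (r u) *\<^sub>R D (c 0) u w + D (\<lambda>y. inverse (r y)) u w *\<^sub>R c 0 u"
    by (rule lift_D(1)[OF c r cx u])
  have "ip (D x u w) (D x u w) = inverse (r u) * inverse (r u) * (2 * (formP c u w * formP c u w - formQ c u w * formQ c u w))"
    unfolding Dx cyclide_frame_D[OF c u]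
    by (simp add: ip_simps w_ip[of c u, OF hc] frame_ip[OF hc] algebra_simps)
  then have "null_vec x u w \<longleftrightarrow> formP c u w * formP c u w = formQ c u w * formQ c u w"
    using r(2)[OF u] by (simp add: null_vec_def)
  then show ?thesis
    by (simp add: square_eq_iff)
qed

lemma cyclidic_hyperbolic:
  assumes M: "cyclidic M"
  shows "hyperbolic_surface M"
  unfolding hyperbolic_surface_def
proof (intro conjI allI impI ballI)
  show "surface M"
    using M by (simp add: cyclidic_def)
  fix U x u assume x: "local_lift M U x" and u: "u \<in> U"
  obtain V v w where f: "framed_at M V v w (pt (x u))"
    using M local_lift_in[OF x u] unfolding cyclidic_def by blast
  obtain U' c r where *: "open U'" "u \<in> U'" "U' \<subseteq> U" "cyclide_frame U' c" "smooth_on U' r"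
    "\<And>y. y \<in> U' \<Longrightarrow> r y \<noteq> 0" "\<And>y. y \<in> U' \<Longrightarrow> c 0 y = r y *\<^sub>R x y"
    using framed_transfer[OF f x u refl] by metis
  note null = cyclide_null_vec[OF *(4-7,2)]
  note lin = form_linear[OF *(4,2)]
  obtain a b where ab: "formP c u a = 1" "formQ c u a = 0" "formP c u b = 0" "formQ c u b = 1"
    and w: "\<And>w. w = formP c u w *\<^sub>R a + formQ c u w *\<^sub>R b"
    using cyclide_frame_coords[OF *(4,2)] by metis
  have F: "formP c u (s *\<^sub>R (a + k *\<^sub>R b)) = s" "formQ c u (s *\<^sub>R (a + k *\<^sub>R b)) = s * k" for s k
    by (simp_all add: linear_add[OF lin(1)] linear_scale[OF lin(1)] linear_add[OF lin(2)] linear_scale[OF lin(2)] ab)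
  have nz: "a + k *\<^sub>R b \<noteq> 0" for k
    using F(1)[of 1 k] linear_0[OF lin(1)] by auto
  have sp: "span {s *\<^sub>R y} = span {y}" if "s \<noteq> 0" for s and y :: "real^2"
  proof -
    have "y = inverse s *\<^sub>R s *\<^sub>R y"
      using that by simp
    then have "y \<in> span {s *\<^sub>R y}"
      by (metis span_base span_scale singletonI)
    moreover have "s *\<^sub>R y \<in> span {y}"
      by (simp add: span_base span_scale)
    ultimately show ?thesis
      by (simp add: span_eq)
  qed
  have "{span {w} |w. w \<noteq> 0 \<and> null_vec x u w} = {span {a + 1 *\<^sub>R b}, span {a + (-1) *\<^sub>R b}}" (is "?L = ?R")
  proof
    show "?L \<subseteq> ?R"
    proof
      fix S assume "S \<in> ?L"
      then obtain y where y: "S = span {y}" "y \<noteq> 0" "formP c u y = formQ c u y \<or> formP c u y = - formQ c u y"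
        using null by auto
      then obtain k where k: "k = 1 \<or> k = -1" "formQ c u y = k * formP c u y"
        by (metis minus_equation_iff mult_1 mult_minus1)
      have yk: "y = formP c u y *\<^sub>R (a + k *\<^sub>R b)"
        using w[of y] k(2) by (simp add: scaleR_add_right mult.commute)
      with y(2) have "formP c u y \<noteq> 0"
        by (metis scaleR_zero_left)
      then have "S = span {a + k *\<^sub>R b}"
        using y(1) yk sp by metis
      then show "S \<in> ?R"
        using k(1) by auto
    qed
    have "null_vec x u (a + k *\<^sub>R b)" if "k = 1 \<or> k = -1" for k
      using that F[of 1 k] by (auto simp: null)
    then show "?R \<subseteq> ?L"
      using nz by blast
  qed
  moreover have "span {a + 1 *\<^sub>R b} \<noteq> span {a + (-1) *\<^sub>R b}"
  proof
    assume "span {a + 1 *\<^sub>R b} = span {a + (-1) *\<^sub>R b}"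
    then have "a + 1 *\<^sub>R b \<in> span {a + (-1) *\<^sub>R b}"
      using span_base[of "a + 1 *\<^sub>R b" "{a + 1 *\<^sub>R b}"] by simp
    then obtain s where "1 *\<^sub>R (a + 1 *\<^sub>R b) = s *\<^sub>R (a + (-1) *\<^sub>R b)"
      unfolding span_singleton by auto
    then have "formP c u (1 *\<^sub>R (a + 1 *\<^sub>R b)) = formP c u (s *\<^sub>R (a + (-1) *\<^sub>R b))"
      "formQ c u (1 *\<^sub>R (a + 1 *\<^sub>R b)) = formQ c u (s *\<^sub>R (a + (-1) *\<^sub>R b))"
      by simp_all
    then show False
      unfolding F by simp
  qed
  ultimately show "card {span {w} |w. w \<noteq> 0 \<and> null_vec x u w} = 2"
    by simp
qed

text \<open>Cramer's rule instead of a pointwise choice, so that the dual basis is smooth;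
  \<open>is_epsilon\<close> asks for smooth null fields.\<close>

lemma cyclide_dual_fields:
  assumes c: "cyclide_frame U c"
  obtains a b where "smooth_on U a" "smooth_on U b"
    "\<And>y. y \<in> U \<Longrightarrow> formP c y (a y) = 1" "\<And>y. y \<in> U \<Longrightarrow> formQ c y (a y) = 0"
    "\<And>y. y \<in> U \<Longrightarrow> formP c y (b y) = 0" "\<And>y. y \<in> U \<Longrightarrow> formQ c y (b y) = 1"
proof -
  define p where "p i y = formP c y (axis i 1)" for i :: 2 and y
  define q where "q i y = formQ c y (axis i 1)" for i :: 2 and y
  have s: "smooth_on U (p i)" "smooth_on U (q i)" for i
    unfolding p_def[abs_def] q_def[abs_def] by (rule cyclide_frame_smooth_w[OF c])+
  define d where "d y = p 1 y * q 2 y - p 2 y * q 1 y" for y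
  have eval: "formP c y w = w$1 * p 1 y + w$2 * p 2 y" "formQ c y w = w$1 * q 1 y + w$2 * q 2 y" if "y \<in> U" for y w
  proof -
    note l = form_linear[OF c that]
    have w: "w = (w$1) *\<^sub>R axis 1 1 + (w$2) *\<^sub>R axis 2 1"
      by (simp add: vec_eq_iff forall_2 axis_def)
    show "formP c y w = w$1 * p 1 y + w$2 * p 2 y" "formQ c y w = w$1 * q 1 y + w$2 * q 2 y"
      unfolding p_def q_def
      by (subst w, simp add: linear_add[OF l(1)] linear_scale[OF l(1)] linear_add[OF l(2)] linear_scale[OF l(2)])+
  qed
  have d0: "d y \<noteq> 0" if y: "y \<in> U" for y
  proof -
    obtain a b where ab: "formP c y a = 1" "formQ c y a = 0" "formP c y b = 0" "formQ c y b = 1"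
      using cyclide_frame_coords[OF c y] by metis
    have "d y * (a$1 * b$2 - a$2 * b$1) = 1"
      using ab unfolding eval[OF y] d_def by algebra
    then show ?thesis
      by auto
  qed
  have ds: "smooth_on U (\<lambda>y. inverse (d y))"
  proof (rule smooth_on_inverse[OF _ d0])
    show "smooth_on U d"
      unfolding d_def[abs_def] by (intro smooth_on_diff smooth_on_mult s)
  qed
  define a b where "a y = (vector [q 2 y * inverse (d y), - (q 1 y) * inverse (d y)] :: real^2)"
    and "b y = (vector [- (p 2 y) * inverse (d y), p 1 y * inverse (d y)] :: real^2)" for y
  have "smooth_on U a" "smooth_on U b"
    unfolding a_def[abs_def] b_def[abs_def]
    by (intro smooth_on_vector2 smooth_on_mult smooth_on_uminus s ds)+
  moreover have "formP c y (a y) = 1" "formQ c y (a y) = 0" "formP c y (b y) = 0" "formQ c y (b y) = 1" if "y \<in> U" for y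
    using d0[OF that] by (simp_all add: eval[OF that] a_def b_def field_simps) (simp_all add: d_def algebra_simps)
  ultimately show ?thesis
    by (rule that)
qed

text \<open>With the null fields \<open>a + b\<close>, \<open>a - b\<close> and the normal
  \<open>c 3\<close>, both quantities \<open>ell\<close> equal \<open>8 / r\<close>; their product
  is a positive square.\<close>

lemma cyclidic_is_epsilon:
  assumes M: "cyclidic M" and x: "local_lift M U x" and u: "u \<in> U"
  shows "is_epsilon x U u 1"
proof -
  obtain V v w where f: "framed_at M V v w (pt (x u))"
    using M local_lift_in[OF x u] unfolding cyclidic_def by blast
  obtain U' c r where *: "open U'" "u \<in> U'" "U' \<subseteq> U" "cyclide_frame U' c" "smooth_on U' r"
    "\<And>y. y \<in> U' \<Longrightarrow> r y \<noteq> 0" "\<And>y. y \<in> U' \<Longrightarrow> c 0 y = r y *\<^sub>R x y"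
    using framed_transfer[OF f x u refl] by metis
  note null = cyclide_null_vec[OF *(4-7)] and hc = cyclide_frame_hyperbolic[OF *(4)]
  note fc = w_ip[of c, OF hc] frame_ip[OF hc] ip_simps
  note dc = cyclide_frame_D[OF *(4)]
  have Dx: "D x y w = inverse (r y) *\<^sub>R D (c 0) y w + D (\<lambda>y. inverse (r y)) y w *\<^sub>R c 0 y"
    if "y \<in> U'" for y w
    by (rule lift_D(1)[OF *(4-7) that])
  have x0: "x y = inverse (r y) *\<^sub>R c 0 y" if "y \<in> U'" for y
    by (rule lift_D(2)[OF *(4-7) that])
  obtain a b where ab: "smooth_on U' a" "smooth_on U' b"
    "\<And>y. y \<in> U' \<Longrightarrow> formP c y (a y) = 1" "\<And>y. y \<in> U' \<Longrightarrow> formQ c y (a y) = 0"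
    "\<And>y. y \<in> U' \<Longrightarrow> formP c y (b y) = 0" "\<And>y. y \<in> U' \<Longrightarrow> formQ c y (b y) = 1"
    using cyclide_dual_fields[OF *(4)] by blast
  define N1 N2 where "N1 y = a y + b y" and "N2 y = a y - b y" for y
  have N: "smooth_on U' N1" "smooth_on U' N2"
    unfolding N1_def[abs_def] N2_def[abs_def] by (intro smooth_on_add smooth_on_diff ab)+
  have FN: "formP c y (N1 y) = 1" "formQ c y (N1 y) = 1" "formP c y (N2 y) = 1" "formQ c y (N2 y) = -1" if "y \<in> U'" for y
    using form_linear[OF *(4) that] ab(3-6)[OF that]
    by (simp_all add: N1_def N2_def linear_add linear_diff)
  have sp: "span {N1 y, N2 y} = UNIV" if y: "y \<in> U'" for y
  proof -
    obtain a' b' where w: "\<And>w. w = formP c y w *\<^sub>R a' + formQ c y w *\<^sub>R b'"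
      using cyclide_frame_coords[OF *(4) y] by metis
    have "w \<in> span {N1 y, N2 y}" for w
    proof -
      have "N1 y = a' + b'" "N2 y = a' - b'"
        using w[of "N1 y"] w[of "N2 y"] FN[OF y] by simp_all
      then have "w = ((formP c y w + formQ c y w) / 2) *\<^sub>R N1 y + ((formP c y w - formQ c y w) / 2) *\<^sub>R N2 y"
        using w[of w] by (simp add: vec_eq_iff) (simp add: field_simps)
      then show ?thesis
        by (metis insertI1 insertI2 singletonI span_add span_base span_scale)
    qed
    then show ?thesis
      by auto
  qed
  have xs: "smooth_on U' x"
    using smooth_on_subset[OF local_lift_smooth[OF x] *(1,3)] .
  have n0: "ip (c 3 y) (D x y w) = 0" "ip (D x y w) (c 3 y) = 0" if "y \<in> U'" for y w
    unfolding Dx[OF that] dc[OF that] by (simp_all add: fc that)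
  \<comment> \<open>Moving one derivative to the normal avoids second derivatives of the
    lift.\<close>
  have ell: "ell x N u (c 3 u) = - ip (D x u (N u)) (D (c 3) u (N u))" if "smooth_on U' N" for N
    unfolding ell_def
    by (rule ip_const_D[OF smooth_on_D_field[OF xs that] cyclide_frame_smooth[OF *(4)] *(2)]) (simp_all add: n0)
  have "ell x N1 u (c 3 u) = 8 * inverse (r u)" "ell x N2 u (c 3 u) = 8 * inverse (r u)"
    unfolding ell[OF N(1)] ell[OF N(2)] Dx[OF *(2)] dc[OF *(2)] by (simp_all add: FN fc *(2))
  then have "sgn (ell x N1 u (c 3 u) * ell x N2 u (c 3 u)) = 1"
    using *(6)[OF *(2)] by (simp add: sgn_mult sgn_1_pos zero_less_mult_iff linorder_neq_iff)
  moreover have "ip (c 3 u) (x u) = 0"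
    unfolding x0[OF *(2)] by (simp add: fc *(2))
  ultimately show ?thesis
    unfolding is_epsilon_def using * N sp n0 FN null
    by (intro exI[of _ U'] exI[of _ N1] exI[of _ N2] exI[of _ "c 3 u"]) (auto simp: fc)
qed

lemma cyclidic_two_elliptic: "cyclidic M \<Longrightarrow> two_elliptic M"
  using cyclidic_is_epsilon unfolding two_elliptic_def by blast

lemma cyclidic_two_generic: "cyclidic M \<Longrightarrow> two_generic M"
  using cyclidic_is_epsilon unfolding two_generic_def by (metis zero_neq_one)

lemma framed_normalized:
  assumes M: "cyclidic M" and f: "framed_at M U v u p"
  shows "normalized_frame M 1 U v (\<lambda>_. 0) (\<lambda>_. 0) (cyclide_tau v)"
proof -
  have v: "cyclide_frame U v" "local_lift M U (v 0)"
    using f by (auto simp: framed_at_def)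
  note a = cyclide_frame_adapted[OF v(1) local_lift_rank[OF v(2)]]
  show ?thesis
    unfolding normalized_frame_def three_adapted_def
    using a[unfolded adapted_def] v(2) cyclidic_hyperbolic[OF M] cyclidic_two_generic[OF M]
    by (rule_tac exI[of _ "\<lambda>u w. formP v u w + formQ v u w"], rule_tac exI[of _ "\<lambda>u w. formP v u w - formQ v u w"],
        rule_tac exI[of _ "\<lambda>_. 1"], rule_tac exI[of _ "\<lambda>_. 1"]) simp
qed

lemma normalized_frame_framed:
  assumes n: "normalized_frame M 1 U v \<kappa>1 \<kappa>2 \<tau>" and u: "u \<in> U" and f: "framed_at M V c w (pt (v 0 u))"
  shows "\<kappa>1 u = 0" "\<kappa>2 u = 0" "\<tau> u = cyclide_tau c w"
proof -
  obtain \<theta>1 \<theta>2 b12 b21 where t: "three_adapted M U v \<theta>1 \<theta>2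
        (\<lambda>u w. 3/2 * \<kappa>2 u * \<theta>1 u w + 1/2 * \<kappa>1 u * \<theta>2 u w)
        (\<lambda>u w. 1/2 * \<kappa>2 u * \<theta>1 u w + 3/2 * \<kappa>1 u * \<theta>2 u w)
        (\<lambda>u w. \<tau> u * \<theta>1 u w + b12 u * \<theta>2 u w)
        (\<lambda>u w. b21 u * \<theta>1 u w + 1 * \<tau> u * \<theta>2 u w)
        (\<lambda>_. 1) (\<lambda>_. 1)"
    using n unfolding normalized_frame_def by blast
  have l: "local_lift M U (v 0)"
    using t by (simp add: three_adapted_def)
  obtain U' c' r where *: "open U'" "u \<in> U'" "U' \<subseteq> U" "cyclide_frame U' c'" "smooth_on U' r"
    "\<And>y. y \<in> U' \<Longrightarrow> r y \<noteq> 0" "\<And>y. y \<in> U' \<Longrightarrow> c' 0 y = r y *\<^sub>R v 0 y"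
    "cyclide_tau c' u = cyclide_tau c w"
    using framed_transfer[OF f l u refl] by metis
  note a = adapted_subset[OF three_adapted_imp_adapted[OF t] *(1,3)]
  show "\<kappa>1 u = 0" "\<kappa>2 u = 0" "\<tau> u = cyclide_tau c w"
    using normalized_comparison(1-3)[OF *(4) a *(5-7) *(2)] *(8) by simp_all
qed

lemma cyclidic_kappas_vanish: "cyclidic M \<Longrightarrow> kappas_vanish M"
  unfolding kappas_vanish_def
proof (intro allI impI ballI)
  fix U v \<kappa>1 \<kappa>2 \<tau> u assume M: "cyclidic M" and n: "normalized_frame M 1 U v \<kappa>1 \<kappa>2 \<tau>" and u: "u \<in> U"
  then have "pt (v 0 u) \<in> M"
    using local_lift_in[of M U "v 0" u] unfolding normalized_frame_def three_adapted_def by blast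
  then obtain V c w where f: "framed_at M V c w (pt (v 0 u))"
    using M unfolding cyclidic_def by blast
  show "\<kappa>1 u = 0 \<and> \<kappa>2 u = 0"
    using normalized_frame_framed[OF n u f] by simp
qed

section \<open>Constancy of \<tau> on connected surfaces\<close>

lemma connected_locally_constant:
  assumes con: "connectedin proj_space M"
    and loc: "\<And>p. p \<in> M \<Longrightarrow> \<exists>W. openin (subtopology proj_space M) W \<and> p \<in> W \<and> (\<forall>q\<in>W. T q = T p)"
    and pq: "p \<in> M" "q \<in> M"
  shows "T p = T q"
proof -
  let ?X = "subtopology proj_space M"
  have M: "topspace ?X = M" and X: "connected_space ?X"
    using con unfolding connectedin_def by auto
  \<comment> \<open>Every union of level sets is open; applied to one level and to its complement.
    The values may be of any type, since whole model surfaces are compared later as well as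
    numbers.\<close>
  have o: "openin ?X {s \<in> M. T s \<in> A}" for A
  proof (subst openin_subopen, intro ballI)
    fix s assume s: "s \<in> {s \<in> M. T s \<in> A}"
    then obtain W where W: "openin ?X W" "s \<in> W" "\<forall>q\<in>W. T q = T s"
      using loc by blast
    then have "W \<subseteq> M"
      using openin_subset[OF W(1)] M by simp
    moreover have "T q \<in> A" if "q \<in> W" for q
      using W(3) that s by simp
    ultimately have "W \<subseteq> {s \<in> M. T s \<in> A}"
      by blast
    with W(1,2) show "\<exists>W. openin ?X W \<and> s \<in> W \<and> W \<subseteq> {s \<in> M. T s \<in> A}"
      by (intro exI[of _ W] conjI)
  qed
  define E1 E2 where "E1 = {s \<in> M. T s \<in> {T p}}" and "E2 = {s \<in> M. T s \<in> - {T p}}"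
  have "openin ?X E1" "openin ?X E2" "topspace ?X \<subseteq> E1 \<union> E2" "E1 \<inter> E2 = {}" "E1 \<noteq> {}"
    using o[of "{T p}"] o[of "- {T p}"] pq(1) unfolding M E1_def E2_def by (simp, simp, auto)
  then have "E2 = {}"
    using X unfolding connected_space_def by metis
  then show ?thesis
    using pq(2) by (auto simp: E2_def)
qed

lemma framed_neighbourhood:
  assumes f: "framed_at M U v u p"
  obtains B where "open B" "convex B" "u \<in> B" "B \<subseteq> U" "openin (subtopology proj_space M) ((\<lambda>u. pt (v 0 u)) ` B)"
    "p \<in> (\<lambda>u. pt (v 0 u)) ` B" "cyclide_frame B v" "\<And>y. y \<in> B \<Longrightarrow> framed_at M B v y (pt (v 0 y))"
proof -
  have v: "cyclide_frame U v" "local_lift M U (v 0)" "u \<in> U" "p = pt (v 0 u)"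
    using f by (auto simp: framed_at_def)
  obtain e where e: "e > 0" "ball u e \<subseteq> U"
    using cyclide_frame_open[OF v(1)] v(3) openE by blast
  have c: "cyclide_frame (ball u e) v"
    using v(1) e(2) smooth_on_subset[of U _ "ball u e"] unfolding cyclide_frame_def by auto
  have l: "local_lift M (ball u e) (v 0)"
    by (rule local_lift_subset[OF v(2) _ e(2)]) simp
  show ?thesis
    using e v(4) c l local_lift_openin[OF v(2) _ e(2)]
    by (intro that[of "ball u e"]) (auto simp: framed_at_def)
qed

text \<open>\<open>framed_unique\<close> makes \<tau> a function on the surface itself, and it is
  constant on the image of every convex parameter domain.\<close>

lemma cyclidic_tau_const:
  assumes M: "cyclidic M" and con: "connectedin proj_space M"
  obtains t where "\<And>U v u p. framed_at M U v u p \<Longrightarrow> cyclide_tau v u = t"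
proof -
  define T where "T p = (SOME t. \<exists>U v u. framed_at M U v u p \<and> cyclide_tau v u = t)" for p
  have T: "T p = cyclide_tau v u" if "framed_at M U v u p" for U v u p
  proof -
    have "\<exists>U v u. framed_at M U v u p \<and> cyclide_tau v u = T p"
      unfolding T_def by (rule someI) (use that in blast)
    then show ?thesis
      using framed_unique(1)[OF that] by metis
  qed
  have loc: "\<exists>W. openin (subtopology proj_space M) W \<and> p \<in> W \<and> (\<forall>q\<in>W. T q = T p)" if pM: "p \<in> M" for p
  proof -
    obtain U v u where f: "framed_at M U v u p"
      using M pM unfolding cyclidic_def by blast
    obtain B where B: "open B" "convex B" "u \<in> B" "B \<subseteq> U" "openin (subtopology proj_space M) ((\<lambda>u. pt (v 0 u)) ` B)"
      "p \<in> (\<lambda>u. pt (v 0 u)) ` B" "cyclide_frame B v" "\<And>y. y \<in> B \<Longrightarrow> framed_at M B v y (pt (v 0 y))"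
      using framed_neighbourhood[OF f] by blast
    have "T (pt (v 0 y)) = T p" if "y \<in> B" for y
      using T[OF f] T[OF B(8)[OF that]] cyclide_tau_const[OF B(7,2) that B(3)] by simp
    then show ?thesis
      using B(5,6) by blast
  qed
  obtain p0 where p0: "p0 \<in> M"
    using M unfolding cyclidic_def surface_def by auto
  have "cyclide_tau v u = T p0" if "framed_at M U v u p" for U v u p
    using connected_locally_constant[OF con loc framed_at_in[OF that] p0] T[OF that] by simp
  then show ?thesis
    using that by blast
qed

text \<open>Every normalized frame has the \<tau> of a cyclide frame over the same point, and
  cyclide frames are themselves normalized; so it suffices to test them.\<close>

lemma framed_tau_const:
  assumes M: "cyclidic M"
  shows "tau_const M t \<longleftrightarrow> (\<forall>U v u p. framed_at M U v u p \<longrightarrow> cyclide_tau v u = t)"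
proof
  assume t: "tau_const M t"
  show "\<forall>U v u p. framed_at M U v u p \<longrightarrow> cyclide_tau v u = t"
  proof (intro allI impI)
    fix U v u p assume f: "framed_at M U v u p"
    have "normalized_frame M 1 U v (\<lambda>_. 0) (\<lambda>_. 0) (cyclide_tau v)"
      by (rule framed_normalized[OF M f])
    moreover have "u \<in> U"
      using f by (simp add: framed_at_def)
    moreover have "\<forall>U v \<kappa>1 \<kappa>2 \<tau>. normalized_frame M 1 U v \<kappa>1 \<kappa>2 \<tau> \<longrightarrow> (\<forall>u\<in>U. \<tau> u = t)"
      using t unfolding tau_const_def by (rule conjunct2)
    ultimately show "cyclide_tau v u = t"
      by (elim allE impE) (assumption, erule bspec)
  qed
next
  assume t: "\<forall>U v u p. framed_at M U v u p \<longrightarrow> cyclide_tau v u = t"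
  show "tau_const M t"
    unfolding tau_const_def
  proof (intro conjI ballI allI impI)
    fix p assume "p \<in> M"
    then obtain U v u where f: "framed_at M U v u p"
      using M unfolding cyclidic_def by blast
    then have "p \<in> (\<lambda>u. pt (v 0 u)) ` U"
      by (auto simp: framed_at_def)
    then show "\<exists>U v \<kappa>1 \<kappa>2 \<tau>. normalized_frame M 1 U v \<kappa>1 \<kappa>2 \<tau> \<and> p \<in> (\<lambda>u. pt (v 0 u)) ` U"
      using framed_normalized[OF M f] by blast
  next
    fix U v \<kappa>1 \<kappa>2 \<tau> u assume n: "normalized_frame M 1 U v \<kappa>1 \<kappa>2 \<tau>" and u: "u \<in> U"
    then have "pt (v 0 u) \<in> M"
      using local_lift_in[of M U "v 0" u] unfolding normalized_frame_def three_adapted_def by blast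
    then obtain V c w where f: "framed_at M V c w (pt (v 0 u))"
      using M unfolding cyclidic_def by blast
    show "\<tau> u = t"
      using normalized_frame_framed(3)[OF n u f] t f by simp
  qed
qed

lemma cyclidic_ex_tau_const:
  assumes "cyclidic M" "connectedin proj_space M"
  shows "\<exists>t. tau_const M t"
  using cyclidic_tau_const[OF assms] framed_tau_const[OF assms(1)] by metis

section \<open>Cyclidic surfaces are Dupin cyclides\<close>

lemma proj_rank_line:
  fixes z :: "real^2 \<Rightarrow> real^5"
  assumes D: "\<And>w. D z u w = g w *\<^sub>R A" and g: "g w0 \<noteq> 0" and A: "A \<noteq> 0" and z: "z u \<notin> span {A}"
  shows "proj_rank z u = 1"
proof -
  have "A \<in> span (range (D z u))"
  proof -
    have "A = inverse (g w0) *\<^sub>R D z u w0"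
      using g by (simp add: D)
    then show ?thesis
      by (metis rangeI span_base span_scale)
  qed
  moreover have "range (D z u) \<subseteq> span {A}"
    by (auto simp: D span_singleton)
  ultimately have sp: "span (range (D z u)) = span {A}"
    by (simp add: span_eq)
  then have "dim (range (D z u)) = 1"
    using A by (metis dim_span dim_singleton)
  then have "dim (insert (z u) (range (D z u))) = 2"
    using z sp by (simp add: dim_insert)
  then show ?thesis
    by (simp add: proj_rank_def)
qed

lemma proj_rank_plane:
  fixes z :: "real^2 \<Rightarrow> real^5"
  assumes D: "\<And>w. D z u w = g w *\<^sub>R A + h w *\<^sub>R B" and AB: "D z u wa = a *\<^sub>R A" "D z u wb = b *\<^sub>R B" "a \<noteq> 0" "b \<noteq> 0"
    and ind: "B \<noteq> 0" "A \<notin> span {B}" and z: "z u \<notin> span {A, B}"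
  shows "proj_rank z u = 2"
proof -
  have "A = inverse a *\<^sub>R D z u wa" "B = inverse b *\<^sub>R D z u wb"
    using AB by simp_all
  then have "A \<in> span (range (D z u))" "B \<in> span (range (D z u))"
    by (metis rangeI span_base span_scale)+
  moreover have "range (D z u) \<subseteq> span {A, B}"
  proof
    fix y assume "y \<in> range (D z u)"
    then obtain w where "y = g w *\<^sub>R A + h w *\<^sub>R B"
      using D by auto
    also have "\<dots> \<in> span {A, B}"
      by (intro span_add span_scale span_base) simp_all
    finally show "y \<in> span {A, B}" .
  qed
  ultimately have sp: "span (range (D z u)) = span {A, B}"
    by (simp add: span_eq)
  have "dim {A, B} = 2"
    using ind by (simp add: dim_insert)
  then have "dim (range (D z u)) = 2"
    using sp by (metis dim_span)
  then have "dim (insert (z u) (range (D z u))) = 3"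
    using z sp by (simp add: dim_insert)
  then show ?thesis
    by (simp add: proj_rank_def)
qed

lemma ip_notin_span1: "ip z y \<noteq> 0 \<Longrightarrow> ip A y = 0 \<Longrightarrow> z \<notin> span {A}"
  by (auto simp: span_singleton ip_simps)

lemma ip_notin_span2:
  assumes "ip z y \<noteq> 0" "ip A y = 0" "ip B y = 0"
  shows "z \<notin> span {A, B}"
proof
  assume "z \<in> span {A, B}"
  then have "ip z y = 0"
    by (induction rule: span_induct_alt) (use assms in \<open>auto simp: ip_simps\<close>)
  with assms show False
    by simp
qed

lemma sphere_of_iff: "x \<noteq> 0 \<Longrightarrow> pt x \<in> sphere_of z \<longleftrightarrow> ip z x = 0 \<and> pt x \<in> quadric"
proof -
  assume x: "x \<noteq> 0"
  have "ip z x = 0" if y: "pt x = pt y" "ip z y = 0" for y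
  proof -
    obtain c where "c \<noteq> 0" "y = c *\<^sub>R x"
      using pt_eqD[OF y(1) x] .
    then show ?thesis
      using y(2) by (simp add: ip_simps)
  qed
  then show ?thesis
    using x unfolding sphere_of_def by auto
qed

text \<open>An envelope is given by a map on points of the surface, not on parameters, hence the
  choice of a frame over the point; \<open>framed_unique\<close> shows that the result does not
  depend on it. The values \<open>e = 1\<close> and \<open>e = -1\<close> give \<open>zplus\<close>
  and \<open>zminus\<close>.\<close>

definition sphere_field :: "(real^5) set set \<Rightarrow> real \<Rightarrow> (real^5) set \<Rightarrow> (real^5) set" where
  "sphere_field M e p = (SOME Z. \<exists>U v u. framed_at M U v u p \<and> Z = pt (v 3 u + (2 * e) *\<^sub>R v 0 u))"

lemma sphere_field:
  assumes "framed_at M U v u p"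
  shows "sphere_field M e p = pt (v 3 u + (2 * e) *\<^sub>R v 0 u)"
proof -
  have "\<exists>U v u. framed_at M U v u p \<and> sphere_field M e p = pt (v 3 u + (2 * e) *\<^sub>R v 0 u)"
    unfolding sphere_field_def by (rule someI_ex) (use assms in blast)
  then obtain V c w where c: "framed_at M V c w p" "sphere_field M e p = pt (c 3 w + (2 * e) *\<^sub>R c 0 w)"
    by blast
  obtain k where k: "k \<noteq> 0" "c 0 w = k *\<^sub>R v 0 u" "c 3 w = k *\<^sub>R v 3 u"
    using framed_unique(2)[OF assms c(1)] by blast
  have "c 3 w + (2 * e) *\<^sub>R c 0 w = k *\<^sub>R (v 3 u + (2 * e) *\<^sub>R v 0 u)"
    by (simp add: k scaleR_add_right mult.commute)
  then show ?thesis
    using c(2) k(1) by simp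
qed

lemma cyclidic_envelope:
  assumes M: "cyclidic M" and e: "e = 1 \<or> e = -1"
  shows "envelope_family M (sphere_field M e)"
  unfolding envelope_family_def
proof (intro allI impI ballI)
  fix U x u assume x: "local_lift M U x" and u: "u \<in> U"
  obtain V v w where f: "framed_at M V v w (pt (x u))"
    using M local_lift_in[OF x u] unfolding cyclidic_def by blast
  obtain U' c r where *: "open U'" "u \<in> U'" "U' \<subseteq> U" "cyclide_frame U' c" "smooth_on U' r"
    "\<And>y. y \<in> U' \<Longrightarrow> r y \<noteq> 0" "\<And>y. y \<in> U' \<Longrightarrow> c 0 y = r y *\<^sub>R x y"
    "\<And>y. y \<in> U' \<Longrightarrow> framed_at M U' c y (pt (x y))"
    using framed_transfer[OF f x u refl] by metis
  have Dx: "D x y w = inverse (r y) *\<^sub>R D (c 0) y w + D (\<lambda>y. inverse (r y)) y w *\<^sub>R c 0 y" if "y \<in> U'" for y w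
    by (rule lift_D(1)[OF *(4-7) that])
  have x0: "x y = inverse (r y) *\<^sub>R c 0 y" if "y \<in> U'" for y
    by (rule lift_D(2)[OF *(4-7) that])
  note hc = cyclide_frame_hyperbolic[OF *(4)] and zz = zplus_zminus[OF *(4)]
  note fc = w_ip[of c, OF hc] frame_ip[OF hc] ip_simps
  define z where "z = (if e = 1 then zplus c else zminus c)"
  have ze: "z y = c 3 y + (2 * e) *\<^sub>R c 0 y" for y
    using e by (auto simp: z_def zplus_def zminus_def)
  have zs: "smooth_on U' z"
    using zz(1,2) by (simp add: z_def)
  have zc: "ip (z y) (c 3 y) = - 2" "ip (z y) (wplus c y) = 0" "ip (z y) (wminus c y) = 0" "ip (z y) (c 0 y) = 0" if "y \<in> U'" for y
    unfolding ze by (simp_all add: fc that)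
  have "z y \<noteq> 0 \<and> sphere_field M e (pt (x y)) = pt (z y) \<and> proj_rank z y = 1 \<and>
           pt (x y) \<in> sphere_of (z y) \<and> (\<forall>w. ip (z y) (D x y w) = 0)" if y: "y \<in> U'" for y
  proof (intro conjI allI)
    obtain a b where ab: "formP c y a = 1" "formQ c y b = 1"
      using cyclide_frame_coords[OF *(4) y] by metis
    have W: "wplus c y \<noteq> 0" "wminus c y \<noteq> 0"
      using fc(1)[OF y] fc(2)[OF y] by (auto simp: ip_simps)
    show z0: "z y \<noteq> 0"
      using zc(1)[OF y] by (auto simp: ip_simps)
    show "sphere_field M e (pt (x y)) = pt (z y)"
      unfolding ze by (rule sphere_field[OF *(8)[OF y]])
    have sp: "z y \<notin> span {wplus c y}" "z y \<notin> span {wminus c y}"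
      using zc(1)[OF y] ip_notin_span1[of "z y" "c 3 y"] by (simp_all add: fc y)
    show "proj_rank z y = 1"
    proof (cases "e = 1")
      case True
      then show ?thesis
        using zz(3)[OF y] ab sp W by (intro proj_rank_line[of _ _ "\<lambda>w. 4 * formQ c y w" "wminus c y" b]) (auto simp: z_def)
    next
      case False
      then show ?thesis
        using zz(4)[OF y] ab sp W by (intro proj_rank_line[of _ _ "\<lambda>w. - 4 * formP c y w" "wplus c y" a]) (auto simp: z_def)
    qed
    have "x y \<noteq> 0"
      using local_lift_nonzero[OF x] y *(3) by blast
    moreover have "pt (x y) \<in> quadric"
      using local_lift_in[OF x] y *(3) M unfolding cyclidic_def surface_def by blast
    moreover have "ip (z y) (x y) = 0"
      unfolding x0[OF y] using zc[OF y] by (simp add: ip_simps)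
    ultimately show "pt (x y) \<in> sphere_of (z y)"
      by (simp add: sphere_of_iff)
    show "ip (z y) (D x y w) = 0" for w
      unfolding Dx[OF y] cyclide_frame_D[OF *(4) y] using zc[OF y] by (simp add: ip_simps)
  qed
  then show "\<exists>U' z. u \<in> U' \<and> U' \<subseteq> U \<and> smooth_on U' z \<and>
        (\<forall>y\<in>U'. z y \<noteq> 0 \<and> sphere_field M e (pt (x y)) = pt (z y) \<and> proj_rank z y = 1 \<and>
           pt (x y) \<in> sphere_of (z y) \<and> (\<forall>w. ip (z y) (D x y w) = 0))"
    using *(2,3) zs by (intro exI[of _ U'] exI[of _ z]) simp
qed

lemma cyclidic_dupin:
  assumes M: "cyclidic M"
  shows "dupin_cyclide M"
  unfolding dupin_cyclide_def
proof (intro exI conjI ballI)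
  show "envelope_family M (sphere_field M 1)" "envelope_family M (sphere_field M (-1))"
    using cyclidic_envelope[OF M] by simp_all
  fix p assume "p \<in> M"
  then obtain U v u where f: "framed_at M U v u p"
    using M unfolding cyclidic_def by blast
  then have h: "hyperbolic_frame (\<lambda>i. v i u)"
    using cyclide_frame_hyperbolic unfolding framed_at_def by blast
  note fv = frame_ip[OF h] ip_simps
  have "pt (v 3 u + 2 *\<^sub>R v 0 u) \<noteq> pt (v 3 u - 2 *\<^sub>R v 0 u)"
  proof
    assume e: "pt (v 3 u + 2 *\<^sub>R v 0 u) = pt (v 3 u - 2 *\<^sub>R v 0 u)"
    have "v 3 u + 2 *\<^sub>R v 0 u \<noteq> 0"
    proof
      assume "v 3 u + 2 *\<^sub>R v 0 u = 0"
      then have "ip (v 3 u + 2 *\<^sub>R v 0 u) (v 3 u) = 0"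
        by (simp add: ip_simps)
      then show False
        by (simp add: fv)
    qed
    then obtain k where k: "v 3 u - 2 *\<^sub>R v 0 u = k *\<^sub>R (v 3 u + 2 *\<^sub>R v 0 u)"
      using pt_eqD[OF e] by metis
    \<comment> \<open>Pairing with \<open>v 3\<close> gives \<open>k = 1\<close>, pairing with
      \<open>v 4\<close> gives \<open>k = -1\<close>.\<close>
    show False
      using arg_cong[OF k, of "\<lambda>z. ip z (v 3 u)"] arg_cong[OF k, of "\<lambda>z. ip z (v 4 u)"] by (simp add: fv)
  qed
  then show "sphere_field M 1 p \<noteq> sphere_field M (-1) p"
    by (simp add: sphere_field[OF f])
qed

text \<open>\<open>D (c 4)\<close> has coefficients \<open>1 + \<tau>\<close> and
  \<open>1 - \<tau>\<close> on the independent directions \<open>wplus\<close> and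
  \<open>wminus\<close>; at most one of them vanishes, so the rank never drops to 0.\<close>

lemma cyclide_conjugate_rank:
  assumes c: "cyclide_frame U c" and u: "u \<in> U"
  shows "proj_rank (c 4) u = (if cyclide_tau c u = 1 \<or> cyclide_tau c u = -1 then 1 else 2)"
proof -
  define t where "t = cyclide_tau c u"
  note hc = cyclide_frame_hyperbolic[OF c u]
  note fc = w_ip[of c u, OF hc] frame_ip[OF hc] ip_simps
  have D4: "D (c 4) u w = ((1 + t) * formP c u w) *\<^sub>R wplus c u + ((1 - t) * formQ c u w) *\<^sub>R wminus c u" for w
    unfolding t_def by (rule cyclide_frame_structure(1)[OF c u])
  obtain a b where ab: "formP c u a = 1" "formQ c u a = 0" "formP c u b = 0" "formQ c u b = 1"
    using cyclide_frame_coords[OF c u] by metis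
  have W: "wplus c u \<noteq> 0" "wminus c u \<noteq> 0"
    using fc(1,2) by (auto simp: ip_simps)
  have sp: "c 4 u \<notin> span {wplus c u}" "c 4 u \<notin> span {wminus c u}" "c 4 u \<notin> span {wplus c u, wminus c u}"
    using ip_notin_span1[of "c 4 u" "c 0 u"] ip_notin_span2[of "c 4 u" "c 0 u"] by (simp_all add: fc)
  have spW: "wplus c u \<notin> span {wminus c u}"
    by (rule ip_notin_span1[of _ "wplus c u"]) (simp_all add: fc)
  consider "t = 1" | "t = -1" | "t \<noteq> 1" "t \<noteq> -1"
    by blast
  then show ?thesis
  proof cases
    case 1
    then have "proj_rank (c 4) u = 1"
      using D4 W sp ab by (intro proj_rank_line[of _ _ "\<lambda>w. 2 * formP c u w" "wplus c u" a]) auto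
    then show ?thesis
      using 1 by (simp add: t_def)
  next
    case 2
    then have "proj_rank (c 4) u = 1"
      using D4 W sp ab by (intro proj_rank_line[of _ _ "\<lambda>w. 2 * formQ c u w" "wminus c u" b]) auto
    then show ?thesis
      using 2 by (simp add: t_def)
  next
    case 3
    have "proj_rank (c 4) u = 2"
      by (rule proj_rank_plane[OF D4, of a "1 + t" b "1 - t"]) (use 3 W sp spW ab in \<open>auto simp: D4\<close>)
    then show ?thesis
      using 3 by (simp add: t_def)
  qed
qed

text \<open>By \<open>frame_comparison\<close> the last vector of any 3-adapted frame is a
  nonvanishing smooth multiple of that of a cyclide frame, and such a factor does not change the
  projective rank.\<close>

lemma cyclidic_conj_dim:
  assumes M: "cyclidic M" and t: "tau_const M t"
  shows "conj_dim M d \<longleftrightarrow> d = (if t = 1 \<or> t = -1 then 1 else 2)"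
proof -
  define d0 where "d0 = (if t = 1 \<or> t = -1 then 1 else 2 :: nat)"
  note tau = t[unfolded framed_tau_const[OF M], rule_format]
  have ex: "\<exists>U v. three_adapted_frame M U v \<and> p \<in> (\<lambda>u. pt (v 0 u)) ` U" if "p \<in> M" for p
  proof -
    obtain U v u where f: "framed_at M U v u p"
      using M \<open>p \<in> M\<close> unfolding cyclidic_def by blast
    have "three_adapted_frame M U v"
      using framed_normalized[OF M f] unfolding normalized_frame_def three_adapted_frame_def by blast
    then show ?thesis
      using f unfolding framed_at_def by blast
  qed
  have rank: "proj_rank (v 4) u = d0" if v: "three_adapted_frame M U v" and u: "u \<in> U" for U v u
  proof -
    obtain \<theta>1 \<theta>2 \<alpha>11 \<alpha>22 \<beta>1 \<beta>2 lam11 lam22 where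
      v: "three_adapted M U v \<theta>1 \<theta>2 \<alpha>11 \<alpha>22 \<beta>1 \<beta>2 lam11 lam22"
      using v unfolding three_adapted_frame_def by blast
    then have l: "local_lift M U (v 0)" and s4: "smooth_on U (v 4)"
      by (auto simp: three_adapted_def)
    obtain V c0 w where f: "framed_at M V c0 w (pt (v 0 u))"
      using M local_lift_in[OF l u] unfolding cyclidic_def by blast
    obtain U' c r where *: "open U'" "u \<in> U'" "U' \<subseteq> U" "cyclide_frame U' c" "smooth_on U' r"
      "\<And>y. y \<in> U' \<Longrightarrow> r y \<noteq> 0" "\<And>y. y \<in> U' \<Longrightarrow> c 0 y = r y *\<^sub>R v 0 y"
      "\<And>y. y \<in> U' \<Longrightarrow> framed_at M U' c y (pt (v 0 y))"
      using framed_transfer[OF f l u refl] by metis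
    note a = adapted_subset[OF three_adapted_imp_adapted[OF v] *(1,3)]
    have c4: "c 4 y = inverse (r y) *\<^sub>R v 4 y" if "y \<in> U'" for y
      using frame_comparison[OF *(4) a *(5-7) that] by (metis inverse_eq_divide)
    have "d0 = proj_rank (c 4) u"
      using cyclide_conjugate_rank[OF *(4,2)] tau[OF *(8)[OF *(2)]] by (simp add: d0_def)
    also have "\<dots> = proj_rank (\<lambda>y. inverse (r y) *\<^sub>R v 4 y) u"
      by (rule proj_rank_cong[OF *(1,2) c4])
    also have "\<dots> = proj_rank (v 4) u"
      using smooth_on_differentiable[OF smooth_on_inverse[OF *(5,6)] *(2)] smooth_on_differentiable[OF s4 u] *(6)[OF *(2)]
      by (intro proj_rank_scale) auto
    finally show ?thesis
      by simp
  qed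
  obtain p where "p \<in> M"
    using M unfolding cyclidic_def surface_def by auto
  then obtain U v u where v: "three_adapted_frame M U v" "u \<in> U"
    using ex by blast
  show ?thesis
    unfolding d0_def[symmetric]
  proof
    assume "conj_dim M d"
    then have "\<forall>U v. three_adapted_frame M U v \<longrightarrow> (\<forall>u\<in>U. proj_rank (v 4) u = d)"
      unfolding conj_dim_def by (rule conjunct2)
    then have "proj_rank (v 4) u = d"
      using v by blast
    then show "d = d0"
      using rank[OF v] by simp
  next
    assume "d = d0"
    then show "conj_dim M d"
      unfolding conj_dim_def by (intro conjI ballI allI impI) (simp_all only: ex rank)
  qed
qed

text \<open>\<open>tau_const\<close> provides a normalized frame near each point. Without \<kappa>1
  and \<kappa>2 its equations are those of a cyclide frame, with P and Q half the sum and half the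
  difference of \<theta>1 and \<theta>2.\<close>

lemma tau_const_imp_cyclidic:
  assumes M: "surface M" and k: "kappas_vanish M" and t: "tau_const M t"
  shows "cyclidic M"
  unfolding cyclidic_def
proof (intro conjI ballI)
  fix p assume "p \<in> M"
  from bspec[OF conjunct1[OF t[unfolded tau_const_def]] this]
  obtain U v \<kappa>1 \<kappa>2 \<tau> where n: "normalized_frame M 1 U v \<kappa>1 \<kappa>2 \<tau>" and p: "p \<in> (\<lambda>u. pt (v 0 u)) ` U"
    by (elim exE conjE)
  obtain \<theta>1 \<theta>2 b12 b21 where a: "three_adapted M U v \<theta>1 \<theta>2
        (\<lambda>u w. 3/2 * \<kappa>2 u * \<theta>1 u w + 1/2 * \<kappa>1 u * \<theta>2 u w)
        (\<lambda>u w. 1/2 * \<kappa>2 u * \<theta>1 u w + 3/2 * \<kappa>1 u * \<theta>2 u w)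
        (\<lambda>u w. \<tau> u * \<theta>1 u w + b12 u * \<theta>2 u w)
        (\<lambda>u w. b21 u * \<theta>1 u w + 1 * \<tau> u * \<theta>2 u w)
        (\<lambda>_. 1) (\<lambda>_. 1)"
    using n unfolding normalized_frame_def by blast
  have k0: "\<kappa>1 u = 0" "\<kappa>2 u = 0" if "u \<in> U" for u
    using k n that unfolding kappas_vanish_def by blast+
  have l: "local_lift M U (v 0)"
    using a by (simp add: three_adapted_def)
  note st = adapted_eqs[OF three_adapted_imp_adapted[OF a]]
  have "cyclide_frame U v"
    unfolding cyclide_frame_def
  proof (intro conjI ballI allI impI)
    show "open U"
      by (rule local_lift_open[OF l])
    show "smooth_on U (v i)" if "i \<le> 4" for i
      using a that by (simp add: three_adapted_def)
    fix u assume u: "u \<in> U"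
    show "hyperbolic_frame (\<lambda>i. v i u)"
      by (rule st(1)[OF u])
    show "inj (D (v 0) u)"
      unfolding linear_injective_0[OF D_lin[OF st(5)[OF u]]]
      using immersion_kernel(1)[OF st(5)[OF u] local_lift_rank[OF l u], of _ 0] by simp
    fix w
    show "\<exists>P Q. D (v 0) u w = P *\<^sub>R (v 1 u + v 2 u) + Q *\<^sub>R (v 1 u - v 2 u) \<and>
           D (v 3) u w = - (2 * P) *\<^sub>R (v 1 u + v 2 u) + (2 * Q) *\<^sub>R (v 1 u - v 2 u)"
      unfolding st(2)[OF u] st(3)[OF u] k0[OF u]
      by (intro exI[of _ "(\<theta>1 u w + \<theta>2 u w) / 2"] exI[of _ "(\<theta>1 u w - \<theta>2 u w) / 2"])
        (simp add: vec_eq_iff field_simps)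
  qed
  then show "\<exists>U v u. framed_at M U v u p"
    using l p unfolding framed_at_def by blast
qed (rule M)

section \<open>Dupin cyclides are cyclidic\<close>

text \<open>Generically the solution is the cross product of the two coefficient rows; the other
  cases treat a vanishing leading minor.\<close>

lemma two_equations:
  fixes a1 a2 b1 b2 c1 c2 :: real
  obtains p q r where "p \<noteq> 0 \<or> q \<noteq> 0 \<or> r \<noteq> 0" "p * a1 + q * b1 + r * c1 = 0" "p * a2 + q * b2 + r * c2 = 0"
proof -
  consider "a1 * b2 - a2 * b1 \<noteq> 0" | "a1 * b2 - a2 * b1 = 0" "a1 \<noteq> 0" | "a1 * b2 - a2 * b1 = 0" "a2 \<noteq> 0" | "a1 = 0" "a2 = 0"
    by blast
  then show ?thesis
  proof cases
    case 1
    then show ?thesis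
      by (intro that[of "b1 * c2 - b2 * c1" "c1 * a2 - c2 * a1" "a1 * b2 - a2 * b1"]) (auto simp: algebra_simps)
  next
    case 2
    then show ?thesis
      by (intro that[of "- b1" a1 0]) (auto simp: algebra_simps)
  next
    case 3
    then show ?thesis
      by (intro that[of "- b2" a2 0]) (auto simp: algebra_simps)
  next
    case 4
    then show ?thesis
      by (intro that[of 1 0 0]) auto
  qed
qed

text \<open>Signature \<open>(2,3)\<close>: a three-dimensional positive semidefinite space would meet the negative
  definite one given by \<open>z\<^sub>0 = z\<^sub>4\<close>, \<open>z\<^sub>1 = - z\<^sub>3\<close>.\<close>

lemma ip_normal_negative:
  assumes x: "ip x x = 0" "x \<noteq> 0" and ab: "ip a a = 0" "ip b b = 0" "ip a b = 1"
    and xab: "ip x a = 0" "ip x b = 0" and z: "ip z x = 0" "ip z a = 0" "ip z b = 0" and ne: "z \<notin> span {x}"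
  shows "ip z z < 0"
proof (rule ccontr)
  assume "\<not> ip z z < 0"
  then have zz: "ip z z \<ge> 0"
    by simp
  \<comment> \<open>A vector of norm 2 orthogonal to \<open>x\<close> and \<open>z\<close>; together
    the three span a semidefinite space if \<open>ip z z\<close> is nonnegative.\<close>
  define s where "s = a + b"
  have "ip a x = 0" "ip b x = 0" "ip x z = 0" "ip a z = 0" "ip b z = 0" "ip b a = 1"
    using xab z ab(3) by (simp_all add: ip_sym)
  then have s: "ip s s = 2" "ip s x = 0" "ip x s = 0" "ip s z = 0" "ip z s = 0" "ip x z = 0"
    using ab xab z by (simp_all add: s_def ip_simps)
  \<comment> \<open>A nontrivial combination of \<open>x\<close>, \<open>s\<close>, \<open>z\<close>
    that lies in the three-dimensional negative definite subspace, hence is 0.\<close>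
  obtain p q r where pqr: "p \<noteq> 0 \<or> q \<noteq> 0 \<or> r \<noteq> 0"
    "p * (x$0 - x$4) + q * (s$0 - s$4) + r * (z$0 - z$4) = 0"
    "p * (x$1 + x$3) + q * (s$1 + s$3) + r * (z$1 + z$3) = 0"
    by (rule two_equations[where ?a1.0 = "x$0 - x$4" and ?b1.0 = "s$0 - s$4" and ?c1.0 = "z$0 - z$4"
        and ?a2.0 = "x$1 + x$3" and ?b2.0 = "s$1 + s$3" and ?c2.0 = "z$1 + z$3"])
  define y where "y = p *\<^sub>R x + q *\<^sub>R s + r *\<^sub>R z"
  have y: "y$0 = y$4" "y$1 = - y$3"
  proof -
    have "y$0 - y$4 = p * (x$0 - x$4) + q * (s$0 - s$4) + r * (z$0 - z$4)"
      "y$1 + y$3 = p * (x$1 + x$3) + q * (s$1 + s$3) + r * (z$1 + z$3)"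
      unfolding y_def by (simp_all add: algebra_simps)
    then show "y$0 = y$4" "y$1 = - y$3"
      using pqr by simp_all
  qed
  have "ip y y = 2 * q^2 + r^2 * ip z z"
    by (simp add: y_def ip_simps s z x power2_eq_square)
  moreover have "ip y y = - 2 * ((y$4)^2 + (y$3)^2 + (y$2)^2)"
    by (simp add: ip_def y power2_eq_square)
  moreover have "2 * q^2 + r^2 * ip z z \<ge> 0"
    using zz by simp
  ultimately have "0 \<le> - 2 * ((y$4)^2 + (y$3)^2 + (y$2)^2)"
    by simp
  then have "(y$4)^2 + (y$3)^2 + (y$2)^2 \<le> 0"
    by simp
  then have "y$4 = 0" "y$3 = 0" "y$2 = 0"
    using zero_le_power2[of "y$4"] zero_le_power2[of "y$3"] zero_le_power2[of "y$2"]
    by (smt (verit) zero_less_power2)+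
  then have y0: "y = 0"
    using y by (simp add: vec_eq_iff all_5)
  have "ip y s = 2 * q"
    by (simp add: y_def ip_simps s)
  then have q: "q = 0"
    using y0 by (simp add: ip_simps)
  then have e: "r *\<^sub>R z = (- p) *\<^sub>R x"
    using y0 unfolding y_def by (simp add: eq_neg_iff_add_eq_0 add.commute)
  have "r = 0"
  proof (rule ccontr)
    assume "r \<noteq> 0"
    then have "z = (- p / r) *\<^sub>R x"
      using arg_cong[OF e, of "\<lambda>y. inverse r *\<^sub>R y"] by (simp add: divide_inverse mult.commute)
    then have "z \<in> range (\<lambda>k. k *\<^sub>R x)"
      by (rule range_eqI)
    then show False
      using ne by (simp add: span_singleton)
  qed
  then show False
    using e q pqr(1) x(2) by simp
qed

text \<open>\<open>c\<close> is \<open>e\<close> freed of its components along \<open>v1\<close>,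
  \<open>v2\<close>, \<open>v3\<close>; scaling by \<open>k\<close> makes the product with
  \<open>v0\<close> equal to -1, and the added multiple of \<open>v0\<close> makes the result null.
  The formulas are explicit so that smooth dependence on a parameter can be read off.\<close>

lemma null_completion:
  assumes v: "ip v0 v0 = 0" "ip v0 v1 = 0" "ip v0 v2 = 0" "ip v0 v3 = 0" "ip v1 v1 = 0" "ip v1 v2 = 1" "ip v1 v3 = 0"
    "ip v2 v2 = 0" "ip v2 v3 = 0" "ip v3 v3 = -2" and e: "ip v0 e \<noteq> 0"
    and c: "c = e - ip e v2 *\<^sub>R v1 - ip e v1 *\<^sub>R v2 + (ip e v3 / 2) *\<^sub>R v3"
    and k: "k = - inverse (ip v0 e)"
    and v4: "v4 = k *\<^sub>R c + (k * k * ip c c / 2) *\<^sub>R v0"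
  shows "hyperbolic_frame (\<lambda>i::nat. if i = 0 then v0 else if i = 1 then v1 else if i = 2 then v2 else if i = 3 then v3 else v4)"
proof -
  note s = v ip_sym[of v1 v0] ip_sym[of v2 v0] ip_sym[of v3 v0] ip_sym[of v2 v1] ip_sym[of v3 v1] ip_sym[of v3 v2]
  have c0: "ip v0 c = ip v0 e" "ip v1 c = 0" "ip v2 c = 0" "ip v3 c = 0"
    unfolding c by (simp_all add: ip_simps s ip_sym[of e])
  have c0': "ip c v0 = ip v0 e"
    using c0(1) ip_sym by metis
  have "ip v0 v4 = -1"
    using e by (simp add: v4 ip_simps c0 s k)
  moreover have "ip v1 v4 = 0" "ip v2 v4 = 0" "ip v3 v4 = 0"
    by (simp_all add: v4 ip_simps c0 s)
  moreover have "ip v4 v4 = k * k * ip c c + k * (k * k * ip c c / 2) * ip v0 e + (k * k * ip c c / 2) * k * ip v0 e"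
    by (simp add: v4 ip_simps c0 c0' s algebra_simps)
  then have "ip v4 v4 = 0"
    using e by (simp add: k)
  ultimately show ?thesis
    unfolding hyperbolic_frame_iff frame_table_def using v by simp
qed

lemma ip_ex_nonorthogonal: "x \<noteq> 0 \<Longrightarrow> \<exists>e. ip x e \<noteq> 0"
  using ip_nondegenerate by blast

text \<open>Two null lines span the plane. Rescaling one generator normalizes the product of the two
  images, provided that this product is nonzero.\<close>

lemma hyperbolic_null_basis:
  assumes card: "card {span {w} | w. w \<noteq> 0 \<and> null_vec x u w} = 2" and d: "x differentiable (at u)"
  obtains n1 n2 where "ip (D x u n1) (D x u n1) = 0" "ip (D x u n2) (D x u n2) = 0" "ip (D x u n1) (D x u n2) = 1"
    "\<And>w. \<exists>s t. w = s *\<^sub>R n1 + t *\<^sub>R n2"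
proof -
  let ?S = "{span {w} | w. w \<noteq> 0 \<and> null_vec x u w}"
  obtain S1 S2 where S: "?S = {S1, S2}" "S1 \<noteq> S2"
    using card unfolding card_2_iff by blast
  have "S1 \<in> ?S" "S2 \<in> ?S"
    using S(1) by blast+
  then obtain a b where ab: "S1 = span {a}" "a \<noteq> 0" "null_vec x u a" "S2 = span {b}" "b \<noteq> 0" "null_vec x u b"
    by blast
  note l = D_lin[OF d]
  have nspan: "a \<notin> span {b}"
  proof
    assume "a \<in> span {b}"
    then obtain k where "a = k *\<^sub>R b"
      by (auto simp: span_singleton)
    moreover from this have "b = inverse k *\<^sub>R a"
      using ab(2) by auto
    ultimately have "a \<in> span {b}" "b \<in> span {a}"
      by (metis span_base span_scale singletonI)+
    then have "S1 = S2"
      unfolding ab by (simp add: span_eq)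
    then show False
      using S by simp
  qed
  have ind: "independent {a, b}"
    using nspan ab by (simp add: independent_insert)
  have "a \<noteq> b"
    using nspan by (auto intro: span_base)
  then have "span {a, b} = UNIV"
    using card_eq_dim[of "{a, b}" UNIV] ind by (simp add: top.extremum_unique)
  then have all: "\<exists>s t. w = s *\<^sub>R a + t *\<^sub>R b" for w
    using span_breakdown_eq[of w a "{b}"] by (auto simp: span_singleton) (metis diff_add_cancel add.commute)
  define g where "g = ip (D x u a) (D x u b)"
  \<comment> \<open>If the two null directions were orthogonal, \<open>a + b\<close> would span a
    third null line.\<close>
  have "g \<noteq> 0"
  proof
    assume g0: "g = 0"
    have nv: "null_vec x u (a + b)"
      using g0 ab(3,6) ip_sym[of "D x u a" "D x u b"] by (simp add: null_vec_def linear_add[OF l] ip_simps g_def)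
    have "a + b \<noteq> 0"
      using nspan by (metis add_eq_0_iff2 span_base span_neg singletonI)
    then have "span {a + b} = S1 \<or> span {a + b} = S2"
      using nv S(1) by blast
    then have "a + b \<in> span {a} \<or> a + b \<in> span {b}"
      unfolding ab by (metis span_base singletonI)
    then show False
    proof
      assume "a + b \<in> span {b}"
      then show False
        using nspan span_diff[of "a + b" "{b}" b] by (simp add: span_base)
    next
      assume "a + b \<in> span {a}"
      then have "b \<in> span {a}"
        using span_diff[of "a + b" "{a}" a] by (simp add: span_base)
      then show False
        using ind \<open>a \<noteq> b\<close> unfolding insert_commute[of a b] by (simp add: independent_insert)
    qed
  qed
  show ?thesis
  proof (rule that[of a "inverse g *\<^sub>R b"])
    show "ip (D x u a) (D x u a) = 0" "ip (D x u (inverse g *\<^sub>R b)) (D x u (inverse g *\<^sub>R b)) = 0"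
      "ip (D x u a) (D x u (inverse g *\<^sub>R b)) = 1"
      using ab(3,6) \<open>g \<noteq> 0\<close> by (simp_all add: null_vec_def linear_scale[OF l] ip_simps flip: g_def)
    fix w
    obtain s t where "w = s *\<^sub>R a + t *\<^sub>R b"
      using all by blast
    then have "w = s *\<^sub>R a + (t * g) *\<^sub>R (inverse g *\<^sub>R b)"
      using \<open>g \<noteq> 0\<close> by simp
    then show "\<exists>s t. w = s *\<^sub>R a + t *\<^sub>R (inverse g *\<^sub>R b)"
      by blast
  qed
qed

lemma proj_rank_1_dependent:
  assumes r: "proj_rank z u = 1"
  obtains p q r where "p \<noteq> 0 \<or> q \<noteq> 0 \<or> r \<noteq> 0" "p *\<^sub>R z u + q *\<^sub>R D z u a + r *\<^sub>R D z u b = 0"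
proof -
  let ?S = "insert (z u) (range (D z u))"
  have dim: "dim ?S = 2"
    using r by (simp add: proj_rank_def)
  consider "z u = 0" | "D z u a \<in> span {z u}" | "D z u b \<in> span {D z u a, z u}"
    | "z u \<noteq> 0" "D z u a \<notin> span {z u}" "D z u b \<notin> span {D z u a, z u}"
    by blast
  then show ?thesis
  proof cases
    case 1
    then show ?thesis
      by (intro that[of 1 0 0]) auto
  next
    case 2
    then obtain k where "D z u a = k *\<^sub>R z u"
      by (auto simp: span_singleton)
    then show ?thesis
      by (intro that[of "- k" 1 0]) auto
  next
    case 3
    then obtain k where "D z u b - k *\<^sub>R D z u a \<in> span {z u}"
      using span_breakdown_eq by blast
    then obtain l where "D z u b - k *\<^sub>R D z u a = l *\<^sub>R z u"
      by (auto simp: span_singleton)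
    then show ?thesis
      by (intro that[of "- l" "- k" 1]) (auto simp: algebra_simps)
  next
    case 4
    have ne: "D z u a \<noteq> z u" "D z u b \<noteq> D z u a" "D z u b \<noteq> z u"
      using 4(2,3) by (auto intro: span_base)
    then have "independent {D z u b, D z u a, z u}"
      using 4 by (simp add: independent_insert)
    moreover have "{D z u b, D z u a, z u} \<subseteq> ?S"
      by auto
    ultimately have "card {D z u b, D z u a, z u} \<le> dim ?S"
      using independent_card_le_dim by blast
    then show ?thesis
      using ne dim by simp
  qed
qed

section \<open>From two sphere maps to a cyclide frame\<close>

lemma open_positive:
  fixes f :: "real^2 \<Rightarrow> real"
  assumes "smooth_on V f"
  shows "open {y \<in> V. f y > 0}" "open {y \<in> V. f y \<noteq> 0}"
proof -
  have "{y \<in> V. f y > 0} = V \<inter> f -` {0<..}" "{y \<in> V. f y \<noteq> 0} = V \<inter> f -` (- {0})"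
    by auto
  then show "open {y \<in> V. f y > 0}" "open {y \<in> V. f y \<noteq> 0}"
    using continuous_open_preimage[OF smooth_on_continuous[OF assms] smooth_on_open[OF assms]]
    by (simp_all add: open_Compl)
qed

text \<open>\<open>Z1\<close> and \<open>Z2\<close> are to become \<open>zplus\<close> and
  \<open>zminus\<close>, which forces \<open>v 0 = (Z1 - Z2) / 4\<close> and
  \<open>v 3 = (Z1 + Z2) / 2\<close>. As \<open>zplus\<close> moves along \<open>wminus\<close>, of
  norm -2, and \<open>zminus\<close> along \<open>wplus\<close>, of norm 2, the normalized
  directions of \<open>Z1\<close> and \<open>Z2\<close> serve as these two vectors; this explains
  the signs assumed for \<open>A\<close> and \<open>B\<close>.\<close>

lemma cyclide_frame_construct:
  assumes s: "smooth_on V Z1" "smooth_on V Z2" "smooth_on V A" "smooth_on V B" and u: "u \<in> V"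
    and Z: "\<And>y. y \<in> V \<Longrightarrow> ip (Z1 y) (Z1 y) = -2" "\<And>y. y \<in> V \<Longrightarrow> ip (Z2 y) (Z2 y) = -2" "\<And>y. y \<in> V \<Longrightarrow> ip (Z1 y) (Z2 y) = -2"
      "\<And>y. y \<in> V \<Longrightarrow> Z1 y \<noteq> Z2 y"
    and AB: "\<And>y. y \<in> V \<Longrightarrow> ip (A y) (A y) < 0" "\<And>y. y \<in> V \<Longrightarrow> ip (B y) (B y) > 0" "\<And>y. y \<in> V \<Longrightarrow> ip (A y) (B y) = 0"
    and ABZ: "\<And>y. y \<in> V \<Longrightarrow> ip (A y) (Z1 y) = 0" "\<And>y. y \<in> V \<Longrightarrow> ip (A y) (Z2 y) = 0"
      "\<And>y. y \<in> V \<Longrightarrow> ip (B y) (Z1 y) = 0" "\<And>y. y \<in> V \<Longrightarrow> ip (B y) (Z2 y) = 0"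
    and DZ: "\<And>y w. y \<in> V \<Longrightarrow> \<exists>k. D Z1 y w = k *\<^sub>R A y" "\<And>y w. y \<in> V \<Longrightarrow> \<exists>k. D Z2 y w = k *\<^sub>R B y"
    and inj: "\<And>y. y \<in> V \<Longrightarrow> inj (D (\<lambda>y. (1/4) *\<^sub>R (Z1 y - Z2 y)) y)"
  obtains V' v where "open V'" "u \<in> V'" "V' \<subseteq> V" "cyclide_frame V' v" "v 0 = (\<lambda>y. (1/4) *\<^sub>R (Z1 y - Z2 y))"
proof -
  define v0 v3 where "v0 y = (1/4) *\<^sub>R (Z1 y - Z2 y)" and "v3 y = (1/2) *\<^sub>R (Z1 y + Z2 y)" for y
  have v0f: "v0 = (\<lambda>y. (1/4) *\<^sub>R (Z1 y - Z2 y))"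
    by (simp add: v0_def fun_eq_iff)
  define Wp Wm where "Wp y = sqrt (2 * inverse (ip (B y) (B y))) *\<^sub>R B y" and "Wm y = sqrt (-2 * inverse (ip (A y) (A y))) *\<^sub>R A y" for y
  define v1 v2 where "v1 y = (1/2) *\<^sub>R (Wp y + Wm y)" and "v2 y = (1/2) *\<^sub>R (Wp y - Wm y)" for y
  have "v0 u \<noteq> 0"
    using Z(4)[OF u] by (simp add: v0_def)
  \<comment> \<open>A fixed vector pairing nontrivially with \<open>v0\<close> at \<open>u\<close>,
    and hence near it; from it \<open>null_completion\<close> produces \<open>v4\<close>
    smoothly.\<close>
  then obtain e where e: "ip (v0 u) e \<noteq> 0"
    using ip_ex_nonorthogonal by blast
  define V' where "V' = {y \<in> V. ip (v0 y) e \<noteq> 0}"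
  note oV = smooth_on_open[OF s(1)]
  have sv0: "smooth_on V v0" and sv3: "smooth_on V v3"
    unfolding v0_def[abs_def] v3_def[abs_def] by (intro smooth_on_scaleR_const smooth_on_diff smooth_on_add s)+
  have V': "open V'" "u \<in> V'" "V' \<subseteq> V"
    unfolding V'_def using open_positive(2)[OF smooth_on_ip[OF sv0 smooth_on_const[OF oV, of e]]] u e by auto
  have pos: "2 * inverse (ip (B y) (B y)) > 0" "-2 * inverse (ip (A y) (A y)) > 0" if "y \<in> V" for y
    using AB[OF that] by auto
  have sW: "smooth_on V Wp" "smooth_on V Wm"
  proof -
    have inv: "smooth_on V (\<lambda>y. inverse (ip (B y) (B y)))" "smooth_on V (\<lambda>y. inverse (ip (A y) (A y)))"
      using AB by (auto intro!: smooth_on_inverse smooth_on_ip s simp: less_le)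
    show "smooth_on V Wp" "smooth_on V Wm"
      unfolding Wp_def[abs_def] Wm_def[abs_def]
      by (rule smooth_on_scaleR[OF smooth_on_sqrt[OF smooth_on_mult[OF smooth_on_const[OF oV]]]], (rule inv s pos, assumption?)+)+
  qed
  have sv12: "smooth_on V v1" "smooth_on V v2"
    unfolding v1_def[abs_def] v2_def[abs_def] by (intro smooth_on_scaleR_const smooth_on_diff smooth_on_add sW)+
  define c where "c y = e - ip e (v2 y) *\<^sub>R v1 y - ip e (v1 y) *\<^sub>R v2 y + (ip e (v3 y) * (1/2)) *\<^sub>R v3 y" for y
  define k where "k y = - inverse (ip (v0 y) e)" for y
  define v4 where "v4 y = k y *\<^sub>R c y + (k y * k y * ip (c y) (c y) * (1/2)) *\<^sub>R v0 y" for y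
  have sc: "smooth_on V c"
    unfolding c_def[abs_def]
    by (intro smooth_on_add smooth_on_diff smooth_on_scaleR smooth_on_mult smooth_on_ip smooth_on_const[OF oV] sv12 sv3)
  note sub = smooth_on_subset[OF _ V'(1,3)]
  have sk: "smooth_on V' k"
    unfolding k_def[abs_def]
    by (intro smooth_on_uminus smooth_on_inverse smooth_on_ip smooth_on_const[OF V'(1)] sub[OF sv0]) (simp add: V'_def)
  have sv4: "smooth_on V' v4"
    unfolding v4_def[abs_def]
    by (intro smooth_on_add smooth_on_scaleR smooth_on_mult smooth_on_ip smooth_on_const[OF V'(1)] sk sub[OF sc] sub[OF sv0])
  define v where "v i = (if i = 0 then v0 else if i = 1 then v1 else if i = 2 then v2 else if i = 3 then v3 else v4)" for i :: nat
  have W: "ip (Wp y) (Wp y) = 2" "ip (Wm y) (Wm y) = -2" "ip (Wp y) (Wm y) = 0" "ip (Wm y) (Wp y) = 0" if y: "y \<in> V" for y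
  proof -
    have q: "sqrt r * (sqrt r * t) = r * t" if "r > 0" for r t :: real
      using that by (simp add: mult.assoc[symmetric])
    have BA: "ip (B y) (A y) = 0"
      using AB(3)[OF y] by (simp add: ip_sym)
    show "ip (Wp y) (Wp y) = 2" "ip (Wm y) (Wm y) = -2" "ip (Wp y) (Wm y) = 0" "ip (Wm y) (Wp y) = 0"
      unfolding Wp_def Wm_def using AB[OF y] BA
      by (simp_all only: ip_simps real_scaleR_def q[OF pos(1)[OF y]] q[OF pos(2)[OF y]]) simp_all
  qed
  have WZ: "ip (Z y) (Wp y) = 0" "ip (Z y) (Wm y) = 0" "ip (Wp y) (Z y) = 0" "ip (Wm y) (Z y) = 0" if y: "y \<in> V" "Z = Z1 \<or> Z = Z2" for y Z
  proof -
    have "ip (Z1 y) (A y) = 0" "ip (Z2 y) (A y) = 0" "ip (Z1 y) (B y) = 0" "ip (Z2 y) (B y) = 0"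
      using ABZ[OF y(1)] ip_sym by metis+
    then show "ip (Z y) (Wp y) = 0" "ip (Z y) (Wm y) = 0" "ip (Wp y) (Z y) = 0" "ip (Wm y) (Z y) = 0"
      unfolding Wp_def Wm_def using y(2) ABZ[OF y(1)] by (auto simp: ip_simps)
  qed
  have hf: "hyperbolic_frame (\<lambda>i. v i y)" if y: "y \<in> V'" for y
  proof -
    have yV: "y \<in> V"
      using y V' by blast
    have Z21: "ip (Z2 y) (Z1 y) = -2"
      using Z(3)[OF yV] by (simp add: ip_sym)
    note t = ip_simps W[OF yV] Z(1-3)[OF yV] Z21 WZ[OF yV, of Z1, simplified] WZ[OF yV, of Z2, simplified]
    have "hyperbolic_frame (\<lambda>i::nat. if i = 0 then v0 y else if i = 1 then v1 y else if i = 2 then v2 y else if i = 3 then v3 y else v4 y)"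
    proof (rule null_completion[where e = e and c = "c y" and k = "k y"])
      show "ip (v0 y) e \<noteq> 0"
        using y by (simp add: V'_def)
      show "c y = e - ip e (v2 y) *\<^sub>R v1 y - ip e (v1 y) *\<^sub>R v2 y + (ip e (v3 y) / 2) *\<^sub>R v3 y"
        "k y = - inverse (ip (v0 y) e)" "v4 y = k y *\<^sub>R c y + (k y * k y * ip (c y) (c y) / 2) *\<^sub>R v0 y"
        unfolding c_def k_def v4_def by simp_all
    qed (unfold v0_def v1_def v2_def v3_def, simp_all add: t)
    then show ?thesis
      unfolding v_def by (simp add: if_distrib[of "\<lambda>f. f y"] cong: if_cong)
  qed
  have "cyclide_frame V' v"
    unfolding cyclide_frame_def
  proof (intro conjI ballI allI impI)
    show "open V'"
      by (rule V')
    show "smooth_on V' (v i)" for i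
      unfolding v_def using sub[OF sv0] sub[OF sv12(1)] sub[OF sv12(2)] sub[OF sv3] sv4 by simp
    fix y assume y: "y \<in> V'"
    then have yV: "y \<in> V"
      using V' by blast
    show "hyperbolic_frame (\<lambda>i. v i y)"
      by (rule hf[OF y])
    show "inj (D (v 0) y)"
      using inj[OF yV] by (simp add: v_def v0f)
    fix w
    obtain a b where ab: "D Z1 y w = a *\<^sub>R A y" "D Z2 y w = b *\<^sub>R B y"
      using DZ[OF yV] by blast
    \<comment> \<open>Solves \<open>D Z2 = - 4 P *\<^sub>R Wp\<close>; in the same way
      \<open>Q\<close> solves \<open>D Z1 = 4 Q *\<^sub>R Wm\<close>.\<close>
    define P where "P = - b / (4 * sqrt (2 * inverse (ip (B y) (B y))))"
    define Q where "Q = a / (4 * sqrt (-2 * inverse (ip (A y) (A y))))"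
    have P: "(1/4) *\<^sub>R D Z2 y w = - P *\<^sub>R Wp y" and Q: "(1/4) *\<^sub>R D Z1 y w = Q *\<^sub>R Wm y"
      unfolding ab P_def Q_def Wp_def Wm_def using pos[OF yV] by simp_all
    note d = smooth_on_differentiable[OF s(1) yV] smooth_on_differentiable[OF s(2) yV]
    note dd = smooth_on_differentiable[OF smooth_on_diff[OF s(1,2)] yV] smooth_on_differentiable[OF smooth_on_add[OF s(1,2)] yV]
    have "D v0 y w = (1/4) *\<^sub>R D Z1 y w - (1/4) *\<^sub>R D Z2 y w"
      unfolding v0_def[abs_def] D_linear_comp[OF bounded_linear_scaleR_right dd(1)] D_minus[OF d] by (rule scaleR_diff_right)
    moreover have "D v3 y w = 2 *\<^sub>R ((1/4) *\<^sub>R D Z1 y w) + 2 *\<^sub>R ((1/4) *\<^sub>R D Z2 y w)"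
      unfolding v3_def[abs_def] D_linear_comp[OF bounded_linear_scaleR_right dd(2)] D_plus[OF d] by (simp add: scaleR_add_right)
    moreover have "v 1 y + v 2 y = Wp y" "v 1 y - v 2 y = Wm y"
      unfolding v_def v1_def v2_def by (simp_all add: vec_eq_iff field_simps)
    ultimately show "\<exists>P Q. D (v 0) y w = P *\<^sub>R (v 1 y + v 2 y) + Q *\<^sub>R (v 1 y - v 2 y) \<and>
           D (v 3) y w = - (2 * P) *\<^sub>R (v 1 y + v 2 y) + (2 * Q) *\<^sub>R (v 1 y - v 2 y)"
      unfolding P Q by (intro exI[of _ P] exI[of _ Q]) (simp add: v_def)
  qed
  moreover have "v 0 = (\<lambda>y. (1/4) *\<^sub>R (Z1 y - Z2 y))"
    by (simp add: v_def v0f)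
  ultimately show ?thesis
    using that[OF V'] by blast
qed

text \<open>Since \<open>Z\<^sub>1\<close> and \<open>Z\<^sub>2\<close> have rank one, \<open>dZ\<^sub>1\<close> and \<open>dZ\<^sub>2\<close> have constant directions \<open>A\<close> and \<open>B\<close>; these
  span the tangent plane, and the symmetry of the second fundamental form makes them orthogonal.\<close>

lemma sphere_pair_directions:
  assumes s: "smooth_on V Z1" "smooth_on V Z2" and u: "u \<in> V"
    and Z: "\<And>y. y \<in> V \<Longrightarrow> ip (Z1 y) (Z1 y) = -2" "\<And>y. y \<in> V \<Longrightarrow> ip (Z2 y) (Z2 y) = -2" "\<And>y. y \<in> V \<Longrightarrow> ip (Z1 y) (Z2 y) = -2"
    and DZ: "\<And>y w. y \<in> V \<Longrightarrow> ip (D Z1 y w) (Z2 y) = 0" "\<And>y w. y \<in> V \<Longrightarrow> ip (D Z2 y w) (Z1 y) = 0"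
    and rank: "\<And>y. y \<in> V \<Longrightarrow> proj_rank Z1 y = 1" "\<And>y. y \<in> V \<Longrightarrow> proj_rank Z2 y = 1"
    and null: "\<And>y. y \<in> V \<Longrightarrow> \<exists>n1 n2. ip (D Z1 y n1 - D Z2 y n1) (D Z1 y n1 - D Z2 y n1) = 0 \<and>
      ip (D Z1 y n2 - D Z2 y n2) (D Z1 y n2 - D Z2 y n2) = 0 \<and> ip (D Z1 y n1 - D Z2 y n1) (D Z1 y n2 - D Z2 y n2) \<noteq> 0"
  obtains V' A B where "open V'" "u \<in> V'" "V' \<subseteq> V" "smooth_on V' A" "smooth_on V' B"
    "\<And>y w. y \<in> V' \<Longrightarrow> \<exists>k. D Z1 y w = k *\<^sub>R A y" "\<And>y w. y \<in> V' \<Longrightarrow> \<exists>k. D Z2 y w = k *\<^sub>R B y"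
    "\<And>y. y \<in> V' \<Longrightarrow> ip (A y) (B y) = 0" "\<And>y. y \<in> V' \<Longrightarrow> ip (A y) (A y) * ip (B y) (B y) < 0"
    "\<And>y. y \<in> V' \<Longrightarrow> ip (A y) (Z1 y) = 0" "\<And>y. y \<in> V' \<Longrightarrow> ip (A y) (Z2 y) = 0"
    "\<And>y. y \<in> V' \<Longrightarrow> ip (B y) (Z1 y) = 0" "\<And>y. y \<in> V' \<Longrightarrow> ip (B y) (Z2 y) = 0"
proof -
  note oV = smooth_on_open[OF s(1)]
  have self: "ip (D Z y w) (Z y) = 0" if "smooth_on V Z" "\<And>y. y \<in> V \<Longrightarrow> ip (Z y) (Z y) = -2" "y \<in> V" for Z y w
    using ip_const_D[OF that(1,1,3,2), of w] ip_sym[of "Z y" "D Z y w"] by simp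
  have parallel: "\<exists>k. D Z y w = k *\<^sub>R D Z y w'" if Z: "smooth_on V Z" "\<And>y. y \<in> V \<Longrightarrow> ip (Z y) (Z y) = -2" "y \<in> V"
    "proj_rank Z y = 1" "D Z y w' \<noteq> 0" for Z y w w'
  proof -
    obtain p q r where pqr: "p \<noteq> 0 \<or> q \<noteq> 0 \<or> r \<noteq> 0" "p *\<^sub>R Z y + q *\<^sub>R D Z y w + r *\<^sub>R D Z y w' = 0"
      by (rule proj_rank_1_dependent[OF Z(4)])
    \<comment> \<open>Derivatives of \<open>Z\<close> are orthogonal to \<open>Z\<close>, which has
      norm -2; pairing the dependence relation with \<open>Z y\<close> isolates
      \<open>p\<close>.\<close>
    have "p = 0"
      using arg_cong[OF pqr(2), of "\<lambda>z. ip z (Z y)"] self[OF Z(1-3)] Z(2,3) by (simp add: ip_simps)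
    then have e: "q *\<^sub>R D Z y w = (- r) *\<^sub>R D Z y w'"
      using pqr(2) by (simp add: eq_neg_iff_add_eq_0)
    then have "q \<noteq> 0"
      using pqr(1) \<open>p = 0\<close> Z(5) by auto
    then have "D Z y w = (- r / q) *\<^sub>R D Z y w'"
      using arg_cong[OF e, of "\<lambda>y. inverse q *\<^sub>R y"] by (simp add: divide_inverse mult.commute)
    then show ?thesis
      by blast
  qed
  have ex: "\<exists>w. D Z u w \<noteq> 0" if "proj_rank Z u = 1" for Z :: "real^2 \<Rightarrow> real^5"
  proof (rule ccontr)
    assume "\<nexists>w. D Z u w \<noteq> 0"
    then have "range (D Z u) \<subseteq> {0}"
      by blast
    moreover have "{0} \<subseteq> span {Z u}"
      using span_0[of "{Z u}"] by simp
    ultimately have "range (D Z u) \<subseteq> span {Z u}"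
      by (rule subset_trans)
    moreover have "Z u \<in> span {Z u}"
      by (rule span_base) simp
    ultimately have "insert (Z u) (range (D Z u)) \<subseteq> span {Z u}"
      by (intro insert_subsetI)
    then have "dim (insert (Z u) (range (D Z u))) \<le> dim {Z u}"
      by (rule dim_mono)
    also have "\<dots> \<le> 1"
      using dim_le_card'[of "{Z u}"] by simp
    finally have "dim (insert (Z u) (range (D Z u))) \<le> 1" .
    then show False
      using that by (simp add: proj_rank_def)
  qed
  obtain wa wb where wab: "D Z1 u wa \<noteq> 0" "D Z2 u wb \<noteq> 0"
    using ex[OF rank(1)[OF u]] ex[OF rank(2)[OF u]] by auto
  define A B where "A y = D Z1 y wa" and "B y = D Z2 y wb" for y
  have sAB: "smooth_on V A" "smooth_on V B"
    unfolding A_def[abs_def] B_def[abs_def] by (intro smooth_on_D s)+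
  define V' where "V' = {y \<in> {y \<in> V. A y \<bullet> A y \<noteq> 0}. B y \<bullet> B y \<noteq> 0}"
  have o1: "open {y \<in> V. A y \<bullet> A y \<noteq> 0}"
    by (rule open_positive(2)[OF smooth_on_inner[OF sAB(1,1)]])
  have V': "open V'" "u \<in> V'" "V' \<subseteq> V"
    unfolding V'_def using wab u o1
      open_positive(2)[OF smooth_on_subset[OF smooth_on_inner[OF sAB(2,2)] o1]] by (auto simp: A_def B_def)
  have nz: "A y \<noteq> 0" "B y \<noteq> 0" if "y \<in> V'" for y
    using that by (auto simp: V'_def)
  have DA: "\<exists>k. D Z1 y w = k *\<^sub>R A y" and DB: "\<exists>k. D Z2 y w = k *\<^sub>R B y" if "y \<in> V'" for y w
    using parallel[OF s(1) Z(1) _ rank(1)] parallel[OF s(2) Z(2) _ rank(2)] nz[OF that] that V' by (auto simp: A_def B_def)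
  have main: "ip (A y) (B y) = 0 \<and> ip (A y) (A y) * ip (B y) (B y) < 0" if y: "y \<in> V'" for y
  proof -
    have yV: "y \<in> V"
      using y V' by blast
    obtain n1 n2 where n: "ip (D Z1 y n1 - D Z2 y n1) (D Z1 y n1 - D Z2 y n1) = 0"
      "ip (D Z1 y n2 - D Z2 y n2) (D Z1 y n2 - D Z2 y n2) = 0" "ip (D Z1 y n1 - D Z2 y n1) (D Z1 y n2 - D Z2 y n2) \<noteq> 0"
      using null[OF yV] by blast
    obtain a1 b1 a2 b2 where ab: "D Z1 y n1 = a1 *\<^sub>R A y" "D Z2 y n1 = b1 *\<^sub>R B y" "D Z1 y n2 = a2 *\<^sub>R A y" "D Z2 y n2 = b2 *\<^sub>R B y"
      using DA[OF y] DB[OF y] by metis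
    define AA BB AB where "AA = ip (A y) (A y)" and "BB = ip (B y) (B y)" and "AB = ip (A y) (B y)"
    have BA: "ip (B y) (A y) = AB"
      by (simp add: AB_def ip_sym)
    \<comment> \<open>Symmetry of \<langle>dZ1, dZ2\<rangle>, valid since \<open>D Z1\<close> is
      orthogonal to \<open>Z2\<close>.\<close>
    have c: "a1 * a2 * 0 + a2 * b1 * AB = a1 * b2 * AB"
      using curl_identity0[OF s(1,2) yV DZ(1), of n2 n1] unfolding ab
      by (simp add: ip_simps AB_def mult.commute)
    have n': "a1 * a1 * AA - 2 * a1 * b1 * AB + b1 * b1 * BB = 0" "a2 * a2 * AA - 2 * a2 * b2 * AB + b2 * b2 * BB = 0"
      "a1 * a2 * AA - (a1 * b2 + a2 * b1) * AB + b1 * b2 * BB \<noteq> 0"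
      using n unfolding ab by (simp_all add: ip_simps BA AA_def[symmetric] BB_def[symmetric] AB_def[symmetric] algebra_simps)
    have "AB = 0"
    proof (rule ccontr)
      assume "AB \<noteq> 0"
      then have d: "a2 * b1 = a1 * b2"
        using c by simp
      \<comment> \<open>The metric product of the two null vectors. Once the coefficient pairs are
        proportional, multiplying \<open>G\<close> by any of the coefficients gives a multiple of
        the norm of a null vector.\<close>
      define G where "G = a1 * a2 * AA - (a1 * b2 + a2 * b1) * AB + b1 * b2 * BB"
      have "a1 * G = 0" "b1 * G = 0"
        using n'(1) d unfolding G_def by algebra+
      moreover have "a2 * G = 0" "b2 * G = 0"
        using n'(2) d unfolding G_def by algebra+
      ultimately have "a1 = 0" "b1 = 0"
        using n'(3) unfolding G_def by auto
      then show False
        using n'(3) by simp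
    qed
    have m: "a1 * a1 * AA = - (b1 * b1 * BB)" "a2 * a2 * AA = - (b2 * b2 * BB)" "a1 * a2 * AA + b1 * b2 * BB \<noteq> 0"
      using n' \<open>AB = 0\<close> by simp_all
    have "AA * BB < 0"
    proof (rule ccontr)
      assume "\<not> AA * BB < 0"
      then have nn: "AA * BB \<ge> 0"
        by simp
      \<comment> \<open>For a diagonal form whose entries do not have opposite signs, every null
        vector lies in the radical; two null vectors could not have a nonzero product.\<close>
      have *: "a * AA = 0 \<and> b * BB = 0" if "a * a * AA = - (b * b * BB)" for a b
      proof -
        have "(a * AA) * (a * AA) = - (b * b * (AA * BB))" "(b * BB) * (b * BB) = - (a * a * (AA * BB))"
          using that by algebra+
        then show ?thesis
          using nn by (smt (verit) mult_nonneg_nonneg zero_le_square mult_eq_0_iff)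
      qed
      show False
        using *[OF m(1)] *[OF m(2)] m(3) by (auto simp: mult.assoc)
    qed
    then show ?thesis
      using \<open>AB = 0\<close> by (simp add: AA_def BB_def AB_def)
  qed
  show ?thesis
  proof (rule that[OF V' smooth_on_subset[OF sAB(1) V'(1,3)] smooth_on_subset[OF sAB(2) V'(1,3)] DA DB])
    fix y assume "y \<in> V'"
    then have y: "y \<in> V" "y \<in> V'"
      using V' by auto
    show "ip (A y) (B y) = 0" "ip (A y) (A y) * ip (B y) (B y) < 0"
      using main[OF y(2)] by auto
    show "ip (A y) (Z1 y) = 0" "ip (A y) (Z2 y) = 0" "ip (B y) (Z1 y) = 0" "ip (B y) (Z2 y) = 0"
      unfolding A_def B_def using self[OF s(1) Z(1)] self[OF s(2) Z(2)] DZ y(1) by blast+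
  qed
qed

text \<open>One of the two directions is positive and the other negative, but it is not known which.
  In the second case the sphere maps exchange roles, which changes the sign of \<open>v 0\<close>;
  hence the constant \<open>k\<close>.\<close>

lemma sphere_pair_frame:
  assumes s: "smooth_on V Z1" "smooth_on V Z2" and u: "u \<in> V"
    and Z: "\<And>y. y \<in> V \<Longrightarrow> ip (Z1 y) (Z1 y) = -2" "\<And>y. y \<in> V \<Longrightarrow> ip (Z2 y) (Z2 y) = -2" "\<And>y. y \<in> V \<Longrightarrow> ip (Z1 y) (Z2 y) = -2"
      "\<And>y. y \<in> V \<Longrightarrow> Z1 y \<noteq> Z2 y"
    and DZ: "\<And>y w. y \<in> V \<Longrightarrow> ip (D Z1 y w) (Z2 y) = 0" "\<And>y w. y \<in> V \<Longrightarrow> ip (D Z2 y w) (Z1 y) = 0"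
    and rank: "\<And>y. y \<in> V \<Longrightarrow> proj_rank Z1 y = 1" "\<And>y. y \<in> V \<Longrightarrow> proj_rank Z2 y = 1"
    and null: "\<And>y. y \<in> V \<Longrightarrow> \<exists>n1 n2. ip (D Z1 y n1 - D Z2 y n1) (D Z1 y n1 - D Z2 y n1) = 0 \<and>
      ip (D Z1 y n2 - D Z2 y n2) (D Z1 y n2 - D Z2 y n2) = 0 \<and> ip (D Z1 y n1 - D Z2 y n1) (D Z1 y n2 - D Z2 y n2) \<noteq> 0"
    and inj: "\<And>y. y \<in> V \<Longrightarrow> inj (D (\<lambda>y. (1/4) *\<^sub>R (Z1 y - Z2 y)) y)"
  obtains V' v k where "open V'" "u \<in> V'" "V' \<subseteq> V" "cyclide_frame V' v" "k \<noteq> 0" "v 0 = (\<lambda>y. k *\<^sub>R (Z1 y - Z2 y))"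
proof -
  obtain V' A B where *: "open V'" "u \<in> V'" "V' \<subseteq> V" "smooth_on V' A" "smooth_on V' B"
    "\<And>y w. y \<in> V' \<Longrightarrow> \<exists>k. D Z1 y w = k *\<^sub>R A y" "\<And>y w. y \<in> V' \<Longrightarrow> \<exists>k. D Z2 y w = k *\<^sub>R B y"
    "\<And>y. y \<in> V' \<Longrightarrow> ip (A y) (B y) = 0" "\<And>y. y \<in> V' \<Longrightarrow> ip (A y) (A y) * ip (B y) (B y) < 0"
    "\<And>y. y \<in> V' \<Longrightarrow> ip (A y) (Z1 y) = 0" "\<And>y. y \<in> V' \<Longrightarrow> ip (A y) (Z2 y) = 0"
    "\<And>y. y \<in> V' \<Longrightarrow> ip (B y) (Z1 y) = 0" "\<And>y. y \<in> V' \<Longrightarrow> ip (B y) (Z2 y) = 0"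
    using sphere_pair_directions[OF s u Z(1-3) DZ rank null] by blast
  show ?thesis
  proof (cases "ip (B u) (B u) > 0")
    case True
    define V'' where "V'' = {y \<in> V'. ip (B y) (B y) > 0}"
    have V'': "open V''" "u \<in> V''" "V'' \<subseteq> V'" "V'' \<subseteq> V"
      unfolding V''_def using open_positive(1)[OF smooth_on_ip[OF *(5,5)]] True *(2,3) by auto
    note sub = smooth_on_subset[OF _ V''(1)]
    have in': "y \<in> V'" "y \<in> V" if "y \<in> V''" for y
      using that V'' by auto
    have Apos: "ip (A y) (A y) < 0" and Bneg: "ip (B y) (B y) > 0" if "y \<in> V''" for y
      using *(9)[OF in'(1)[OF that]] that by (simp_all add: V''_def mult_less_0_iff)
    obtain V3 v where "open V3" "u \<in> V3" "V3 \<subseteq> V''" "cyclide_frame V3 v" "v 0 = (\<lambda>y. (1/4) *\<^sub>R (Z1 y - Z2 y))"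
      by (rule cyclide_frame_construct[OF sub[OF s(1) V''(4)] sub[OF s(2) V''(4)] sub[OF *(4) V''(3)] sub[OF *(5) V''(3)] V''(2)
          Z(1)[OF in'(2)] Z(2)[OF in'(2)] Z(3)[OF in'(2)] Z(4)[OF in'(2)] Apos Bneg *(8)[OF in'(1)] *(10)[OF in'(1)] *(11)[OF in'(1)] *(12)[OF in'(1)]
          *(13)[OF in'(1)] *(6)[OF in'(1)] *(7)[OF in'(1)] inj[OF in'(2)]])
    then show ?thesis
      using V''(4) by (intro that[of V3 v "1/4"]) auto
  next
    case False
    define V'' where "V'' = {y \<in> V'. ip (A y) (A y) > 0}"
    have "ip (A u) (A u) > 0"
      using *(9)[OF *(2)] False by (auto simp: mult_less_0_iff)
    then have V'': "open V''" "u \<in> V''" "V'' \<subseteq> V'" "V'' \<subseteq> V"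
      unfolding V''_def using open_positive(1)[OF smooth_on_ip[OF *(4,4)]] *(2,3) by auto
    note sub = smooth_on_subset[OF _ V''(1)]
    have in': "y \<in> V'" "y \<in> V" if "y \<in> V''" for y
      using that V'' by auto
    have Apos: "ip (A y) (A y) > 0" and Bneg: "ip (B y) (B y) < 0" if "y \<in> V''" for y
      using *(9)[OF in'(1)[OF that]] that by (simp_all add: V''_def mult_less_0_iff)
    have sym: "ip (Z2 y) (Z1 y) = -2" "Z2 y \<noteq> Z1 y" "ip (B y) (A y) = 0" if "y \<in> V''" for y
      using Z(3,4)[OF in'(2)[OF that]] *(8)[OF in'(1)[OF that]] ip_sym by metis+
    have inj': "inj (D (\<lambda>y. (1/4) *\<^sub>R (Z2 y - Z1 y)) y)" if y: "y \<in> V''" for y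
    proof -
      note d = smooth_on_differentiable[OF smooth_on_scaleR_const[OF smooth_on_diff[OF s], of "1/4"] in'(2)[OF y]]
      have "(\<lambda>y. (1/4) *\<^sub>R (Z2 y - Z1 y)) = (\<lambda>y. (-1) *\<^sub>R ((1/4) *\<^sub>R (Z1 y - Z2 y)))"
        by (simp add: fun_eq_iff scaleR_diff_right)
      then have "D (\<lambda>y. (1/4) *\<^sub>R (Z2 y - Z1 y)) y w = (-1) *\<^sub>R D (\<lambda>y. (1/4) *\<^sub>R (Z1 y - Z2 y)) y w" for w
        using D_linear_comp[OF bounded_linear_scaleR_right[of "-1"] d, of w] by (simp only:)
      then show ?thesis
        using inj[OF in'(2)[OF y]] by (simp add: inj_def)
    qed
    obtain V3 v where "open V3" "u \<in> V3" "V3 \<subseteq> V''" "cyclide_frame V3 v" "v 0 = (\<lambda>y. (1/4) *\<^sub>R (Z2 y - Z1 y))"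
      by (rule cyclide_frame_construct[OF sub[OF s(2) V''(4)] sub[OF s(1) V''(4)] sub[OF *(5) V''(3)] sub[OF *(4) V''(3)] V''(2)
          Z(2)[OF in'(2)] Z(1)[OF in'(2)] sym(1) sym(2) Bneg Apos sym(3) *(13)[OF in'(1)] *(12)[OF in'(1)] *(11)[OF in'(1)] *(10)[OF in'(1)]
          *(7)[OF in'(1)] *(6)[OF in'(1)] inj'])
    then show ?thesis
      using V''(4) by (intro that[of V3 v "-1/4"]) (auto simp: fun_eq_iff scaleR_diff_right)
  qed
qed

lemma open_inter_smooth:
  "smooth_on U1 z1 \<Longrightarrow> smooth_on U2 z2 \<Longrightarrow> smooth_on (U1 \<inter> U2) z1 \<and> smooth_on (U1 \<inter> U2) z2"
  by (auto intro!: smooth_on_subset[of _ _ "U1 \<inter> U2"] open_Int dest: smooth_on_open)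

lemma quadric_lift:
  assumes M: "M \<subseteq> quadric" and l: "local_lift M U x" and u: "u \<in> U"
  shows "ip (x u) (x u) = 0" "ip (x u) (D x u w) = 0" "ip (D x u w) (x u) = 0"
proof -
  have 0: "ip (x y) (x y) = 0" if y: "y \<in> U" for y
  proof -
    obtain z where z: "pt (x y) = pt z" "ip z z = 0"
      using M local_lift_in[OF l y] unfolding quadric_def by blast
    obtain c where c: "c \<noteq> 0" "z = c *\<^sub>R x y"
      by (rule pt_eqD[OF z(1) local_lift_nonzero[OF l y]])
    then show ?thesis
      using z(2) by (simp add: ip_simps)
  qed
  then show "ip (x u) (x u) = 0"
    using u .
  show "ip (D x u w) (x u) = 0"
    using ip_const_D[OF local_lift_smooth[OF l] local_lift_smooth[OF l] u 0, of w] ip_sym[of "x u" "D x u w"] by simp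
  then show "ip (x u) (D x u w) = 0"
    by (simp add: ip_sym)
qed

text \<open>A map with \<open>ip z x = 0\<close>, \<open>ip z dx = 0\<close> and \<open>z = b x\<close> at a point inherits \<open>b\<close> times the metric there,
  hence is an immersion.\<close>

lemma rank_one_normal_nondegenerate:
  assumes x: "smooth_on V x" and z: "smooth_on V z" and u: "u \<in> V"
    and xx: "ip (x u) (x u) = 0" and xD: "\<And>y w. y \<in> V \<Longrightarrow> ip (x y) (D x y w) = 0"
    and zx: "\<And>y. y \<in> V \<Longrightarrow> ip (z y) (x y) = 0" and zD: "\<And>y w. y \<in> V \<Longrightarrow> ip (z y) (D x y w) = 0"
    and rank: "proj_rank z u = 1" and z0: "z u \<noteq> 0"
    and n: "ip (D x u n1) (D x u n1) = 0" "ip (D x u n2) (D x u n2) = 0" "ip (D x u n1) (D x u n2) = 1"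
  shows "z u \<notin> span {x u}"
proof
  assume "z u \<in> span {x u}"
  then obtain b where b: "z u = b *\<^sub>R x u"
    by (auto simp: span_singleton)
  with z0 have b0: "b \<noteq> 0"
    by auto
  note sD = smooth_on_D[OF x]
  have k: "ip (D z u w') (D x u w) = b * ip (D x u w') (D x u w)" for w w'
  proof -
    have "ip (D z u w') (D x u w) = - ip (z u) (D (\<lambda>y. D x y w) u w')"
      by (rule ip_const_D[OF z sD u zD])
    moreover have "ip (D x u w') (D x u w) = - ip (x u) (D (\<lambda>y. D x y w) u w')"
      by (rule ip_const_D[OF x sD u xD])
    ultimately show ?thesis
      by (simp add: b ip_simps)
  qed
  have n21: "ip (D x u n2) (D x u n1) = 1"
    using n(3) ip_sym by metis
  obtain p q r where pqr: "p \<noteq> 0 \<or> q \<noteq> 0 \<or> r \<noteq> 0" "p *\<^sub>R z u + q *\<^sub>R D z u n1 + r *\<^sub>R D z u n2 = 0"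
    by (rule proj_rank_1_dependent[OF rank])
  have "q * b = 0" "r * b = 0"
    using arg_cong[OF pqr(2), of "\<lambda>y. ip y (D x u n2)"] arg_cong[OF pqr(2), of "\<lambda>y. ip y (D x u n1)"] zD[OF u]
    by (simp_all add: ip_simps k n n21)
  then show False
    using b0 pqr z0 by auto
qed

lemma smooth_on_neg_norm:
  assumes z: "smooth_on V z" and neg: "\<And>y. y \<in> V \<Longrightarrow> ip (z y) (z y) < 0"
  shows "smooth_on V (\<lambda>y. sqrt (2 * inverse (- ip (z y) (z y))))"
proof (rule smooth_on_sqrt)
  have "smooth_on V (\<lambda>y. inverse (- ip (z y) (z y)))"
    using neg by (intro smooth_on_inverse smooth_on_uminus smooth_on_ip z) (auto simp: less_le)
  then show "smooth_on V (\<lambda>y. 2 * inverse (- ip (z y) (z y)))"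
    by (rule smooth_on_mult[OF smooth_on_const[OF smooth_on_open[OF z]]])
  show "2 * inverse (- ip (z y) (z y)) > 0" if "y \<in> V" for y
    using neg[OF that] by simp
qed

text \<open>Both sphere maps are normal to the lift and have negative norm, so they can be scaled to
  norm -2. Normal vectors form a plane containing the null line of \<open>x\<close>, so two of them
  with norm -2 agree up to sign modulo \<open>x\<close>. After adjusting the sign the difference is
  a multiple of \<open>x\<close>, nonzero because the spheres are distinct.\<close>

lemma dupin_lift_frame:
  assumes M: "hyperbolic_surface M" and Z: "envelope_family M F1" "envelope_family M F2" "\<forall>p\<in>M. F1 p \<noteq> F2 p"
    and x: "local_lift M U x" and u: "u \<in> U"
  shows "\<exists>V v w. framed_at M V v w (pt (x u))"
proof -
  have Mq: "M \<subseteq> quadric"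
    using M by (simp add: hyperbolic_surface_def surface_def)
  obtain U1 z1 where 1: "u \<in> U1" "U1 \<subseteq> U" "smooth_on U1 z1" "\<forall>y\<in>U1. z1 y \<noteq> 0 \<and> F1 (pt (x y)) = pt (z1 y) \<and> proj_rank z1 y = 1 \<and>
           pt (x y) \<in> sphere_of (z1 y) \<and> (\<forall>w. ip (z1 y) (D x y w) = 0)"
    using Z(1) x u unfolding envelope_family_def by metis
  obtain U2 z2 where 2: "u \<in> U2" "U2 \<subseteq> U" "smooth_on U2 z2" "\<forall>y\<in>U2. z2 y \<noteq> 0 \<and> F2 (pt (x y)) = pt (z2 y) \<and> proj_rank z2 y = 1 \<and>
           pt (x y) \<in> sphere_of (z2 y) \<and> (\<forall>w. ip (z2 y) (D x y w) = 0)"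
    using Z(2) x u unfolding envelope_family_def by metis
  define V where "V = U1 \<inter> U2"
  have V: "u \<in> V" "V \<subseteq> U" "V \<subseteq> U1" "V \<subseteq> U2"
    using 1 2 by (auto simp: V_def)
  have sz: "smooth_on V z1" "smooth_on V z2"
    using open_inter_smooth[OF 1(3) 2(3)] by (auto simp: V_def)
  have oV: "open V"
    by (rule smooth_on_open[OF sz(1)])
  have l: "local_lift M V x"
    by (rule local_lift_subset[OF x oV V(2)])
  note sx = local_lift_smooth[OF l] and q = quadric_lift[OF Mq l] and x0 = local_lift_nonzero[OF l]
  have z: "z1 y \<noteq> 0" "z2 y \<noteq> 0" "proj_rank z1 y = 1" "proj_rank z2 y = 1" "ip (z1 y) (x y) = 0" "ip (z2 y) (x y) = 0"
    "ip (z1 y) (D x y w) = 0" "ip (z2 y) (D x y w) = 0" if "y \<in> V" for y w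
    using 1(4) 2(4) V(3,4) that sphere_of_iff[OF x0[OF that]] by blast+
  have ptne: "pt (z1 y) \<noteq> pt (z2 y)" if "y \<in> V" for y
    using Z(3) 1(4) 2(4) V(3,4) that local_lift_in[OF l that] by (metis subsetD)
  have null: "\<exists>n1 n2. ip (D x y n1) (D x y n1) = 0 \<and> ip (D x y n2) (D x y n2) = 0 \<and> ip (D x y n1) (D x y n2) = 1" if y: "y \<in> V" for y
  proof -
    have "card {span {w} | w. w \<noteq> 0 \<and> null_vec x y w} = 2"
      using M l y unfolding hyperbolic_surface_def by blast
    then obtain n1 n2 where "ip (D x y n1) (D x y n1) = 0" "ip (D x y n2) (D x y n2) = 0" "ip (D x y n1) (D x y n2) = 1"
      by (rule hyperbolic_null_basis[OF _ smooth_on_differentiable[OF sx y]])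
    then show ?thesis
      by blast
  qed
  have neg: "ip (z1 y) (z1 y) < 0" "ip (z2 y) (z2 y) < 0" if y: "y \<in> V" for y
  proof -
    obtain n1 n2 where n: "ip (D x y n1) (D x y n1) = 0" "ip (D x y n2) (D x y n2) = 0" "ip (D x y n1) (D x y n2) = 1"
      using null[OF y] by blast
    have "z1 y \<notin> span {x y}" "z2 y \<notin> span {x y}"
      using rank_one_normal_nondegenerate[OF sx sz(1) y q(1)[OF y] q(2) z(5) z(7) z(3)[OF y] z(1)[OF y] n]
        rank_one_normal_nondegenerate[OF sx sz(2) y q(1)[OF y] q(2) z(6) z(8) z(4)[OF y] z(2)[OF y] n] by blast+
    then show "ip (z1 y) (z1 y) < 0" "ip (z2 y) (z2 y) < 0"
      using ip_normal_negative[OF q(1)[OF y] x0[OF y] n q(2)[OF y] q(2)[OF y]] z(5-8)[OF y] by blast+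
  qed
  define s1 s2 where "s1 y = sqrt (2 * inverse (- ip (z1 y) (z1 y)))" and "s2 y = sqrt (2 * inverse (- ip (z2 y) (z2 y)))" for y
  have s: "smooth_on V s1" "smooth_on V s2"
    unfolding s1_def[abs_def] s2_def[abs_def]
    using smooth_on_neg_norm[OF sz(1) neg(1)] smooth_on_neg_norm[OF sz(2) neg(2)] by blast+
  have spos: "s1 y > 0" "s2 y > 0" "s1 y * s1 y * ip (z1 y) (z1 y) = -2" "s2 y * s2 y * ip (z2 y) (z2 y) = -2" if "y \<in> V" for y
    using neg[OF that] by (auto simp: s1_def s2_def divide_simps)
  define Z1 where "Z1 y = s1 y *\<^sub>R z1 y" for y
  \<comment> \<open>The sign relating the two orientations; the factor -1/2 compensates the norm -2.
    It is kept as a smooth function rather than fixed by cases.\<close>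
  define k where "k y = (-1/2) * (s1 y * s2 y * ip (z1 y) (z2 y))" for y
  define Z2 where "Z2 y = (k y * s2 y) *\<^sub>R z2 y" for y
  have sk: "smooth_on V k"
    unfolding k_def[abs_def] by (intro smooth_on_mult smooth_on_const[OF oV] s smooth_on_ip sz)
  have sks: "smooth_on V (\<lambda>y. k y * s2 y)"
    by (intro smooth_on_mult sk s)
  have sZ: "smooth_on V Z1" "smooth_on V Z2"
    unfolding Z1_def[abs_def] Z2_def[abs_def] by (intro smooth_on_scaleR sks s sz)+
  have ZZ: "ip (Z1 y) (Z1 y) = -2" if "y \<in> V" for y
    using spos[OF that] by (simp add: Z1_def ip_simps)
  have key: "\<exists>r. r \<noteq> 0 \<and> Z1 y - Z2 y = r *\<^sub>R x y" and kk: "k y * k y = 1" if y: "y \<in> V" for y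
  proof -
    obtain n1 n2 where n: "ip (D x y n1) (D x y n1) = 0" "ip (D x y n2) (D x y n2) = 0" "ip (D x y n1) (D x y n2) = 1"
      using null[OF y] by blast
    obtain e where e: "ip (x y) e \<noteq> 0"
      using ip_ex_nonorthogonal[OF x0[OF y]] by blast
    have o: "ip (x y) (Z1 y) = 0" "ip (D x y w) (Z1 y) = 0" "ip (s2 y *\<^sub>R z2 y) (x y) = 0" "ip (s2 y *\<^sub>R z2 y) (D x y w) = 0" for w
      using z[OF y] ip_sym by (simp_all add: Z1_def ip_simps)
    note hf = null_completion[OF q(1)[OF y] q(2)[OF y] q(2)[OF y] o(1) n(1,3) o(2) n(2) o(2) ZZ[OF y] e refl refl refl]
    have k: "ip (s2 y *\<^sub>R z2 y) (Z1 y) = -2 * k y"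
      by (simp add: k_def Z1_def ip_simps ip_sym[of "z2 y"])
    \<comment> \<open>In a frame through \<open>x\<close>, its two null tangents and
      \<open>Z1\<close>, a vector orthogonal to \<open>x\<close> and to the tangents has components
      along \<open>x\<close> and \<open>Z1\<close> only.\<close>
    obtain b where b: "s2 y *\<^sub>R z2 y = b *\<^sub>R x y + k y *\<^sub>R Z1 y"
    proof -
      obtain v4 where "hyperbolic_frame (\<lambda>i::nat. if i = 0 then x y else if i = 1 then D x y n1 else if i = 2 then D x y n2
          else if i = 3 then Z1 y else v4)"
        using hf by blast
      from frame_expand[OF this, of "s2 y *\<^sub>R z2 y"]
      have "s2 y *\<^sub>R z2 y = (- ip (s2 y *\<^sub>R z2 y) v4) *\<^sub>R x y + k y *\<^sub>R Z1 y"
        using o(3,4) k by simp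
      then show ?thesis
        using that by blast
    qed
    have "ip (s2 y *\<^sub>R z2 y) (s2 y *\<^sub>R z2 y) = -2"
      using spos[OF y] by (simp add: ip_simps)
    moreover have "ip (Z1 y) (x y) = 0"
      using o(1) by (simp add: ip_sym)
    ultimately show kk: "k y * k y = 1"
      unfolding b using o(1) q(1)[OF y] ZZ[OF y] by (simp add: ip_simps)
    then have k0: "k y \<noteq> 0"
      by auto
    have "Z2 y = k y *\<^sub>R (s2 y *\<^sub>R z2 y)"
      by (simp add: Z2_def)
    then have "Z2 y = (k y * b) *\<^sub>R x y + (k y * k y) *\<^sub>R Z1 y"
      unfolding b by (simp add: scaleR_add_right)
    then have e: "Z1 y - Z2 y = (- (k y * b)) *\<^sub>R x y"
      using kk by simp
    have "b \<noteq> 0"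
    proof
      assume "b = 0"
      then have "Z1 y = Z2 y"
        using e by simp
      then have "pt (s1 y *\<^sub>R z1 y) = pt ((k y * s2 y) *\<^sub>R z2 y)"
        by (simp add: Z1_def Z2_def)
      moreover have "s1 y \<noteq> 0" "k y * s2 y \<noteq> 0"
        using spos(1,2)[OF y] k0 by auto
      ultimately show False
        using ptne[OF y] by simp
    qed
    then show "\<exists>r. r \<noteq> 0 \<and> Z1 y - Z2 y = r *\<^sub>R x y"
      using e k0 by (intro exI[of _ "- (k y * b)"]) simp
  qed
  have Zx: "ip (Z1 y) (x y) = 0" "ip (Z2 y) (x y) = 0" "ip (Z1 y) (D x y w) = 0" "ip (Z2 y) (D x y w) = 0" if "y \<in> V" for y w
    using z[OF that] by (simp_all add: Z1_def Z2_def ip_simps)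
  have DZx: "ip (D Z1 y w) (x y) = 0" "ip (D Z2 y w) (x y) = 0" if y: "y \<in> V" for y w
    using ip_const_D[OF sZ(1) sx y Zx(1), of w] ip_const_D[OF sZ(2) sx y Zx(2), of w] Zx(3,4)[OF y] by simp_all
  have ZZ2: "ip (Z2 y) (Z2 y) = -2" if y: "y \<in> V" for y
  proof -
    have "ip (Z2 y) (Z2 y) = (k y * k y) * (s2 y * s2 y * ip (z2 y) (z2 y))"
      by (simp add: Z2_def ip_simps)
    then show ?thesis
      using kk[OF y] spos(4)[OF y] by simp
  qed
  have Z12: "ip (Z1 y) (Z2 y) = -2" if y: "y \<in> V" for y
  proof -
    obtain r where "Z1 y - Z2 y = r *\<^sub>R x y"
      using key[OF y] by blast
    then have "Z2 y = Z1 y - r *\<^sub>R x y"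
      by (metis diff_diff_eq2 add_diff_cancel_left' diff_add_cancel)
    then show ?thesis
      using ZZ[OF y] Zx(1)[OF y] by (simp add: ip_simps)
  qed
  have self: "ip (D Z y w) (Z y) = 0" if "smooth_on V Z" "\<And>y. y \<in> V \<Longrightarrow> ip (Z y) (Z y) = -2" "y \<in> V" for Z y w
    using ip_const_D[OF that(1,1,3,2), of w] ip_sym[of "Z y" "D Z y w"] by simp
  have DZZ: "ip (D Z1 y w) (Z2 y) = 0" "ip (D Z2 y w) (Z1 y) = 0" if y: "y \<in> V" for y w
  proof -
    obtain r where r: "Z1 y - Z2 y = r *\<^sub>R x y"
      using key[OF y] by blast
    then have "ip (D Z1 y w) (Z1 y - Z2 y) = 0" "ip (D Z2 y w) (Z1 y - Z2 y) = 0"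
      using DZx[OF y] by (simp_all add: ip_simps)
    then show "ip (D Z1 y w) (Z2 y) = 0" "ip (D Z2 y w) (Z1 y) = 0"
      using self[OF sZ(1) ZZ y, of w] self[OF sZ(2) ZZ2 y, of w] by (simp_all add: ip_simps)
  qed
  have rank: "proj_rank Z1 y = 1" "proj_rank Z2 y = 1" if y: "y \<in> V" for y
  proof -
    have "k y \<noteq> 0" "s1 y \<noteq> 0" "s2 y \<noteq> 0"
      using kk[OF y] spos(1,2)[OF y] by auto
    then show "proj_rank Z1 y = 1" "proj_rank Z2 y = 1"
      unfolding Z1_def[abs_def] Z2_def[abs_def]
      using proj_rank_scale[OF smooth_on_differentiable[OF s(1) y] _ smooth_on_differentiable[OF sz(1) y]]
        proj_rank_scale[OF smooth_on_differentiable[OF sks y] _ smooth_on_differentiable[OF sz(2) y]] z(3,4)[OF y]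
      by simp_all
  qed
  \<comment> \<open>Gives the pointwise factors between \<open>Z1 - Z2\<close> and \<open>x\<close>
    as one smooth function.\<close>
  define \<rho> where "\<rho> y = ((Z1 y - Z2 y) \<bullet> x y) * inverse (x y \<bullet> x y)" for y
  have s\<rho>: "smooth_on V \<rho>"
    unfolding \<rho>_def[abs_def]
    by (intro smooth_on_mult smooth_on_inverse smooth_on_inner smooth_on_diff sZ sx) (use x0 in auto)
  have \<rho>: "\<rho> y \<noteq> 0 \<and> Z1 y - Z2 y = \<rho> y *\<^sub>R x y" if y: "y \<in> V" for y
  proof -
    obtain r where r: "r \<noteq> 0" "Z1 y - Z2 y = r *\<^sub>R x y"
      using key[OF y] by blast
    then have "\<rho> y = r"
      using x0[OF y] by (simp add: \<rho>_def)
    with r show ?thesis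
      by simp
  qed
  have sd: "smooth_on V (\<lambda>y. Z1 y - Z2 y)"
    by (intro smooth_on_diff sZ)
  have Dd: "D Z1 y w - D Z2 y w = \<rho> y *\<^sub>R D x y w + D \<rho> y w *\<^sub>R x y" if y: "y \<in> V" for y w
  proof -
    have "D Z1 y w - D Z2 y w = D (\<lambda>y. Z1 y - Z2 y) y w"
      by (rule D_minus[OF smooth_on_differentiable[OF sZ(1) y] smooth_on_differentiable[OF sZ(2) y], symmetric])
    also have "D (\<lambda>y. Z1 y - Z2 y) y = D (\<lambda>y. \<rho> y *\<^sub>R x y) y"
      using oV y by (rule D_cong) (use \<rho> in blast)
    finally show ?thesis
      using D_scale[OF smooth_on_differentiable[OF s\<rho> y] smooth_on_differentiable[OF sx y]] by simp
  qed
  have null': "\<exists>n1 n2. ip (D Z1 y n1 - D Z2 y n1) (D Z1 y n1 - D Z2 y n1) = 0 \<and>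
      ip (D Z1 y n2 - D Z2 y n2) (D Z1 y n2 - D Z2 y n2) = 0 \<and> ip (D Z1 y n1 - D Z2 y n1) (D Z1 y n2 - D Z2 y n2) \<noteq> 0"
    if y: "y \<in> V" for y
  proof -
    obtain n1 n2 where n: "ip (D x y n1) (D x y n1) = 0" "ip (D x y n2) (D x y n2) = 0" "ip (D x y n1) (D x y n2) = 1"
      using null[OF y] by blast
    have "ip (D Z1 y w - D Z2 y w) (D Z1 y w' - D Z2 y w') = \<rho> y * \<rho> y * ip (D x y w) (D x y w')" for w w'
      unfolding Dd[OF y] by (simp add: ip_simps q[OF y])
    then show ?thesis
      using n \<rho>[OF y] by (intro exI[of _ n1] exI[of _ n2]) simp
  qed
  have inj: "inj (D (\<lambda>y. (1/4) *\<^sub>R (Z1 y - Z2 y)) y)" if y: "y \<in> V" for y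
  proof -
    note d = smooth_on_differentiable[OF sd y]
    have dq: "(\<lambda>y. (1/4) *\<^sub>R (Z1 y - Z2 y)) differentiable (at y)"
      using smooth_on_differentiable[OF smooth_on_scaleR_const[OF sd] y] .
    have e: "D (\<lambda>y. (1/4) *\<^sub>R (Z1 y - Z2 y)) y w = (1/4) *\<^sub>R (\<rho> y *\<^sub>R D x y w + D \<rho> y w *\<^sub>R x y)" for w
      unfolding D_linear_comp[OF bounded_linear_scaleR_right d] Dd[OF y, symmetric]
        D_minus[OF smooth_on_differentiable[OF sZ(1) y] smooth_on_differentiable[OF sZ(2) y]] ..
    have "w = 0" if "D (\<lambda>y. (1/4) *\<^sub>R (Z1 y - Z2 y)) y w = 0" for w
    proof -
      have "0 = \<rho> y *\<^sub>R D x y w + D \<rho> y w *\<^sub>R x y"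
        using that unfolding e by simp
      then have "D x y w = (- D \<rho> y w / \<rho> y) *\<^sub>R x y"
        using \<rho>[OF y] by (intro scaleR_solve) simp_all
      then show ?thesis
        using immersion_kernel(1)[OF smooth_on_differentiable[OF sx y] local_lift_rank[OF l y]] by blast
    qed
    then show ?thesis
      using linear_injective_0[OF D_lin[OF dq]] by blast
  qed
  have ne: "Z1 y \<noteq> Z2 y" if "y \<in> V" for y
    using \<rho>[OF that] x0[OF that] by auto
  obtain V' v c where v: "open V'" "u \<in> V'" "V' \<subseteq> V" "cyclide_frame V' v" "c \<noteq> 0" "v 0 = (\<lambda>y. c *\<^sub>R (Z1 y - Z2 y))"
    by (rule sphere_pair_frame[OF sZ V(1) ZZ ZZ2 Z12 ne DZZ rank null' inj])
  have l': "local_lift M V' x"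
    by (rule local_lift_subset[OF l v(1,3)])
  have "local_lift M V' (\<lambda>y. (c * \<rho> y) *\<^sub>R x y)"
    using v(3,5) \<rho> by (intro local_lift_scale[OF l'] smooth_on_mult smooth_on_const[OF v(1)] smooth_on_subset[OF s\<rho> v(1,3)]) auto
  then have "local_lift M V' (v 0)"
    by (rule local_lift_cong) (use v(3,6) \<rho> in auto)
  moreover have "pt (x u) = pt (v 0 u)"
    using \<rho>[OF V(1)] v(5,6) by simp
  ultimately show ?thesis
    using v(2,4) unfolding framed_at_def by blast
qed

lemma dupin_cyclidic:
  assumes M: "hyperbolic_surface M" and d: "dupin_cyclide M"
  shows "cyclidic M"
  unfolding cyclidic_def
proof (intro conjI ballI)
  show s: "surface M"
    using M by (simp add: hyperbolic_surface_def)
  obtain F1 F2 where F: "envelope_family M F1" "envelope_family M F2" "\<forall>p\<in>M. F1 p \<noteq> F2 p"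
    using d unfolding dupin_cyclide_def by blast
  fix p assume "p \<in> M"
  then obtain U x u where "local_lift M U x" "u \<in> U" "p = pt (x u)"
    using s unfolding surface_def by blast
  then show "\<exists>U v u. framed_at M U v u p"
    using dupin_lift_frame[OF M F] by blast
qed

section \<open>Isometries acting on projective space\<close>

definition ip_isometry :: "(real^5 \<Rightarrow> real^5) \<Rightarrow> bool" where
  "ip_isometry L \<longleftrightarrow> linear L \<and> (\<forall>z w. ip (L z) (L w) = ip z w)"

abbreviation proj_image :: "(real^5 \<Rightarrow> real^5) \<Rightarrow> (real^5) set set \<Rightarrow> (real^5) set set" where
  "proj_image L M \<equiv> (`) L ` M"

lemma ip_isometry_linear: "ip_isometry L \<Longrightarrow> linear L"
  and ip_isometry_ip: "ip_isometry L \<Longrightarrow> ip (L z) (L w) = ip z w"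
  by (auto simp: ip_isometry_def)

lemma ip_isometry_bij:
  assumes L: "ip_isometry L"
  shows "bij L"
proof -
  note l = ip_isometry_linear[OF L]
  have "z = 0" if "L z = 0" for z
  proof (rule ip_nondegenerate)
    fix y
    have "ip (L z) (L y) = 0"
      using that by (simp add: ip_simps)
    then show "ip z y = 0"
      by (simp add: ip_isometry_ip[OF L])
  qed
  then have "inj L"
    using linear_injective_0[OF l] by blast
  then show ?thesis
    using linear_injective_imp_surjective[OF l] by (simp add: bij_def)
qed

lemma ip_isometry_inv:
  assumes L: "ip_isometry L"
  shows "ip_isometry (inv L)"
proof -
  note b = ip_isometry_bij[OF L] and l = ip_isometry_linear[OF L]
  have LL: "L (inv L z) = z" "inv L (L z) = z" for z
    using b by (simp_all add: bij_is_surj surj_f_inv_f bij_is_inj)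
  have "linear (inv L)"
  proof (rule linearI)
    fix x y c
    show "inv L (x + y) = inv L x + inv L y"
      by (metis LL linear_add[OF l])
    show "inv L (c *\<^sub>R x) = c *\<^sub>R inv L x"
      by (metis LL linear_scale[OF l])
  qed
  then show ?thesis
    unfolding ip_isometry_def using ip_isometry_ip[OF L] LL by metis
qed

lemma ip_isometry_inverse:
  assumes "ip_isometry L"
  shows "L (inv L z) = z" "inv L (L z) = z"
  using ip_isometry_bij[OF assms] by (simp_all add: bij_is_surj surj_f_inv_f bij_is_inj)

lemma ip_isometry_pt: "ip_isometry L \<Longrightarrow> L ` pt z = pt (L z)"
  using linear_span_image[OF ip_isometry_linear, of L "{z}"] by simp

lemma ip_isometry_nonzero: "ip_isometry L \<Longrightarrow> L z = 0 \<longleftrightarrow> z = 0"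
  using ip_isometry_bij linear_0[OF ip_isometry_linear] by (metis bij_is_inj injD)

lemma proj_image_inv:
  assumes "ip_isometry L"
  shows "proj_image (inv L) (proj_image L M) = M" "proj_image L (proj_image (inv L) M) = M"
  by (simp_all add: image_image ip_isometry_inverse[OF assms])

lemma openin_proj_image:
  assumes L: "ip_isometry L" and W: "openin proj_space W"
  shows "openin proj_space (proj_image L W)"
proof -
  have eq: "{z. z \<noteq> 0 \<and> pt z \<in> proj_image L W} = inv L -` {z. z \<noteq> 0 \<and> pt z \<in> W}"
  proof (intro equalityI subsetI)
    fix z assume "z \<in> {z. z \<noteq> 0 \<and> pt z \<in> proj_image L W}"
    then obtain p where p: "z \<noteq> 0" "p \<in> W" "pt z = L ` p"
      by auto
    have "pt (inv L z) = inv L ` L ` p"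
      using ip_isometry_pt[OF ip_isometry_inv[OF L]] p by metis
    also have "\<dots> = p"
      by (simp add: image_image ip_isometry_inverse[OF L])
    finally show "z \<in> inv L -` {z. z \<noteq> 0 \<and> pt z \<in> W}"
      using p ip_isometry_nonzero[OF ip_isometry_inv[OF L]] by simp
  next
    fix z assume "z \<in> inv L -` {z. z \<noteq> 0 \<and> pt z \<in> W}"
    then have z: "inv L z \<noteq> 0" "pt (inv L z) \<in> W"
      by auto
    have "L ` pt (inv L z) = pt z"
      using ip_isometry_pt[OF L, of "inv L z"] by (simp add: ip_isometry_inverse[OF L])
    then show "z \<in> {z. z \<noteq> 0 \<and> pt z \<in> proj_image L W}"
      using z ip_isometry_nonzero[OF ip_isometry_inv[OF L]] by (auto intro!: rev_image_eqI[OF z(2)])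
  qed
  have "open {z. z \<noteq> 0 \<and> pt z \<in> W}"
    using W unfolding openin_proj_space by simp
  then have "open (inv L -` {z. z \<noteq> 0 \<and> pt z \<in> W})"
    by (rule open_vimage) (simp add: linear_continuous_on linear_conv_bounded_linear[symmetric]
        ip_isometry_linear[OF ip_isometry_inv[OF L]])
  moreover have "proj_image L W \<subseteq> {pt z | z. z \<noteq> 0}"
  proof
    fix p assume "p \<in> proj_image L W"
    then obtain z where "z \<noteq> 0" "p = L ` pt z"
      using W unfolding openin_proj_space by blast
    then show "p \<in> {pt z | z. z \<noteq> 0}"
      using ip_isometry_pt[OF L] ip_isometry_nonzero[OF L] by auto
  qed
  ultimately show ?thesis
    unfolding openin_proj_space eq by simp
qed

lemma openin_sub_proj_image:
  assumes L: "ip_isometry L" and W: "openin (subtopology proj_space M) W"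
  shows "openin (subtopology proj_space (proj_image L M)) (proj_image L W)"
proof -
  obtain T where T: "openin proj_space T" "W = T \<inter> M"
    using W unfolding openin_subtopology by auto
  have "inj ((`) L)"
    by (rule injI) (simp add: inj_image_eq_iff[OF bij_is_inj[OF ip_isometry_bij[OF L]]])
  then have "proj_image L W = proj_image L T \<inter> proj_image L M"
    unfolding T by (rule image_Int)
  then show ?thesis
    unfolding openin_subtopology using openin_proj_image[OF L T(1)] by blast
qed

lemma proj_rank_isometry:
  assumes L: "ip_isometry L" and d: "x differentiable (at u)"
  shows "proj_rank (\<lambda>u. L (x u)) u = proj_rank x u"
proof -
  note l = ip_isometry_linear[OF L]
  have "D (\<lambda>u. L (x u)) u w = L (D x u w)" for w
    by (rule D_linear_comp[OF _ d]) (simp add: linear_conv_bounded_linear[symmetric] l)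
  then have "insert (L (x u)) (range (D (\<lambda>u. L (x u)) u)) = L ` insert (x u) (range (D x u))"
    by auto
  moreover have "dim (L ` insert (x u) (range (D x u))) = dim (insert (x u) (range (D x u)))"
    using ip_isometry_bij[OF L] by (intro dim_image_eq[OF l]) (meson bij_is_inj inj_on_subset subset_UNIV)
  ultimately show ?thesis
    by (simp add: proj_rank_def)
qed

lemma local_lift_isometry:
  assumes L: "ip_isometry L" and l: "local_lift M U x"
  shows "local_lift (proj_image L M) U (\<lambda>u. L (x u))"
proof -
  have bl: "bounded_linear L"
    using ip_isometry_linear[OF L] by (simp add: linear_conv_bounded_linear[symmetric])
  have pt: "pt (L (x u)) = L ` pt (x u)" for u
    using ip_isometry_pt[OF L] by simp
  have inj: "inj ((`) L)"
    by (rule injI) (simp add: inj_image_eq_iff[OF bij_is_inj[OF ip_isometry_bij[OF L]]])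
  show ?thesis
    unfolding local_lift_iff
  proof (intro conjI ballI allI impI)
    show "smooth_on U (\<lambda>u. L (x u))"
      by (rule smooth_on_linear_comp[OF bl local_lift_smooth[OF l]])
    show "L (x u) \<noteq> 0" "proj_rank (\<lambda>u. L (x u)) u = 2" if "u \<in> U" for u
      using that local_lift_nonzero[OF l] local_lift_rank[OF l] smooth_on_differentiable[OF local_lift_smooth[OF l]]
      by (simp_all add: ip_isometry_nonzero[OF L] proj_rank_isometry[OF L])
    have "inj_on (\<lambda>u. pt (x u)) U"
      using l by (simp add: local_lift_iff)
    then show "inj_on (\<lambda>u. pt (L (x u))) U"
      unfolding pt by (auto intro!: inj_onI dest!: injD[OF inj] dest: inj_onD)
    fix V assume "open V \<and> V \<subseteq> U"
    then have "openin (subtopology proj_space M) ((\<lambda>u. pt (x u)) ` V)"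
      using local_lift_openin[OF l] by blast
    from openin_sub_proj_image[OF L this]
    show "openin (subtopology proj_space (proj_image L M)) ((\<lambda>u. pt (L (x u))) ` V)"
      unfolding pt by (simp add: image_image)
  qed
qed

text \<open>Cyclide frames and \<tau> are expressed through \<open>ip\<close>, linear combinations
  and derivatives, all of which commute with a linear isometry.\<close>

lemma framed_at_isometry:
  assumes L: "ip_isometry L" and f: "framed_at M U v u p"
  shows "framed_at (proj_image L M) U (\<lambda>i u. L (v i u)) u (L ` p)"
    and "cyclide_tau (\<lambda>i u. L (v i u)) u = cyclide_tau v u"
proof -
  note l = ip_isometry_linear[OF L]
  have bl: "bounded_linear L"
    using l by (simp add: linear_conv_bounded_linear[symmetric])
  have c: "cyclide_frame U v" and u: "u \<in> U"
    using f by (auto simp: framed_at_def)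
  note s = cyclide_frame_smooth[OF c]
  have D: "D (\<lambda>u. L (v i u)) y w = L (D (v i) y w)" if "i \<le> 4" "y \<in> U" for i y w
    by (rule D_linear_comp[OF bl smooth_on_differentiable[OF s[OF that(1)] that(2)]])
  have c': "cyclide_frame U (\<lambda>i u. L (v i u))"
    unfolding cyclide_frame_def
  proof (intro conjI ballI allI impI)
    show "open U"
      by (rule cyclide_frame_open[OF c])
    show "smooth_on U (\<lambda>u. L (v i u))" if "i \<le> 4" for i
      by (rule smooth_on_linear_comp[OF bl s[OF that]])
    fix y assume y: "y \<in> U"
    show "hyperbolic_frame (\<lambda>i. L (v i y))"
      using cyclide_frame_hyperbolic[OF c y] by (simp add: hyperbolic_frame_iff frame_table_def ip_isometry_ip[OF L])
    have "inj (D (v 0) y)"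
      using c y by (simp add: cyclide_frame_def)
    then show "inj (D (\<lambda>u. L (v 0 u)) y)"
      using ip_isometry_bij[OF L] D[of 0 y] y by (simp add: inj_def bij_def)
    fix w
    show "\<exists>P Q. D (\<lambda>u. L (v 0 u)) y w = P *\<^sub>R (L (v 1 y) + L (v 2 y)) + Q *\<^sub>R (L (v 1 y) - L (v 2 y)) \<and>
           D (\<lambda>u. L (v 3 u)) y w = - (2 * P) *\<^sub>R (L (v 1 y) + L (v 2 y)) + (2 * Q) *\<^sub>R (L (v 1 y) - L (v 2 y))"
    proof -
      obtain P Q where PQ: "D (v 0) y w = P *\<^sub>R (v 1 y + v 2 y) + Q *\<^sub>R (v 1 y - v 2 y)"
           "D (v 3) y w = - (2 * P) *\<^sub>R (v 1 y + v 2 y) + (2 * Q) *\<^sub>R (v 1 y - v 2 y)"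
        using c y unfolding cyclide_frame_def by blast
      show ?thesis
        using D[of 0 y w] D[of 3 y w] y
        by (intro exI[of _ P] exI[of _ Q])
          (simp add: PQ linear_add[OF l] linear_diff[OF l] linear_scale[OF l] linear_neg[OF l])
    qed
  qed
  show "framed_at (proj_image L M) U (\<lambda>i u. L (v i u)) u (L ` p)"
    using c' u local_lift_isometry[OF L] f ip_isometry_pt[OF L] by (auto simp: framed_at_def)
  show "cyclide_tau (\<lambda>i u. L (v i u)) u = cyclide_tau v u"
  proof (rule cyclide_tau_unique[OF c' u])
    fix w
    have W: "wplus (\<lambda>i u. L (v i u)) u = L (wplus v u)"
      by (simp add: wplus_def linear_add[OF l])
    have "formP (\<lambda>i u. L (v i u)) u w = formP v u w"
      unfolding formP_def W D[OF zero_le u] by (simp add: ip_isometry_ip[OF L])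
    then show "ip (D (\<lambda>u. L (v 4 u)) u w) (wplus (\<lambda>i u. L (v i u)) u) = 2 * (1 + cyclide_tau v u) * formP (\<lambda>i u. L (v i u)) u w"
      unfolding W D[OF order_refl u] by (simp add: ip_isometry_ip[OF L] cyclide_frame_structure[OF c u] ip_simps
          w_ip[of v u, OF cyclide_frame_hyperbolic[OF c u]])
  qed
qed


section \<open>The conformal symplectic group\<close>

lemma sum_UNIV_4: "(\<Sum>i\<in>(UNIV::4 set). f i) = f 1 + f 2 + f 3 + (f 4 :: 'a::comm_monoid_add)"
  unfolding UNIV_4 by (simp add: add.assoc)

lemma mat4_mult: "(A *v a) $ i = A$i$1 * a$1 + A$i$2 * a$2 + A$i$3 * a$3 + A$i$4 * (a::real^4)$4"
  by (simp add: matrix_vector_mult_def sum_UNIV_4)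

definition minor :: "real^4^4 \<Rightarrow> 4 \<Rightarrow> 4 \<Rightarrow> 4 \<Rightarrow> 4 \<Rightarrow> real" where
  "minor A i j k l = A$i$k * A$j$l - A$i$l * A$j$k"

text \<open>Row \<open>(i, j)\<close> of the second exterior power of \<open>A\<close>, in the coordinates of \<open>plucker_vec\<close>
  (where \<open>p\<^sub>2\<^sub>3 = - z\<^sub>1\<close> and \<open>p\<^sub>2\<^sub>4 = - z\<^sub>2\<close>).\<close>

definition ext_row :: "real^4^4 \<Rightarrow> 4 \<Rightarrow> 4 \<Rightarrow> real^5 \<Rightarrow> real" where
  "ext_row A i j z = minor A i j 1 2 * z$0 - minor A i j 2 3 * z$1 + (minor A i j 1 3 - minor A i j 2 4) * z$2
     + minor A i j 1 4 * z$3 + minor A i j 3 4 * z$4"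

text \<open>The action of \<open>A\<close> on bivectors, restricted to the five coordinates that
  survive on isotropic pairs.\<close>

definition ext_map :: "real^4^4 \<Rightarrow> real^5 \<Rightarrow> real^5" where
  "ext_map A z = (\<chi> k. if k = 0 then ext_row A 1 2 z else if k = 1 then - ext_row A 2 3 z
     else if k = 2 then ext_row A 1 3 z else if k = 3 then ext_row A 1 4 z else ext_row A 3 4 z)"

lemma ext_map_nth [simp]:
  "ext_map A z $ 0 = ext_row A 1 2 z" "ext_map A z $ 1 = - ext_row A 2 3 z" "ext_map A z $ 2 = ext_row A 1 3 z"
  "ext_map A z $ 3 = ext_row A 1 4 z" "ext_map A z $ 4 = ext_row A 3 4 z"
  by (simp_all add: ext_map_def)

lemma plucker_vec_nth [simp]:
  "plucker_vec a b $ 0 = a$1 * b$2 - a$2 * b$1" "plucker_vec a b $ 1 = - (a$2 * b$3 - a$3 * b$2)"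
  "plucker_vec a b $ 2 = a$1 * b$3 - a$3 * b$1" "plucker_vec a b $ 3 = a$1 * b$4 - a$4 * b$1"
  "plucker_vec a b $ 4 = a$3 * b$4 - a$4 * b$3"
  by (simp_all add: plucker_vec_def Let_def)

lemma linear_ext_map: "linear (ext_map A)"
  by (auto simp: linear_iff vec_eq_iff all_5 ext_row_def algebra_simps)

lemma ext_map_plucker:
  assumes "omega a b = 0"
  shows "plucker_vec (A *v a) (A *v b) = ext_map A (plucker_vec a b)"
proof -
  have "a$2 * b$4 - a$4 * b$2 = - (a$1 * b$3 - a$3 * b$1)"
    using assms by (simp add: omega_def)
  then have "(A *v a)$i * (A *v b)$j - (A *v a)$j * (A *v b)$i = ext_row A i j (plucker_vec a b)" for i j
    unfolding mat4_mult ext_row_def minor_def plucker_vec_nth by algebra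
  then show ?thesis
    by (simp add: vec_eq_iff all_5)
qed

text \<open>\<open>ip\<close> is minus the symmetric form that \<open>omega\<close> induces on
  bivectors. This is why the symplectic group acts by isometries.\<close>

lemma ip_plucker:
  assumes "omega a b = 0" "omega c d = 0"
  shows "ip (plucker_vec a b) (plucker_vec c d) = - (omega a c * omega b d - omega a d * omega b c)"
  using assms unfolding ip_def plucker_vec_nth omega_def by algebra

lemma span_plucker: "span {plucker_vec a b | a b. omega a b = 0} = UNIV"
proof -
  let ?S = "{plucker_vec a b | a b. omega a b = 0}"
  let ?e = "\<lambda>i. axis i 1 :: real^4"
  have iso: "omega (?e 1) (?e 2) = 0" "omega (?e 3) (?e 2) = 0" "omega (?e 1) (?e 4) = 0" "omega (?e 3) (?e 4) = 0"
    "omega (?e 1 + ?e 4) (?e 2 + ?e 3) = 0"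
    by (simp_all add: omega_def axis_def)
  have "z \<in> span ?S" for z
  proof -
    \<comment> \<open>The last of these vectors is \<open>axis 0 1 + axis 2 1 - axis 4 1\<close>; it
      supplies the middle coordinate, which accounts for the corrections by \<open>z$2\<close> in
      the coefficients of the first and fourth.\<close>
    have "z = (z$0 - z$2) *\<^sub>R plucker_vec (?e 1) (?e 2) + z$1 *\<^sub>R plucker_vec (?e 3) (?e 2) + z$3 *\<^sub>R plucker_vec (?e 1) (?e 4)
        + (z$4 + z$2) *\<^sub>R plucker_vec (?e 3) (?e 4) + z$2 *\<^sub>R plucker_vec (?e 1 + ?e 4) (?e 2 + ?e 3)"
      by (simp add: vec_eq_iff all_5 axis_def)
    also have "\<dots> \<in> span ?S"
      using iso by (intro span_add span_scale span_base) blast+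
    finally show ?thesis .
  qed
  then show ?thesis
    by auto
qed

text \<open>Isotropic decomposable bivectors span, so linear identities need checking only on them,
  where \<open>ext_map\<close> has a meaning in terms of \<open>A\<close>.\<close>

lemma plucker_induct:
  assumes "subspace {z. P z}" "\<And>a b. omega a b = 0 \<Longrightarrow> P (plucker_vec a b)"
  shows "P z"
proof -
  have "z \<in> span {plucker_vec a b | a b. omega a b = 0}"
    by (simp add: span_plucker)
  moreover have "{plucker_vec a b | a b. omega a b = 0} \<subseteq> {z. P z}"
    using assms(2) by blast
  ultimately show ?thesis
    using span_minimal[OF _ assms(1)] by blast
qed

lemma ip_ext_map:
  assumes A: "\<And>a b. omega (A *v a) (A *v b) = c * omega a b"
  shows "ip (ext_map A z) (ext_map A w) = c * c * ip z w"
proof -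
  note l = linear_ext_map[of A]
  have 1: "ip (ext_map A (plucker_vec a b)) (ext_map A w) = c * c * ip (plucker_vec a b) w" if ab: "omega a b = 0" for a b
  proof (rule plucker_induct[where P = "\<lambda>w. ip (ext_map A (plucker_vec a b)) (ext_map A w) = c * c * ip (plucker_vec a b) w"])
    show "subspace {w. ip (ext_map A (plucker_vec a b)) (ext_map A w) = c * c * ip (plucker_vec a b) w}"
      by (auto simp: subspace_def ip_simps linear_add[OF l] linear_scale[OF l] linear_0[OF l] algebra_simps)
    fix p q assume pq: "omega p q = 0"
    have "omega (A *v a) (A *v b) = 0" "omega (A *v p) (A *v q) = 0"
      using ab pq A by simp_all
    then show "ip (ext_map A (plucker_vec a b)) (ext_map A (plucker_vec p q)) = c * c * ip (plucker_vec a b) (plucker_vec p q)"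
      unfolding ext_map_plucker[OF ab, symmetric] ext_map_plucker[OF pq, symmetric]
      by (simp add: ip_plucker ab pq A algebra_simps)
  qed
  show ?thesis
  proof (rule plucker_induct[where P = "\<lambda>z. ip (ext_map A z) (ext_map A w) = c * c * ip z w"])
    show "subspace {z. ip (ext_map A z) (ext_map A w) = c * c * ip z w}"
      by (auto simp: subspace_def ip_simps linear_add[OF l] linear_scale[OF l] linear_0[OF l] algebra_simps)
  qed (rule 1)
qed

definition vec4 :: "real \<Rightarrow> real \<Rightarrow> real \<Rightarrow> real \<Rightarrow> real^4" where
  "vec4 a b c d = (\<chi> i. if i = 1 then a else if i = 2 then b else if i = 3 then c else d)"

lemma vec4_nth [simp]: "vec4 a b c d $ 1 = a" "vec4 a b c d $ 2 = b" "vec4 a b c d $ 3 = c" "vec4 a b c d $ 4 = d"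
  by (simp_all add: vec4_def)

text \<open>Inverse of the Pluecker map in affine charts: if one of \<open>z$0\<close>,
  \<open>z$4\<close>, \<open>z$1\<close> is nonzero, a basis of the plane can be written down;
  otherwise \<open>z\<close> is a multiple of \<open>axis 3 1\<close>.\<close>

lemma plucker_surj:
  assumes z: "ip z z = 0"
  obtains a b where "omega a b = 0" "plucker_vec a b = z"
proof -
  have z': "z$1 * z$3 = z$0 * z$4 + z$2 * z$2"
    using z by (simp add: ip_def)
  consider "z$0 \<noteq> 0" | "z$4 \<noteq> 0" | "z$0 = 0" "z$4 = 0" "z$1 \<noteq> 0" | "z$0 = 0" "z$4 = 0" "z$1 = 0"
    by blast
  then show ?thesis
  proof cases
    case 1
    then show ?thesis
      using z' by (intro that[of "vec4 (z$0) 0 (z$1) (z$2)" "vec4 0 1 (z$2 / z$0) (z$3 / z$0)"])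
        (auto simp: omega_def vec_eq_iff all_5 field_simps)
  next
    case 2
    then show ?thesis
      using z' by (intro that[of "vec4 (z$3) (- z$2) (z$4) 0" "vec4 (- z$2 / z$4) (z$1 / z$4) 0 1"])
        (auto simp: omega_def vec_eq_iff all_5 field_simps)
  next
    case 3
    then show ?thesis
      using z' by (intro that[of "vec4 (z$2) (- z$1) 0 0" "vec4 0 0 1 (z$2 / z$1)"])
        (auto simp: omega_def vec_eq_iff all_5 field_simps)
  next
    case 4
    then show ?thesis
      using z' by (intro that[of "vec4 (z$3) 0 0 0" "vec4 0 0 0 1"])
        (auto simp: omega_def vec_eq_iff all_5 field_simps)
  qed
qed

lemma omega_add: "omega (a + b) c = omega a c + omega b c" "omega c (a + b) = omega c a + omega c b"
  and omega_diff: "omega (a - b) c = omega a c - omega b c" "omega c (a - b) = omega c a - omega c b"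
  and omega_scale: "omega (r *\<^sub>R a) c = r * omega a c" "omega c (r *\<^sub>R a) = r * omega c a"
  and omega_self: "omega a a = 0" and omega_swap: "omega a b = - omega b a"
  by (simp_all add: omega_def algebra_simps)

lemma quadric_plucker:
  assumes "p \<in> quadric"
  obtains L where "L \<in> LG" "plucker L = p"
proof -
  obtain z where z: "z \<noteq> 0" "ip z z = 0" "p = pt z"
    using assms unfolding quadric_def by blast
  obtain a b where ab: "omega a b = 0" "plucker_vec a b = z"
    using plucker_surj[OF z(2)] by blast
  have sp: "x \<in> span {a, b} \<longleftrightarrow> (\<exists>s t. x = s *\<^sub>R a + t *\<^sub>R b)" for x
    unfolding span_breakdown_eq[of x a "{b}"] span_singleton image_iff
    by (simp add: diff_eq_eq add.commute)
  have "a \<notin> span {b}"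
  proof
    assume "a \<in> span {b}"
    then obtain k where "a = k *\<^sub>R b"
      by (auto simp: span_singleton)
    then have "plucker_vec a b = 0"
      by (simp add: vec_eq_iff all_5)
    then show False
      using ab z by simp
  qed
  moreover have "b \<noteq> 0"
  proof
    assume "b = 0"
    then have "plucker_vec a b = 0"
      by (simp add: vec_eq_iff all_5)
    then show False
      using ab z by simp
  qed
  ultimately have "dim (span {a, b}) = 2"
    by (simp add: dim_insert)
  moreover have "omega x y = 0" if "x \<in> span {a, b}" "y \<in> span {a, b}" for x y
    using that ab(1) omega_swap[of b a] unfolding sp by (auto simp: omega_add omega_scale omega_self)
  ultimately have L: "span {a, b} \<in> LG"
    by (simp add: LG_def)
  have pv: "plucker_vec (s *\<^sub>R a + t *\<^sub>R b) (s' *\<^sub>R a + t' *\<^sub>R b) = (s * t' - t * s') *\<^sub>R plucker_vec a b" for s t s' t'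
    by (simp add: vec_eq_iff all_5 algebra_simps)
  have "{plucker_vec x y | x y. x \<in> span {a, b} \<and> y \<in> span {a, b}} \<subseteq> pt z"
    unfolding sp using pv ab(2) by (auto simp: span_singleton)
  moreover have "z \<in> {plucker_vec x y | x y. x \<in> span {a, b} \<and> y \<in> span {a, b}}"
  proof -
    have "a \<in> span {a, b}" "b \<in> span {a, b}"
      by (simp_all add: span_base)
    then show ?thesis
      using ab(2) by blast
  qed
  ultimately have "plucker (span {a, b}) = pt z"
    unfolding plucker_def by (metis (no_types, lifting) empty_subsetI insert_subset span_eq span_mono span_span span_superset subset_antisym)
  then show ?thesis
    using that[OF L] z(3) by simp
qed

lemma plucker_image:
  assumes L: "L \<in> LG"
  shows "plucker ((*v) A ` L) = ext_map A ` plucker L"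
proof -
  have e: "plucker_vec (A *v a) (A *v b) = ext_map A (plucker_vec a b)" if "a \<in> L" "b \<in> L" for a b
    using L that by (intro ext_map_plucker) (simp add: LG_def)
  have "{plucker_vec a b | a b. a \<in> (*v) A ` L \<and> b \<in> (*v) A ` L} = (\<lambda>(a, b). plucker_vec (A *v a) (A *v b)) ` (L \<times> L)"
    by auto
  also have "\<dots> = (\<lambda>(a, b). ext_map A (plucker_vec a b)) ` (L \<times> L)"
    using e by (intro image_cong) auto
  also have "\<dots> = ext_map A ` {plucker_vec a b | a b. a \<in> L \<and> b \<in> L}"
    by auto
  finally show ?thesis
    unfolding plucker_def by (simp add: linear_span_image[OF linear_ext_map])
qed

lemma csp_act_ext_map:
  assumes "M \<subseteq> quadric"
  shows "csp_act A M = (`) (ext_map A) ` M"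
proof (intro equalityI subsetI)
  fix p assume "p \<in> csp_act A M"
  then show "p \<in> (`) (ext_map A) ` M"
    unfolding csp_act_def using plucker_image by auto
next
  fix p assume "p \<in> (`) (ext_map A) ` M"
  then obtain q where q: "q \<in> M" "p = ext_map A ` q"
    by auto
  then obtain L where "L \<in> LG" "plucker L = q"
    using quadric_plucker assms by blast
  then show "p \<in> csp_act A M"
    unfolding csp_act_def using q plucker_image by blast
qed

text \<open>\<open>ext_map A\<close> scales \<open>ip\<close> by the square of the multiplier of
  \<open>A\<close>; division by the multiplier gives an isometry with the same effect on
  points.\<close>

lemma csp_act_isometry:
  assumes "A \<in> CSp"
  obtains L c where "ip_isometry L" "c \<noteq> 0" "\<And>z. ext_map A z = c *\<^sub>R L z" "\<And>M. M \<subseteq> quadric \<Longrightarrow> csp_act A M = proj_image L M"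
proof -
  obtain c where c: "c \<noteq> 0" "\<And>a b. omega (A *v a) (A *v b) = c * omega a b"
    using assms unfolding CSp_def by blast
  define L where "L z = inverse c *\<^sub>R ext_map A z" for z
  note l = linear_ext_map[of A]
  have cc: "inverse c * (inverse c * (c * c)) = 1"
    using c(1) by (simp add: field_simps)
  have L: "ip_isometry L"
    unfolding ip_isometry_def
    using cc by (auto simp: L_def linear_iff linear_add[OF l] linear_scale[OF l] ip_simps ip_ext_map[OF c(2)] scaleR_add_right)
  have e: "ext_map A z = c *\<^sub>R L z" for z
    using c(1) by (simp add: L_def)
  have "csp_act A M = proj_image L M" if M: "M \<subseteq> quadric" for M
    unfolding csp_act_ext_map[OF M]
  proof (rule image_cong[OF refl])
    fix p assume "p \<in> M"
    then obtain z where z: "p = pt z"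
      using M unfolding quadric_def by blast
    have "ext_map A ` p = pt (ext_map A z)"
      unfolding z using linear_span_image[OF l, of "{z}"] by simp
    also have "\<dots> = L ` p"
      unfolding z e ip_isometry_pt[OF L] using c(1) by simp
    finally show "ext_map A ` p = L ` p" .
  qed
  with L c(1) e show ?thesis
    using that by blast
qed

lemma CSp_mult:
  assumes "A \<in> CSp" "B \<in> CSp"
  shows "A ** B \<in> CSp" "ext_map (A ** B) z = ext_map A (ext_map B z)"
proof -
  obtain c d where c: "c \<noteq> 0" "\<And>a b. omega (A *v a) (A *v b) = c * omega a b"
    and d: "d \<noteq> 0" "\<And>a b. omega (B *v a) (B *v b) = d * omega a b"
    using assms unfolding CSp_def by blast
  have cd: "omega ((A ** B) *v a) ((A ** B) *v b) = (c * d) * omega a b" for a b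
    unfolding matrix_vector_mul_assoc[symmetric] c d by simp
  then show "A ** B \<in> CSp"
    unfolding CSp_def using c(1) d(1) by (intro CollectI exI[of _ "c * d"]) simp
  note l = linear_ext_map
  show "ext_map (A ** B) z = ext_map A (ext_map B z)"
  proof (rule plucker_induct[where P = "\<lambda>z. ext_map (A ** B) z = ext_map A (ext_map B z)"])
    show "subspace {z. ext_map (A ** B) z = ext_map A (ext_map B z)}"
      by (auto simp: subspace_def linear_add[OF l] linear_scale[OF l] linear_0[OF l])
    fix a b assume ab: "omega a b = 0"
    then have "omega (B *v a) (B *v b) = 0"
      by (simp add: d)
    then show "ext_map (A ** B) (plucker_vec a b) = ext_map A (ext_map B (plucker_vec a b))"
      using ab by (simp add: ext_map_plucker[symmetric] matrix_vector_mul_assoc)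
  qed
qed

lemma omega_nondegenerate: "(\<And>b. omega a b = 0) \<Longrightarrow> a = 0"
proof -
  assume "\<And>b. omega a b = 0"
  from this[of "axis 1 1"] this[of "axis 2 1"] this[of "axis 3 1"] this[of "axis 4 1"] show "a = 0"
    by (simp add: omega_def vec_eq_iff forall_4 axis_def)
qed

lemma CSp_inverse:
  assumes A: "A \<in> CSp"
  obtains B where "B \<in> CSp" "\<And>z. ext_map B (ext_map A z) = z"
proof -
  obtain c where c: "c \<noteq> 0" "\<And>a b. omega (A *v a) (A *v b) = c * omega a b"
    using A unfolding CSp_def by blast
  have "a = 0" if "A *v a = 0" for a
  proof (rule omega_nondegenerate)
    fix b
    have "omega (A *v a) (A *v b) = 0"
      unfolding that by (simp add: omega_def)
    then show "omega a b = 0"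
      using c by simp
  qed
  then obtain B where B: "B ** A = mat 1"
    using matrix_left_invertible_ker[of A] by blast
  then have AB: "A ** B = mat 1"
    using matrix_left_right_inverse by blast
  have "omega (B *v a) (B *v b) = inverse c * omega a b" for a b
  proof -
    have "omega (A *v (B *v a)) (A *v (B *v b)) = c * omega (B *v a) (B *v b)"
      by (rule c(2))
    then show ?thesis
      using c(1) by (simp add: matrix_vector_mul_assoc AB)
  qed
  then have BC: "B \<in> CSp"
    unfolding CSp_def using c(1) by (intro CollectI exI[of _ "inverse c"]) simp
  have "ext_map (mat 1) z = z" for z
    by (simp add: vec_eq_iff all_5 ext_row_def minor_def mat_def)
  then have "ext_map B (ext_map A z) = z" for z
    using CSp_mult(2)[OF BC A] B by metis
  then show ?thesis
    using that BC by blast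
qed

section \<open>Realization of hyperbolic frames by conformal symplectic matrices\<close>

definition cols4 :: "real^4 \<Rightarrow> real^4 \<Rightarrow> real^4 \<Rightarrow> real^4 \<Rightarrow> real^4^4" where
  "cols4 a b c d = (\<chi> i j. if j = 1 then a$i else if j = 2 then b$i else if j = 3 then c$i else d$i)"

lemma cols4_mult: "cols4 a b c d *v x = x$1 *\<^sub>R a + x$2 *\<^sub>R b + x$3 *\<^sub>R c + x$4 *\<^sub>R d"
  by (simp add: vec_eq_iff mat4_mult cols4_def mult.commute)

lemma cols4_CSp:
  assumes "omega a b = 0" "omega a d = 0" "omega b c = 0" "omega c d = 0" "omega a c = k" "omega b d = k" "k \<noteq> 0"
  shows "cols4 a b c d \<in> CSp"
proof -
  have "omega (cols4 a b c d *v x) (cols4 a b c d *v y) = k * omega x y" for x y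
    unfolding cols4_mult using assms omega_swap[of b a] omega_swap[of d a] omega_swap[of c b] omega_swap[of d c]
      omega_swap[of c a] omega_swap[of d b]
    by (simp add: omega_add omega_scale omega_self) (simp add: omega_def algebra_simps)
  then show ?thesis
    unfolding CSp_def using assms(7) by blast
qed

lemma ext_map_cols4_axis:
  "ext_map (cols4 a b c d) (axis 0 1) = plucker_vec a b"
  "ext_map (cols4 a b c d) (axis 1 1) = plucker_vec c b"
  "ext_map (cols4 a b c d) (axis 3 1) = plucker_vec a d"
  "ext_map (cols4 a b c d) (axis 4 1) = plucker_vec c d"
  "omega a c = omega b d \<Longrightarrow> ext_map (cols4 a b c d) (axis 2 1) = plucker_vec a c - plucker_vec b d"
  by (simp_all add: vec_eq_iff all_5 ext_row_def minor_def cols4_def omega_def algebra_simps)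

text \<open>The product -1 of \<open>f0\<close> and \<open>f4\<close> says that \<open>omega\<close>
  pairs the two Lagrangian planes with determinant 1. The basis of the second plane can thus be made
  dual to that of the first by a substitution of determinant 1, which leaves its Pluecker vector
  unchanged.\<close>

lemma null_pair_realization:
  assumes "ip f0 f0 = 0" "ip f4 f4 = 0" "ip f0 f4 = -1"
  obtains A where "A \<in> CSp" "ip_isometry (ext_map A)" "ext_map A (axis 0 1) = f0" "ext_map A (axis 4 1) = f4"
proof -
  obtain a b where ab: "omega a b = 0" "plucker_vec a b = f0"
    using plucker_surj[OF assms(1)] by blast
  obtain c d where cd: "omega c d = 0" "plucker_vec c d = f4"
    using plucker_surj[OF assms(2)] by blast
  have det: "omega a c * omega b d - omega a d * omega b c = 1"
    using ip_plucker[OF ab(1) cd(1)] assms(3) ab(2) cd(2) by simp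
  define c' d' where "c' = omega b d *\<^sub>R c + (- omega b c) *\<^sub>R d" and "d' = (- omega a d) *\<^sub>R c + omega a c *\<^sub>R d"
  have o: "omega a c' = 1" "omega b c' = 0" "omega a d' = 0" "omega b d' = 1" "omega c' d' = 0"
    using det cd(1) omega_swap[of d c] by (simp_all add: c'_def d'_def omega_add omega_diff omega_scale omega_self algebra_simps)
  have "plucker_vec c' d' = (omega a c * omega b d - omega a d * omega b c) *\<^sub>R plucker_vec c d"
    by (simp add: vec_eq_iff all_5 c'_def d'_def algebra_simps)
  then have p: "plucker_vec c' d' = f4"
    using det cd by simp
  have A: "omega (cols4 a b c' d' *v x) (cols4 a b c' d' *v y) = 1 * omega x y" for x y
    unfolding cols4_mult using o ab(1) omega_swap[of b a] omega_swap[of d' a] omega_swap[of c' b] omega_swap[of d' c']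
      omega_swap[of c' a] omega_swap[of d' b]
    by (simp add: omega_add omega_scale omega_self) (simp add: omega_def algebra_simps)
  show ?thesis
  proof (rule that[of "cols4 a b c' d'"])
    show "cols4 a b c' d' \<in> CSp"
      using o ab(1) by (intro cols4_CSp[of _ _ _ _ 1]) auto
    show "ip_isometry (ext_map (cols4 a b c' d'))"
      unfolding ip_isometry_def using linear_ext_map ip_ext_map[OF A] by simp
  qed (simp_all add: ext_map_cols4_axis ab p)
qed

text \<open>A singular symmetric 2 by 2 matrix is, up to sign, the square of a vector.\<close>

lemma square_form:
  fixes z1 z2 z3 :: real
  assumes "z1 * z3 = z2 * z2"
  obtains e x y where "e = 1 \<or> e = -1" "z1 = e * (x * x)" "z2 = e * (x * y)" "z3 = e * (y * y)"
proof -
  define e :: real where "e = (if z1 > 0 \<or> z3 > 0 then 1 else -1)"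
  have e: "e = 1 \<or> e = -1"
    by (simp add: e_def)
  have nn: "z1 * z3 \<ge> 0"
    using assms by simp
  have "\<not> (z1 > 0 \<and> z3 < 0)" "\<not> (z1 < 0 \<and> z3 > 0)"
    using nn by (auto simp: zero_le_mult_iff)
  then have pos: "e * z1 \<ge> 0" "e * z3 \<ge> 0"
    by (auto simp: e_def)
  define x y where "x = sqrt (e * z1)" and "y = (if e * z2 < 0 then - sqrt (e * z3) else sqrt (e * z3))"
  have ee: "e * e = 1"
    using e by auto
  have xx: "x * x = e * z1" "y * y = e * z3"
    using pos by (auto simp: x_def y_def)
  have "(e * z1) * (e * z3) = (e * z2) * (e * z2)"
    using assms by algebra
  then have s: "sqrt (e * z1) * sqrt (e * z3) = \<bar>e * z2\<bar>"
    by (metis real_sqrt_abs2 real_sqrt_mult)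
  have xy: "x * y = e * z2"
    using s by (auto simp: x_def y_def)
  have "e * (e * r) = r" for r
    using ee by (simp add: mult.assoc[symmetric])
  then show ?thesis
    using that[OF e, of x y] xx xy by simp
qed

text \<open>After the null pair \<open>f 0\<close>, \<open>f 4\<close> has been moved into place,
  the rest happens in coordinates 1, 2, 3, the symmetric 2 by 2 matrices, on which block diagonal
  symplectic matrices act by congruence. There \<open>f 1\<close> and \<open>f 2\<close> are squares
  of vectors, from which the blocks are written down. The sign \<open>k\<close> negates the whole
  frame and is invisible on points; the axes 2 and 3 are interchanged because \<open>ip\<close>
  pairs coordinate 1 with coordinate 3.\<close>

lemma frame_realization:
  assumes f: "hyperbolic_frame f"
  obtains A k where "A \<in> CSp" "k = 1 \<or> k = -1"
    "ext_map A (axis 0 1) = k *\<^sub>R f 0" "ext_map A (axis 1 1) = k *\<^sub>R f 1" "ext_map A (axis 3 1) = k *\<^sub>R f 2"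
    "ext_map A (axis 2 1) = k *\<^sub>R f 3" "ext_map A (axis 4 1) = k *\<^sub>R f 4"
proof -
  note ff = frame_ip[OF f]
  obtain A where A: "A \<in> CSp" "ip_isometry (ext_map A)" "ext_map A (axis 0 1) = f 0" "ext_map A (axis 4 1) = f 4"
    by (rule null_pair_realization[OF ff(1) ff(25) ff(5)])
  note iA = ip_isometry_ip[OF A(2)] and lA = linear_ext_map[of A]
  define z where "z = inv (ext_map A) (f 1)"
  define w where "w = inv (ext_map A) (f 2)"
  have z: "ext_map A z = f 1" and w: "ext_map A w = f 2"
    by (simp_all add: z_def w_def ip_isometry_inverse[OF A(2)])
  have "ip z (axis 0 1) = 0" "ip z (axis 4 1) = 0" "ip w (axis 0 1) = 0" "ip w (axis 4 1) = 0"
    "ip z z = 0" "ip w w = 0" "ip z w = 1"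
    using iA[of z "axis 0 1"] iA[of z "axis 4 1"] iA[of w "axis 0 1"] iA[of w "axis 4 1"] iA[of z z] iA[of w w] iA[of z w]
    by (simp_all add: z w A(3,4) ff)
  then have zw: "z$0 = 0" "z$4 = 0" "w$0 = 0" "w$4 = 0" "z$1 * z$3 = z$2 * z$2" "w$1 * w$3 = w$2 * w$2"
    "z$1 * w$3 + z$3 * w$1 - 2 * (z$2 * w$2) = 1"
    by (simp_all add: ip_def)
  obtain e x y where e: "e = 1 \<or> e = -1" "z$1 = e * (x * x)" "z$2 = e * (x * y)" "z$3 = e * (y * y)"
    by (rule square_form[OF zw(5)])
  obtain e' x' y' where e': "e' = 1 \<or> e' = -1" "w$1 = e' * (x' * x')" "w$2 = e' * (x' * y')" "w$3 = e' * (y' * y')"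
    by (rule square_form[OF zw(6)])
  \<comment> \<open>The determinant of the two vectors whose squares are \<open>z\<close> and
    \<open>w\<close>; the condition \<open>ip z w = 1\<close> becomes
    \<open>e * e' * \<Delta>^2 = 1\<close>, which forces equal signs.\<close>
  define \<Delta> where "\<Delta> = x * y' - x' * y"
  have D: "e * e' * (\<Delta> * \<Delta>) = 1"
    using zw(7) unfolding e e' \<Delta>_def by algebra
  have "e' = e"
  proof (rule ccontr)
    assume "e' \<noteq> e"
    then have "e * e' = -1"
      using e(1) e'(1) by auto
    then show False
      using D zero_le_square[of \<Delta>] by simp
  qed
  have ee: "e * e = 1"
    using e(1) by auto
  have DD: "\<Delta> * \<Delta> = 1"
    using D \<open>e' = e\<close> ee by simp
  \<comment> \<open>The symmetrized product of the vectors \<open>(x, y)\<close> and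
    \<open>(x', y')\<close>, orthogonal to both squares and scaled to norm -2; it is the preimage of
    \<open>f 3\<close> up to the sign \<open>\<epsilon>\<close>.\<close>
  define h :: "real^5" where "h = (\<chi> i. if i = 1 then 2 * (\<Delta> * e) * (x * x') else if i = 2 then \<Delta> * e * (x * y' + x' * y)
      else if i = 3 then 2 * (\<Delta> * e) * (y * y') else 0)"
  have h: "h$0 = 0" "h$1 = 2 * (\<Delta> * e) * (x * x')" "h$2 = \<Delta> * e * (x * y' + x' * y)" "h$3 = 2 * (\<Delta> * e) * (y * y')" "h$4 = 0"
    by (simp_all add: h_def)
  have "ip h (axis 0 1) = 0" "ip h (axis 4 1) = 0"
    by (simp_all add: ip_def h)
  moreover have "ip h z = 0" "ip h w = 0"
    unfolding ip_def h e e' zw \<open>e' = e\<close> by algebra+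
  moreover have "ip h h = - 2 * (e * e) * (\<Delta> * \<Delta>) * (\<Delta> * \<Delta>)"
    unfolding ip_def h \<Delta>_def by algebra
  ultimately have g: "ip (ext_map A h) (f 0) = 0" "ip (ext_map A h) (f 4) = 0" "ip (ext_map A h) (f 1) = 0" "ip (ext_map A h) (f 2) = 0"
    "ip (ext_map A h) (ext_map A h) = -2"
    using iA[of h "axis 0 1"] iA[of h "axis 4 1"] iA[of h z] iA[of h w] iA[of h h] by (simp_all add: z w A(3,4) DD ee)
  define \<epsilon> where "\<epsilon> = - ip (ext_map A h) (f 3) / 2"
  have gf: "ext_map A h = \<epsilon> *\<^sub>R f 3"
    using frame_expand[OF f, of "ext_map A h"] g by (simp add: \<epsilon>_def)
  have \<epsilon>: "\<epsilon> * \<epsilon> = 1"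
    using g(5) unfolding gf by (simp add: ip_simps ff)
  define s where "s = \<epsilon> * \<Delta>"
  have ss: "s * s = 1" and s\<Delta>: "s * \<Delta> = \<epsilon>"
    using \<epsilon> DD by (simp_all add: s_def) algebra+
  \<comment> \<open>Lower block: the vectors \<open>(x, y)\<close> and \<open>(x', y')\<close> with
    signs. Upper block: the basis dual to it up to the factor \<open>e\<close>, which becomes the
    multiplier of the matrix. The signs are arranged so that all five axes acquire the same factor
    \<open>\<epsilon>\<close>.\<close>
  define a b c d :: "real^4" where "a = vec4 y' (- x') 0 0" and "b = vec4 (- (s * y)) (s * x) 0 0"
    and "c = vec4 0 0 (\<Delta> * e * x) (\<Delta> * e * y)" and "d = vec4 0 0 (\<epsilon> * e * x') (\<epsilon> * e * y')"
  have abcd: "a$1 = y'" "a$2 = - x'" "a$3 = 0" "a$4 = 0" "b$1 = - (s * y)" "b$2 = s * x" "b$3 = 0" "b$4 = 0"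
    "c$1 = 0" "c$2 = 0" "c$3 = \<Delta> * e * x" "c$4 = \<Delta> * e * y" "d$1 = 0" "d$2 = 0" "d$3 = \<epsilon> * e * x'" "d$4 = \<epsilon> * e * y'"
    by (simp_all add: a_def b_def c_def d_def)
  have oac: "omega a c = e"
    unfolding omega_def abcd using DD unfolding \<Delta>_def by algebra
  have obd: "omega b d = e"
    unfolding omega_def abcd using \<epsilon> s\<Delta> unfolding \<Delta>_def by algebra
  have e0: "e \<noteq> 0"
    using ee by auto
  have B: "cols4 a b c d \<in> CSp"
    by (rule cols4_CSp[of _ _ _ _ e]) (use oac obd e0 in \<open>simp_all\<close>, simp_all add: omega_def abcd)
  have p0: "plucker_vec a b = \<epsilon> *\<^sub>R axis 0 1"
    by (simp add: vec_eq_iff all_5 abcd) (use s\<Delta> in \<open>simp add: \<Delta>_def algebra_simps\<close>)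
  have p1: "plucker_vec c b = \<epsilon> *\<^sub>R z"
    by (simp add: vec_eq_iff all_5 abcd zw e) (use s\<Delta> in \<open>simp add: algebra_simps flip: s\<Delta>\<close>)
  have p3: "plucker_vec a d = \<epsilon> *\<^sub>R w"
    by (simp add: vec_eq_iff all_5 abcd zw e' \<open>e' = e\<close>)
  have "(\<epsilon> * \<epsilon>) * (e * e) * (\<Delta> * \<Delta>) = 1"
    using \<epsilon> ee DD by simp
  then have "\<Delta> * e * x * (\<epsilon> * e * y') - \<Delta> * e * y * (\<epsilon> * e * x') = \<epsilon>"
    using \<epsilon> ee DD unfolding \<Delta>_def by algebra
  then have p4: "plucker_vec c d = \<epsilon> *\<^sub>R axis 4 1"
    by (simp add: vec_eq_iff all_5 abcd)
  have p2: "plucker_vec a c - plucker_vec b d = h"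
  proof -
    have "\<epsilon> * s = \<Delta>"
      using \<epsilon> by (simp add: s_def flip: mult.assoc)
    then show ?thesis
      by (simp add: vec_eq_iff all_5 abcd h) (simp add: algebra_simps)
  qed
  note m = CSp_mult(2)[OF A(1) B]
  show ?thesis
  proof (rule that[OF CSp_mult(1)[OF A(1) B]])
    show "\<epsilon> = 1 \<or> \<epsilon> = -1"
      using \<epsilon> by (simp add: square_eq_1_iff)
  qed (simp_all add: m ext_map_cols4_axis oac obd p0 p1 p2 p3 p4 linear_scale[OF lA] A(3,4) z w gf)
qed

text \<open>Both frames are realized from the standard one; the product of one matrix with the
  inverse of the other carries \<open>f\<close> to \<open>g\<close> up to the sign
  \<open>k * l\<close>, which is absorbed into \<open>L\<close>.\<close>

lemma csp_frame_transport:
  assumes f: "hyperbolic_frame f" and g: "hyperbolic_frame g"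
  obtains A L where "A \<in> CSp" "ip_isometry L" "\<And>i. i \<le> 4 \<Longrightarrow> L (f i) = g i"
    "\<And>M. M \<subseteq> quadric \<Longrightarrow> csp_act A M = proj_image L M"
proof -
  obtain A k where A: "A \<in> CSp" "k = 1 \<or> k = -1"
    "ext_map A (axis 0 1) = k *\<^sub>R f 0" "ext_map A (axis 1 1) = k *\<^sub>R f 1" "ext_map A (axis 3 1) = k *\<^sub>R f 2"
    "ext_map A (axis 2 1) = k *\<^sub>R f 3" "ext_map A (axis 4 1) = k *\<^sub>R f 4"
    by (rule frame_realization[OF f])
  obtain B l where B: "B \<in> CSp" "l = 1 \<or> l = -1"
    "ext_map B (axis 0 1) = l *\<^sub>R g 0" "ext_map B (axis 1 1) = l *\<^sub>R g 1" "ext_map B (axis 3 1) = l *\<^sub>R g 2"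
    "ext_map B (axis 2 1) = l *\<^sub>R g 3" "ext_map B (axis 4 1) = l *\<^sub>R g 4"
    by (rule frame_realization[OF g])
  obtain C where C: "C \<in> CSp" "\<And>z. ext_map C (ext_map A z) = z"
    by (rule CSp_inverse[OF A(1)]) blast
  note lC = linear_ext_map[of C] and lB = linear_ext_map[of B]
  have kk: "k * k = 1" "l * l = 1"
    using A(2) B(2) by auto
  have Cf: "ext_map C (f i) = k *\<^sub>R z" if "ext_map A z = k *\<^sub>R f i" for i z
  proof -
    have "z = k *\<^sub>R ext_map C (f i)"
      using C(2)[of z] unfolding that linear_scale[OF lC] by simp
    then have "k *\<^sub>R z = (k * k) *\<^sub>R ext_map C (f i)"
      by simp
    then show ?thesis
      using kk by simp
  qed
  have BC: "B ** C \<in> CSp" and m: "ext_map (B ** C) z = ext_map B (ext_map C z)" for z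
    using CSp_mult[OF B(1) C(1)] by auto
  have BCf: "ext_map (B ** C) (f 0) = (k * l) *\<^sub>R g 0" "ext_map (B ** C) (f 1) = (k * l) *\<^sub>R g 1"
    "ext_map (B ** C) (f 2) = (k * l) *\<^sub>R g 2" "ext_map (B ** C) (f 3) = (k * l) *\<^sub>R g 3" "ext_map (B ** C) (f 4) = (k * l) *\<^sub>R g 4"
    unfolding m Cf[OF A(3)] Cf[OF A(4)] Cf[OF A(5)] Cf[OF A(6)] Cf[OF A(7)] linear_scale[OF lB] B by simp_all
  have kl: "(k * l) * (k * l) = 1"
    using A(2) B(2) by auto
  define L where "L z = (k * l) *\<^sub>R ext_map (B ** C) z" for z
  note lBC = linear_ext_map[of "B ** C"]
  have linL: "linear L"
    by (auto simp: L_def linear_iff linear_add[OF lBC] linear_scale[OF lBC] scaleR_add_right)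
  have Lf: "\<forall>i\<le>4. L (f i) = g i"
    unfolding all_le_4 L_def BCf using kl by simp
  obtain c where c: "c \<noteq> 0" "\<And>a b. omega ((B ** C) *v a) ((B ** C) *v b) = c * omega a b"
    using BC unfolding CSp_def by blast
  have ipL: "ip (L z) (L w) = c * c * ip z w" for z w
    using kl by (simp add: L_def ip_simps ip_ext_map[OF c(2)] mult.assoc[symmetric])
  \<comment> \<open>\<open>L\<close> scales \<open>ip\<close> by \<open>c * c\<close>; one nonzero
    product of frame vectors shows that this factor is 1.\<close>
  have "ip (L (f 0)) (L (f 4)) = -1" "ip (f 0) (f 4) = -1"
    using Lf frame_ip(5)[OF g] frame_ip(5)[OF f] by simp_all
  then have "c * c = 1"
    using ipL[of "f 0" "f 4"] by simp
  then have L: "ip_isometry L"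
    unfolding ip_isometry_def using linL ipL by simp
  have "csp_act (B ** C) M = proj_image L M" if M: "M \<subseteq> quadric" for M
    unfolding csp_act_ext_map[OF M]
  proof (rule image_cong[OF refl])
    fix p assume "p \<in> M"
    then obtain z where z: "p = pt z"
      using M unfolding quadric_def by blast
    have e: "ext_map (B ** C) z = (k * l) *\<^sub>R L z"
      using kl by (simp add: L_def)
    have "k * l \<noteq> 0"
      using kl by auto
    have "ext_map (B ** C) ` p = pt (ext_map (B ** C) z)"
      unfolding z using linear_span_image[OF lBC, of "{z}"] by simp
    also have "\<dots> = L ` p"
      unfolding z e ip_isometry_pt[OF L] using \<open>k * l \<noteq> 0\<close> by simp
    finally show "ext_map (B ** C) ` p = L ` p" .
  qed
  then show ?thesis
    using that[OF BC L] Lf by blast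
qed

section \<open>The homogeneous models\<close>

text \<open>For \<open>K = 4\<close> the points \<open>(B, A / 2)\<close> of an arc form the orbit \<open>(s, v)\<close>, \<open>s\<^sup>2 = 2 v + m v\<^sup>2\<close>, of the
  one-parameter group with \<open>s' = 1 + m v\<close>, \<open>v' = s\<close>: an ellipse, a parabola or one branch of a hyperbola.\<close>

definition orbit_arc :: "real \<Rightarrow> real \<Rightarrow> real \<Rightarrow> real \<Rightarrow> bool" where
  "orbit_arc m K A B \<longleftrightarrow> 4 * (B * B) = K * A + m * (A * A) \<and> (m > 0 \<longrightarrow> K * (K + 2 * m * A) > 0)"

text \<open>The vector \<open>4 v4 + 2 t v3 - 4 v0\<close> has zero derivative along a cyclide frame
  with \<tau> = t. The sign makes the coordinate of \<open>f 0\<close> equal to 4.\<close>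

definition coordK :: "(nat \<Rightarrow> real^5) \<Rightarrow> real \<Rightarrow> real^5 \<Rightarrow> real" where
  "coordK f t z = - ip z (4 *\<^sub>R f 4 + (2 * t) *\<^sub>R f 3 - 4 *\<^sub>R f 0)"

text \<open>Besides the fixed coordinate there are two pairs, each moved by one of the two families
  only; the parameters of the orbits are \<open>t + 2\<close> and \<open>t - 2\<close>. The
  conditions are homogeneous, so they define a cone over a product of two arcs.\<close>

definition cone :: "(nat \<Rightarrow> real^5) \<Rightarrow> real \<Rightarrow> real^5 \<Rightarrow> bool" where
  "cone f t z \<longleftrightarrow> coordK f t z \<noteq> 0 \<and>
     orbit_arc (t + 2) (coordK f t z) (ip z (f 3 - 2 *\<^sub>R f 0)) (ip z (f 1 + f 2)) \<and>
     orbit_arc (t - 2) (coordK f t z) (ip z (f 3 + 2 *\<^sub>R f 0)) (ip z (f 1 - f 2))"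

definition model :: "(nat \<Rightarrow> real^5) \<Rightarrow> real \<Rightarrow> (real^5) set set" where
  "model f t = {pt z | z. cone f t z}"

lemma orbit_arc_scale: "c \<noteq> 0 \<Longrightarrow> orbit_arc m (c * K) (c * A) (c * B) \<longleftrightarrow> orbit_arc m K A B"
proof -
  assume c: "c \<noteq> 0"
  then have cc: "c * c > 0"
    by (simp add: zero_less_mult_iff linorder_neq_iff) auto
  have "4 * ((c * B) * (c * B)) = (c * c) * (4 * (B * B))"
    "(c * K) * (c * A) + m * ((c * A) * (c * A)) = (c * c) * (K * A + m * (A * A))"
    "(c * K) * (c * K + 2 * m * (c * A)) = (c * c) * (K * (K + 2 * m * A))"
    by algebra+
  moreover have "(c * c) * (K * (K + 2 * m * A)) > 0 \<longleftrightarrow> K * (K + 2 * m * A) > 0"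
    using cc by (simp add: zero_less_mult_iff)
  ultimately show ?thesis
    unfolding orbit_arc_def using c by (simp only: mult_cancel_left) simp
qed

lemma cone_scale:
  assumes "c \<noteq> 0"
  shows "cone f t (c *\<^sub>R z) \<longleftrightarrow> cone f t z"
proof -
  have "coordK f t (c *\<^sub>R z) = c * coordK f t z"
    by (simp add: coordK_def ip_simps algebra_simps)
  then show ?thesis
    using assms unfolding cone_def bounded_bilinear.scaleR_left[OF bounded_bilinear_ip] real_scaleR_def
    by (simp add: orbit_arc_scale[OF assms])
qed

lemma cone_nonzero: "cone f t z \<Longrightarrow> z \<noteq> 0"
  by (auto simp: cone_def coordK_def ip_simps)

lemma pt_in_model: "z \<noteq> 0 \<Longrightarrow> pt z \<in> model f t \<longleftrightarrow> cone f t z"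
proof
  assume z: "z \<noteq> 0" "pt z \<in> model f t"
  then obtain y where y: "pt z = pt y" "cone f t y"
    unfolding model_def by blast
  obtain c where "c \<noteq> 0" "y = c *\<^sub>R z"
    by (rule pt_eqD[OF y(1) z(1)])
  then show "cone f t z"
    using y(2) cone_scale by simp
qed (auto simp: model_def)

lemma orbit_arc_minus_B: "orbit_arc m K A (- B) \<longleftrightarrow> orbit_arc m K A B"
  by (simp add: orbit_arc_def)

text \<open>Arcs are symmetric under \<open>B \<mapsto> - B\<close> and under negating all
  coordinates, so they cannot see the signs in which two cyclide frames over one point may
  differ.\<close>

lemma cone_sign_change:
  assumes k: "k = 1 \<or> k = -1" and f: "g 0 = k *\<^sub>R f 0" "g 3 = k *\<^sub>R f 3" "g 4 = k *\<^sub>R f 4"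
    and a: "a = 1 \<or> a = -1" "g 1 + g 2 = a *\<^sub>R (f 1 + f 2)" and b: "b = 1 \<or> b = -1" "g 1 - g 2 = b *\<^sub>R (f 1 - f 2)"
  shows "cone g t z \<longleftrightarrow> cone f t z"
proof -
  have K: "coordK g t z = k * coordK f t z"
    by (simp add: coordK_def f ip_simps algebra_simps)
  have "g 3 - 2 *\<^sub>R g 0 = k *\<^sub>R (f 3 - 2 *\<^sub>R f 0)" "g 3 + 2 *\<^sub>R g 0 = k *\<^sub>R (f 3 + 2 *\<^sub>R f 0)"
    by (simp_all add: f algebra_simps)
  then have A: "ip z (g 3 - 2 *\<^sub>R g 0) = k * ip z (f 3 - 2 *\<^sub>R f 0)" "ip z (g 3 + 2 *\<^sub>R g 0) = k * ip z (f 3 + 2 *\<^sub>R f 0)"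
    by (simp_all only: ip_simps real_scaleR_def)
  have B: "ip z (g 1 + g 2) = a * ip z (f 1 + f 2)" "ip z (g 1 - g 2) = b * ip z (f 1 - f 2)"
    by (simp_all only: a(2) b(2) bounded_bilinear.scaleR_right[OF bounded_bilinear_ip] real_scaleR_def)
  have "orbit_arc m (k * K) (k * A) (c * B) \<longleftrightarrow> orbit_arc m K A B" if "c = 1 \<or> c = -1" for m K A B c
    using k that orbit_arc_scale[of "-1" m K A B] orbit_arc_minus_B by auto
  then show ?thesis
    unfolding cone_def K A B using k a(1) b(1) by auto
qed

lemma model_isometry:
  assumes L: "ip_isometry L"
  shows "model (\<lambda>i. L (f i)) t = proj_image L (model f t)"
proof -
  note l = ip_isometry_linear[OF L]
  have "cone (\<lambda>i. L (f i)) t (L z) \<longleftrightarrow> cone f t z" for z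
    unfolding cone_def coordK_def
    by (simp add: ip_isometry_ip[OF L] flip: linear_add[OF l] linear_diff[OF l] linear_scale[OF l])
  then have c: "cone (\<lambda>i. L (f i)) t z \<longleftrightarrow> cone f t (inv L z)" for z
    by (metis ip_isometry_inverse(1)[OF L])
  show ?thesis
  proof (intro equalityI subsetI)
    fix p assume "p \<in> model (\<lambda>i. L (f i)) t"
    then obtain z where z: "p = pt z" "cone f t (inv L z)"
      unfolding model_def c by blast
    have "p = L ` pt (inv L z)"
      using z(1) ip_isometry_pt[OF L, of "inv L z"] by (simp add: ip_isometry_inverse[OF L])
    then show "p \<in> proj_image L (model f t)"
      unfolding model_def using z(2) by blast
  next
    fix p assume "p \<in> proj_image L (model f t)"
    then obtain z where z: "p = L ` pt z" "cone f t z"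
      unfolding model_def by blast
    then have "cone (\<lambda>i. L (f i)) t (L z)"
      unfolding c by (simp add: ip_isometry_inverse[OF L])
    then show "p \<in> model (\<lambda>i. L (f i)) t"
      unfolding model_def z(1) ip_isometry_pt[OF L] by blast
  qed
qed

text \<open>In these coordinates \<open>ip z z\<close> is the difference of the two arc equations
  divided by 8, which places the cone in the quadric.\<close>

lemma coords_expand:
  assumes f: "hyperbolic_frame f"
  shows "ip z z = ((ip z (f 1 + f 2))^2 - (ip z (f 1 - f 2))^2) / 2
    + (coordK f t z * (ip z (f 3 + 2 *\<^sub>R f 0) - ip z (f 3 - 2 *\<^sub>R f 0))
    + (t - 2) * (ip z (f 3 + 2 *\<^sub>R f 0))^2 - (t + 2) * (ip z (f 3 - 2 *\<^sub>R f 0))^2) / 8"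
proof -
  note ff = frame_ip[OF f]
  define a b c d e where "a = ip z (f 0)" and "b = ip z (f 1)" and "c = ip z (f 2)" and "d = ip z (f 3)" and "e = ip z (f 4)"
  have "ip z z = ip z (- e *\<^sub>R f 0 + c *\<^sub>R f 1 + b *\<^sub>R f 2 - (d / 2) *\<^sub>R f 3 - a *\<^sub>R f 4)"
    unfolding a_def b_def c_def d_def e_def using frame_expand[OF f, of z] by simp
  also have "\<dots> = 2 * b * c - 2 * a * e - d^2 / 2"
    by (simp add: ip_simps a_def[symmetric] b_def[symmetric] c_def[symmetric] d_def[symmetric] e_def[symmetric] power2_eq_square)
  finally show ?thesis
    unfolding coordK_def ip_simps real_scaleR_def a_def[symmetric] b_def[symmetric] c_def[symmetric] d_def[symmetric] e_def[symmetric]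
    by (simp add: power2_eq_square field_simps)
qed

lemma model_quadric:
  assumes f: "hyperbolic_frame f"
  shows "model f t \<subseteq> quadric"
proof
  fix p assume "p \<in> model f t"
  then obtain z where z: "p = pt z" "cone f t z"
    unfolding model_def by blast
  have "ip z z = 0"
    using z(2) unfolding coords_expand[OF f, of z t] cone_def orbit_arc_def by (simp add: power2_eq_square field_simps)
  then show "p \<in> quadric"
    unfolding quadric_def using z cone_nonzero by blast
qed

lemma model_base:
  assumes f: "hyperbolic_frame f"
  shows "cone f t (f 0)" "pt (f 0) \<in> model f t"
proof -
  note ff = frame_ip[OF f]
  show "cone f t (f 0)"
    by (simp add: cone_def coordK_def orbit_arc_def ip_simps ff)
  then show "pt (f 0) \<in> model f t"
    unfolding model_def by blast
qed

lemma nonzero_constant_sign: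
  fixes E :: "real^2 \<Rightarrow> real"
  assumes "connected U" "continuous_on U E" "\<And>y. y \<in> U \<Longrightarrow> E y \<noteq> 0" "u \<in> U" "u' \<in> U" "E u > 0"
  shows "E u' > 0"
proof (rule ccontr)
  assume "\<not> E u' > 0"
  then have "E u' \<le> 0"
    by simp
  have "connected (E ` U)"
    by (rule connected_continuous_image[OF assms(2,1)])
  then have "{E u'..E u} \<subseteq> E ` U"
    using assms(4,5) by (intro connected_contains_Icc) auto
  then have "0 \<in> E ` U"
    using \<open>E u' \<le> 0\<close> assms(6) by (auto simp: subset_iff)
  then show False
    using assms(3) by auto
qed

text \<open>\<open>4 B^2 - K A - m A^2\<close> is a first integral of the flow. On the conic, for
  \<open>m > 0\<close>, the square of \<open>K + 2 m A\<close> is \<open>K^2 + 16 m B^2\<close>, so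
  it cannot vanish and the branch does not change.\<close>

lemma orbit_arc_constant:
  fixes A B :: "real^2 \<Rightarrow> real"
  assumes U: "convex U" and A: "\<And>y. y \<in> U \<Longrightarrow> (A has_derivative (\<lambda>w. P y w * B y)) (at y)"
    and B: "\<And>y. y \<in> U \<Longrightarrow> (B has_derivative (\<lambda>w. P y w * (K + 2 * m * A y) / 8)) (at y)"
    and K: "K \<noteq> 0" and u: "u \<in> U" "u' \<in> U" and orbit_arc: "orbit_arc m K (A u) (B u)"
  shows "orbit_arc m K (A u') (B u')"
proof -
  define Q where "Q y = 4 * (B y * B y) - (K * A y + m * (A y * A y))" for y
  have Qd: "(Q has_derivative (\<lambda>w. 0)) (at y)" if y: "y \<in> U" for y
    unfolding Q_def[abs_def]
    by (rule derivative_eq_intros A[OF y] B[OF y] refl)+ (simp add: fun_eq_iff field_simps)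
  have "\<exists>c. \<forall>y\<in>U. Q y = c"
    by (rule has_derivative_zero_constant[OF U]) (rule has_derivative_at_withinI[OF Qd])
  then have "Q y = 0" if "y \<in> U" for y
    using orbit_arc u(1) that unfolding orbit_arc_def by (metis Q_def diff_self)
  then have Q: "4 * (B y * B y) = K * A y + m * (A y * A y)" if "y \<in> U" for y
    using that by (simp add: Q_def)
  have "K * (K + 2 * m * A u') > 0" if m: "m > 0"
  proof (rule nonzero_constant_sign[of U "\<lambda>y. K * (K + 2 * m * A y)" u])
    show "connected U"
      using U by (rule convex_connected)
    have "continuous_on U A"
      using A by (meson continuous_at_imp_continuous_on has_derivative_continuous)
    then show "continuous_on U (\<lambda>y. K * (K + 2 * m * A y))"
      by (intro continuous_intros)
    fix y assume "y \<in> U"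
    then have "(K + 2 * m * A y) * (K + 2 * m * A y) = K * K + 16 * m * (B y * B y)"
      using Q[of y] by algebra
    moreover have "K * K > 0" "16 * m * (B y * B y) \<ge> 0"
      using K m by (auto simp: zero_less_mult_iff linorder_neq_iff)
    ultimately have "(K + 2 * m * A y) * (K + 2 * m * A y) > 0"
      by linarith
    then have "K + 2 * m * A y \<noteq> 0"
      by auto
    then show "K * (K + 2 * m * A y) \<noteq> 0"
      using K by simp
  qed (use u orbit_arc m in \<open>auto simp: orbit_arc_def\<close>)
  with Q[OF u(2)] show ?thesis
    by (simp add: orbit_arc_def)
qed

text \<open>Along a cyclide frame the coordinates of a fixed vector move on an arc.\<close>

lemma cone_constant:
  assumes c: "cyclide_frame U v" and U: "convex U" and t: "\<And>y. y \<in> U \<Longrightarrow> cyclide_tau v y = t" and u: "u \<in> U" "u' \<in> U"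
    and cone: "cone (\<lambda>i. v i u) t z"
  shows "cone (\<lambda>i. v i u') t z"
proof -
  note s = cyclide_frame_smooth[OF c] and sw = cyclide_frame_smooth_w[OF c] and zz = zplus_zminus[OF c]
  have d: "v 0 differentiable (at y)" "v 3 differentiable (at y)" "v 4 differentiable (at y)" if "y \<in> U" for y
    using smooth_on_differentiable[OF s that] by simp_all
  have bl: "bounded_linear (ip z)"
    by (rule bounded_bilinear.bounded_linear_right[OF bounded_bilinear_ip])
  have ipd: "((\<lambda>y. ip z (g y)) has_derivative (\<lambda>w. ip z (D g y w))) (at y)" if "g differentiable (at y)" for g :: "real^2 \<Rightarrow> real^5" and y
    by (rule bounded_linear.has_derivative[OF bl has_D[OF that]])
  let ?K = "\<lambda>y. coordK (\<lambda>i. v i y) t z"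
  have Kd: "(?K has_derivative (\<lambda>w. 0)) (at y)" if y: "y \<in> U" for y
  proof -
    have "((\<lambda>y. - (4 * ip z (v 4 y) + 2 * t * ip z (v 3 y) - 4 * ip z (v 0 y))) has_derivative
      (\<lambda>w. - (4 * ip z (D (v 4) y w) + 2 * t * ip z (D (v 3) y w) - 4 * ip z (D (v 0) y w)))) (at y)"
      by (auto intro!: derivative_eq_intros ipd d[OF y])
    moreover have "4 * ip z (D (v 4) y w) + 2 * t * ip z (D (v 3) y w) - 4 * ip z (D (v 0) y w) = 0" for w
      unfolding cyclide_frame_structure(1)[OF c y] cyclide_frame_D[OF c y] t[OF y] by (simp add: ip_simps algebra_simps)
    ultimately show ?thesis
      by (simp add: coordK_def ip_simps)
  qed
  have "\<exists>k. \<forall>y\<in>U. ?K y = k"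
    by (rule has_derivative_zero_constant[OF U]) (rule has_derivative_at_withinI[OF Kd])
  then obtain k where k: "\<And>y. y \<in> U \<Longrightarrow> ?K y = k"
    by blast
  have cone_iff: "cone (\<lambda>i. v i y) t z \<longleftrightarrow> k \<noteq> 0 \<and> orbit_arc (t + 2) k (ip z (zminus v y)) (ip z (wplus v y)) \<and>
      orbit_arc (t - 2) k (ip z (zplus v y)) (ip z (wminus v y))" if "y \<in> U" for y
    using k[OF that] by (simp add: cone_def zminus_def zplus_def wplus_def wminus_def)
  \<comment> \<open>The constant coordinate eliminates \<open>v 4\<close>, so that each pair
    satisfies a closed linear system.\<close>
  have kz: "ip z (v 4 y) = (- k - 2 * t * ip z (v 3 y) + 4 * ip z (v 0 y)) / 4" if "y \<in> U" for y
    using k[OF that] by (simp add: coordK_def ip_simps)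
  have k0: "k \<noteq> 0" and a1: "orbit_arc (t + 2) k (ip z (zminus v u)) (ip z (wplus v u))" and a2: "orbit_arc (t - 2) k (ip z (zplus v u)) (ip z (wminus v u))"
    using cone unfolding cone_iff[OF u(1)] by auto
  have "orbit_arc (t + 2) k (ip z (zminus v u')) (ip z (wplus v u'))"
  proof (rule orbit_arc_constant[where P = "\<lambda>y w. - 4 * formP v y w" and A = "\<lambda>y. ip z (zminus v y)" and B = "\<lambda>y. ip z (wplus v y)", OF U _ _ k0 u a1])
    fix y assume y: "y \<in> U"
    have "((\<lambda>y. ip z (zminus v y)) has_derivative (\<lambda>w. ip z (D (zminus v) y w))) (at y)"
      by (rule ipd[OF smooth_on_differentiable[OF zz(2) y]])
    then show "((\<lambda>y. ip z (zminus v y)) has_derivative (\<lambda>w. - 4 * formP v y w * ip z (wplus v y))) (at y)"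
      by (rule has_derivative_eq_rhs) (simp add: zz(4)[OF y] ip_simps fun_eq_iff)
    have "((\<lambda>y. ip z (wplus v y)) has_derivative (\<lambda>w. ip z (D (wplus v) y w))) (at y)"
      by (rule ipd[OF smooth_on_differentiable[OF sw(1) y]])
    then show "((\<lambda>y. ip z (wplus v y)) has_derivative (\<lambda>w. - 4 * formP v y w * (k + 2 * (t + 2) * ip z (zminus v y)) / 8)) (at y)"
      by (rule has_derivative_eq_rhs)
        (simp add: cyclide_frame_structure(2)[OF c y] t[OF y] zminus_def ip_simps kz[OF y] fun_eq_iff field_simps)
  qed
  moreover have "orbit_arc (t - 2) k (ip z (zplus v u')) (ip z (wminus v u'))"
  proof (rule orbit_arc_constant[where P = "\<lambda>y w. 4 * formQ v y w" and A = "\<lambda>y. ip z (zplus v y)" and B = "\<lambda>y. ip z (wminus v y)", OF U _ _ k0 u a2])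
    fix y assume y: "y \<in> U"
    have "((\<lambda>y. ip z (zplus v y)) has_derivative (\<lambda>w. ip z (D (zplus v) y w))) (at y)"
      by (rule ipd[OF smooth_on_differentiable[OF zz(1) y]])
    then show "((\<lambda>y. ip z (zplus v y)) has_derivative (\<lambda>w. 4 * formQ v y w * ip z (wminus v y))) (at y)"
      by (rule has_derivative_eq_rhs) (simp add: zz(3)[OF y] ip_simps fun_eq_iff)
    have "((\<lambda>y. ip z (wminus v y)) has_derivative (\<lambda>w. ip z (D (wminus v) y w))) (at y)"
      by (rule ipd[OF smooth_on_differentiable[OF sw(2) y]])
    then show "((\<lambda>y. ip z (wminus v y)) has_derivative (\<lambda>w. 4 * formQ v y w * (k + 2 * (t - 2) * ip z (zplus v y)) / 8)) (at y)"
      by (rule has_derivative_eq_rhs)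
        (simp add: cyclide_frame_structure(3)[OF c y] t[OF y] zplus_def ip_simps kz[OF y] fun_eq_iff field_simps)
  qed
  ultimately show ?thesis
    using k0 cone_iff[OF u(2)] by blast
qed

lemma model_constant:
  assumes "cyclide_frame U v" "convex U" "\<And>y. y \<in> U \<Longrightarrow> cyclide_tau v y = t" "u \<in> U" "u' \<in> U"
  shows "model (\<lambda>i. v i u) t = model (\<lambda>i. v i u') t"
  unfolding model_def using cone_constant[OF assms] cone_constant[OF assms(1-3) assms(5,4)] by metis

section \<open>Invariance of the arcs under the flows\<close>

lemma branch_shift:
  fixes K E B C s m :: real
  assumes m: "m > 0" "C > 0" "C * C = 1 + m * (s * s)" and E: "E * E = K * K + 16 * m * (B * B)" and K: "K \<noteq> 0" "K * E > 0"
  shows "K * (C * E - 4 * m * s * B) > 0"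
proof -
  \<comment> \<open>A hyperbolic rotation preserves the branch: \<open>E^2 - 16 m B^2 = K^2\<close>
    and \<open>C^2 - m s^2 = 1\<close>, and comparison of \<open>x^2\<close> with \<open>y^2\<close>
    replaces hyperbolic functions.\<close>
  define x y where "x = C * (K * E)" and "y = K * (4 * m * s * B)"
  have x: "x > 0"
    using m(2) K(2) by (simp add: x_def)
  have KK: "K * K > 0"
    using K(1) by (auto simp: zero_less_mult_iff linorder_neq_iff)
  have "x * x - y * y = (K * K) * ((C * C) * (E * E) - 16 * m * m * (s * s) * (B * B))"
    unfolding x_def y_def by algebra
  also have "\<dots> = (K * K) * (K * K + m * (s * s) * (K * K) + 16 * m * (B * B))"
    unfolding m(3) E by algebra
  also have "\<dots> > 0"
  proof (rule mult_pos_pos[OF KK])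
    have "m * (s * s) * (K * K) \<ge> 0" "16 * m * (B * B) \<ge> 0"
      using m(1) by simp_all
    then show "K * K + m * (s * s) * (K * K) + 16 * m * (B * B) > 0"
      using KK by linarith
  qed
  finally have "y * y < x * x"
    by simp
  then have "y < x"
    using x mult_mono[of x y x y] by (cases "x \<le> y") auto
  then show ?thesis
    by (simp add: x_def y_def algebra_simps)
qed

text \<open>The new pair is the image of \<open>(A, B)\<close> under the group element with
  parameters \<open>(s, v)\<close>; the conic equation is invariant. The element with parameters
  \<open>(- s, v)\<close> is the inverse, so the branch argument applies in both directions.\<close>

lemma orbit_arc_shift:
  fixes K A B s v m :: real
  assumes s: "s * s = 2 * v + m * (v * v)" "m > 0 \<longrightarrow> 1 + m * v > 0" and K: "K \<noteq> 0"
  shows "orbit_arc m K (A - 2 * s * B + v * (K + 2 * m * A) / 2) ((1 + m * v) * B - s * (K + 2 * m * A) / 4) \<longleftrightarrow> orbit_arc m K A B"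
proof -
  define A' B' where "A' = A - 2 * s * B + v * (K + 2 * m * A) / 2" and "B' = (1 + m * v) * B - s * (K + 2 * m * A) / 4"
  have AB: "2 * A' = 2 * A - 4 * s * B + v * (K + 2 * m * A)" "4 * B' = 4 * (1 + m * v) * B - s * (K + 2 * m * A)"
    by (simp_all add: A'_def B'_def)
  have "4 * (4 * (B' * B') - (K * A' + m * (A' * A'))) = 4 * (4 * (B * B) - (K * A + m * (A * A)))"
    using AB s(1) by algebra
  then have q: "4 * (B' * B') = K * A' + m * (A' * A') \<longleftrightarrow> 4 * (B * B) = K * A + m * (A * A)"
    by (metis (no_types) mult_cancel_left right_minus_eq zero_neq_numeral)
  have E': "K + 2 * m * A' = (1 + m * v) * (K + 2 * m * A) - 4 * m * s * B"
    using AB(1) by algebra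
  have E: "K + 2 * m * A = (1 + m * v) * (K + 2 * m * A') - 4 * m * (- s) * B'"
    unfolding E' using AB(2) s(1) by algebra
  have C: "(1 + m * v) * (1 + m * v) = 1 + m * (s * s)"
    unfolding s(1) by algebra
  have EE: "(K + 2 * m * A) * (K + 2 * m * A) = K * K + 16 * m * (B * B)" if "4 * (B * B) = K * A + m * (A * A)" for A B
    using that by algebra
  have br: "K * (K + 2 * m * A') > 0 \<longleftrightarrow> K * (K + 2 * m * A) > 0" if m: "m > 0" and e: "4 * (B * B) = K * A + m * (A * A)"
  proof
    have Cp: "1 + m * v > 0"
      using s(2) m by simp
    show "K * (K + 2 * m * A') > 0" if "K * (K + 2 * m * A) > 0"
      unfolding E' by (rule branch_shift[OF m Cp C EE[OF e] K that])
    have C': "(1 + m * v) * (1 + m * v) = 1 + m * ((- s) * (- s))"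
      using C by simp
    show "K * (K + 2 * m * A) > 0" if "K * (K + 2 * m * A') > 0"
      using branch_shift[OF m Cp C' EE[OF iffD2[OF q e]] K that] unfolding E[symmetric] .
  qed
  show ?thesis
    unfolding orbit_arc_def A'_def[symmetric] B'_def[symmetric] using q br by blast
qed

section \<open>Frames moved along the two families\<close>

locale model_frame =
  fixes f :: "nat \<Rightarrow> real^5" and t :: real
  assumes f: "hyperbolic_frame f"
begin

definition "Wp = f 1 + f 2"
definition "Wm = f 1 - f 2"
text \<open>By the structure equations \<open>D wplus\<close> is \<open>2 P\<close> times the vector
  \<open>Yp\<close>, and \<open>D wminus\<close> is \<open>2 Q\<close> times
  \<open>Ym\<close>.\<close>

definition "Yp = (t + 1) *\<^sub>R f 0 - f 3 + f 4"
definition "Ym = (t - 1) *\<^sub>R f 0 - f 3 - f 4"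
definition "Zp = f 3 + 2 *\<^sub>R f 0"
definition "Zm = f 3 - 2 *\<^sub>R f 0"
definition "kv = 4 *\<^sub>R f 4 + (2 * t) *\<^sub>R f 3 - 4 *\<^sub>R f 0"

text \<open>Solution of the flow W' = Y, Y' = (t + 2) W, Z' = - 2 W, where
  \<open>s' = 1 + (t + 2) v\<close> and \<open>v' = s\<close>; for the other family
  \<open>t + 2\<close> becomes \<open>t - 2\<close> and the sign in Z' changes.\<close>

definition "mWp s v = (1 + (t + 2) * v) *\<^sub>R Wp + s *\<^sub>R Yp"
definition "mWm s v = (1 + (t - 2) * v) *\<^sub>R Wm + s *\<^sub>R Ym"
definition "mZm s v = Zm - 2 *\<^sub>R (s *\<^sub>R Wp + v *\<^sub>R Yp)"
definition "mZp s v = Zp + 2 *\<^sub>R (s *\<^sub>R Wm + v *\<^sub>R Ym)"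

text \<open>The frame obtained from \<open>f\<close> by the flows along the two families, for the parameters \<open>(s, v)\<close> and
  \<open>(s', v')\<close> of the orbits; no exponentials are needed since \<open>(s, v)\<close> depends linearly on the flow.\<close>

definition moved :: "real \<Rightarrow> real \<Rightarrow> real \<Rightarrow> real \<Rightarrow> nat \<Rightarrow> real^5" where
  "moved s v s' v' i =
     (if i = 0 then (1/4) *\<^sub>R (mZp s' v' - mZm s v)
      else if i = 1 then (1/2) *\<^sub>R (mWp s v + mWm s' v')
      else if i = 2 then (1/2) *\<^sub>R (mWp s v - mWm s' v')
      else if i = 3 then (1/2) *\<^sub>R (mZp s' v' + mZm s v)
      else (1/4) *\<^sub>R kv - (t/4) *\<^sub>R (mZp s' v' + mZm s v) + (1/4) *\<^sub>R (mZp s' v' - mZm s v))"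

lemma moved_nth:
  "moved s v s' v' 0 = (1/4) *\<^sub>R (mZp s' v' - mZm s v)"
  "moved s v s' v' 1 = (1/2) *\<^sub>R (mWp s v + mWm s' v')"
  "moved s v s' v' 2 = (1/2) *\<^sub>R (mWp s v - mWm s' v')"
  "moved s v s' v' 3 = (1/2) *\<^sub>R (mZp s' v' + mZm s v)"
  "moved s v s' v' 4 = (1/4) *\<^sub>R kv - (t/4) *\<^sub>R (mZp s' v' + mZm s v) + (1/4) *\<^sub>R (mZp s' v' - mZm s v)"
  by (simp_all add: moved_def)

lemma moved_combine:
  "moved s v s' v' 1 + moved s v s' v' 2 = mWp s v" "moved s v s' v' 1 - moved s v s' v' 2 = mWm s' v'"
  "moved s v s' v' 3 + 2 *\<^sub>R moved s v s' v' 0 = mZp s' v'" "moved s v s' v' 3 - 2 *\<^sub>R moved s v s' v' 0 = mZm s v"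
  "4 *\<^sub>R moved s v s' v' 4 + (2 * t) *\<^sub>R moved s v s' v' 3 - 4 *\<^sub>R moved s v s' v' 0 = kv"
  unfolding moved_nth by (simp_all add: vec_eq_iff field_simps)

lemma gram:
  "ip Wp Wp = 2" "ip Wp Wm = 0" "ip Wp Yp = 0" "ip Wp Ym = 0" "ip Wp Zp = 0" "ip Wp Zm = 0" "ip Wp kv = 0"
  "ip Wm Wp = 0" "ip Wm Wm = -2" "ip Wm Yp = 0" "ip Wm Ym = 0" "ip Wm Zp = 0" "ip Wm Zm = 0" "ip Wm kv = 0"
  "ip Yp Wp = 0" "ip Yp Wm = 0" "ip Yp Yp = - 2 * (t + 2)" "ip Yp Ym = 0" "ip Yp Zp = 0" "ip Yp Zm = 4" "ip Yp kv = 0"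
  "ip Ym Wp = 0" "ip Ym Wm = 0" "ip Ym Yp = 0" "ip Ym Ym = 2 * (t - 2)" "ip Ym Zp = 4" "ip Ym Zm = 0" "ip Ym kv = 0"
  "ip Zp Wp = 0" "ip Zp Wm = 0" "ip Zp Yp = 0" "ip Zp Ym = 4" "ip Zp Zp = -2" "ip Zp Zm = -2" "ip Zp kv = - 8 - 4 * t"
  "ip Zm Wp = 0" "ip Zm Wm = 0" "ip Zm Yp = 4" "ip Zm Ym = 0" "ip Zm Zp = -2" "ip Zm Zm = -2" "ip Zm kv = 8 - 4 * t"
  "ip kv Wp = 0" "ip kv Wm = 0" "ip kv Yp = 0" "ip kv Ym = 0" "ip kv Zp = - 8 - 4 * t" "ip kv Zm = 8 - 4 * t" "ip kv kv = 32 - 8 * (t * t)"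
  unfolding Wp_def Wm_def Yp_def Ym_def Zp_def Zm_def kv_def
  by (simp_all add: ip_simps frame_ip[OF f] algebra_simps)

text \<open>This is \<open>orbit_arc m 4 (2 * v) s\<close> with common factors cancelled.\<close>

definition on_orbit :: "real \<Rightarrow> real \<Rightarrow> real \<Rightarrow> bool" where
  "on_orbit m s v \<longleftrightarrow> s * s = 2 * v + m * (v * v) \<and> (m > 0 \<longrightarrow> 1 + m * v > 0)"

lemma moved_gram:
  assumes "on_orbit (t + 2) s v" "on_orbit (t - 2) s' v'"
  shows "ip (mWp s v) (mWp s v) = 2" "ip (mWm s' v') (mWm s' v') = -2" "ip (mWp s v) (mWm s' v') = 0"
    "ip (mWp s v) (mZm s v) = 0" "ip (mWp s v) (mZp s' v') = 0" "ip (mWm s' v') (mZm s v) = 0" "ip (mWm s' v') (mZp s' v') = 0"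
    "ip (mZm s v) (mZm s v) = -2" "ip (mZp s' v') (mZp s' v') = -2" "ip (mZm s v) (mZp s' v') = -2"
    "ip (mWp s v) kv = 0" "ip (mWm s' v') kv = 0" "ip (mZm s v) kv = 8 - 4 * t" "ip (mZp s' v') kv = - 8 - 4 * t"
proof -
  have s: "s * s = 2 * v + (t + 2) * (v * v)" "s' * s' = 2 * v' + (t - 2) * (v' * v')"
    using assms by (simp_all add: on_orbit_def)
  note d = mWp_def mWm_def mZm_def mZp_def
  show "ip (mWp s v) (mWp s v) = 2"
    unfolding d ip_simps gram real_scaleR_def using s by algebra
  show "ip (mWm s' v') (mWm s' v') = -2"
    unfolding d ip_simps gram real_scaleR_def using s by algebra
  show "ip (mWp s v) (mWm s' v') = 0"
    unfolding d by (simp add: ip_simps gram)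
  show "ip (mWp s v) (mZm s v) = 0"
    unfolding d by (simp add: ip_simps gram algebra_simps)
  show "ip (mWp s v) (mZp s' v') = 0"
    unfolding d by (simp add: ip_simps gram)
  show "ip (mWm s' v') (mZm s v) = 0"
    unfolding d by (simp add: ip_simps gram)
  show "ip (mWm s' v') (mZp s' v') = 0"
    unfolding d by (simp add: ip_simps gram algebra_simps)
  show "ip (mZm s v) (mZm s v) = -2"
    unfolding d ip_simps gram real_scaleR_def using s by algebra
  show "ip (mZp s' v') (mZp s' v') = -2"
    unfolding d ip_simps gram real_scaleR_def using s by algebra
  show "ip (mZm s v) (mZp s' v') = -2"
    unfolding d by (simp add: ip_simps gram)
  show "ip (mWp s v) kv = 0"
    unfolding d by (simp add: ip_simps gram)
  show "ip (mWm s' v') kv = 0"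
    unfolding d by (simp add: ip_simps gram)
  show "ip (mZm s v) kv = 8 - 4 * t"
    unfolding d by (simp add: ip_simps gram)
  show "ip (mZp s' v') kv = - 8 - 4 * t"
    unfolding d by (simp add: ip_simps gram)
qed

lemma moved_hyperbolic:
  assumes "on_orbit (t + 2) s v" "on_orbit (t - 2) s' v'"
  shows "hyperbolic_frame (moved s v s' v')"
proof -
  note g = moved_gram[OF assms]
  have g': "ip (mWm s' v') (mWp s v) = 0" "ip (mZm s v) (mWp s v) = 0" "ip (mZp s' v') (mWp s v) = 0"
    "ip (mZm s v) (mWm s' v') = 0" "ip (mZp s' v') (mWm s' v') = 0" "ip (mZp s' v') (mZm s v) = -2"
    "ip kv (mWp s v) = 0" "ip kv (mWm s' v') = 0" "ip kv (mZm s v) = 8 - 4 * t" "ip kv (mZp s' v') = - 8 - 4 * t"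
    using g ip_sym by metis+
  show ?thesis
    unfolding hyperbolic_frame_iff frame_table_def moved_nth
    by (simp add: ip_simps g g' gram algebra_simps)
qed

lemma ip_Y:
  "ip z Yp = - (coordK f t z + 2 * (t + 2) * ip z Zm) / 4" "ip z Ym = (coordK f t z + 2 * (t - 2) * ip z Zp) / 4"
  unfolding Yp_def Ym_def Zp_def Zm_def coordK_def by (simp_all add: ip_simps field_simps)

lemma cone_iff: "cone f t z \<longleftrightarrow> coordK f t z \<noteq> 0 \<and> orbit_arc (t + 2) (coordK f t z) (ip z Zm) (ip z Wp) \<and>
    orbit_arc (t - 2) (coordK f t z) (ip z Zp) (ip z Wm)"
  by (simp add: cone_def Wp_def Wm_def Zp_def Zm_def)

text \<open>Passing to the moved frame leaves the coordinate \<open>coordK\<close> alone and shifts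
  each pair by a group element, under which arcs are invariant.\<close>

lemma moved_cone:
  assumes o: "on_orbit (t + 2) s v" "on_orbit (t - 2) s' v'"
  shows "cone (moved s v s' v') t z \<longleftrightarrow> cone f t z"
proof -
  let ?K = "coordK f t z"
  have K: "coordK (moved s v s' v') t z = ?K"
    unfolding coordK_def moved_combine kv_def ..
  have s: "s * s = 2 * v + (t + 2) * (v * v)" "t + 2 > 0 \<longrightarrow> 1 + (t + 2) * v > 0"
    \<comment> \<open>The coordinates of the second family are shifted with parameter
      \<open>- s'\<close>, owing to the opposite sign in \<open>mZp\<close>.\<close>
    "(- s') * (- s') = 2 * v' + (t - 2) * (v' * v')" "t - 2 > 0 \<longrightarrow> 1 + (t - 2) * v' > 0"
    using o by (simp_all add: on_orbit_def)
  have m: "ip z (mZm s v) = ip z Zm - 2 * s * ip z Wp + v * (?K + 2 * (t + 2) * ip z Zm) / 2"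
    "ip z (mWp s v) = (1 + (t + 2) * v) * ip z Wp - s * (?K + 2 * (t + 2) * ip z Zm) / 4"
    "ip z (mZp s' v') = ip z Zp - 2 * (- s') * ip z Wm + v' * (?K + 2 * (t - 2) * ip z Zp) / 2"
    "ip z (mWm s' v') = (1 + (t - 2) * v') * ip z Wm - (- s') * (?K + 2 * (t - 2) * ip z Zp) / 4"
    unfolding mZm_def mWp_def mZp_def mWm_def by (simp_all add: ip_simps ip_Y field_simps)
  show ?thesis
    unfolding cone_def[of "moved s v s' v'"] K moved_combine m cone_iff
    using orbit_arc_shift[OF s(1,2)] orbit_arc_shift[OF s(3,4)] by blast
qed

lemma moved_model:
  assumes "on_orbit (t + 2) s v" "on_orbit (t - 2) s' v'"
  shows "model (moved s v s' v') t = model f t"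
  unfolding model_def moved_cone[OF assms] ..

lemma moved_0_coords:
  "coordK f t (moved s v s' v' 0) = 4" "ip (moved s v s' v' 0) Zm = 2 * v" "ip (moved s v s' v' 0) Wp = s"
  "ip (moved s v s' v' 0) Zp = 2 * v'" "ip (moved s v s' v' 0) Wm = - s'"
  unfolding coordK_def kv_def[symmetric] moved_nth mZp_def mZm_def
  by (simp_all add: ip_simps gram algebra_simps)

lemma moved_0_eqI:
  assumes "coordK f t z = 4" "ip z Zm = 2 * v" "ip z Wp = s" "ip z Zp = 2 * v'" "ip z Wm = - s'"
  shows "z = moved s v s' v' 0"
proof -
  have "coordK f t z = coordK f t (moved s v s' v' 0)" "ip z Zm = ip (moved s v s' v' 0) Zm" "ip z Wp = ip (moved s v s' v' 0) Wp"
    "ip z Zp = ip (moved s v s' v' 0) Zp" "ip z Wm = ip (moved s v s' v' 0) Wm"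
    using assms moved_0_coords by simp_all
  then have e: "4 * ip z (f 4) + 2 * t * ip z (f 3) - 4 * ip z (f 0) = 4 * ip (moved s v s' v' 0) (f 4) + 2 * t * ip (moved s v s' v' 0) (f 3) - 4 * ip (moved s v s' v' 0) (f 0)"
    "ip z (f 3) - 2 * ip z (f 0) = ip (moved s v s' v' 0) (f 3) - 2 * ip (moved s v s' v' 0) (f 0)"
    "ip z (f 1) + ip z (f 2) = ip (moved s v s' v' 0) (f 1) + ip (moved s v s' v' 0) (f 2)"
    "ip z (f 3) + 2 * ip z (f 0) = ip (moved s v s' v' 0) (f 3) + 2 * ip (moved s v s' v' 0) (f 0)"
    "ip z (f 1) - ip z (f 2) = ip (moved s v s' v' 0) (f 1) - ip (moved s v s' v' 0) (f 2)"
    unfolding coordK_def Wp_def Wm_def Zp_def Zm_def by (simp_all add: ip_simps)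
  have e3: "ip z (f 3) = ip (moved s v s' v' 0) (f 3)" and e0: "ip z (f 0) = ip (moved s v s' v' 0) (f 0)"
    using e(2,4) by linarith+
  show ?thesis
    using e by (intro frame_eqI[OF f] e3 e0) (simp_all add: e3 e0)
qed

text \<open>The group acts transitively: after scaling to \<open>coordK = 4\<close> the remaining
  coordinates of a point are themselves the parameters of the group element that reaches it.\<close>

lemma model_point:
  assumes "p \<in> model f t"
  obtains s v s' v' where "on_orbit (t + 2) s v" "on_orbit (t - 2) s' v'" "p = pt (moved s v s' v' 0)"
proof -
  obtain z where z: "p = pt z" "cone f t z"
    using assms unfolding model_def by blast
  have K: "coordK f t z \<noteq> 0"
    using z(2) by (simp add: cone_def)
  define y where "y = (4 / coordK f t z) *\<^sub>R z"
  have y: "p = pt y" "cone f t y"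
    using K z cone_scale[of "4 / coordK f t z" f t z] by (simp_all add: y_def)
  have Ky: "coordK f t y = 4"
  proof -
    have "coordK f t (c *\<^sub>R z) = c * coordK f t z" for c
      by (simp add: coordK_def ip_simps algebra_simps)
    then show ?thesis
      using K by (simp add: y_def)
  qed
  define s v s' v' where "s = ip y Wp" and "v = ip y Zm / 2" and "s' = - ip y Wm" and "v' = ip y Zp / 2"
  have c: "orbit_arc (t + 2) 4 (2 * v) s" "orbit_arc (t - 2) 4 (2 * v') (- s')"
    using y(2) unfolding cone_iff Ky by (simp_all add: s_def v_def s'_def v'_def)
  have o: "on_orbit m s v" if "orbit_arc m 4 (2 * v) s" for m s v
    using that by (auto simp: orbit_arc_def on_orbit_def algebra_simps)
  have "on_orbit (t + 2) s v" "on_orbit (t - 2) s' v'"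
    using o[OF c(1)] o[OF c(2)] by (simp_all add: on_orbit_def)
  moreover have "y = moved s v s' v' 0"
    by (rule moved_0_eqI) (simp_all add: Ky s_def v_def s'_def v'_def)
  ultimately show ?thesis
    using that y(1) by blast
qed

text \<open>\<open>sfun\<close> and \<open>vfun\<close> give the second intersection of the conic
  \<open>s^2 = 2 v + m v^2\<close> with the line \<open>v = h s\<close> through the base point. One
  formula covers ellipse, parabola and hyperbola.\<close>

definition sfun :: "real \<Rightarrow> real \<Rightarrow> real" where
  "sfun m h = 2 * h * inverse (1 - m * (h * h))"

definition vfun :: "real \<Rightarrow> real \<Rightarrow> real" where
  "vfun m h = 2 * (h * h) * inverse (1 - m * (h * h))"

text \<open>The rational parameter of the conic is \<open>h = s / (2 + m v)\<close>.\<close>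

lemma chart_denominator:
  fixes m h :: real
  assumes "\<bar>m\<bar> * (h * h) < 1"
  shows "1 - m * (h * h) > 0" "1 + m * (h * h) > 0"
proof -
  have "\<bar>m * (h * h)\<bar> < 1"
    using assms by (simp add: abs_mult)
  then show "1 - m * (h * h) > 0" "1 + m * (h * h) > 0"
    by linarith+
qed

lemma chart_orbit:
  assumes h: "\<bar>m\<bar> * (h * h) < 1"
  shows "1 + m * vfun m h > 0" "on_orbit m (sfun m h) (vfun m h)" "sfun m h / (2 + m * vfun m h) = h"
proof -
  note d = chart_denominator[OF h]
  define r where "r = inverse (1 - m * (h * h))"
  have r: "r > 0" "(1 - m * (h * h)) * r = 1"
    using d by (simp_all add: r_def)
  have "1 + m * vfun m h = (1 + m * (h * h)) * r"
    unfolding vfun_def r_def[symmetric] using r(2) by algebra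
  then show p: "1 + m * vfun m h > 0"
    using d(2) r(1) by simp
  have "sfun m h * sfun m h = 2 * vfun m h + m * (vfun m h * vfun m h)"
    unfolding sfun_def vfun_def r_def[symmetric] using r(2) by algebra
  then show "on_orbit m (sfun m h) (vfun m h)"
    using p by (simp add: on_orbit_def)
  have "2 + m * vfun m h = 2 * r"
    unfolding vfun_def r_def[symmetric] using r(2) by algebra
  then show "sfun m h / (2 + m * vfun m h) = h"
    using r(1) by (simp add: sfun_def flip: r_def)
qed

lemma chart_inverse:
  assumes o: "on_orbit m s v" and p: "1 + m * v > 0"
  shows "sfun m (s / (2 + m * v)) = s" "vfun m (s / (2 + m * v)) = v"
proof -
  define r where "r = inverse (2 + m * v)"
  have r: "(2 + m * v) * r = 1" "r > 0"
    using p by (simp_all add: r_def)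
  have ss: "s * s = 2 * v + m * (v * v)"
    using o by (simp add: on_orbit_def)
  have h: "s / (2 + m * v) = s * r"
    by (simp add: r_def divide_inverse)
  have hh: "(s * r) * (s * r) = v * r"
    using ss r(1) by algebra
  have "1 - m * ((s * r) * (s * r)) = 2 * r"
    unfolding hh using r(1) by algebra
  then have i: "inverse (1 - m * ((s * r) * (s * r))) = inverse (2 * r)"
    by simp
  show "sfun m (s / (2 + m * v)) = s" "vfun m (s / (2 + m * v)) = v"
    unfolding h sfun_def vfun_def i unfolding hh using r(2) by (simp_all add: field_simps)
qed

text \<open>\<open>(s, v)\<close> follows the flow \<open>s' = 1 + m v\<close>,
  \<open>v' = s\<close> up to the common speed \<open>G\<close>.\<close>

lemma chart_deriv:
  assumes h: "\<bar>m\<bar> * (h * h) < 1"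
  defines "G \<equiv> 2 * inverse (1 - m * (h * h))"
  shows "(sfun m has_real_derivative G * (1 + m * vfun m h)) (at h)" "(vfun m has_real_derivative G * sfun m h) (at h)"
proof -
  have d: "1 - m * (h * h) \<noteq> 0"
    using chart_denominator[OF h] by simp
  define r where "r = inverse (1 - m * (h * h))"
  have r: "(1 - m * (h * h)) * r = 1"
    using d by (simp add: r_def)
  have inv: "((\<lambda>h. inverse (1 - m * (h * h))) has_real_derivative r * (2 * m * h) * r) (at h)"
    unfolding r_def by (rule derivative_eq_intros refl d)+ (simp add: algebra_simps)
  have "((\<lambda>h. 2 * h * inverse (1 - m * (h * h))) has_real_derivative 2 * h * (r * (2 * m * h) * r) + 2 * r) (at h)"
    by (rule derivative_eq_intros inv refl)+ (simp add: r_def)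
  moreover have "2 * h * (r * (2 * m * h) * r) + 2 * r = 2 * r * (1 + m * (2 * (h * h) * r))"
    by (simp add: algebra_simps)
  ultimately show "(sfun m has_real_derivative G * (1 + m * vfun m h)) (at h)"
    unfolding sfun_def[abs_def] vfun_def G_def r_def[symmetric] by simp
  have "((\<lambda>h. 2 * (h * h) * inverse (1 - m * (h * h))) has_real_derivative 2 * (h * h) * (r * (2 * m * h) * r) + 4 * h * r) (at h)"
    by (rule derivative_eq_intros inv refl)+ (simp add: r_def)
  moreover have "2 * (h * h) * (r * (2 * m * h) * r) + 4 * h * r = 2 * r * (2 * h * r)"
    using r by algebra
  ultimately show "(vfun m has_real_derivative G * sfun m h) (at h)"
    unfolding sfun_def vfun_def[abs_def] G_def r_def[symmetric] by simp
qed

text \<open>The absolute values make both \<open>1 - m h^2\<close> and \<open>1 + m h^2\<close>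
  positive, hence also \<open>1 + m v\<close>, which is their quotient.\<close>

definition chart_dom :: "(real^2) set" where
  "chart_dom = {u. \<bar>t + 2\<bar> * (u$1 * u$1) < 1 \<and> \<bar>t - 2\<bar> * (u$2 * u$2) < 1}"

lemma chart_dom_open: "open chart_dom"
  unfolding chart_dom_def by (intro open_Collect_conj open_Collect_less continuous_intros)

lemma zero_chart_dom: "0 \<in> chart_dom"
  by (simp add: chart_dom_def)

lemma chart_dom_convex: "convex chart_dom"
proof -
  have sq: "\<bar>m\<bar> * ((a * x + b * y) * (a * x + b * y)) < 1" if "\<bar>m\<bar> * (x * x) < 1" "\<bar>m\<bar> * (y * y) < 1" "a \<ge> 0" "b \<ge> 0" "a + b = 1"
    for m a b x y :: real
  proof -
    have "(a * x + b * y) * (a * x + b * y) = a * (x * x) + b * (y * y) - a * b * ((x - y) * (x - y))"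
      using that(5) by algebra
    also have "\<dots> \<le> a * (x * x) + b * (y * y)"
      using that(3,4) by simp
    also have "\<dots> \<le> max (x * x) (y * y)"
      using convex_bound_le[of "x * x" "max (x * x) (y * y)" "y * y" a b] that(3-5) by simp
    finally have "\<bar>m\<bar> * ((a * x + b * y) * (a * x + b * y)) \<le> \<bar>m\<bar> * max (x * x) (y * y)"
      by (intro mult_left_mono) auto
    also have "\<dots> < 1"
      using that(1,2) by (auto simp: max_def)
    finally show ?thesis .
  qed
  show ?thesis
    unfolding convex_def chart_dom_def by (auto intro!: sq)
qed

definition chart_frame :: "nat \<Rightarrow> real^2 \<Rightarrow> real^5" where
  "chart_frame i u = moved (sfun (t + 2) (u$1)) (vfun (t + 2) (u$1)) (sfun (t - 2) (u$2)) (vfun (t - 2) (u$2)) i"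

lemma chart_frame_orbit:
  assumes "u \<in> chart_dom"
  shows "on_orbit (t + 2) (sfun (t + 2) (u$1)) (vfun (t + 2) (u$1))" "on_orbit (t - 2) (sfun (t - 2) (u$2)) (vfun (t - 2) (u$2))"
    "1 + (t + 2) * vfun (t + 2) (u$1) > 0" "1 + (t - 2) * vfun (t - 2) (u$2) > 0"
  using assms chart_orbit unfolding chart_dom_def by blast+

lemma chart_smooth:
  assumes "\<And>u. u \<in> chart_dom \<Longrightarrow> \<bar>m\<bar> * (u$i * u$i) < 1"
  shows "smooth_on chart_dom (\<lambda>u. sfun m (u$i))" "smooth_on chart_dom (\<lambda>u. vfun m (u$i))"
proof -
  have i: "smooth_on chart_dom (\<lambda>u. u$i)"
    by (rule smooth_on_linear[OF chart_dom_open bounded_linear_vec_nth])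
  have d: "smooth_on chart_dom (\<lambda>u. inverse (1 - m * (u$i * u$i)))"
    using chart_denominator[OF assms]
    by (intro smooth_on_inverse smooth_on_diff smooth_on_mult smooth_on_const[OF chart_dom_open] i) (simp add: less_le)
  show "smooth_on chart_dom (\<lambda>u. sfun m (u$i))" "smooth_on chart_dom (\<lambda>u. vfun m (u$i))"
    unfolding sfun_def vfun_def by (intro smooth_on_mult smooth_on_const[OF chart_dom_open] i d)+
qed

lemma chart_frame_smooth: "smooth_on chart_dom (chart_frame i)"
proof -
  have s: "smooth_on chart_dom (\<lambda>u. sfun (t + 2) (u$1))" "smooth_on chart_dom (\<lambda>u. vfun (t + 2) (u$1))"
    "smooth_on chart_dom (\<lambda>u. sfun (t - 2) (u$2))" "smooth_on chart_dom (\<lambda>u. vfun (t - 2) (u$2))"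
    by (rule chart_smooth; simp add: chart_dom_def)+
  note c = smooth_on_const[OF chart_dom_open]
  have "smooth_on chart_dom (\<lambda>u. mWp (sfun (t + 2) (u$1)) (vfun (t + 2) (u$1)))"
    "smooth_on chart_dom (\<lambda>u. mWm (sfun (t - 2) (u$2)) (vfun (t - 2) (u$2)))"
    "smooth_on chart_dom (\<lambda>u. mZm (sfun (t + 2) (u$1)) (vfun (t + 2) (u$1)))"
    "smooth_on chart_dom (\<lambda>u. mZp (sfun (t - 2) (u$2)) (vfun (t - 2) (u$2)))"
    unfolding mWp_def mWm_def mZm_def mZp_def
    by (intro smooth_on_add smooth_on_diff smooth_on_scaleR smooth_on_mult s c)+
  note m = this
  have "smooth_on chart_dom (\<lambda>u. chart_frame 0 u)" "smooth_on chart_dom (\<lambda>u. chart_frame 1 u)"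
     "smooth_on chart_dom (\<lambda>u. chart_frame 2 u)" "smooth_on chart_dom (\<lambda>u. chart_frame 3 u)" "smooth_on chart_dom (\<lambda>u. chart_frame 4 u)"
    unfolding chart_frame_def moved_nth
    by (intro smooth_on_add smooth_on_diff smooth_on_scaleR_const smooth_on_scaleR m c)+
  moreover have "chart_frame i = chart_frame 4" if "i \<noteq> 0" "i \<noteq> 1" "i \<noteq> 2" "i \<noteq> 3"
    using that by (simp add: fun_eq_iff chart_frame_def moved_def)
  ultimately show ?thesis
    by (cases "i = 0"; cases "i = 1"; cases "i = 2"; cases "i = 3") simp_all
qed

lemma chart_Z_deriv:
  assumes u: "u \<in> chart_dom"
  defines "G1 \<equiv> 2 * inverse (1 - (t + 2) * (u$1 * u$1))" and "G2 \<equiv> 2 * inverse (1 - (t - 2) * (u$2 * u$2))"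
  shows "((\<lambda>u. mZm (sfun (t + 2) (u$1)) (vfun (t + 2) (u$1))) has_derivative
      (\<lambda>w. (- 2 * (G1 * w$1)) *\<^sub>R mWp (sfun (t + 2) (u$1)) (vfun (t + 2) (u$1)))) (at u)"
    "((\<lambda>u. mZp (sfun (t - 2) (u$2)) (vfun (t - 2) (u$2))) has_derivative
      (\<lambda>w. (2 * (G2 * w$2)) *\<^sub>R mWm (sfun (t - 2) (u$2)) (vfun (t - 2) (u$2)))) (at u)"
proof -
  have h: "\<bar>t + 2\<bar> * (u$1 * u$1) < 1" "\<bar>t - 2\<bar> * (u$2 * u$2) < 1"
    using u by (simp_all add: chart_dom_def)
  have n: "((\<lambda>u. u$i) has_derivative (\<lambda>w. w$i)) (at u)" for i
    by (rule bounded_linear_imp_has_derivative[OF bounded_linear_vec_nth])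
  have ch: "((\<lambda>u. g (u$i)) has_derivative (\<lambda>w. d * w$i)) (at u)" if "(g has_real_derivative d) (at (u$i))" for g d i
    using has_derivative_compose[OF n[of i], of g "\<lambda>x. d * x"] that by (simp add: has_field_derivative_def)
  note s1 = ch[OF chart_deriv(1)[OF h(1)], folded G1_def] and v1 = ch[OF chart_deriv(2)[OF h(1)], folded G1_def]
    and s2 = ch[OF chart_deriv(1)[OF h(2)], folded G2_def] and v2 = ch[OF chart_deriv(2)[OF h(2)], folded G2_def]
  note sc = has_derivative_scaleR_left and ssr = has_derivative_scaleR_right
  show "((\<lambda>u. mZm (sfun (t + 2) (u$1)) (vfun (t + 2) (u$1))) has_derivative
      (\<lambda>w. (- 2 * (G1 * w$1)) *\<^sub>R mWp (sfun (t + 2) (u$1)) (vfun (t + 2) (u$1)))) (at u)"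
    unfolding mZm_def
    by (rule has_derivative_eq_rhs[OF has_derivative_diff[OF has_derivative_const ssr[OF has_derivative_add[OF sc[OF s1] sc[OF v1]]]]])
      (simp add: fun_eq_iff mWp_def vec_eq_iff algebra_simps)
  show "((\<lambda>u. mZp (sfun (t - 2) (u$2)) (vfun (t - 2) (u$2))) has_derivative
      (\<lambda>w. (2 * (G2 * w$2)) *\<^sub>R mWm (sfun (t - 2) (u$2)) (vfun (t - 2) (u$2)))) (at u)"
    unfolding mZp_def
    by (rule has_derivative_eq_rhs[OF has_derivative_add[OF has_derivative_const ssr[OF has_derivative_add[OF sc[OF s2] sc[OF v2]]]]])
      (simp add: fun_eq_iff mWm_def vec_eq_iff algebra_simps)
qed

text \<open>The vectors 0, 3 and 4 are combinations of the two moved sphere vectors and the fixed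
  vector \<open>kv\<close>, so the derivatives of \<open>mZm\<close> and \<open>mZp\<close>
  suffice.\<close>

lemma chart_frame_D:
  assumes u: "u \<in> chart_dom"
  obtains a b where "a > 0" "b > 0"
    "\<And>w. D (chart_frame 0) u w = (a * w$1) *\<^sub>R (chart_frame 1 u + chart_frame 2 u) + (b * w$2) *\<^sub>R (chart_frame 1 u - chart_frame 2 u)"
    "\<And>w. D (chart_frame 3) u w = (- 2 * (a * w$1)) *\<^sub>R (chart_frame 1 u + chart_frame 2 u) + (2 * (b * w$2)) *\<^sub>R (chart_frame 1 u - chart_frame 2 u)"
    "\<And>w. D (chart_frame 4) u w = ((1 + t) * (a * w$1)) *\<^sub>R (chart_frame 1 u + chart_frame 2 u) + ((1 - t) * (b * w$2)) *\<^sub>R (chart_frame 1 u - chart_frame 2 u)"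
proof -
  define a b where "a = inverse (1 - (t + 2) * (u$1 * u$1))" and "b = inverse (1 - (t - 2) * (u$2 * u$2))"
  have pos: "a > 0" "b > 0"
    using u chart_denominator(1)[of "t + 2" "u$1"] chart_denominator(1)[of "t - 2" "u$2"] by (simp_all add: a_def b_def chart_dom_def)
  note Zm' = chart_Z_deriv(1)[OF u, folded a_def] and Zp' = chart_Z_deriv(2)[OF u, folded b_def]
  note ssr = has_derivative_scaleR_right
  note cf = chart_frame_def[of 0, abs_def] chart_frame_def[of 3, abs_def] chart_frame_def[of 4, abs_def]
  have W: "chart_frame 1 u + chart_frame 2 u = mWp (sfun (t + 2) (u$1)) (vfun (t + 2) (u$1))"
    "chart_frame 1 u - chart_frame 2 u = mWm (sfun (t - 2) (u$2)) (vfun (t - 2) (u$2))"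
    unfolding chart_frame_def by (rule moved_combine)+
  show ?thesis
  proof (rule that[OF pos])
    fix w
    show "D (chart_frame 0) u w = (a * w$1) *\<^sub>R (chart_frame 1 u + chart_frame 2 u) + (b * w$2) *\<^sub>R (chart_frame 1 u - chart_frame 2 u)"
      unfolding W unfolding cf moved_nth D_eqI[OF ssr[OF has_derivative_diff[OF Zp' Zm']]]
      by (simp add: vec_eq_iff field_simps)
    show "D (chart_frame 3) u w = (- 2 * (a * w$1)) *\<^sub>R (chart_frame 1 u + chart_frame 2 u) + (2 * (b * w$2)) *\<^sub>R (chart_frame 1 u - chart_frame 2 u)"
      unfolding W unfolding cf moved_nth D_eqI[OF ssr[OF has_derivative_add[OF Zp' Zm']]]
      by (simp add: vec_eq_iff field_simps)
    show "D (chart_frame 4) u w = ((1 + t) * (a * w$1)) *\<^sub>R (chart_frame 1 u + chart_frame 2 u) + ((1 - t) * (b * w$2)) *\<^sub>R (chart_frame 1 u - chart_frame 2 u)"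
      unfolding W unfolding cf moved_nth D_eqI[OF has_derivative_add[OF has_derivative_diff[OF has_derivative_const
            ssr[OF has_derivative_add[OF Zp' Zm']]] ssr[OF has_derivative_diff[OF Zp' Zm']]]]
      by (simp add: vec_eq_iff field_simps)
  qed
qed

lemma chart_cyclide_frame: "cyclide_frame chart_dom chart_frame"
  and chart_tau: "u \<in> chart_dom \<Longrightarrow> cyclide_tau chart_frame u = t"
  and chart_rank: "u \<in> chart_dom \<Longrightarrow> proj_rank (chart_frame 0) u = 2"
proof -
  have hf: "hyperbolic_frame (\<lambda>i. chart_frame i u)" if "u \<in> chart_dom" for u
    unfolding chart_frame_def using moved_hyperbolic[OF chart_frame_orbit(1,2)[OF that]] by simp
  note w = w_ip[of chart_frame, OF hf]
  show c: "cyclide_frame chart_dom chart_frame"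
    unfolding cyclide_frame_def
  proof (intro conjI ballI allI impI)
    show "open chart_dom" "smooth_on chart_dom (chart_frame i)" for i
      by (rule chart_dom_open chart_frame_smooth)+
    fix u assume u: "u \<in> chart_dom"
    show "hyperbolic_frame (\<lambda>i. chart_frame i u)"
      by (rule hf[OF u])
    obtain a b where ab: "a > 0" "b > 0"
      "\<And>w. D (chart_frame 0) u w = (a * w$1) *\<^sub>R (chart_frame 1 u + chart_frame 2 u) + (b * w$2) *\<^sub>R (chart_frame 1 u - chart_frame 2 u)"
      "\<And>w. D (chart_frame 3) u w = (- 2 * (a * w$1)) *\<^sub>R (chart_frame 1 u + chart_frame 2 u) + (2 * (b * w$2)) *\<^sub>R (chart_frame 1 u - chart_frame 2 u)"
      using chart_frame_D[OF u] by metis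
    show "\<exists>P Q. D (chart_frame 0) u w = P *\<^sub>R (chart_frame 1 u + chart_frame 2 u) + Q *\<^sub>R (chart_frame 1 u - chart_frame 2 u) \<and>
           D (chart_frame 3) u w = - (2 * P) *\<^sub>R (chart_frame 1 u + chart_frame 2 u) + (2 * Q) *\<^sub>R (chart_frame 1 u - chart_frame 2 u)" for w
      using ab(3,4)[of w] by (intro exI[of _ "a * w$1"] exI[of _ "b * w$2"]) simp
    have lin: "linear (D (chart_frame 0) u)"
      by (rule D_lin[OF smooth_on_differentiable[OF chart_frame_smooth u]])
    have "w = 0" if "D (chart_frame 0) u w = 0" for w
    proof -
      have "ip (D (chart_frame 0) u w) (wplus chart_frame u) = 0" "ip (D (chart_frame 0) u w) (wminus chart_frame u) = 0"
        by (simp_all add: that ip_simps)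
      then have "a * w$1 = 0" "b * w$2 = 0"
        unfolding ab(3) wplus_def[symmetric] wminus_def[symmetric] by (simp_all add: ip_simps w u)
      then show ?thesis
        using ab(1,2) by (simp add: vec_eq_iff forall_2)
    qed
    then show "inj (D (chart_frame 0) u)"
      using linear_injective_0[OF lin] by blast
  qed
  assume u: "u \<in> chart_dom"
  obtain a b where ab: "a > 0" "b > 0"
      "\<And>w. D (chart_frame 0) u w = (a * w$1) *\<^sub>R (chart_frame 1 u + chart_frame 2 u) + (b * w$2) *\<^sub>R (chart_frame 1 u - chart_frame 2 u)"
      "\<And>w. D (chart_frame 4) u w = ((1 + t) * (a * w$1)) *\<^sub>R (chart_frame 1 u + chart_frame 2 u) + ((1 - t) * (b * w$2)) *\<^sub>R (chart_frame 1 u - chart_frame 2 u)"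
    using chart_frame_D[OF u] by metis
  note ab' = ab(3,4)[folded wplus_def wminus_def]
  show "cyclide_tau chart_frame u = t"
    by (rule cyclide_tau_unique[OF c u]) (simp add: formP_def ab' ip_simps w u algebra_simps)
  have nz: "wminus chart_frame u \<noteq> 0"
    using w(2)[OF u] by (auto simp: ip_simps)
  have sp: "wplus chart_frame u \<notin> span {wminus chart_frame u}"
    by (rule ip_notin_span1[of _ "wplus chart_frame u"]) (simp_all add: w u)
  have sp0: "chart_frame 0 u \<notin> span {wplus chart_frame u, wminus chart_frame u}"
    by (rule ip_notin_span2[of _ "chart_frame 4 u"]) (simp_all add: w u frame_ip[OF hf[OF u]])
  show "proj_rank (chart_frame 0) u = 2"
    by (rule proj_rank_plane[OF ab'(1), of "axis 1 1" a "axis 2 1" b])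
      (use ab(1,2) nz sp sp0 in \<open>simp_all add: ab' axis_def\<close>)
qed

end

section \<open>Charts of the model as local lifts\<close>

context model_frame
begin

lemma chart_frame_hyperbolic: "u \<in> chart_dom \<Longrightarrow> hyperbolic_frame (\<lambda>i. chart_frame i u)"
  by (rule cyclide_frame_hyperbolic[OF chart_cyclide_frame])

lemma chart_frame_nonzero:
  assumes "u \<in> chart_dom"
  shows "chart_frame 0 u \<noteq> 0"
  using frame_ip(5)[OF chart_frame_hyperbolic[OF assms]] by (auto simp: ip_simps)

text \<open>The parameter \<open>h = s / (2 + m v)\<close> made homogeneous of degree 0, with
  \<open>4, 2 v, s\<close> replaced by the coordinates of \<open>z\<close>. It is continuous on an
  open cone of the ambient space, which proves openness of the chart without an inverse function
  theorem.\<close>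

definition chart_inv :: "real^5 \<Rightarrow> real^2" where
  "chart_inv z = (2 * ip z Wp / (coordK f t z + (t + 2) * ip z Zm)) *\<^sub>R axis 1 1
     + (- 2 * ip z Wm / (coordK f t z + (t - 2) * ip z Zp)) *\<^sub>R axis 2 1"

text \<open>On vectors scaled to \<open>coordK = 4\<close> these inequalities read
  \<open>1 + m v > 0\<close> for both families.\<close>

definition chart_cone :: "(real^5) set" where
  "chart_cone = {z. coordK f t z * (coordK f t z + 2 * ((t + 2) * ip z Zm)) > 0 \<and> coordK f t z * (coordK f t z + 2 * ((t - 2) * ip z Zp)) > 0}"

lemma chart_cone_denominator:
  assumes "z \<in> chart_cone"
  shows "coordK f t z + (t + 2) * ip z Zm \<noteq> 0" "coordK f t z + (t - 2) * ip z Zp \<noteq> 0"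
proof -
  have *: "K + m * A \<noteq> 0" if "K * (K + 2 * (m * A)) > 0" for K m A :: real
  proof
    assume "K + m * A = 0"
    then have "K * (K + 2 * (m * A)) = - (K * K)"
      by algebra
    then show False
      using that zero_le_square[of K] by linarith
  qed
  show "coordK f t z + (t + 2) * ip z Zm \<noteq> 0" "coordK f t z + (t - 2) * ip z Zp \<noteq> 0"
    using assms *[of "coordK f t z" "t + 2" "ip z Zm"] *[of "coordK f t z" "t - 2" "ip z Zp"] unfolding chart_cone_def by simp_all
qed

lemma continuous_on_ip_left: "continuous_on S (\<lambda>z. ip z w)"
  by (rule linear_continuous_on[OF bounded_bilinear.bounded_linear_left[OF bounded_bilinear_ip]])

lemma continuous_on_coordK: "continuous_on S (coordK f t)"
  unfolding coordK_def[abs_def] by (intro continuous_intros continuous_on_ip_left)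

lemma chart_cone_open: "open chart_cone"
  unfolding chart_cone_def
  by (intro open_Collect_conj open_Collect_less continuous_intros continuous_on_ip_left continuous_on_coordK)

lemma chart_inv_continuous: "continuous_on chart_cone chart_inv"
  unfolding chart_inv_def[abs_def]
  by (intro continuous_intros continuous_on_ip_left continuous_on_coordK) (use chart_cone_denominator in auto)

lemma coordK_scale: "coordK f t (c *\<^sub>R z) = c * coordK f t z"
  by (simp add: coordK_def ip_simps algebra_simps)

lemma chart_cone_scale:
  assumes "c \<noteq> 0" "z \<in> chart_cone"
  shows "c *\<^sub>R z \<in> chart_cone" "chart_inv (c *\<^sub>R z) = chart_inv z"
proof -
  have e: "(c * K) * (c * K + 2 * (m * (c * A))) = (c * c) * (K * (K + 2 * (m * A)))" "c * K + m * (c * A) = c * (K + m * A)" for K m A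
    by algebra+
  have "c * c > 0"
    using assms(1) by (auto simp: zero_less_mult_iff linorder_neq_iff)
  then show "c *\<^sub>R z \<in> chart_cone"
    using assms(2) unfolding chart_cone_def by (simp add: coordK_scale ip_simps e)
  show "chart_inv (c *\<^sub>R z) = chart_inv z"
    unfolding chart_inv_def coordK_scale ip_simps real_scaleR_def e using assms(1) by simp
qed

lemma chart_frame_cone:
  assumes u: "u \<in> chart_dom"
  shows "chart_frame 0 u \<in> chart_cone" "chart_inv (chart_frame 0 u) = u" "cone f t (chart_frame 0 u)"
proof -
  note o = chart_frame_orbit[OF u]
  define s v s' v' where d: "s = sfun (t + 2) (u$1)" "v = vfun (t + 2) (u$1)" "s' = sfun (t - 2) (u$2)" "v' = vfun (t - 2) (u$2)"
  have c: "chart_frame 0 u = moved s v s' v' 0"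
    by (simp add: chart_frame_def d)
  show "chart_frame 0 u \<in> chart_cone"
    unfolding c chart_cone_def mem_Collect_eq moved_0_coords using o(3,4) unfolding d[symmetric] by (simp add: algebra_simps)
  have h: "s / (2 + (t + 2) * v) = u$1" "s' / (2 + (t - 2) * v') = u$2"
    using u chart_orbit(3) unfolding d chart_dom_def by blast+
  have "2 * s / (4 + (t + 2) * (2 * v)) = s / (2 + (t + 2) * v)" "- 2 * (- s') / (4 + (t - 2) * (2 * v')) = s' / (2 + (t - 2) * v')"
    using o(3,4) by (simp_all add: d divide_simps)
  then show "chart_inv (chart_frame 0 u) = u"
    unfolding c chart_inv_def moved_0_coords by (simp add: h vec_eq_iff forall_2 axis_def)
  have "cone (moved s v s' v') t (moved s v s' v' 0)"
    using model_base(1)[OF moved_hyperbolic[OF o(1,2)]] by (simp add: d)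
  then show "cone f t (chart_frame 0 u)"
    unfolding c using moved_cone[OF o(1,2)] by (simp add: d)
qed

text \<open>A model point in the open cone is scaled to \<open>coordK = 4\<close>; its coordinates
  then lie on the orbits with positive \<open>1 + m v\<close>, and \<open>chart_inverse\<close>
  recovers it from the parameters.\<close>

lemma chart_image:
  assumes V: "V \<subseteq> chart_dom"
  shows "(\<lambda>u. pt (chart_frame 0 u)) ` V = model f t \<inter> {pt z | z. z \<noteq> 0 \<and> z \<in> {z \<in> chart_cone. chart_inv z \<in> V}}"
proof (intro equalityI subsetI)
  fix p assume "p \<in> (\<lambda>u. pt (chart_frame 0 u)) ` V"
  then obtain u where u: "u \<in> V" "p = pt (chart_frame 0 u)"
    by auto
  then have ud: "u \<in> chart_dom"
    using V by auto
  show "p \<in> model f t \<inter> {pt z | z. z \<noteq> 0 \<and> z \<in> {z \<in> chart_cone. chart_inv z \<in> V}}"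
  proof (rule IntI)
    show "p \<in> model f t"
      unfolding u(2) pt_in_model[OF chart_frame_nonzero[OF ud]] by (rule chart_frame_cone(3)[OF ud])
    have "chart_frame 0 u \<noteq> 0 \<and> chart_frame 0 u \<in> {z \<in> chart_cone. chart_inv z \<in> V}"
      using chart_frame_nonzero[OF ud] chart_frame_cone(1,2)[OF ud] u(1) by simp
    then show "p \<in> {pt z | z. z \<noteq> 0 \<and> z \<in> {z \<in> chart_cone. chart_inv z \<in> V}}"
      unfolding u(2) by (intro CollectI exI[of _ "chart_frame 0 u"] conjI refl) simp_all
  qed
next
  fix p assume p: "p \<in> model f t \<inter> {pt z | z. z \<noteq> 0 \<and> z \<in> {z \<in> chart_cone. chart_inv z \<in> V}}"
  then obtain z where z: "p = pt z" "z \<noteq> 0" "z \<in> chart_cone" "chart_inv z \<in> V"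
    by blast
  then have cz: "cone f t z"
    using p pt_in_model[OF z(2)] by simp
  then have K: "coordK f t z \<noteq> 0"
    by (simp add: cone_def)
  define y where "y = (4 / coordK f t z) *\<^sub>R z"
  have c0: "4 / coordK f t z \<noteq> 0"
    using K by simp
  have y: "p = pt y" "y \<in> chart_cone" "chart_inv y \<in> V" "cone f t y" "coordK f t y = 4"
    using z cz K chart_cone_scale[OF c0 z(3)] cone_scale[OF c0] by (simp_all add: y_def coordK_scale)
  define s v s' v' where d: "s = ip y Wp" "v = ip y Zm / 2" "s' = - ip y Wm" "v' = ip y Zp / 2"
  have br: "1 + (t + 2) * v > 0" "1 + (t - 2) * v' > 0"
    using y(2) unfolding chart_cone_def mem_Collect_eq y(5) by (auto simp: d zero_less_mult_iff field_simps)
  have o: "on_orbit (t + 2) s v" "on_orbit (t - 2) s' v'"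
  proof -
    have *: "on_orbit m (k * B) (A / 2)" if "orbit_arc m 4 A B" "1 + m * (A / 2) > 0" "k * k = 1" for m A B k
    proof -
      have "4 * (B * B) = 4 * A + m * (A * A)"
        using that(1) by (simp add: orbit_arc_def)
      then have "B * B = 2 * (A / 2) + m * (A / 2 * (A / 2))"
        by simp
      moreover have "k * B * (k * B) = (k * k) * (B * B)"
        by simp
      ultimately show ?thesis
        using that(2,3) by (simp add: on_orbit_def)
    qed
    have c: "orbit_arc (t + 2) 4 (ip y Zm) (ip y Wp)" "orbit_arc (t - 2) 4 (ip y Zp) (ip y Wm)"
      using y(4) unfolding cone_iff y(5) by auto
    show "on_orbit (t + 2) s v" "on_orbit (t - 2) s' v'"
      using *[OF c(1), of 1] *[OF c(2), of "-1"] br unfolding d by auto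
  qed
  define u where "u = chart_inv y"
  have "2 * s / (4 + (t + 2) * (2 * v)) = s / (2 + (t + 2) * v)" "- 2 * (- s') / (4 + (t - 2) * (2 * v')) = s' / (2 + (t - 2) * v')"
    using br by (simp_all add: divide_simps)
  then have u12: "u$1 = s / (2 + (t + 2) * v)" "u$2 = s' / (2 + (t - 2) * v')"
    unfolding u_def chart_inv_def y(5) by (simp_all add: d axis_def)
  have "chart_frame 0 u = moved s v s' v' 0"
    unfolding chart_frame_def u12 chart_inverse[OF o(1) br(1)] chart_inverse[OF o(2) br(2)] ..
  also have "\<dots> = y"
    by (rule moved_0_eqI[symmetric]) (simp_all add: y d)
  finally show "p \<in> (\<lambda>u. pt (chart_frame 0 u)) ` V"
    using y(1,3) by (auto simp: u_def intro!: rev_image_eqI[of "chart_inv y"])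
qed

lemma chart_local_lift: "local_lift (model f t) chart_dom (chart_frame 0)"
  unfolding local_lift_iff
proof (intro conjI ballI allI impI)
  show "smooth_on chart_dom (chart_frame 0)"
    by (rule chart_frame_smooth)
  show "chart_frame 0 u \<noteq> 0" "proj_rank (chart_frame 0) u = 2" if "u \<in> chart_dom" for u
    using that by (rule chart_frame_nonzero chart_rank)+
  show "inj_on (\<lambda>u. pt (chart_frame 0 u)) chart_dom"
  proof (rule inj_onI)
    fix u u' assume u: "u \<in> chart_dom" "u' \<in> chart_dom" and e: "pt (chart_frame 0 u) = pt (chart_frame 0 u')"
    obtain c where "c \<noteq> 0" "chart_frame 0 u' = c *\<^sub>R chart_frame 0 u"
      by (rule pt_eqD[OF e chart_frame_nonzero[OF u(1)]])
    then have "chart_inv (chart_frame 0 u') = chart_inv (chart_frame 0 u)"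
      using chart_cone_scale(2)[OF _ chart_frame_cone(1)[OF u(1)]] by simp
    then show "u = u'"
      using chart_frame_cone(2) u by simp
  qed
  fix V assume V: "open V \<and> V \<subseteq> chart_dom"
  have "{z \<in> chart_cone. chart_inv z \<in> V} = chart_cone \<inter> chart_inv -` V"
    by auto
  then have o: "open {z \<in> chart_cone. chart_inv z \<in> V}"
    using continuous_open_preimage[OF chart_inv_continuous chart_cone_open] V by simp
  have "openin proj_space {pt z | z. z \<noteq> 0 \<and> z \<in> {z \<in> chart_cone. chart_inv z \<in> V}}"
    by (rule openin_proj_cone[OF o]) (simp add: chart_cone_scale)
  then show "openin (subtopology proj_space (model f t)) ((\<lambda>u. pt (chart_frame 0 u)) ` V)"
    unfolding chart_image[OF conjunct2[OF V]] openin_subtopology by blast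
qed

lemma chart_framed_at: "u \<in> chart_dom \<Longrightarrow> framed_at (model f t) chart_dom chart_frame u (pt (chart_frame 0 u))"
  unfolding framed_at_def using chart_cyclide_frame chart_local_lift by simp

lemma chart_frame_zero: "chart_frame i 0 = moved 0 0 0 0 i"
  by (simp add: chart_frame_def sfun_def vfun_def)

lemma chart_frame_zero_0: "chart_frame 0 0 = f 0"
proof -
  have "f 0 = moved 0 0 0 0 0"
    by (rule moved_0_eqI) (simp_all add: coordK_def Zm_def Wp_def Zp_def Wm_def ip_simps frame_ip[OF f])
  then show ?thesis
    by (simp add: chart_frame_zero)
qed

lemma base_framed_at: "framed_at (model f t) chart_dom chart_frame 0 (pt (f 0))"
  using chart_framed_at[OF zero_chart_dom] by (simp add: chart_frame_zero_0)

end

text \<open>Every point of a model is the base point of a moved frame with the same model, so charts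
  are needed at the base point only.\<close>

lemma model_reframe:
  assumes f: "hyperbolic_frame f" and p: "p \<in> model f t"
  obtains g where "hyperbolic_frame g" "p = pt (g 0)" "model g t = model f t"
proof -
  interpret model_frame f t
    by unfold_locales (rule f)
  obtain s v s' v' where "on_orbit (t + 2) s v" "on_orbit (t - 2) s' v'" "p = pt (moved s v s' v' 0)"
    by (rule model_point[OF p])
  then show ?thesis
    using that moved_hyperbolic moved_model by blast
qed

lemma model_framed:
  assumes f: "hyperbolic_frame f" and p: "p \<in> model f t"
  obtains U v u where "framed_at (model f t) U v u p" "cyclide_tau v u = t"
proof -
  obtain g where g: "hyperbolic_frame g" "p = pt (g 0)" "model g t = model f t"
    by (rule model_reframe[OF f p])
  interpret model_frame g t
    by unfold_locales (rule g)
  show ?thesis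
    using that[OF base_framed_at[unfolded g(3) g(2)[symmetric]]] chart_tau[OF zero_chart_dom] by blast
qed

lemma model_surface:
  assumes f: "hyperbolic_frame f"
  shows "surface (model f t)"
  unfolding surface_def
proof (intro conjI ballI)
  show "model f t \<noteq> {}" "model f t \<subseteq> quadric"
    using model_base(2)[OF f] model_quadric[OF f] by blast+
  fix p assume "p \<in> model f t"
  then show "\<exists>U x u. local_lift (model f t) U x \<and> u \<in> U \<and> p = pt (x u)"
    using model_framed[OF f] unfolding framed_at_def by metis
qed

text \<open>The model is taken with base frames at \<open>p\<close> and at \<open>q\<close>; the map
  carrying one frame to the other carries the model to itself, since a model is determined by frame
  and parameter.\<close>

lemma model_homogeneous:
  assumes f: "hyperbolic_frame f"
  shows "homogeneous_surface (model f t)"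
  unfolding homogeneous_surface_def
proof (intro conjI ballI)
  show "surface (model f t)"
    by (rule model_surface[OF f])
  fix p q assume pq: "p \<in> model f t" "q \<in> model f t"
  obtain g where g: "hyperbolic_frame g" "p = pt (g 0)" "model g t = model f t"
    by (rule model_reframe[OF f pq(1)])
  obtain h where h: "hyperbolic_frame h" "q = pt (h 0)" "model h t = model f t"
    by (rule model_reframe[OF f pq(2)])
  obtain A L where A: "A \<in> CSp" "ip_isometry L" "\<And>i. i \<le> 4 \<Longrightarrow> L (g i) = h i" "\<And>M. M \<subseteq> quadric \<Longrightarrow> csp_act A M = proj_image L M"
    by (rule csp_frame_transport[OF g(1) h(1)]) blast
  have "cone (\<lambda>i. L (g i)) t z \<longleftrightarrow> cone h t z" for z
    by (simp add: cone_def coordK_def A(3))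
  then have "model (\<lambda>i. L (g i)) t = model h t"
    by (simp add: model_def)
  then have "proj_image L (model g t) = model h t"
    using model_isometry[OF A(2)] by metis
  then have "csp_act A (model f t) = model f t"
    using A(4)[OF model_quadric[OF f]] g(3) h(3) by metis
  moreover have "csp_act A {p} = {q}"
  proof -
    have "{p} \<subseteq> quadric"
      using pq(1) model_quadric[OF f] by blast
    then have "csp_act A {p} = {L ` p}"
      using A(4) by simp
    also have "L ` p = q"
      unfolding g(2) h(2) ip_isometry_pt[OF A(2)] A(3)[OF zero_le] ..
    finally show ?thesis .
  qed
  ultimately show "\<exists>A\<in>CSp. csp_act A (model f t) = model f t \<and> csp_act A {p} = {q}"
    using A(1) by blast
qed

text \<open>Over a common point the vectors 0, 3, 4 of two cyclide frames agree up to one sign, and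
  the derivatives of the sphere maps show the same for \<open>wplus\<close> and for
  \<open>wminus\<close>, each with its own sign; the cone is blind to these.\<close>

lemma framed_unique_cone:
  assumes v: "framed_at M U v u p" and c: "framed_at M V c w p"
  shows "cone (\<lambda>i. c i w) t z \<longleftrightarrow> cone (\<lambda>i. v i u) t z"
proof -
  have fv: "cyclide_frame U v" "local_lift M U (v 0)" "u \<in> U" "p = pt (v 0 u)"
    using v by (auto simp: framed_at_def)
  have fc: "cyclide_frame V c" "local_lift M V (c 0)" "w \<in> V" "pt (v 0 u) = pt (c 0 w)"
    using c fv(4) by (auto simp: framed_at_def)
  obtain U' \<phi> r where *: "open U'" "u \<in> U'" "U' \<subseteq> U" "smooth_on U' \<phi>" "\<phi> ` U' \<subseteq> V" "\<phi> u = w"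
    "smooth_on U' r" "\<And>s. s \<in> U' \<Longrightarrow> r s \<noteq> 0" "\<And>s. s \<in> U' \<Longrightarrow> c 0 (\<phi> s) = r s *\<^sub>R v 0 s"
    "\<And>s. s \<in> U' \<Longrightarrow> bij (D \<phi> s)"
    using transition[OF fv(2) fc(2) fv(3) fc(3,4)] by blast
  define c' where "c' = (\<lambda>i s. c i (\<phi> s))"
  have c': "cyclide_frame U' c'"
    unfolding c'_def by (rule cyclide_frame_pullback(1)[OF fc(1) *(4,5,10)])
  have v': "cyclide_frame U' v"
    using fv(1) *(1,3) smooth_on_subset[of U _ U'] unfolding cyclide_frame_def by auto
  have cv: "\<And>y. y \<in> U' \<Longrightarrow> c' 0 y = r y *\<^sub>R v 0 y"
    using *(9) by (simp add: c'_def)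
  note a = cyclide_frame_adapted[OF v', OF local_lift_rank[OF fv(2)], OF subsetD[OF *(3)]]
  note n = normalized_comparison[where ?\<kappa>1.0 = "\<lambda>_. 0" and ?\<kappa>2.0 = "\<lambda>_. 0" and ?b12.0 = "\<lambda>_. 1", OF c' a *(7,8) cv]
  have rr: "r y * r y = 1" and c3: "c' 3 y = r y *\<^sub>R v 3 y" if "y \<in> U'" for y
    by (rule n(4); simp add: that) (rule n(5); simp add: that)
  have Dr: "D r u w = 0" for w
    by (rule square_one_D[OF *(7) rr *(2)])
  have c4: "c' 4 u = r u *\<^sub>R v 4 u"
  proof -
    have "c' 4 u = (1 / r u) *\<^sub>R v 4 u"
      using frame_comparison[OF c' a *(7,8) cv *(2)] by metis
    moreover have "1 / r u = r u"
      using rr[OF *(2)] *(8)[OF *(2)] by (simp add: field_simps)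
    ultimately show ?thesis
      by simp
  qed
  have zz: "zminus c' y = r y *\<^sub>R zminus v y" "zplus c' y = r y *\<^sub>R zplus v y" if "y \<in> U'" for y
    using cv[OF that] c3[OF that] by (simp_all add: zminus_def zplus_def scaleR_diff_right scaleR_add_right mult.commute)
  note zc = zplus_zminus[OF c'] and zv = zplus_zminus[OF v']
  have Dz: "D (zminus c') u w = r u *\<^sub>R D (zminus v) u w" "D (zplus c') u w = r u *\<^sub>R D (zplus v) u w" for w
    using D_cong[OF *(1,2), of "zminus c'" "\<lambda>y. r y *\<^sub>R zminus v y"] D_cong[OF *(1,2), of "zplus c'" "\<lambda>y. r y *\<^sub>R zplus v y"] zz
      D_scale[OF smooth_on_differentiable[OF *(7,2)] smooth_on_differentiable[OF zv(2) *(2)], of w]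
      D_scale[OF smooth_on_differentiable[OF *(7,2)] smooth_on_differentiable[OF zv(1) *(2)], of w] Dr[of w]
    by simp_all
  obtain a b where ab: "formP v u a = 1" "formQ v u b = 1"
    using cyclide_frame_coords[OF v' *(2)] by metis
  note hv = cyclide_frame_hyperbolic[OF v' *(2)] and hc = cyclide_frame_hyperbolic[OF c' *(2)]
  \<comment> \<open>Parallel vectors of equal nonzero norm differ by a sign only.\<close>
  have par: "\<exists>k. (k = 1 \<or> k = -1) \<and> Y = k *\<^sub>R X" if "x *\<^sub>R Y = y *\<^sub>R X" "y \<noteq> 0" "ip X X = e" "ip Y Y = e" "e \<noteq> 0" for x y e and X Y :: "real^5"
  proof -
    have "x \<noteq> 0"
      using that by (auto simp: ip_simps)
    then have Y: "Y = (y / x) *\<^sub>R X"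
      using arg_cong[OF that(1), of "\<lambda>z. inverse x *\<^sub>R z"] by (simp add: divide_inverse mult.commute)
    then have "(y / x) * (y / x) * e = e"
      using that(3,4) by (simp add: ip_simps)
    then have "(y / x) * (y / x) = 1"
      using that(5) unfolding mult_cancel_right2 by blast
    then show ?thesis
      unfolding square_eq_1_iff using Y by blast
  qed
  obtain k1 where k1: "k1 = 1 \<or> k1 = -1" "wplus c' u = k1 *\<^sub>R wplus v u"
    using par[of "- 4 * formP c' u a" "wplus c' u" "- 4 * r u" "wplus v u" 2] Dz(1)[of a] *(8)[OF *(2)]
    unfolding zc(4)[OF *(2)] zv(4)[OF *(2)] by (auto simp: ab w_ip[of v u, OF hv] w_ip[of c' u, OF hc])
  obtain k2 where k2: "k2 = 1 \<or> k2 = -1" "wminus c' u = k2 *\<^sub>R wminus v u"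
    using par[of "4 * formQ c' u b" "wminus c' u" "4 * r u" "wminus v u" "-2"] Dz(2)[of b] *(8)[OF *(2)]
    unfolding zc(3)[OF *(2)] zv(3)[OF *(2)] by (auto simp: ab w_ip[of v u, OF hv] w_ip[of c' u, OF hc])
  have k: "r u = 1 \<or> r u = -1"
    using rr[OF *(2)] by (simp add: square_eq_1_iff)
  have "cone (\<lambda>i. c' i u) t z \<longleftrightarrow> cone (\<lambda>i. v i u) t z"
    by (rule cone_sign_change[OF k cv[OF *(2)] c3[OF *(2)] c4 k1(1) _ k2(1)])
      (use k1 k2 in \<open>simp_all add: wplus_def wminus_def\<close>)
  then show ?thesis
    by (simp add: c'_def *(6))
qed

text \<open>In local parameters the inclusion is a continuous injection between open sets of the
  plane, so invariance of domain applies. Continuity comes from the openness of lifts of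
  \<open>N\<close>.\<close>

lemma surface_open_in_surface:
  assumes M: "\<And>p. p \<in> M \<Longrightarrow> \<exists>U x u. local_lift M U x \<and> u \<in> U \<and> p = pt (x u)"
    and N: "\<And>p. p \<in> N \<Longrightarrow> \<exists>U x u. local_lift N U x \<and> u \<in> U \<and> p = pt (x u)" and MN: "M \<subseteq> N"
  shows "openin (subtopology proj_space N) M"
proof (subst openin_subopen, intro ballI)
  fix p assume p: "p \<in> M"
  obtain U x u where x: "local_lift M U x" "u \<in> U" "p = pt (x u)"
    using M[OF p] by blast
  obtain V y w where y: "local_lift N V y" "w \<in> V" "p = pt (y w)"
    using N subsetD[OF MN p] by blast
  define \<psi> where "\<psi> = (\<lambda>s. pt (y s))"
  have inj: "inj_on \<psi> V"
    using y(1) by (simp add: local_lift_iff \<psi>_def)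
  have pre: "open {s \<in> U. pt (x s) \<in> W}" if W: "openin (subtopology proj_space N) W" for W
  proof -
    obtain T where T: "openin proj_space T" "W = T \<inter> N"
      using W[unfolded openin_subtopology] by (elim exE conjE)
    have "{s \<in> U. pt (x s) \<in> W} = {s \<in> U. pt (x s) \<in> T}"
      using T local_lift_in[OF x(1)] MN by auto
    then show ?thesis
      using open_preimage_pt[OF smooth_on_continuous[OF local_lift_smooth[OF x(1)]] local_lift_open[OF x(1)]
          local_lift_nonzero[OF x(1)] T(1)] by simp
  qed
  define U1 where "U1 = {s \<in> U. pt (x s) \<in> \<psi> ` V}"
  have U1: "open U1"
    unfolding U1_def \<psi>_def using local_lift_openin[OF y(1) local_lift_open[OF y(1)]] by (intro pre) simp
  define \<phi> where "\<phi> s = inv_into V \<psi> (pt (x s))" for s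
  have \<phi>: "\<phi> s \<in> V" "\<psi> (\<phi> s) = pt (x s)" if "s \<in> U1" for s
  proof -
    have "pt (x s) \<in> \<psi> ` V"
      using that by (simp add: U1_def)
    then show "\<phi> s \<in> V" "\<psi> (\<phi> s) = pt (x s)"
      unfolding \<phi>_def by (rule inv_into_into, rule f_inv_into_f)
  qed
  have "continuous_on U1 \<phi>"
  proof (subst continuous_on_open_vimage[OF U1], intro allI impI)
    fix B :: "(real^2) set" assume B: "open B"
    have "\<phi> -` B \<inter> U1 = U1 \<inter> {s \<in> U. pt (x s) \<in> \<psi> ` (B \<inter> V)}"
    proof (intro equalityI subsetI)
      fix s assume "s \<in> \<phi> -` B \<inter> U1"
      then show "s \<in> U1 \<inter> {s \<in> U. pt (x s) \<in> \<psi> ` (B \<inter> V)}"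
        using \<phi>[of s] by (auto simp: U1_def intro!: rev_image_eqI[of "\<phi> s"])
    next
      fix s assume s: "s \<in> U1 \<inter> {s \<in> U. pt (x s) \<in> \<psi> ` (B \<inter> V)}"
      then obtain b where b: "b \<in> B" "b \<in> V" "\<psi> b = pt (x s)"
        by auto
      then have "\<phi> s = b"
        using \<phi>[of s] s by (intro inj_onD[OF inj]) auto
      then show "s \<in> \<phi> -` B \<inter> U1"
        using s b by auto
    qed
    moreover have "open {s \<in> U. pt (x s) \<in> \<psi> ` (B \<inter> V)}"
      unfolding \<psi>_def using B local_lift_open[OF y(1)] by (intro pre local_lift_openin[OF y(1)]) auto
    ultimately show "open (\<phi> -` B \<inter> U1)"
      using U1 by (simp only: open_Int)
  qed
  moreover have "inj_on \<phi> U1"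
  proof (rule inj_onI)
    fix s s' assume s: "s \<in> U1" "s' \<in> U1" "\<phi> s = \<phi> s'"
    then have "pt (x s) = pt (x s')"
      using \<phi>(2) by metis
    then show "s = s'"
      using s x(1) by (auto simp: local_lift_iff U1_def dest: inj_onD)
  qed
  ultimately have "open (\<phi> ` U1)"
    using U1 by (intro invariance_of_domain)
  then have "openin (subtopology proj_space N) (\<psi> ` \<phi> ` U1)"
    unfolding \<psi>_def using \<phi>(1) by (intro local_lift_openin[OF y(1)]) auto
  moreover have "\<psi> ` \<phi> ` U1 = (\<lambda>s. pt (x s)) ` U1"
    using \<phi>(2) by (auto simp: image_image)
  moreover have "u \<in> U1"
    using x y by (auto simp: U1_def \<psi>_def)
  moreover have "(\<lambda>s. pt (x s)) ` U1 \<subseteq> M"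
    using local_lift_in[OF x(1)] by (auto simp: U1_def)
  ultimately show "\<exists>T. openin (subtopology proj_space N) T \<and> p \<in> T \<and> T \<subseteq> M"
    using x(3) by (intro exI[of _ "(\<lambda>s. pt (x s)) ` U1"]) auto
qed

text \<open>The model built from a frame depends only on the point below it and, with constant
  \<tau>, is the same for all points of a convex parameter domain; on a connected surface it is
  therefore a single one. Each point lies in its own model.\<close>

lemma cyclidic_in_model:
  assumes M: "cyclidic M" and con: "connectedin proj_space M" and t: "\<And>U v u p. framed_at M U v u p \<Longrightarrow> cyclide_tau v u = t"
    and f: "framed_at M U v u p"
  shows "M \<subseteq> model (\<lambda>i. v i u) t" "openin (subtopology proj_space (model (\<lambda>i. v i u) t)) M"
proof -
  define T where "T q = (SOME N. \<exists>U v u. framed_at M U v u q \<and> N = model (\<lambda>i. v i u) t)" for q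
  have T: "T q = model (\<lambda>i. c i w) t" if c: "framed_at M V c w q" for V c w q
  proof -
    have "\<exists>U v u. framed_at M U v u q \<and> T q = model (\<lambda>i. v i u) t"
      unfolding T_def by (rule someI_ex) (use c in blast)
    then obtain V' c' w' where c': "framed_at M V' c' w' q" "T q = model (\<lambda>i. c' i w') t"
      by blast
    show ?thesis
      unfolding c'(2) model_def framed_unique_cone[OF c c'(1)] ..
  qed
  have loc: "\<exists>W. openin (subtopology proj_space M) W \<and> q \<in> W \<and> (\<forall>q'\<in>W. T q' = T q)" if q: "q \<in> M" for q
  proof -
    obtain V c w where c: "framed_at M V c w q"
      using M q unfolding cyclidic_def by blast
    obtain B where B: "open B" "convex B" "w \<in> B" "B \<subseteq> V" "openin (subtopology proj_space M) ((\<lambda>u. pt (c 0 u)) ` B)"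
      "q \<in> (\<lambda>u. pt (c 0 u)) ` B" "cyclide_frame B c" "\<And>y. y \<in> B \<Longrightarrow> framed_at M B c y (pt (c 0 y))"
      using framed_neighbourhood[OF c] by blast
    have "T (pt (c 0 y)) = T q" if "y \<in> B" for y
      unfolding T[OF c] T[OF B(8)[OF that]]
      by (rule model_constant[OF B(7,2) t[OF B(8)] that B(3)])
    then show ?thesis
      using B(5,6) by blast
  qed
  let ?N = "model (\<lambda>i. v i u) t"
  have hf: "hyperbolic_frame (\<lambda>i. v i u)"
    using f cyclide_frame_hyperbolic unfolding framed_at_def by blast
  show sub: "M \<subseteq> ?N"
  proof
    fix q assume q: "q \<in> M"
    obtain V c w where c: "framed_at M V c w q"
      using M q unfolding cyclidic_def by blast
    have "hyperbolic_frame (\<lambda>i. c i w)"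
      using c cyclide_frame_hyperbolic unfolding framed_at_def by blast
    then have "q \<in> T q"
      unfolding T[OF c] using c model_base(2) by (auto simp: framed_at_def)
    also have "T q = T p"
      by (rule connected_locally_constant[OF con loc q framed_at_in[OF f]])
    finally show "q \<in> ?N"
      unfolding T[OF f] .
  qed
  show "openin (subtopology proj_space ?N) M"
  proof (rule surface_open_in_surface[OF _ _ sub])
    show "\<exists>U x u. local_lift M U x \<and> u \<in> U \<and> q = pt (x u)" if "q \<in> M" for q
      using M that unfolding cyclidic_def surface_def by blast
    show "\<exists>U x u. local_lift ?N U x \<and> u \<in> U \<and> q = pt (x u)" if "q \<in> ?N" for q
      using model_surface[OF hf] that unfolding surface_def by blast
  qed
qed

lemma cyclidic_CSI:
  assumes M: "cyclidic M" and con: "connectedin proj_space M"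
  shows "CSI_surface M"
proof -
  obtain t where t: "\<And>U v u p. framed_at M U v u p \<Longrightarrow> cyclide_tau v u = t"
    using cyclidic_tau_const[OF M con] by blast
  obtain p where "p \<in> M"
    using M unfolding cyclidic_def surface_def by auto
  then obtain U v u where f: "framed_at M U v u p"
    using M unfolding cyclidic_def by blast
  have hf: "hyperbolic_frame (\<lambda>i. v i u)"
    using f cyclide_frame_hyperbolic unfolding framed_at_def by blast
  have "openin (subtopology proj_space (model (\<lambda>i. v i u) t)) M"
    by (rule cyclidic_in_model(2)[OF M con _ f]) (rule t)
  then show ?thesis
    unfolding CSI_surface_def using M model_homogeneous[OF hf, of t] unfolding cyclidic_def by blast
qed

text \<open>Both surfaces are open in models with the same \<tau>, and a frame transport matches
  these models together with the chosen points \<open>p\<close> and \<open>q\<close>.\<close>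

lemma cyclidic_equivalent:
  assumes M1: "cyclidic M1" "connectedin proj_space M1" "\<And>U v u p. framed_at M1 U v u p \<Longrightarrow> cyclide_tau v u = t"
    and M2: "cyclidic M2" "connectedin proj_space M2" "\<And>U v u p. framed_at M2 U v u p \<Longrightarrow> cyclide_tau v u = t"
  shows "csp_equivalent M1 M2"
proof -
  obtain p q where pq: "p \<in> M1" "q \<in> M2"
    using M1(1) M2(1) unfolding cyclidic_def surface_def by auto
  obtain U v u where f: "framed_at M1 U v u p"
    using M1(1) pq(1) unfolding cyclidic_def by blast
  obtain V c w where g: "framed_at M2 V c w q"
    using M2(1) pq(2) unfolding cyclidic_def by blast
  have hf: "hyperbolic_frame (\<lambda>i. v i u)" and hg: "hyperbolic_frame (\<lambda>i. c i w)"
    using f g cyclide_frame_hyperbolic unfolding framed_at_def by blast+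
  obtain A L where A: "A \<in> CSp" "ip_isometry L" "\<And>i. i \<le> 4 \<Longrightarrow> L (v i u) = c i w" "\<And>M. M \<subseteq> quadric \<Longrightarrow> csp_act A M = proj_image L M"
    by (rule csp_frame_transport[OF hf hg]) blast
  let ?N1 = "model (\<lambda>i. v i u) t" and ?N2 = "model (\<lambda>i. c i w) t"
  note iL = ip_isometry_inv[OF A(2)]
  have "cone (\<lambda>i. L (v i u)) t z \<longleftrightarrow> cone (\<lambda>i. c i w) t z" for z
    by (simp add: cone_def coordK_def A(3))
  then have "model (\<lambda>i. L (v i u)) t = ?N2"
    by (simp add: model_def)
  then have LN: "proj_image L ?N1 = ?N2"
    using model_isometry[OF A(2), of "\<lambda>i. v i u" t] by simp
  note N1 = cyclidic_in_model[OF M1 f] and N2 = cyclidic_in_model[OF M2 g]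
  \<comment> \<open>The overlap inside the common model; it is open in both surfaces and contains
    \<open>p\<close>.\<close>
  define W1 W2 where "W1 = M1 \<inter> proj_image (inv L) M2" and "W2 = proj_image L W1"
  have inj: "inj ((`) L)"
    by (rule injI) (simp add: inj_image_eq_iff[OF bij_is_inj[OF ip_isometry_bij[OF A(2)]]])
  have W2: "W2 = proj_image L M1 \<inter> M2"
    unfolding W2_def W1_def image_Int[OF inj] proj_image_inv(2)[OF A(2)] ..
  have "openin (subtopology proj_space ?N1) (proj_image (inv L) M2)"
    using openin_sub_proj_image[OF iL N2(2)] unfolding LN[symmetric] proj_image_inv(1)[OF A(2)] .
  then have "openin (subtopology proj_space ?N1) W1"
    unfolding W1_def using N1(2) by (rule openin_Int[rotated])
  then have o1: "openin (subtopology proj_space M1) W1"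
    by (rule openin_subtopology_mono) (use N1(1) W1_def in auto)
  have "openin (subtopology proj_space ?N2) (proj_image L M1)"
    using openin_sub_proj_image[OF A(2) N1(2)] unfolding LN .
  then have "openin (subtopology proj_space ?N2) W2"
    unfolding W2 using N2(2) by (rule openin_Int)
  then have o2: "openin (subtopology proj_space M2) W2"
    by (rule openin_subtopology_mono) (use N2(1) W2 in auto)
  have "L ` p = q"
    using f g ip_isometry_pt[OF A(2)] A(3)[of 0] by (simp add: framed_at_def)
  then have "inv L ` q = p"
    by (auto simp: image_image ip_isometry_inverse[OF A(2)])
  then have "p \<in> W1"
    using pq unfolding W1_def by blast
  moreover have "W1 \<subseteq> quadric"
    using M1(1) unfolding W1_def cyclidic_def surface_def by blast
  then have "csp_act A W1 = W2"
    unfolding W2_def by (rule A(4))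
  ultimately show ?thesis
    unfolding csp_equivalent_def using A(1) o1 o2 by blast
qed

text \<open>A frame over a point of the matched piece is restricted to that piece, moved by the
  isometry and read as a frame of \<open>M2\<close>; \<tau> does not change on the way.\<close>

lemma cyclidic_equivalent_tau:
  assumes M1: "cyclidic M1" "\<And>U v u p. framed_at M1 U v u p \<Longrightarrow> cyclide_tau v u = t1"
    and M2: "\<And>U v u p. framed_at M2 U v u p \<Longrightarrow> cyclide_tau v u = t2"
    and e: "csp_equivalent M1 M2"
  shows "t1 = t2"
proof -
  obtain A W1 W2 where W: "A \<in> CSp" "W1 \<noteq> {}" "openin (subtopology proj_space M1) W1" "openin (subtopology proj_space M2) W2" "csp_act A W1 = W2"
    using e unfolding csp_equivalent_def by blast
  obtain L c where L: "ip_isometry L" "\<And>M. M \<subseteq> quadric \<Longrightarrow> csp_act A M = proj_image L M"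
    by (rule csp_act_isometry[OF W(1)]) blast
  have W1M: "W1 \<subseteq> M1"
    using W(3) by (rule openin_imp_subset)
  obtain p where p: "p \<in> W1"
    using W(2) by blast
  obtain U v u where f: "framed_at M1 U v u p"
    using M1(1) p W1M unfolding cyclidic_def by blast
  have v: "cyclide_frame U v" "local_lift M1 U (v 0)" "u \<in> U" "p = pt (v 0 u)"
    using f by (auto simp: framed_at_def)
  define B where "B = {s \<in> U. pt (v 0 s) \<in> W1}"
  have B: "open B" "B \<subseteq> U" "u \<in> B"
    using open_local_lift_preimage[OF v(2) W(3)] v(3,4) p by (auto simp: B_def)
  have l1: "local_lift M1 B (v 0)"
    by (rule local_lift_subset[OF v(2) B(1,2)])
  have "openin (subtopology proj_space W1) ((\<lambda>u. pt (v 0 u)) ` B)"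
    by (rule openin_subtopology_mono[OF local_lift_openin[OF l1 B(1) order_refl] _ W1M]) (auto simp: B_def)
  then have l: "local_lift W1 B (v 0)"
    by (rule local_lift_openin_change[OF l1])
  have cB: "cyclide_frame B v"
    using v(1) B(1,2) smooth_on_subset[of U _ B] unfolding cyclide_frame_def by auto
  have fB: "framed_at W1 B v u p"
    using cB l B(3) v(4) by (simp add: framed_at_def)
  have "W1 \<subseteq> quadric"
    using M1(1) W1M unfolding cyclidic_def surface_def by blast
  then have LW: "proj_image L W1 = W2"
    using L(2) W(5) by simp
  note g = framed_at_isometry[OF L(1) fB, unfolded LW]
  have g': "cyclide_frame B (\<lambda>i u. L (v i u))" "local_lift W2 B (\<lambda>u. L (v 0 u))" "L ` p = pt (L (v 0 u))"
    using g(1) by (auto simp: framed_at_def)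
  have "local_lift M2 B (\<lambda>u. L (v 0 u))"
    by (rule local_lift_openin_change[OF g'(2) openin_subtopology_trans[OF local_lift_openin[OF g'(2) B(1) order_refl] W(4)]])
  then have "framed_at M2 B (\<lambda>i u. L (v i u)) u (L ` p)"
    using g'(1,3) B(3) by (simp add: framed_at_def)
  then have "cyclide_tau (\<lambda>i u. L (v i u)) u = t2"
    by (rule M2)
  moreover have "cyclide_tau v u = t1"
    by (rule M1(2)[OF f])
  ultimately show ?thesis
    using g(2) by simp
qed

text \<open>The image of the convex chart domain is used rather than the whole model, which makes
  connectedness immediate.\<close>

lemma ex_cyclidic:
  shows "\<exists>M. cyclidic M \<and> connectedin proj_space M \<and> (\<forall>U v u p. framed_at M U v u p \<longrightarrow> cyclide_tau v u = t)"
proof -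
  \<comment> \<open>The coordinate axes with 2 and 3 interchanged, since \<open>ip\<close> pairs
    coordinates 1 and 3 and gives coordinate 2 norm -2.\<close>
  define f :: "nat \<Rightarrow> real^5" where "f i = (if i = 0 then axis 0 1 else if i = 1 then axis 1 1 else if i = 2 then axis 3 1
      else if i = 3 then axis 2 1 else axis 4 1)" for i
  have f: "hyperbolic_frame f"
    by (simp add: hyperbolic_frame_iff frame_table_def f_def ip_def)
  interpret model_frame f t
    by unfold_locales (rule f)
  define M where "M = (\<lambda>u. pt (chart_frame 0 u)) ` chart_dom"
  have l: "local_lift M chart_dom (chart_frame 0)"
    unfolding M_def by (rule local_lift_openin_change[OF chart_local_lift]) (simp add: openin_subtopology_self
        local_lift_in[OF chart_local_lift] openin_subtopology_mono[OF local_lift_openin[OF chart_local_lift chart_dom_open order_refl]]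
        image_subset_iff)
  have fr: "framed_at M chart_dom chart_frame u (pt (chart_frame 0 u))" if "u \<in> chart_dom" for u
    using that l chart_cyclide_frame by (simp add: framed_at_def)
  have "M \<subseteq> quadric"
    using local_lift_in[OF chart_local_lift] model_quadric[OF f] unfolding M_def by blast
  moreover have "M \<noteq> {}"
    using zero_chart_dom by (auto simp: M_def)
  ultimately have "surface M"
    unfolding surface_def using l by (auto simp: M_def)
  then have c: "cyclidic M"
    unfolding cyclidic_def using fr by (auto simp: M_def)
  have "connectedin proj_space M"
  proof -
    have "continuous_map (top_of_set chart_dom) proj_space (\<lambda>u. pt (chart_frame 0 u))"
      by (rule continuous_map_pt[OF smooth_on_continuous[OF chart_frame_smooth] chart_dom_open chart_frame_nonzero])
    moreover have "connectedin (top_of_set chart_dom) chart_dom"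
      using convex_connected[OF chart_dom_convex] by (simp add: connectedin_subtopology)
    ultimately show ?thesis
      unfolding M_def by (rule connectedin_continuous_map_image)
  qed
  moreover have "cyclide_tau v u = t" if g: "framed_at M U v u p" for U v u p
  proof -
    obtain w where w: "w \<in> chart_dom" "p = pt (chart_frame 0 w)"
      using framed_at_in[OF g] by (auto simp: M_def)
    show ?thesis
      using framed_unique(1)[OF g fr[OF w(1), folded w(2)]] chart_tau[OF w(1)] by simp
  qed
  ultimately show ?thesis
    using c by blast
qed

theorem theorem6p12:
  shows
    "(\<forall>M. connected_hyperbolic M \<longrightarrow>
        (dupin_cyclide M \<longleftrightarrow> two_elliptic M \<and> kappas_vanish M \<and> (\<exists>t. tau_const M t))) \<and>
     (\<forall>t. \<exists>M. connected_hyperbolic M \<and> dupin_cyclide M \<and> tau_const M t) \<and>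
     (\<forall>M1 M2 t1 t2.
        connected_hyperbolic M1 \<and> dupin_cyclide M1 \<and> tau_const M1 t1 \<and>
        connected_hyperbolic M2 \<and> dupin_cyclide M2 \<and> tau_const M2 t2 \<longrightarrow>
        (csp_equivalent M1 M2 \<longleftrightarrow> t1 = t2)) \<and>
     (\<forall>M. connected_hyperbolic M \<and> dupin_cyclide M \<longrightarrow>
        CSI_surface M \<and> (\<exists>d. conj_dim M d \<and> d \<noteq> 0) \<and>
        (\<forall>t. tau_const M t \<longrightarrow>
           (t = 1 \<or> t = -1 \<longleftrightarrow> conj_dim M 1) \<and>
           (t \<noteq> 1 \<and> t \<noteq> -1 \<longleftrightarrow> conj_dim M 2)))"
proof (intro conjI allI impI)
  fix M assume M: "connected_hyperbolic M"
  then have h: "hyperbolic_surface M" "surface M" "connectedin proj_space M"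
    by (auto simp: connected_hyperbolic_def hyperbolic_surface_def)
  show "dupin_cyclide M \<longleftrightarrow> two_elliptic M \<and> kappas_vanish M \<and> (\<exists>t. tau_const M t)"
  proof
    assume "dupin_cyclide M"
    then have "cyclidic M"
      by (rule dupin_cyclidic[OF h(1)])
    then show "two_elliptic M \<and> kappas_vanish M \<and> (\<exists>t. tau_const M t)"
      using cyclidic_two_elliptic cyclidic_kappas_vanish cyclidic_ex_tau_const[OF _ h(3)] by blast
  next
    assume "two_elliptic M \<and> kappas_vanish M \<and> (\<exists>t. tau_const M t)"
    then have "cyclidic M"
      using tau_const_imp_cyclidic[OF h(2)] by blast
    then show "dupin_cyclide M"
      by (rule cyclidic_dupin)
  qed
next
  fix t
  obtain M where M: "cyclidic M" "connectedin proj_space M" "\<forall>U v u p. framed_at M U v u p \<longrightarrow> cyclide_tau v u = t"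
    using ex_cyclidic[of t] by blast
  show "\<exists>M. connected_hyperbolic M \<and> dupin_cyclide M \<and> tau_const M t"
    using M framed_tau_const[OF M(1)] cyclidic_hyperbolic[OF M(1)] cyclidic_dupin[OF M(1)]
    unfolding connected_hyperbolic_def by blast
next
  fix M1 M2 t1 t2
  assume a: "connected_hyperbolic M1 \<and> dupin_cyclide M1 \<and> tau_const M1 t1 \<and>
        connected_hyperbolic M2 \<and> dupin_cyclide M2 \<and> tau_const M2 t2"
  then have c: "cyclidic M1" "cyclidic M2" and con: "connectedin proj_space M1" "connectedin proj_space M2"
    using dupin_cyclidic by (auto simp: connected_hyperbolic_def)
  have t: "\<And>U v u p. framed_at M1 U v u p \<Longrightarrow> cyclide_tau v u = t1" "\<And>U v u p. framed_at M2 U v u p \<Longrightarrow> cyclide_tau v u = t2"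
    using a framed_tau_const[OF c(1)] framed_tau_const[OF c(2)] by blast+
  show "csp_equivalent M1 M2 \<longleftrightarrow> t1 = t2"
  proof
    assume "csp_equivalent M1 M2"
    then show "t1 = t2"
      by (intro cyclidic_equivalent_tau[OF c(1) t(1) t(2)])
  next
    assume "t1 = t2"
    then show "csp_equivalent M1 M2"
      using cyclidic_equivalent[OF c(1) con(1) t(1) c(2) con(2)] t(2) by simp
  qed
next
  fix M assume "connected_hyperbolic M \<and> dupin_cyclide M"
  then have c: "cyclidic M" and con: "connectedin proj_space M"
    using dupin_cyclidic by (auto simp: connected_hyperbolic_def)
  show "CSI_surface M"
    by (rule cyclidic_CSI[OF c con])
  show "\<exists>d. conj_dim M d \<and> d \<noteq> 0"
    using cyclidic_ex_tau_const[OF c con] cyclidic_conj_dim[OF c] by (metis zero_neq_numeral zero_neq_one)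
  fix t assume t: "tau_const M t"
  show "t = 1 \<or> t = -1 \<longleftrightarrow> conj_dim M 1" "t \<noteq> 1 \<and> t \<noteq> -1 \<longleftrightarrow> conj_dim M 2"
    unfolding cyclidic_conj_dim[OF c t] by auto
qed

end
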